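(* Let $G$ be a discrete group, let $\Gamma\le G$ be a subgroup with property (T), and suppose $t\in G$ is such that $H:=t\Gamma t^{-1}$ is a proper subgroup of $\Gamma$. Let $A=\bigoplus_{G/\Gamma}\mathbb{Z}/2\mathbb{Z}$, let $G$ act on $A$ by permuting coordinates via left translation on $G/\Gamma$, and set $W=A\rtimes G$. For $x\in G/\Gamma$ let $a_x\in A$ be the element that is non-trivial exactly at the coordinate $x$. Let $\gamma\in\Gamma\setminus H$ and set $b_\gamma=a_{\gamma t\Gamma}\,a_{t\Gamma}\in A\subseteq W$ (so $b_\gamma\neq 1$, since $\gamma t\Gamma\neq t\Gamma$). Let $d=(d_n)$ be a sequence of positive integers and suppose that $\pi:W\to U(\mathcal{Q}_d)$ is a group homomorphism. Then $\pi(b_\gamma)=1$. In particular, $W$ is not MF, nor is any discrete group containing $W$ as a subgroup.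
   Context: For a sequence $d=(d_n)_{n\ge1}$ of positive integers, $\mathcal{Q}_d$ denotes the C*-algebra $\mathcal{Q}_d=\prod_{n=1}^\infty M_{d_n}\big/\bigoplus_{n=1}^\infty M_{d_n}$, where $M_k$ is the C*-algebra of $k\times k$ complex matrices, $\prod$ denotes norm-bounded sequences, and $\bigoplus$ denotes sequences whose operator norms tend to $0$. $U(\mathcal{Q}_d)$ is its unitary group. A discrete group is called MF if there is a sequence $d=(d_n)$ of positive integers and an injective group homomorphism from the group into $U(\mathcal{Q}_d)$. The group $A$ is written multiplicatively inside $W$. *)

theory Defs
  imports
    "HOL-Analysis.L2_Norm"
    "HOL-Algebra.Left_Coset"
    "HOL-Algebra.Product_Groups"
    "HOL-Algebra.QuotRing"
    "Jordan_Normal_Form.Schur_Decomposition"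
    "Jordan_Normal_Form.VS_Connect"
begin

section \<open>Complex Hilbert spaces and property (T)\<close>

text \<open>The ring fields \<open>mult\<close> and \<open>one\<close>, which every \<open>module\<close> record carries, are not used.
  The inner product is linear in its first argument.\<close>

record 'h hilb = "(complex, 'h) module" +
  hinner :: "'h \<Rightarrow> 'h \<Rightarrow> complex"

definition hnorm :: "'h hilb \<Rightarrow> 'h \<Rightarrow> real" where
  "hnorm H v = sqrt (Re (hinner H v v))"

locale hilbert_space = module "class_ring :: complex ring" H
  for H :: "'h hilb" (structure) +
  assumes hinner_add: "\<lbrakk>u \<in> carrier H; v \<in> carrier H; w \<in> carrier H\<rbrakk>
      \<Longrightarrow> hinner H (u \<oplus> v) w = hinner H u w + hinner H v w"
    and hinner_smult: "\<lbrakk>u \<in> carrier H; v \<in> carrier H\<rbrakk>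
      \<Longrightarrow> hinner H (c \<odot> u) v = c * hinner H u v"
    and hinner_cnj: "\<lbrakk>u \<in> carrier H; v \<in> carrier H\<rbrakk> \<Longrightarrow> hinner H v u = cnj (hinner H u v)"
    and hinner_pos: "\<lbrakk>v \<in> carrier H; v \<noteq> \<zero>\<rbrakk> \<Longrightarrow> 0 < Re (hinner H v v)"
    and complete: "\<lbrakk>\<And>n. x n \<in> carrier H;
         \<And>\<epsilon>. \<epsilon> > 0 \<Longrightarrow> \<exists>N. \<forall>m\<ge>N. \<forall>n\<ge>N. hnorm H (x m \<ominus> x n) < \<epsilon>\<rbrakk>
      \<Longrightarrow> \<exists>l\<in>carrier H. (\<lambda>n. hnorm H (x n \<ominus> l)) \<longlonglongrightarrow> 0"

definition unitary_op :: "'h hilb \<Rightarrow> ('h \<Rightarrow> 'h) \<Rightarrow> bool" where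
  "unitary_op H U \<longleftrightarrow>
     bij_betw U (carrier H) (carrier H) \<and>
     (\<forall>u\<in>carrier H. \<forall>v\<in>carrier H. U (u \<oplus>\<^bsub>H\<^esub> v) = U u \<oplus>\<^bsub>H\<^esub> U v) \<and>
     (\<forall>c. \<forall>v\<in>carrier H. U (c \<odot>\<^bsub>H\<^esub> v) = c \<odot>\<^bsub>H\<^esub> U v) \<and>
     (\<forall>u\<in>carrier H. \<forall>v\<in>carrier H. hinner H (U u) (U v) = hinner H u v)"

definition unitary_rep :: "'g monoid \<Rightarrow> 'h hilb \<Rightarrow> ('g \<Rightarrow> 'h \<Rightarrow> 'h) \<Rightarrow> bool" where
  "unitary_rep K H \<rho> \<longleftrightarrow>
     (\<forall>g\<in>carrier K. unitary_op H (\<rho> g)) \<and>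
     (\<forall>g\<in>carrier K. \<forall>h\<in>carrier K. \<forall>v\<in>carrier H. \<rho> (g \<otimes>\<^bsub>K\<^esub> h) v = \<rho> g (\<rho> h v))"

text \<open>Property (T) of a discrete group: there are a finite set \<open>F\<close> and \<open>\<epsilon> > 0\<close> such that every
  unitary representation with an \<open>(F, \<epsilon>)\<close>-invariant vector has a nonzero invariant vector.

  HOL does not allow a definition to quantify over all types, so the underlying sets of the Hilbert
  spaces are taken inside the type \<open>'g \<times> nat \<Rightarrow> complex\<close>; their operations and inner products are
  arbitrary.  This is no restriction: an \<open>(F, \<epsilon>)\<close>-invariant vector of any representation lies in
  the closed invariant subspace generated by it.  That subspace has a dense subset of cardinality
  at most that of \<open>'g \<times> nat\<close>, hence its own cardinality is at most that of
  \<open>'g \<times> nat \<Rightarrow> complex\<close>, so an isomorphic copy of it is considered here, and an invariant vector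
  of the subrepresentation is one of the whole representation.\<close>

definition property_T :: "'g monoid \<Rightarrow> bool" where
  "property_T K \<longleftrightarrow>
     (\<exists>F \<epsilon>. finite F \<and> F \<subseteq> carrier K \<and> \<epsilon> > 0 \<and>
       (\<forall>(H :: ('g \<times> nat \<Rightarrow> complex) hilb) \<rho>.
          hilbert_space H \<longrightarrow> unitary_rep K H \<rho> \<longrightarrow>
          (\<exists>v\<in>carrier H. v \<noteq> \<zero>\<^bsub>H\<^esub> \<and> (\<forall>g\<in>F. hnorm H (\<rho> g v \<ominus>\<^bsub>H\<^esub> v) < \<epsilon> * hnorm H v)) \<longrightarrow>
          (\<exists>w\<in>carrier H. w \<noteq> \<zero>\<^bsub>H\<^esub> \<and> (\<forall>g\<in>carrier K. \<rho> g w = w))))"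


section \<open>The algebra \<open>\<Q>\<^sub>d\<close>, its unitary group, and MF groups\<close>

definition vec_l2 :: "complex Matrix.vec \<Rightarrow> real" where
  "vec_l2 v = L2_set (\<lambda>i. cmod (vec_index v i)) {..<dim_vec v}"

definition op_norm :: "complex mat \<Rightarrow> real" where
  "op_norm A = Sup {vec_l2 (A *\<^sub>v v) | v. v \<in> carrier_vec (dim_col A) \<and> vec_l2 v \<le> 1}"

definition prod_mat :: "(nat \<Rightarrow> nat) \<Rightarrow> (nat \<Rightarrow> complex mat) ring" where
  "prod_mat d =
     \<lparr>carrier = {A. (\<forall>n. A n \<in> carrier_mat (d n) (d n)) \<and> bdd_above (range (\<lambda>n. op_norm (A n)))},
      monoid.mult = (\<lambda>A B n. A n * B n),
      one = (\<lambda>n. 1\<^sub>m (d n)),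
      zero = (\<lambda>n. 0\<^sub>m (d n) (d n)),
      add = (\<lambda>A B n. A n + B n)\<rparr>"

definition sum_mat :: "(nat \<Rightarrow> nat) \<Rightarrow> (nat \<Rightarrow> complex mat) set" where
  "sum_mat d = {A \<in> carrier (prod_mat d). (\<lambda>n. op_norm (A n)) \<longlonglongrightarrow> 0}"

text \<open>Only the ring structure and the involution of the quotient are needed for its unitary group.
  The adjoint of a coset is the set of adjoints of its representatives.\<close>

definition Q_alg :: "(nat \<Rightarrow> nat) \<Rightarrow> (nat \<Rightarrow> complex mat) set ring" where
  "Q_alg d = prod_mat d Quot sum_mat d"

definition Q_star :: "(nat \<Rightarrow> complex mat) set \<Rightarrow> (nat \<Rightarrow> complex mat) set" where
  "Q_star X = (\<lambda>A n. mat_adjoint (A n)) ` X"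

definition Q_unitary :: "(nat \<Rightarrow> nat) \<Rightarrow> (nat \<Rightarrow> complex mat) set monoid" where
  "Q_unitary d =
     \<lparr>carrier = {u \<in> carrier (Q_alg d).
        Q_star u \<otimes>\<^bsub>Q_alg d\<^esub> u = \<one>\<^bsub>Q_alg d\<^esub> \<and> u \<otimes>\<^bsub>Q_alg d\<^esub> Q_star u = \<one>\<^bsub>Q_alg d\<^esub>},
      monoid.mult = (\<otimes>\<^bsub>Q_alg d\<^esub>),
      one = \<one>\<^bsub>Q_alg d\<^esub>\<rparr>"

definition MF_group :: "'k monoid \<Rightarrow> bool" where
  "MF_group K \<longleftrightarrow>
     (\<exists>d. (\<forall>n. 0 < d n) \<and> (\<exists>\<pi> \<in> hom K (Q_unitary d). inj_on \<pi> (carrier K)))"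


section \<open>The group \<open>W\<close>\<close>

definition semidirect :: "'n monoid \<Rightarrow> 'g monoid \<Rightarrow> ('g \<Rightarrow> 'n \<Rightarrow> 'n) \<Rightarrow> ('n \<times> 'g) monoid" where
  "semidirect N G \<alpha> =
     \<lparr>carrier = carrier N \<times> carrier G,
      monoid.mult = (\<lambda>(m, g) (n, h). (m \<otimes>\<^bsub>N\<^esub> \<alpha> g n, g \<otimes>\<^bsub>G\<^esub> h)),
      one = (\<one>\<^bsub>N\<^esub>, \<one>\<^bsub>G\<^esub>)\<rparr>"

text \<open>\<open>\<Z>/2\<Z>\<close> is \<open>integer_mod_group 2\<close> with underlying set \<open>{0, 1}\<close>.\<close>

definition coset_sum :: "'g monoid \<Rightarrow> 'g set \<Rightarrow> ('g set \<Rightarrow> int) monoid" where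
  "coset_sum G \<Gamma> = sum_group (lcosets\<^bsub>G\<^esub> \<Gamma>) (\<lambda>_. integer_mod_group 2)"

definition coset_shift :: "'g monoid \<Rightarrow> 'g set \<Rightarrow> 'g \<Rightarrow> ('g set \<Rightarrow> int) \<Rightarrow> ('g set \<Rightarrow> int)" where
  "coset_shift G \<Gamma> g f = (\<lambda>x\<in>lcosets\<^bsub>G\<^esub> \<Gamma>. f (inv\<^bsub>G\<^esub> g <#\<^bsub>G\<^esub> x))"

definition wreath :: "'g monoid \<Rightarrow> 'g set \<Rightarrow> (('g set \<Rightarrow> int) \<times> 'g) monoid" where
  "wreath G \<Gamma> = semidirect (coset_sum G \<Gamma>) G (coset_shift G \<Gamma>)"

definition coset_gen :: "'g monoid \<Rightarrow> 'g set \<Rightarrow> 'g set \<Rightarrow> ('g set \<Rightarrow> int)" where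
  "coset_gen G \<Gamma> x = (\<lambda>y\<in>lcosets\<^bsub>G\<^esub> \<Gamma>. if y = x then 1 else 0)"

text \<open>\<open>b\<^sub>\<gamma>\<close>, regarded as an element of \<open>W\<close> via \<open>a \<mapsto> (a, 1)\<close>.\<close>

definition b_elt :: "'g monoid \<Rightarrow> 'g set \<Rightarrow> 'g \<Rightarrow> 'g \<Rightarrow> ('g set \<Rightarrow> int) \<times> 'g" where
  "b_elt G \<Gamma> t \<gamma> =
     (coset_gen G \<Gamma> ((\<gamma> \<otimes>\<^bsub>G\<^esub> t) <#\<^bsub>G\<^esub> \<Gamma>) \<otimes>\<^bsub>coset_sum G \<Gamma>\<^esub> coset_gen G \<Gamma> (t <#\<^bsub>G\<^esub> \<Gamma>), \<one>\<^bsub>G\<^esub>)"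

end

theory Submission
  imports Defs "HOL-Library.Function_Algebras" "Jordan_Normal_Form.Spectral_Radius"
begin

text \<open>
  For \<open>g \<in> \<Gamma>\<close> let \<open>a\<^sub>g\<close> be the generator of \<open>A\<close> at the coset \<open>g t \<Gamma>\<close>.  These are commuting involutions,
  permuted by \<open>\<Gamma>\<close> through left multiplication, and \<open>a\<^sub>h = a\<^sub>1\<close> for \<open>h \<in> H\<close>.  Since \<open>b\<^sub>\<gamma> = a\<^sub>\<gamma> a\<^sub>1\<close>, the task
  is to show that all \<open>a\<^sub>g\<close> have the same image in \<open>U(\<Q>\<^sub>d)\<close>.  The reason is that the matrix algebras
  are finite-dimensional, while \<open>H\<close> is a conjugate of \<open>\<Gamma>\<close> inside \<open>\<Gamma>\<close>.

  Let \<open>G\<close> act coordinatewise by isometries on an ultraproduct of finite-dimensional Hilbert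
  spaces.  Then the vectors
  that are invariant under \<open>H = t \<Gamma> t\<inverse>\<close> are invariant under \<open>\<Gamma>\<close>
  (\<open>invariance_propagates\<close>): the element \<open>t\<close> carries the \<open>\<Gamma>\<close>-invariant vectors onto the \<open>H\<close>-invariant
  ones, which contain them, and in finite dimension a subspace of the same dimension is the whole
  space.  Property (T) makes this work in the ultraproduct, since it replaces the projection
  onto the invariant vectors by a polynomial in finitely many group elements (\<open>almost_projection\<close>),
  which acts in every coordinate, where a linear map that is bounded below is onto
  (\<open>bounded_below_onto\<close>).

  The half differences \<open>y\<^sub>g = (a\<^sub>g - a\<^sub>1) / 2\<close> satisfy \<open>y\<^sub>g\<^sub>h = y\<^sub>g + g y\<^sub>h\<close> for the conjugation action and vanish
  on \<open>H\<close>.  A Hilbert space valued cocycle of \<open>\<Gamma>\<close> is bounded by property (T), so its values have a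
  circumcentre, fixed by the associated affine action.  If the cocycle vanishes on \<open>H\<close>, the
  circumcentre is \<open>H\<close>-invariant, hence \<open>\<Gamma>\<close>-invariant, and the cocycle is zero (\<open>cocycle_vanishes\<close>).

  It remains to place the \<open>y\<^sub>g\<close> into a Hilbert space in which vanishing has a consequence for
  operator norms (\<open>asymptotic_rigidity\<close>).  Each \<open>y\<^sub>s\<close> equals its own cube, so it lifts to Hermitian
  matrices \<open>D\<^sub>s\<^sub>,\<^sub>n\<close> that equal their cubes exactly (\<open>hermitian_rounding\<close>).  For a finite Kazhdan set \<open>F\<close> of
  \<open>\<Gamma>\<close> the Hilbert-Schmidt norms are scaled in such a way that the squared norms of the \<open>D\<^sub>s\<^sub>,\<^sub>n\<close> sum to 1
  over \<open>s \<in> F\<close>, along an ultrafilter on which some \<open>D\<^sub>s\<^sub>,\<^sub>n\<close> is nonzero.  Trace norm bounds ensure that different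
  lifts of \<open>y\<^sub>g\<close> give the same vector of the ultraproduct.  The resulting cocycle is zero, which
  contradicts the scaling unless \<open>y\<^sub>s = 0\<close> for all \<open>s \<in> F\<close>.  As \<open>F\<close> generates \<open>\<Gamma>\<close> (\<open>kazhdan_generates\<close>),
  all \<open>a\<^sub>g\<close> agree.

  The actions involved are multiplicative only up to null vectors.  Therefore property (T) is first
  translated, by the GNS construction, into an inequality for positive definite functions
  (\<open>property_T_kazhdan\<close>), and used only in this form.  Finally \<open>b\<^sub>\<gamma> \<noteq> 1\<close>, so that no homomorphism from
  \<open>W\<close> to \<open>U(\<Q>\<^sub>d)\<close> is injective, and neither is one from a group that contains \<open>W\<close>.
\<close>

section \<open>Pointwise real scaling\<close>

text \<open>Sequences of matrices and functions on a group become real vector spaces, so that both the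
  ultraproduct and the space of a positive definite function are instances of one locale.\<close>

instantiation "fun" :: (type, real_vector) real_vector
begin
definition "scaleR_fun (r::real) (f::'a \<Rightarrow> 'b) = (\<lambda>x. r *\<^sub>R f x)"
instance
  by standard (auto simp: scaleR_fun_def fun_eq_iff scaleR_add_right scaleR_add_left)
end

section \<open>Positive kernels\<close>

definition psd_on :: "'i set \<Rightarrow> ('i \<Rightarrow> 'i \<Rightarrow> real) \<Rightarrow> bool" where
  "psd_on A k \<longleftrightarrow> (\<forall>i\<in>A. \<forall>j\<in>A. k i j = k j i) \<and>
     (\<forall>a. 0 \<le> (\<Sum>i\<in>A. \<Sum>j\<in>A. a i * a j * k i j))"

lemma psd_onD: "psd_on A k \<Longrightarrow> 0 \<le> (\<Sum>i\<in>A. \<Sum>j\<in>A. a i * a j * k i j)"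
  by (simp add: psd_on_def)

lemma psd_on_sym: "psd_on A k \<Longrightarrow> i \<in> A \<Longrightarrow> j \<in> A \<Longrightarrow> k i j = k j i"
  by (simp add: psd_on_def)

lemma psd_on_diag:
  assumes "psd_on A k" "finite A" "p \<in> A"
  shows "0 \<le> k p p"
proof -
  have "0 \<le> (\<Sum>i\<in>A. \<Sum>j\<in>A. (if i = p then 1 else 0) * (if j = p then 1 else 0) * k i j)"
    by (rule psd_onD[OF assms(1)])
  also have "\<dots> = (\<Sum>i\<in>A. if i = p then (\<Sum>j\<in>A. if j = p then k i j else 0) else 0)"
    by (intro sum.cong refl) (auto intro!: sum.cong)
  also have "\<dots> = k p p"
    using assms(2,3) by simp
  finally show ?thesis .
qed

lemma psd_on_two:
  assumes k: "psd_on A k" and A: "finite A" "p \<in> A" "i \<in> A" "p \<noteq> i"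
  shows "0 \<le> r^2 * k p p + 2 * r * q * k p i + q^2 * k i i"
proof -
  let ?a = "\<lambda>x. if x = p then r else if x = i then q else 0"
  have "(\<Sum>x\<in>A. \<Sum>y\<in>A. ?a x * ?a y * k x y) = (\<Sum>x\<in>{p,i}. \<Sum>y\<in>A. ?a x * ?a y * k x y)"
    by (rule sum.mono_neutral_right) (use A in auto)
  also have "\<dots> = (\<Sum>x\<in>{p,i}. \<Sum>y\<in>{p,i}. ?a x * ?a y * k x y)"
    by (intro sum.cong refl sum.mono_neutral_right) (use A in auto)
  also have "\<dots> = r^2 * k p p + 2 * r * q * k p i + q^2 * k i i"
    using A psd_on_sym[OF k A(2,3)] by (simp add: power2_eq_square algebra_simps)
  finally show ?thesis
    using psd_onD[OF k, of ?a] by simp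
qed

text \<open>Otherwise the form on the span of \<open>p\<close> and \<open>i\<close>, restricted to coefficient 1 at \<open>i\<close>, is a nonconstant
  affine function of the coefficient at \<open>p\<close> and takes negative values.\<close>

lemma psd_on_zero_diag:
  assumes k: "psd_on A k" and A: "finite A" "p \<in> A" "i \<in> A" and z: "k p p = 0"
  shows "k p i = 0"
proof (cases "p = i")
  case False
  show ?thesis
  proof (rule ccontr)
    assume nz: "k p i \<noteq> 0"
    have "0 \<le> 2 * (- (k i i + 1) / (2 * k p i)) * 1 * k p i + k i i"
      using psd_on_two[OF k A(1,2,3) False, of "- (k i i + 1) / (2 * k p i)" 1] z by simp
    then show False using nz by (simp add: field_simps)
  qed
qed (use z in simp)

lemma psd_on_subset:
  assumes k: "psd_on A k" and A: "finite A" "A' \<subseteq> A"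
  shows "psd_on A' k"
  unfolding psd_on_def
proof (intro conjI allI ballI)
  fix a :: "'a \<Rightarrow> real"
  let ?a = "\<lambda>x. if x \<in> A' then a x else 0"
  have "0 \<le> (\<Sum>x\<in>A. \<Sum>y\<in>A. ?a x * ?a y * k x y)"
    by (rule psd_onD[OF k])
  also have "\<dots> = (\<Sum>x\<in>A'. \<Sum>y\<in>A. ?a x * ?a y * k x y)"
    by (rule sum.mono_neutral_right) (use A in auto)
  also have "\<dots> = (\<Sum>x\<in>A'. \<Sum>y\<in>A'. ?a x * ?a y * k x y)"
    by (intro sum.cong refl sum.mono_neutral_right) (use A in auto)
  also have "\<dots> = (\<Sum>x\<in>A'. \<Sum>y\<in>A'. a x * a y * k x y)"
    by (intro sum.cong refl) auto
  finally show "0 \<le> (\<Sum>x\<in>A'. \<Sum>y\<in>A'. a x * a y * k x y)" .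
qed (use assms psd_on_sym[OF k] in blast)

text \<open>The Schur product theorem, by one step of Cholesky elimination: \<open>k = v v\<^sup>T + k'\<close>, where \<open>k'\<close> is
  again positive and vanishes on the row and the column of \<open>p\<close>.  The rank one part turns the sum
  into a value of the form of \<open>l\<close>; the rest is a sum over \<open>A - {p}\<close>, treated by induction.\<close>

lemma psd_on_mult_sum:
  assumes "finite A" "psd_on A k" "psd_on A l"
  shows "0 \<le> (\<Sum>i\<in>A. \<Sum>j\<in>A. a i * a j * (k i j * l i j))"
  using assms
proof (induction "card A" arbitrary: A k)
  case 0
  then show ?case by simp
next
  case (Suc n)
  then obtain p where p: "p \<in> A" by fastforce
  note fin = Suc.prems(1) and k = Suc.prems(2) and l = Suc.prems(3)
  define v where "v i = (if k p p = 0 then 0 else k p i / sqrt (k p p))" for i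
  define k' where "k' i j = k i j - v i * v j" for i j
  have d: "0 \<le> k p p" by (rule psd_on_diag[OF k fin p])
  have vp: "v p * v i = k p i" if "i \<in> A" for i
    using psd_on_zero_diag[OF k fin p that] d by (auto simp: v_def)
  have k'p: "k' p i = 0" "k' i p = 0" if "i \<in> A" for i
    using vp[OF that] psd_on_sym[OF k that p] by (auto simp: k'_def mult.commute)
  have "psd_on A k'"
    unfolding psd_on_def
  proof (intro conjI allI ballI)
    fix a :: "'a \<Rightarrow> real"
    define S where "S = (\<Sum>i\<in>A. a i * v i)"
    \<comment> \<open>The entry at \<open>p\<close> is shifted so that \<open>b\<close> becomes orthogonal to \<open>v\<close>; \<open>k'\<close> does not see the shift.\<close>
    define b where "b i = a i - (if i = p then (if k p p = 0 then 0 else S / sqrt (k p p)) else 0)" for i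
    have exp: "(\<Sum>i\<in>A. \<Sum>j\<in>A. b i * b j * k' i j) = (\<Sum>i\<in>A. \<Sum>j\<in>A. a i * a j * k' i j)"
      by (intro sum.cong refl) (auto simp: b_def k'p)
    have bS: "(\<Sum>i\<in>A. b i * v i) = 0 \<or> k p p = 0"
    proof (cases "k p p = 0")
      case False
      have "(\<Sum>i\<in>A. b i * v i) = S - (\<Sum>i\<in>A. if i = p then S / sqrt (k p p) * v i else 0)"
        unfolding S_def sum_subtractf[symmetric] using False
        by (intro sum.cong refl) (auto simp: b_def S_def algebra_simps)
      also have "\<dots> = S - S / sqrt (k p p) * v p" using fin p by simp
      also have "\<dots> = 0" using False d by (simp add: v_def field_simps)
      finally show ?thesis by blast
    qed simp
    have bS0: "(\<Sum>i\<in>A. b i * v i) = 0"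
      using bS by (auto simp: v_def)
    have "(\<Sum>i\<in>A. \<Sum>j\<in>A. b i * b j * k' i j)
        = (\<Sum>i\<in>A. \<Sum>j\<in>A. b i * b j * k i j) - (\<Sum>i\<in>A. \<Sum>j\<in>A. (b i * v i) * (b j * v j))"
      by (simp add: k'_def sum_subtractf[symmetric] algebra_simps)
    also have "(\<Sum>i\<in>A. \<Sum>j\<in>A. (b i * v i) * (b j * v j)) = (\<Sum>i\<in>A. b i * v i) * (\<Sum>j\<in>A. b j * v j)"
      by (simp add: sum_product)
    finally show "0 \<le> (\<Sum>i\<in>A. \<Sum>j\<in>A. a i * a j * k' i j)"
      using psd_onD[OF k, of b] bS0 exp by simp
  qed (use psd_on_sym[OF k] in \<open>auto simp: k'_def mult.commute\<close>)
  then have k'A: "psd_on (A - {p}) k'"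
    by (rule psd_on_subset[OF _ fin]) auto
  have lA: "psd_on (A - {p}) l"
    by (rule psd_on_subset[OF l fin]) auto
  have IH: "0 \<le> (\<Sum>i\<in>A - {p}. \<Sum>j\<in>A - {p}. a i * a j * (k' i j * l i j))"
    by (rule Suc.hyps(1)) (use Suc.hyps(2) fin p k'A lA in auto)
  have "(\<Sum>i\<in>A. \<Sum>j\<in>A. a i * a j * (k' i j * l i j))
      = (\<Sum>i\<in>A - {p}. \<Sum>j\<in>A. a i * a j * (k' i j * l i j))"
    by (rule sum.mono_neutral_right) (use fin k'p p in auto)
  also have "\<dots> = (\<Sum>i\<in>A - {p}. \<Sum>j\<in>A - {p}. a i * a j * (k' i j * l i j))"
    by (intro sum.cong refl sum.mono_neutral_right) (use fin k'p p in auto)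
  finally have 1: "0 \<le> (\<Sum>i\<in>A. \<Sum>j\<in>A. a i * a j * (k' i j * l i j))"
    using IH by simp
  have "(\<Sum>i\<in>A. \<Sum>j\<in>A. a i * a j * (k i j * l i j))
      = (\<Sum>i\<in>A. \<Sum>j\<in>A. (a i * v i) * (a j * v j) * l i j)
        + (\<Sum>i\<in>A. \<Sum>j\<in>A. a i * a j * (k' i j * l i j))"
    by (simp add: k'_def sum.distrib[symmetric] algebra_simps)
  then show ?case
    using 1 psd_onD[OF l, of "\<lambda>i. a i * v i"] by linarith
qed

lemma psd_on_mult:
  assumes "finite A" "psd_on A k" "psd_on A l"
  shows "psd_on A (\<lambda>i j. k i j * l i j)"
  using psd_on_mult_sum[OF assms] psd_on_sym[OF assms(2)] psd_on_sym[OF assms(3)]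
  unfolding psd_on_def by simp

lemma psd_on_power:
  assumes "finite A" "psd_on A k"
  shows "psd_on A (\<lambda>i j. k i j ^ m)"
proof (induction m)
  case 0
  have "(\<Sum>i\<in>A. \<Sum>j\<in>A. a i * a j) = (\<Sum>i\<in>A. a i)^2" for a :: "'a \<Rightarrow> real"
    by (simp add: power2_eq_square sum_product)
  then show ?case by (simp add: psd_on_def)
next
  case (Suc m)
  then show ?case using psd_on_mult[OF assms(1,2) Suc] by simp
qed

text \<open>The exponential series has nonnegative coefficients, and positivity passes to powers, sums and
  limits.\<close>

lemma psd_on_exp:
  assumes "finite A" "psd_on A k"
  shows "psd_on A (\<lambda>i j. exp (k i j))"
  unfolding psd_on_def
proof (intro conjI allI ballI)
  fix a :: "'a \<Rightarrow> real"
  have *: "(\<lambda>m. a i * a j * (k i j ^ m /\<^sub>R fact m)) sums (a i * a j * exp (k i j))" for i j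
    by (intro sums_mult exp_converges)
  have "(\<lambda>m. \<Sum>i\<in>A. \<Sum>j\<in>A. a i * a j * (k i j ^ m /\<^sub>R fact m)) sums
      (\<Sum>i\<in>A. \<Sum>j\<in>A. a i * a j * exp (k i j))"
    by (intro sums_sum *)
  moreover have "0 \<le> (\<Sum>i\<in>A. \<Sum>j\<in>A. a i * a j * (k i j ^ m /\<^sub>R fact m))" for m
  proof -
    have "(\<Sum>i\<in>A. \<Sum>j\<in>A. a i * a j * (k i j ^ m /\<^sub>R fact m))
        = inverse (fact m) * (\<Sum>i\<in>A. \<Sum>j\<in>A. a i * a j * k i j ^ m)"
      by (simp add: sum_distrib_left algebra_simps)
    then show ?thesis
      using psd_onD[OF psd_on_power[OF assms, of m], of a] by simp
  qed
  ultimately show "0 \<le> (\<Sum>i\<in>A. \<Sum>j\<in>A. a i * a j * exp (k i j))"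
    by (rule sums_le[OF _ sums_zero, rotated]) 
qed (use psd_on_sym[OF assms(2)] in simp)

definition pos_def :: "'g monoid \<Rightarrow> ('g \<Rightarrow> real) \<Rightarrow> bool" where
  "pos_def K \<phi> \<longleftrightarrow> (\<forall>A. finite A \<longrightarrow> A \<subseteq> carrier K \<longrightarrow> psd_on A (\<lambda>g h. \<phi> (inv\<^bsub>K\<^esub> g \<otimes>\<^bsub>K\<^esub> h)))"

text \<open>Property (T) in terms of positive definite functions.  In this form it applies to actions on
  spaces that are neither complete nor separated and that are multiplicative only up to null
  vectors.\<close>

definition kazhdan :: "'g monoid \<Rightarrow> 'g set \<Rightarrow> real \<Rightarrow> bool" where
  "kazhdan K F C \<longleftrightarrow> finite F \<and> F \<subseteq> carrier K \<and> 0 \<le> C \<and>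
     (\<forall>\<phi> M. pos_def K \<phi> \<longrightarrow> \<phi> \<one>\<^bsub>K\<^esub> = 1 \<longrightarrow> 0 \<le> M \<longrightarrow> (\<forall>s\<in>F. 1 - \<phi> s \<le> M) \<longrightarrow>
        (\<forall>g\<in>carrier K. \<bar>\<phi> g - 1\<bar> \<le> C * M))"

section \<open>Semi-inner products\<close>

text \<open>Elements of an ultraproduct are represented by bounded sequences; two of them represent the same
  vector when their difference has seminorm 0.  So the form is only positive semidefinite, and
  equality of vectors is expressed by \<open>N (x - y) = 0\<close>.\<close>

locale semi_inner =
  fixes B :: "'e::real_vector set" and ip :: "'e \<Rightarrow> 'e \<Rightarrow> real"
  assumes B_zero: "0 \<in> B"
    and B_add: "x \<in> B \<Longrightarrow> y \<in> B \<Longrightarrow> x + y \<in> B"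
    and B_scale: "x \<in> B \<Longrightarrow> r *\<^sub>R x \<in> B"
    and ip_add: "\<lbrakk>x \<in> B; y \<in> B; z \<in> B\<rbrakk> \<Longrightarrow> ip (x + y) z = ip x z + ip y z"
    and ip_scale: "\<lbrakk>x \<in> B; z \<in> B\<rbrakk> \<Longrightarrow> ip (r *\<^sub>R x) z = r * ip x z"
    and ip_sym: "\<lbrakk>x \<in> B; y \<in> B\<rbrakk> \<Longrightarrow> ip x y = ip y x"
    and ip_nonneg: "x \<in> B \<Longrightarrow> 0 \<le> ip x x"
begin

definition N :: "'e \<Rightarrow> real" where "N x = sqrt (ip x x)"

lemma B_closed [simp, intro]:
  "0 \<in> B" "x \<in> B \<Longrightarrow> y \<in> B \<Longrightarrow> x + y \<in> B" "x \<in> B \<Longrightarrow> y \<in> B \<Longrightarrow> x - y \<in> B"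
  "x \<in> B \<Longrightarrow> r *\<^sub>R x \<in> B"
  using B_zero B_add B_scale B_add[of x "(-1) *\<^sub>R y"] B_scale[of y "-1"] by auto

lemma B_uminus [simp]: "x \<in> B \<Longrightarrow> - x \<in> B"
  using B_scale[of x "-1"] by simp

lemma B_sum [simp, intro]: "(\<And>i. i \<in> I \<Longrightarrow> x i \<in> B) \<Longrightarrow> (\<Sum>i\<in>I. x i) \<in> B"
  by (induction I rule: infinite_finite_induct) auto

lemma ip_add_right: "\<lbrakk>x \<in> B; y \<in> B; z \<in> B\<rbrakk> \<Longrightarrow> ip z (x + y) = ip z x + ip z y"
  using ip_add[of x y z] ip_sym[of z] by simp

lemma ip_scale_right: "\<lbrakk>x \<in> B; z \<in> B\<rbrakk> \<Longrightarrow> ip z (r *\<^sub>R x) = r * ip z x"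
  using ip_scale[of x z r] ip_sym[of z] by simp

lemma ip_minus: "\<lbrakk>x \<in> B; y \<in> B; z \<in> B\<rbrakk> \<Longrightarrow> ip (x - y) z = ip x z - ip y z"
  using ip_add[of "x - y" y z] by simp

lemma ip_minus_right: "\<lbrakk>x \<in> B; y \<in> B; z \<in> B\<rbrakk> \<Longrightarrow> ip z (x - y) = ip z x - ip z y"
  using ip_add_right[of "x - y" y z] by simp

lemma ip_zero: "z \<in> B \<Longrightarrow> ip 0 z = 0" "z \<in> B \<Longrightarrow> ip z 0 = 0"
  using ip_scale[of 0 z 0] ip_scale_right[of 0 z 0] by auto

lemma ip_sum:
  assumes "\<And>i. i \<in> I \<Longrightarrow> x i \<in> B" "z \<in> B"
  shows "ip (\<Sum>i\<in>I. x i) z = (\<Sum>i\<in>I. ip (x i) z)"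
  using assms(1)
proof (induction I rule: infinite_finite_induct)
  case (insert i I)
  then show ?case by (simp add: ip_add assms(2))
qed (auto simp: ip_zero assms(2))

lemma ip_sum_right:
  assumes "\<And>i. i \<in> I \<Longrightarrow> x i \<in> B" "z \<in> B"
  shows "ip z (\<Sum>i\<in>I. x i) = (\<Sum>i\<in>I. ip z (x i))"
  using ip_sum[OF assms, of I] ip_sym[OF B_sum assms(2), of I x] ip_sym[OF assms(1,2)] assms(1) by simp

lemma N_nonneg [simp]: "x \<in> B \<Longrightarrow> 0 \<le> N x"
  by (simp add: N_def ip_nonneg)

lemma N_sq: "x \<in> B \<Longrightarrow> (N x)^2 = ip x x"
  by (simp add: N_def ip_nonneg)

lemma N_scale: "x \<in> B \<Longrightarrow> N (r *\<^sub>R x) = \<bar>r\<bar> * N x"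
  by (simp add: N_def ip_scale ip_scale_right real_sqrt_mult mult.assoc[symmetric] flip: power2_eq_square)

lemma N_diff_sq: "\<lbrakk>x \<in> B; y \<in> B\<rbrakk> \<Longrightarrow> (N (x - y))^2 = (N x)^2 + (N y)^2 - 2 * ip x y"
  by (simp add: N_sq ip_minus ip_minus_right ip_sym[of y x])

lemma N_add_sq: "\<lbrakk>x \<in> B; y \<in> B\<rbrakk> \<Longrightarrow> (N (x + y))^2 = (N x)^2 + (N y)^2 + 2 * ip x y"
  by (simp add: N_sq ip_add ip_add_right ip_sym[of y x])

lemma psd_gram:
  assumes "\<And>i. i \<in> A \<Longrightarrow> x i \<in> B"
  shows "psd_on A (\<lambda>i j. ip (x i) (x j))"
  unfolding psd_on_def
proof (intro conjI allI ballI)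
  fix a :: "'a \<Rightarrow> real"
  have "0 \<le> ip (\<Sum>i\<in>A. a i *\<^sub>R x i) (\<Sum>j\<in>A. a j *\<^sub>R x j)"
    by (rule ip_nonneg) (use assms in auto)
  also have "\<dots> = (\<Sum>i\<in>A. \<Sum>j\<in>A. a i * a j * ip (x i) (x j))"
  proof -
    have "ip (a i *\<^sub>R x i) (\<Sum>j\<in>A. a j *\<^sub>R x j) = (\<Sum>j\<in>A. a i * a j * ip (x i) (x j))" if "i \<in> A" for i
      using assms that by (simp add: ip_sum_right ip_scale ip_scale_right sum_distrib_left mult.assoc mult.left_commute)
    then show ?thesis
      using assms by (subst ip_sum) auto
  qed
  finally show "0 \<le> (\<Sum>i\<in>A. \<Sum>j\<in>A. a i * a j * ip (x i) (x j))" .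
qed (use assms ip_sym in blast)

lemma Cauchy_Schwarz:
  assumes "x \<in> B" "y \<in> B"
  shows "\<bar>ip x y\<bar> \<le> N x * N y"
proof -
  have q: "0 \<le> (N x)^2 * r^2 + 2 * r * ip x y + (N y)^2" for r
    using N_add_sq[of "r *\<^sub>R x" y] assms zero_le_power2[of "N (r *\<^sub>R x + y)"]
    by (simp add: N_scale ip_scale power_mult_distrib algebra_simps)
  have "(ip x y)^2 \<le> (N x)^2 * (N y)^2"
  proof (cases "N x = 0")
    case True
    have "ip x y = 0"
    proof (rule ccontr)
      assume "ip x y \<noteq> 0"
      with q[of "- ((N y)^2 + 1) / (2 * ip x y)"] True show False by (simp add: field_simps)
    qed
    then show ?thesis by simp
  next
    case False
    then have p: "(N x)^2 > 0" by simp
    have eq: "n * (- q / n)^2 + 2 * (- q / n) * q + m = (n * m - q^2) / n" if "n > 0" for n q m :: real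
      using that by (simp add: field_simps power2_eq_square)
    have "0 \<le> (N x)^2 * (- ip x y / (N x)^2)^2 + 2 * (- ip x y / (N x)^2) * ip x y + (N y)^2"
      by (rule q)
    also note eq[OF p]
    finally show ?thesis unfolding pos_le_divide_eq[OF p] by simp
  qed
  then have "\<bar>ip x y\<bar>^2 \<le> (N x * N y)^2" by (simp add: power_mult_distrib)
  then show ?thesis by (rule power2_le_imp_le) (simp add: assms)
qed

lemma N_triangle:
  assumes "x \<in> B" "y \<in> B"
  shows "N (x + y) \<le> N x + N y"
proof (rule power2_le_imp_le)
  show "(N (x + y))^2 \<le> (N x + N y)^2"
    using N_add_sq[OF assms] Cauchy_Schwarz[OF assms] by (simp add: power2_sum)
qed (simp add: assms)

lemma N_minus_commute: "x \<in> B \<Longrightarrow> y \<in> B \<Longrightarrow> N (x - y) = N (y - x)"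
  by (simp add: N_def ip_minus ip_minus_right)

lemma tri: "\<lbrakk>x \<in> B; y \<in> B; z \<in> B\<rbrakk> \<Longrightarrow> N (x - z) \<le> N (x - y) + N (y - z)"
  using N_triangle[of "x - y" "y - z"] by simp

lemma N_le_add: "\<lbrakk>x \<in> B; y \<in> B\<rbrakk> \<Longrightarrow> N x \<le> N y + N (x - y)"
  using N_triangle[of y "x - y"] by simp

lemma N_zero [simp]: "N 0 = 0" by (simp add: N_def ip_zero)

lemma N_sum_le:
  assumes "\<And>i. i \<in> I \<Longrightarrow> x i \<in> B"
  shows "N (\<Sum>i\<in>I. x i) \<le> (\<Sum>i\<in>I. N (x i))"
  using assms
proof (induction I rule: infinite_finite_induct)
  case (insert i I)
  then show ?case using N_triangle[of "x i" "\<Sum>i\<in>I. x i"] by simp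
qed auto

lemma ip_cong:
  assumes "x \<in> B" "x' \<in> B" "z \<in> B" "N (x - x') = 0"
  shows "ip x z = ip x' z"
  using Cauchy_Schwarz[of "x - x'" z] assms by (simp add: ip_minus)

text \<open>Schoenberg: in \<open>exp (- t |x - y|\<^sup>2) = exp (- t |x|\<^sup>2) exp (- t |y|\<^sup>2) exp (2 t \<langle>x, y\<rangle>)\<close> the last factor
  is a positive kernel by \<open>psd_on_exp\<close>, and the other two only rescale the coefficients.\<close>

lemma psd_exp_dist:
  assumes A: "finite A" "\<And>i. i \<in> A \<Longrightarrow> x i \<in> B" and t: "0 \<le> t"
  shows "psd_on A (\<lambda>i j. exp (- t * (N (x i - x j))^2))"
proof -
  have "psd_on A (\<lambda>i j. ip (sqrt (2 * t) *\<^sub>R x i) (sqrt (2 * t) *\<^sub>R x j))"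
    by (rule psd_gram) (use A in auto)
  then have *: "psd_on A (\<lambda>i j. exp (ip (sqrt (2 * t) *\<^sub>R x i) (sqrt (2 * t) *\<^sub>R x j)))"
    by (rule psd_on_exp[OF A(1)])
  have eq: "exp (- t * (N (x i - x j))^2) = exp (- t * (N (x i))^2) * exp (- t * (N (x j))^2)
      * exp (ip (sqrt (2 * t) *\<^sub>R x i) (sqrt (2 * t) *\<^sub>R x j))" if "i \<in> A" "j \<in> A" for i j
  proof -
    have "ip (sqrt (2 * t) *\<^sub>R x i) (sqrt (2 * t) *\<^sub>R x j) = (sqrt (2 * t) * sqrt (2 * t)) * ip (x i) (x j)"
      using A(2) that by (simp add: ip_scale ip_scale_right)
    also have "\<dots> = 2 * t * ip (x i) (x j)" using t by (simp flip: power2_eq_square)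
    finally have *: "ip (sqrt (2 * t) *\<^sub>R x i) (sqrt (2 * t) *\<^sub>R x j) = 2 * t * ip (x i) (x j)" .
    show ?thesis
      unfolding * exp_add[symmetric] using A(2) that by (simp add: N_diff_sq algebra_simps)
  qed
  show ?thesis
    unfolding psd_on_def
  proof (intro conjI allI ballI)
    fix a :: "'a \<Rightarrow> real"
    have "(\<Sum>i\<in>A. \<Sum>j\<in>A. a i * a j * exp (- t * (N (x i - x j))^2))
      = (\<Sum>i\<in>A. \<Sum>j\<in>A. (a i * exp (- t * (N (x i))^2)) * (a j * exp (- t * (N (x j))^2))
         * exp (ip (sqrt (2 * t) *\<^sub>R x i) (sqrt (2 * t) *\<^sub>R x j)))"
      by (intro sum.cong refl, subst eq) (auto simp: algebra_simps)
    then show "0 \<le> (\<Sum>i\<in>A. \<Sum>j\<in>A. a i * a j * exp (- t * (N (x i - x j))^2))"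
      using psd_onD[OF *, of "\<lambda>i. a i * exp (- t * (N (x i))^2)"] by simp
  qed (use A N_minus_commute in auto)
qed

end

section \<open>Groups acting by almost isometries\<close>

text \<open>\<open>Ops\<close> stands for the operators that act coordinatewise on a family of finite-dimensional spaces.
  Finite dimension enters the argument through \<open>Ops_onto\<close> alone, a property which the unilateral
  shift on a Hilbert space violates.  The action is multiplicative only up to null vectors, since
  it will come from lifts of a homomorphism that are multiplicative only asymptotically.\<close>

locale finite_action = semi_inner B ip + group G
  for B :: "'e::real_vector set" and ip and G :: "'g monoid" (structure) +
  fixes act :: "'g \<Rightarrow> 'e \<Rightarrow> 'e" and Ops :: "('e \<Rightarrow> 'e) set"
  assumes Ops_B: "\<lbrakk>V \<in> Ops; x \<in> B\<rbrakk> \<Longrightarrow> V x \<in> B"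
    and Ops_add: "\<lbrakk>V \<in> Ops; x \<in> B; y \<in> B\<rbrakk> \<Longrightarrow> V (x + y) = V x + V y"
    and Ops_scale: "\<lbrakk>V \<in> Ops; x \<in> B\<rbrakk> \<Longrightarrow> V (r *\<^sub>R x) = r *\<^sub>R V x"
    and id_Ops: "(\<lambda>x. x) \<in> Ops"
    and comp_Ops: "\<lbrakk>U \<in> Ops; V \<in> Ops\<rbrakk> \<Longrightarrow> (\<lambda>x. U (V x)) \<in> Ops"
    and plus_Ops: "\<lbrakk>U \<in> Ops; V \<in> Ops\<rbrakk> \<Longrightarrow> (\<lambda>x. U x + V x) \<in> Ops"
    and scale_Ops: "V \<in> Ops \<Longrightarrow> (\<lambda>x. r *\<^sub>R V x) \<in> Ops"
    and act_Ops: "g \<in> carrier G \<Longrightarrow> act g \<in> Ops"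
    and act_iso: "\<lbrakk>g \<in> carrier G; x \<in> B; y \<in> B\<rbrakk> \<Longrightarrow> ip (act g x) (act g y) = ip x y"
    and act_mult: "\<lbrakk>g \<in> carrier G; h \<in> carrier G; x \<in> B\<rbrakk> \<Longrightarrow> N (act (g \<otimes> h) x - act g (act h x)) = 0"
    and Ops_onto: "\<lbrakk>V \<in> Ops; 0 < c; \<And>y. y \<in> B \<Longrightarrow> c * N y \<le> N (V y); z \<in> B\<rbrakk>
        \<Longrightarrow> \<exists>y\<in>B. N (V y - z) = 0"
begin

lemma act_B [simp, intro]: "g \<in> carrier G \<Longrightarrow> x \<in> B \<Longrightarrow> act g x \<in> B"
  using act_Ops Ops_B by blast

lemma Ops_diff: "\<lbrakk>V \<in> Ops; x \<in> B; y \<in> B\<rbrakk> \<Longrightarrow> V (x - y) = V x - V y"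
  using Ops_add[of V x "(-1) *\<^sub>R y"] Ops_scale[of V y "-1"] by simp

lemma act_diff: "\<lbrakk>g \<in> carrier G; x \<in> B; y \<in> B\<rbrakk> \<Longrightarrow> act g (x - y) = act g x - act g y"
  using act_Ops Ops_diff by blast

lemma N_act: "\<lbrakk>g \<in> carrier G; x \<in> B\<rbrakk> \<Longrightarrow> N (act g x) = N x"
  by (simp add: N_def act_iso)

lemma N_act_diff: "\<lbrakk>g \<in> carrier G; x \<in> B; y \<in> B\<rbrakk> \<Longrightarrow> N (act g x - act g y) = N (x - y)"
  using N_act[of g "x - y"] by (simp add: act_diff)

lemma act_one: "x \<in> B \<Longrightarrow> N (act \<one> x - x) = 0"
  using act_mult[of \<one> \<one> x] N_act_diff[of \<one> "act \<one> x" x] N_minus_commute[of "act \<one> x" "act \<one> (act \<one> x)"]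
  by simp

lemma act_mult_le:
  assumes "g \<in> carrier G" "h \<in> carrier G" "x \<in> B" "y \<in> B"
  shows "N (act g (act h x) - y) = N (act (g \<otimes> h) x - y)"
  using tri[of "act g (act h x)" "act (g \<otimes> h) x" y] tri[of "act (g \<otimes> h) x" "act g (act h x)" y]
    act_mult[OF assms(1-3)] N_minus_commute[of "act (g \<otimes> h) x" "act g (act h x)"] assms by simp

lemma act_one_le: "x \<in> B \<Longrightarrow> y \<in> B \<Longrightarrow> N (act \<one> x - y) = N (x - y)"
  using tri[of "act \<one> x" x y] tri[of x "act \<one> x" y] act_one[of x] N_minus_commute[of x "act \<one> x"] by simp

lemma ip_act_mult:
  assumes "g \<in> carrier G" "h \<in> carrier G" "x \<in> B" "y \<in> B"
  shows "ip (act g (act h x)) y = ip (act (g \<otimes> h) x) y"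
  by (rule sym, rule ip_cong) (use assms act_mult in auto)

lemma ip_act_one: "x \<in> B \<Longrightarrow> y \<in> B \<Longrightarrow> ip (act \<one> x) y = ip x y"
  by (rule ip_cong) (use act_one in auto)

lemma act_adjoint:
  assumes "g \<in> carrier G" "x \<in> B" "y \<in> B"
  shows "ip (act g x) y = ip x (act (inv g) y)"
proof -
  have "ip (act g x) y = ip (act (inv g) (act g x)) (act (inv g) y)"
    using assms by (simp add: act_iso)
  also have "\<dots> = ip x (act (inv g) y)"
    using assms by (simp add: ip_act_mult ip_act_one)
  finally show ?thesis .
qed

end

locale kazhdan_action = finite_action B ip G act Ops
  for B :: "'e::real_vector set" and ip and G :: "'g monoid" (structure) and act Ops +
  fixes \<Gamma> F C
  assumes \<Gamma>_sub: "subgroup \<Gamma> G"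
    and kazhdan_\<Gamma>: "kazhdan (G\<lparr>carrier := \<Gamma>\<rparr>) F C"
begin

lemma \<Gamma>_closed [simp, intro]:
  "g \<in> \<Gamma> \<Longrightarrow> g \<in> carrier G" "g \<in> \<Gamma> \<Longrightarrow> inv g \<in> \<Gamma>" "g \<in> \<Gamma> \<Longrightarrow> h \<in> \<Gamma> \<Longrightarrow> g \<otimes> h \<in> \<Gamma>" "\<one> \<in> \<Gamma>"
  using \<Gamma>_sub subgroup.subset subgroup.m_inv_closed subgroup.m_closed subgroup.one_closed by fastforce+

lemma F_props: "finite F" "F \<subseteq> \<Gamma>" "0 \<le> C"
  using kazhdan_\<Gamma> by (auto simp: kazhdan_def)

lemma pos_def_\<Gamma>:
  assumes "\<And>A. finite A \<Longrightarrow> A \<subseteq> \<Gamma> \<Longrightarrow> psd_on A (\<lambda>g h. \<phi> (inv g \<otimes> h))"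
  shows "pos_def (G\<lparr>carrier := \<Gamma>\<rparr>) \<phi>"
  unfolding pos_def_def
proof (intro allI impI)
  fix A assume "finite A" and A: "A \<subseteq> carrier (G\<lparr>carrier := \<Gamma>\<rparr>)"
  then have "psd_on A (\<lambda>g h. \<phi> (inv g \<otimes> h))" using assms by simp
  then show "psd_on A (\<lambda>g h. \<phi> (inv\<^bsub>G\<lparr>carrier := \<Gamma>\<rparr>\<^esub> g \<otimes>\<^bsub>G\<lparr>carrier := \<Gamma>\<rparr>\<^esub> h))"
    using A unfolding psd_on_def by (simp add: m_inv_consistent[OF \<Gamma>_sub] subset_iff cong: sum.cong)
qed

lemma kazhdanD:
  assumes "\<And>A. finite A \<Longrightarrow> A \<subseteq> \<Gamma> \<Longrightarrow> psd_on A (\<lambda>g h. \<phi> (inv g \<otimes> h))"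
    and "\<phi> \<one> = 1" "0 \<le> M" "\<And>s. s \<in> F \<Longrightarrow> 1 - \<phi> s \<le> M" "g \<in> \<Gamma>"
  shows "\<bar>\<phi> g - 1\<bar> \<le> C * M"
  using kazhdan_\<Gamma> pos_def_\<Gamma>[of \<phi>, OF assms(1)] assms(2-) unfolding kazhdan_def by auto

text \<open>The matrix coefficient \<open>g \<mapsto> \<langle>g y, y\<rangle> / |y|\<^sup>2\<close> is positive definite and differs from 1 by
  \<open>|g y - y|\<^sup>2 / (2 |y|\<^sup>2)\<close>; comparing squares turns the constant \<open>C\<close> into \<open>sqrt C\<close>.\<close>

lemma almost_invariant:
  assumes y: "y \<in> B" and d: "0 \<le> \<delta>" "\<And>s. s \<in> F \<Longrightarrow> N (act s y - y) \<le> \<delta>" and g: "g \<in> \<Gamma>"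
  shows "N (act g y - y) \<le> sqrt C * \<delta>"
proof (cases "N y = 0")
  case True
  then have "N (act g y - y) \<le> 0"
    using N_triangle[of "act g y" "(-1) *\<^sub>R y"] g y N_scale[of y "-1"] N_act[of g y] by simp
  also have "0 \<le> sqrt C * \<delta>" using d F_props by simp
  finally show ?thesis .
next
  case False
  define n where "n = (N y)^2"
  have n: "n > 0" using False by (simp add: n_def)
  define \<phi> where "\<phi> g = ip (act g y) y / n" for g
  have disp: "(N (act g y - y))^2 = 2 * n * (1 - \<phi> g)" if "g \<in> \<Gamma>" for g
    using that y n by (simp add: N_diff_sq N_act \<phi>_def field_simps) (simp add: n_def)
  have "\<bar>\<phi> g - 1\<bar> \<le> C * (\<delta>^2 / (2 * n))"
  proof (rule kazhdanD)
    fix A assume A: "finite A" "A \<subseteq> \<Gamma>"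
    have eq: "\<phi> (inv g \<otimes> h) = ip ((1 / sqrt n) *\<^sub>R act g y) ((1 / sqrt n) *\<^sub>R act h y)" if "g \<in> A" "h \<in> A" for g h
    proof -
      have gh: "g \<in> carrier G" "h \<in> carrier G" using that A by auto
      have "ip (act (inv g \<otimes> h) y) y = ip (act h y) (act g y)"
        using gh y ip_act_mult[of "inv g" h y y] act_adjoint[of "inv g" "act h y" y] by simp
      then show ?thesis
        using gh y n ip_sym[of "act h y" "act g y"] by (simp add: \<phi>_def ip_scale ip_scale_right)
    qed
    have "psd_on A (\<lambda>g h. ip ((1 / sqrt n) *\<^sub>R act g y) ((1 / sqrt n) *\<^sub>R act h y))"
      by (rule psd_gram) (use A y in auto)
    then show "psd_on A (\<lambda>g h. \<phi> (inv g \<otimes> h))"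
      unfolding psd_on_def by (simp add: eq cong: sum.cong)
  next
    show "\<phi> \<one> = 1" using y n by (simp add: \<phi>_def ip_act_one flip: N_sq) (simp add: n_def)
    show "0 \<le> \<delta>^2 / (2 * n)" using n by simp
    show "1 - \<phi> s \<le> \<delta>^2 / (2 * n)" if "s \<in> F" for s
    proof -
      have "(N (act s y - y))^2 \<le> \<delta>^2"
        by (rule power_mono) (use d(2)[OF that] that F_props y in auto)
      then show ?thesis using disp[of s] that F_props n by (auto simp: field_simps)
    qed
  qed (rule g)
  moreover have "2 * n * (1 - \<phi> g) \<le> 2 * n * \<bar>\<phi> g - 1\<bar>" using n by (intro mult_left_mono) auto
  ultimately have "(N (act g y - y))^2 \<le> (sqrt C * \<delta>)^2"
    using disp[OF g] n F_props by (simp add: field_simps power_mult_distrib)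
  then show ?thesis by (rule power2_le_imp_le) (use F_props d in auto)
qed

subsection \<open>An almost projection onto the invariant vectors\<close>

text \<open>Symmetric, so that averaging over it is self-adjoint, and nonempty even if \<open>F\<close> is empty.\<close>

definition S :: "'g set" where "S = insert \<one> (F \<union> (\<lambda>s. inv s) ` F)"

text \<open>The lazy random walk operator.  Laziness makes it positive, not just self-adjoint, which gives
  the monotonicity used in \<open>walk_energy\<close>.\<close>

definition walk :: "'e \<Rightarrow> 'e" where
  "walk x = (1/2) *\<^sub>R x + (1 / (2 * real (card S))) *\<^sub>R (\<Sum>s\<in>S. act s x)"

lemma S_props: "finite S" "S \<subseteq> \<Gamma>" "F \<subseteq> S" "0 < card S" "s \<in> S \<Longrightarrow> inv s \<in> S"
proof -
  show f: "finite S" and "S \<subseteq> \<Gamma>" and "F \<subseteq> S" using F_props by (auto simp: S_def)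
  show "0 < card S" using f by (auto simp: card_gt_0_iff S_def)
  show "s \<in> S \<Longrightarrow> inv s \<in> S" using F_props by (auto simp: S_def)
qed

lemma S_carrier [simp]: "s \<in> S \<Longrightarrow> s \<in> carrier G" using S_props by auto

lemma sum_Ops: "finite I \<Longrightarrow> (\<And>i. i \<in> I \<Longrightarrow> V i \<in> Ops) \<Longrightarrow> (\<lambda>x. \<Sum>i\<in>I. V i x) \<in> Ops"
proof (induction I rule: finite_induct)
  case empty
  then show ?case using scale_Ops[OF id_Ops, of 0] by simp
next
  case (insert i I)
  then show ?case using plus_Ops[of "V i" "\<lambda>x. \<Sum>i\<in>I. V i x"] by simp
qed

lemma walk_Ops: "walk \<in> Ops"
  unfolding walk_def [abs_def]
  by (intro plus_Ops scale_Ops id_Ops sum_Ops S_props act_Ops) auto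

lemma walk_B [simp]: "x \<in> B \<Longrightarrow> walk x \<in> B"
  using walk_Ops Ops_B by blast

lemma ip_walk: "x \<in> B \<Longrightarrow> y \<in> B \<Longrightarrow>
    ip (walk x) y = ip x y / 2 + (\<Sum>s\<in>S. ip (act s x) y) / (2 * card S)"
  by (simp add: walk_def ip_add ip_scale ip_sum)

lemma walk_adjoint:
  assumes "x \<in> B" "y \<in> B" shows "ip (walk x) y = ip x (walk y)"
proof -
  have eq: "ip (act (inv s) y) x = ip (act s x) y" if "s \<in> S" for s
    using that assms act_adjoint[of "inv s" y x] ip_sym[of y "act s x"] by simp
  have "(\<Sum>s\<in>S. ip (act s x) y) = (\<Sum>s\<in>S. ip (act s y) x)"
    by (rule sum.reindex_bij_witness[of _ "\<lambda>s. inv s" "\<lambda>s. inv s"])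
      (use eq S_props(5) in auto)
  then show ?thesis
    using assms ip_walk[of x y] ip_walk[of y x] ip_sym[of x "walk y"] ip_sym[of x y] by simp
qed

lemma walk_gap: "x \<in> B \<Longrightarrow> ip (x - walk x) x = (\<Sum>s\<in>S. (N (act s x - x))^2) / (4 * card S)"
  using S_props(4)
proof -
  assume x: "x \<in> B"
  have "(N (act s x - x))^2 = 2 * ip x x - 2 * ip (act s x) x" if "s \<in> S" for s
    using x that by (simp only: N_diff_sq N_act act_B S_carrier N_sq)
  then have *: "(\<Sum>s\<in>S. (N (act s x - x))^2) = 2 * (card S * ip x x) - 2 * (\<Sum>s\<in>S. ip (act s x) x)"
    by (simp add: sum_subtractf sum_distrib_left)
  show ?thesis
    unfolding * using S_props(4) x by (simp add: ip_minus ip_walk field_simps)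
qed

lemma walk_nonneg: assumes x: "x \<in> B" shows "0 \<le> ip (walk x) x"
proof -
  have "- ip x x \<le> ip (act s x) x" if "s \<in> S" for s
    using Cauchy_Schwarz[of "act s x" x] that x by (simp add: N_act N_sq flip: power2_eq_square)
  then have "(\<Sum>s\<in>S. - ip x x) \<le> (\<Sum>s\<in>S. ip (act s x) x)" by (rule sum_mono)
  moreover have "ip (walk x) x = (card S * ip x x + (\<Sum>s\<in>S. ip (act s x) x)) / (2 * card S)"
    using ip_walk[OF x x] S_props(4) by (simp add: field_simps)
  ultimately show ?thesis by simp
qed

lemma walk_disp:
  assumes "x \<in> B" "s \<in> S"
  shows "(N (act s x - x))^2 \<le> 4 * card S * ip (x - walk x) x"
  using member_le_sum[OF assms(2), of "\<lambda>s. (N (act s x - x))^2"] S_props assms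
  by (auto simp: walk_gap)

lemma walk_contr: assumes x: "x \<in> B" shows "N (walk x) \<le> N x"
proof -
  have "N (walk x) \<le> N ((1/2) *\<^sub>R x) + N ((1 / (2 * real (card S))) *\<^sub>R (\<Sum>s\<in>S. act s x))"
    unfolding walk_def by (rule N_triangle) (use x in auto)
  also have "\<dots> = N x / 2 + N (\<Sum>s\<in>S. act s x) / (2 * card S)"
    using x by (simp add: N_scale)
  also have "N (\<Sum>s\<in>S. act s x) \<le> (\<Sum>s\<in>S. N (act s x))" by (rule N_sum_le) (use x in auto)
  also have "\<dots> = card S * N x" using x by (simp add: N_act)
  finally show ?thesis using S_props(4) by (simp add: field_simps)
qed

lemma walk_funpow:
  "x \<in> B \<Longrightarrow> (walk ^^ k) x \<in> B"
  "x \<in> B \<Longrightarrow> N ((walk ^^ k) x) \<le> N x"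
  "x \<in> B \<Longrightarrow> y \<in> B \<Longrightarrow> ip ((walk ^^ k) x) y = ip x ((walk ^^ k) y)"
  "(walk ^^ k) \<in> Ops"
proof -
  have B: "x \<in> B \<Longrightarrow> (walk ^^ k) x \<in> B" for x k by (induction k) auto
  then show "x \<in> B \<Longrightarrow> (walk ^^ k) x \<in> B" .
  show "x \<in> B \<Longrightarrow> N ((walk ^^ k) x) \<le> N x"
  proof (induction k)
    case (Suc k)
    then show ?case using walk_contr[OF B[of x k]] by simp
  qed simp
  show "x \<in> B \<Longrightarrow> y \<in> B \<Longrightarrow> ip ((walk ^^ k) x) y = ip x ((walk ^^ k) y)"
  proof (induction k arbitrary: y)
    case (Suc k)
    have "ip ((walk ^^ Suc k) x) y = ip ((walk ^^ k) x) (walk y)"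
      using Suc.prems B by (simp add: walk_adjoint)
    also have "\<dots> = ip x ((walk ^^ k) (walk y))" by (rule Suc.IH) (use Suc.prems in auto)
    finally show ?case by (simp add: funpow_swap1)
  qed simp
  show "(walk ^^ k) \<in> Ops"
  proof (induction k)
    case (Suc k)
    then show ?case using comp_Ops[OF walk_Ops Suc] by (simp add: comp_def)
  qed (use id_Ops in \<open>simp add: id_def\<close>)
qed

lemma walk_quadratic_nonneg:
  assumes x: "x \<in> B" shows "0 \<le> ip ((walk ^^ j) x) x"
proof (cases "even j")
  case True
  then obtain i where "j = i + i" by (auto elim: evenE simp: mult_2)
  then have "ip ((walk ^^ j) x) x = ip ((walk ^^ i) x) ((walk ^^ i) x)"
    using x walk_funpow by (simp add: funpow_add)
  then show ?thesis using ip_nonneg[OF walk_funpow(1)[OF x, of i]] by (simp only:)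
next
  case False
  then obtain i where "j = i + Suc i" by (auto elim: oddE simp: mult_2)
  then have "ip ((walk ^^ j) x) x = ip (walk ((walk ^^ i) x)) ((walk ^^ i) x)"
    using walk_funpow(3)[OF walk_B[OF walk_funpow(1)[OF x, of i]] x, of i]
    by (simp only: funpow_add o_apply funpow.simps)
  then show ?thesis using walk_nonneg[OF walk_funpow(1)[OF x, of i]] by (simp only:)
qed

text \<open>With \<open>P\<close> the walk operator and \<open>e\<^sub>j = \<langle>P\<^sup>j y, y\<rangle> \<ge> 0\<close>, the decrements \<open>e\<^sub>j - e\<^sub>j\<^sub>+\<^sub>1\<close> are decreasing in \<open>j\<close>,
  because their differences are values of the positive quadratic form of \<open>P\<^sup>j\<close>.  So the decrement number \<open>2k\<close>,
  which is the left hand energy, is at most the average of the first \<open>2k + 1\<close> of them.\<close>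

lemma walk_energy:
  assumes y: "y \<in> B"
  shows "(2 * real k + 1) * ip ((walk ^^ k) y - walk ((walk ^^ k) y)) ((walk ^^ k) y) \<le> (N y)^2"
proof -
  define e where "e j = ip ((walk ^^ j) y) y" for j
  have conv: "e (Suc j) - e (Suc (Suc j)) \<le> e j - e (Suc j)" for j
  proof -
    define w where "w = y - walk y"
    have w: "w \<in> B" using y by (simp add: w_def)
    have lin: "(walk ^^ j) w = (walk ^^ j) y - (walk ^^ Suc j) y" for j
      unfolding w_def using Ops_diff[OF walk_funpow(4)[of j] y walk_B[OF y]] by (simp add: funpow_swap1)
    have eq: "ip v w = ip v y - ip (walk v) y" if "v \<in> B" for v
      using that y by (simp add: walk_adjoint w_def ip_minus_right)
    have "0 \<le> ip ((walk ^^ j) w) w" by (rule walk_quadratic_nonneg[OF w])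
    also note eq[OF walk_funpow(1)[OF w, of j]]
    also have "ip ((walk ^^ j) w) y - ip (walk ((walk ^^ j) w)) y = (e j - e (Suc j)) - (e (Suc j) - e (Suc (Suc j)))"
      using lin[of j] lin[of "Suc j"] y walk_funpow(1)[OF y] walk_B by (simp add: ip_minus e_def)
    finally show ?thesis by simp
  qed
  have dec: "e n - e (Suc n) \<le> e j - e (Suc j)" if "j \<le> n" for j n
    using that by (induction n rule: dec_induct) (use conv order_trans in blast)+
  have "(2 * real k + 1) * (e (2*k) - e (Suc (2*k))) = (\<Sum>j\<le>2*k. e (2*k) - e (Suc (2*k)))"
    by simp
  also have "\<dots> \<le> (\<Sum>j\<le>2*k. e j - e (Suc j))" by (rule sum_mono) (use dec in auto)
  also have "\<dots> = e 0 - e (Suc (2*k))" by (rule sum_telescope)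
  also have "\<dots> \<le> (N y)^2" using walk_quadratic_nonneg[OF y, of "Suc (2*k)"] y by (simp add: e_def N_sq)
  also have "e (2*k) - e (Suc (2*k)) = ip ((walk ^^ k) y - walk ((walk ^^ k) y)) ((walk ^^ k) y)"
  proof -
    have "e (2*k) = ip ((walk ^^ k) y) ((walk ^^ k) y)"
      using walk_funpow y by (simp add: e_def mult_2 funpow_add)
    moreover have "e (Suc (2*k)) = ip (walk ((walk ^^ k) y)) ((walk ^^ k) y)"
    proof -
      have "Suc (2*k) = k + Suc k" by simp
      then show ?thesis using walk_funpow y by (simp only: e_def funpow_add) simp
    qed
    ultimately show ?thesis using walk_funpow y by (simp add: ip_minus)
  qed
  finally show ?thesis .
qed

text \<open>\<open>g P\<^sup>k y\<close> is a convex combination of vectors \<open>h y\<close> with \<open>h \<in> \<Gamma>\<close>, \<open>P\<close> being the walk operator.\<close>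

lemma walk_fixes:
  assumes y: "y \<in> B" and d: "\<And>g. g \<in> \<Gamma> \<Longrightarrow> N (act g y - y) \<le> \<delta>" and g: "g \<in> \<Gamma>"
  shows "N (act g ((walk ^^ k) y) - y) \<le> \<delta>"
  using g
proof (induction k arbitrary: g)
  case (Suc k)
  define z where "z = (walk ^^ k) y"
  have z: "z \<in> B" using walk_funpow y by (simp add: z_def)
  let ?c = "1 / (2 * real (card S))"
  have lin: "act g (walk z) = (1/2) *\<^sub>R act g z + ?c *\<^sub>R (\<Sum>s\<in>S. act g (act s z))"
  proof -
    have "act g (\<Sum>s\<in>I. act s z) = (\<Sum>s\<in>I. act g (act s z))" if "I \<subseteq> S" for I
      using finite_subset[OF that S_props(1)] that
    proof (induction I rule: finite_induct)
      case empty
      then show ?case using Ops_scale[OF act_Ops, of g 0 0] Suc.prems by simp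
    next
      case (insert s I)
      then have "(\<Sum>s\<in>I. act s z) \<in> B" "act s z \<in> B" using z by (auto intro!: B_sum act_B)
      then show ?case
        using insert Suc.prems Ops_add[OF act_Ops, of g "act s z" "\<Sum>s\<in>I. act s z"] by simp
    qed
    then show ?thesis
      unfolding walk_def using Suc.prems z
      by (subst Ops_add[OF act_Ops]) (auto simp: Ops_scale[OF act_Ops])
  qed
  have yeq: "y = (1/2) *\<^sub>R y + ?c *\<^sub>R (\<Sum>s\<in>S. y)"
    using S_props(4) by (simp add: sum_constant_scaleR flip: scaleR_left.add)
  have "(1/2) *\<^sub>R (act g z - y) + ?c *\<^sub>R (\<Sum>s\<in>S. act g (act s z) - y)
      = act g (walk z) - ((1/2) *\<^sub>R y + ?c *\<^sub>R (\<Sum>s\<in>S. y))"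
    unfolding lin by (simp add: sum_subtractf scaleR_diff_right)
  then have "act g (walk z) - y = (1/2) *\<^sub>R (act g z - y) + ?c *\<^sub>R (\<Sum>s\<in>S. act g (act s z) - y)"
    by (simp only: yeq[symmetric])
  then have "N (act g (walk z) - y) \<le> N ((1/2) *\<^sub>R (act g z - y)) + N (?c *\<^sub>R (\<Sum>s\<in>S. act g (act s z) - y))"
    using Suc.prems z y by (simp add: N_triangle)
  also have "\<dots> = N (act g z - y) / 2 + ?c * N (\<Sum>s\<in>S. act g (act s z) - y)"
    using Suc.prems z y by (simp add: N_scale)
  also have "\<dots> \<le> \<delta> / 2 + ?c * (\<Sum>s\<in>S. \<delta>)"
  proof (intro add_mono mult_left_mono)
    show "N (act g z - y) / 2 \<le> \<delta> / 2" using Suc.IH[OF Suc.prems] by (simp add: z_def)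
    have "N (\<Sum>s\<in>S. act g (act s z) - y) \<le> (\<Sum>s\<in>S. N (act g (act s z) - y))"
      by (rule N_sum_le) (use Suc.prems z y in auto)
    also have "\<dots> \<le> (\<Sum>s\<in>S. \<delta>)"
    proof (rule sum_mono)
      fix s assume s: "s \<in> S"
      then have "g \<otimes> s \<in> \<Gamma>" using S_props Suc.prems by auto
      then show "N (act g (act s z) - y) \<le> \<delta>"
        using Suc.IH[of "g \<otimes> s"] act_mult_le[of g s z y] s Suc.prems z y by (simp add: z_def)
    qed
    finally show "N (\<Sum>s\<in>S. act g (act s z) - y) \<le> (\<Sum>s\<in>S. \<delta>)" .
  qed auto
  also have "\<dots> = \<delta>" using S_props(4) by simp
  finally show ?case by (simp add: z_def)
qed (use d in simp)

text \<open>A large power of the walk operator moves every vector almost into the invariant vectors, by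
  \<open>walk_energy\<close> and property (T).  The projection onto the invariant vectors itself would not do below,
  because it need not act coordinatewise; the power is a polynomial in finitely many group
  elements and lies in \<open>Ops\<close>.\<close>

lemma almost_projection:
  assumes "0 < \<theta>"
  obtains X where "X \<in> Ops" "\<And>x y. x \<in> B \<Longrightarrow> y \<in> B \<Longrightarrow> ip (X x) y = ip x (X y)"
    "\<And>x. x \<in> B \<Longrightarrow> N (X x) \<le> N x"
    "\<And>x g. x \<in> B \<Longrightarrow> g \<in> \<Gamma> \<Longrightarrow> N (act g (X x) - X x) \<le> \<theta> * N x"
    "\<And>x \<delta>. x \<in> B \<Longrightarrow> (\<And>g. g \<in> \<Gamma> \<Longrightarrow> N (act g x - x) \<le> \<delta>) \<Longrightarrow> N (X x - x) \<le> \<delta>"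
proof -
  obtain k :: nat where k: "4 * card S * C / \<theta>^2 < real k" using reals_Archimedean2 by blast
  show thesis
  proof (rule that[of "walk ^^ k"])
    fix x g assume x: "x \<in> B" and g: "g \<in> \<Gamma>"
    define z where "z = (walk ^^ k) x"
    have z: "z \<in> B" using walk_funpow x by (simp add: z_def)
    define \<epsilon> where "\<epsilon> = sqrt (4 * card S / (2 * real k + 1)) * N x"
    have "N (act s z - z) \<le> \<epsilon>" if "s \<in> F" for s
    proof -
      have s: "s \<in> S" using that S_props by auto
      have "(N (act s z - z))^2 \<le> 4 * card S * ip (z - walk z) z" by (rule walk_disp[OF z s])
      also have "\<dots> \<le> 4 * card S * ((N x)^2 / (2 * real k + 1))"
        using walk_energy[OF x, of k] unfolding z_def[symmetric]
        by (intro mult_left_mono) (auto simp: field_simps)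
      also have "\<dots> = \<epsilon>^2" by (simp add: \<epsilon>_def power_mult_distrib)
      finally show ?thesis by (rule power2_le_imp_le) (use x in \<open>simp add: \<epsilon>_def\<close>)
    qed
    then have "N (act g z - z) \<le> sqrt C * \<epsilon>"
      using almost_invariant[OF z _ _ g, of \<epsilon>] x by (simp add: \<epsilon>_def)
    also have "\<dots> = sqrt (C * (4 * card S / (2 * real k + 1))) * N x"
      unfolding \<epsilon>_def by (simp only: real_sqrt_mult mult.assoc)
    also have "\<dots> \<le> \<theta> * N x"
    proof (intro mult_right_mono)
      have "4 * card S * C \<le> \<theta>^2 * real k" using k assms by (simp add: field_simps)
      also have "\<dots> \<le> \<theta>^2 * (2 * real k + 1)" by (rule mult_left_mono) auto
      finally have "C * (4 * card S / (2 * real k + 1)) \<le> \<theta>^2" by (simp add: field_simps)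
      then show "sqrt (C * (4 * card S / (2 * real k + 1))) \<le> \<theta>"
        using assms by (simp add: real_le_lsqrt)
    qed (use x in auto)
    finally show "N (act g ((walk ^^ k) x) - (walk ^^ k) x) \<le> \<theta> * N x" by (simp add: z_def)
  next
    fix x \<delta> assume x: "x \<in> B" and "\<And>g. g \<in> \<Gamma> \<Longrightarrow> N (act g x - x) \<le> \<delta>"
    then have "N (act \<one> ((walk ^^ k) x) - x) \<le> \<delta>" by (intro walk_fixes) auto
    then show "N ((walk ^^ k) x - x) \<le> \<delta>" using act_one_le x walk_funpow by simp
  qed (use walk_funpow in auto)
qed

end

section \<open>Shrinking the group does not create invariant vectors\<close>

locale shrinking_action = kazhdan_action B ip G act Ops \<Gamma> F C
  for B :: "'e::real_vector set" and ip and G :: "'g monoid" (structure) and act Ops \<Gamma> F C +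
  fixes t
  assumes t_G [simp]: "t \<in> carrier G"
    and t_\<Gamma>: "\<gamma> \<in> \<Gamma> \<Longrightarrow> t \<otimes> \<gamma> \<otimes> inv t \<in> \<Gamma>"
begin

text \<open>The vectors invariant under \<open>H = t \<Gamma> t\<inverse>\<close> are the image under \<open>t\<close> of those invariant under \<open>\<Gamma>\<close> and
  contain them.  In finite dimension the two spaces have the same dimension and coincide.  What
  follows is an approximate form of this.  The operator \<open>X\<close> almost projects onto the
  \<open>\<Gamma>\<close>-invariant vectors and \<open>Y = t X t\<inverse>\<close> onto the \<open>H\<close>-invariant ones, so \<open>Y X\<close> is close to \<open>X\<close>.  The two
  summands of \<open>V = X t\<inverse> + (1 - Y)\<close> are almost orthogonal and \<open>|X t\<inverse> x| = |Y x|\<close>; so \<open>V\<close> is bounded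
  below and therefore onto.  Applying \<open>Y\<close> to \<open>z = V y\<close> shows that \<open>Y z\<close> is close to \<open>X t\<inverse> y\<close>, which is
  almost \<open>\<Gamma>\<close>-invariant, and \<open>z\<close> is close to \<open>Y z\<close> if it is almost \<open>H\<close>-invariant.\<close>

lemma invariance_propagates_aux:
  assumes z: "z \<in> B" and d: "\<And>\<gamma>. \<gamma> \<in> \<Gamma> \<Longrightarrow> N (act (t \<otimes> \<gamma> \<otimes> inv t) z - z) \<le> \<delta>"
    and g: "g \<in> \<Gamma>" and \<theta>: "0 < \<theta>" "\<theta> \<le> 1/8"
  shows "N (act g z - z) \<le> 2 * \<delta> + 10 * \<theta> * N z"
proof -
  obtain X where X: "X \<in> Ops" "\<And>x y. x \<in> B \<Longrightarrow> y \<in> B \<Longrightarrow> ip (X x) y = ip x (X y)"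
    "\<And>x. x \<in> B \<Longrightarrow> N (X x) \<le> N x"
    "\<And>x g. x \<in> B \<Longrightarrow> g \<in> \<Gamma> \<Longrightarrow> N (act g (X x) - X x) \<le> \<theta> * N x"
    "\<And>x \<delta>. x \<in> B \<Longrightarrow> (\<And>g. g \<in> \<Gamma> \<Longrightarrow> N (act g x - x) \<le> \<delta>) \<Longrightarrow> N (X x - x) \<le> \<delta>"
    using almost_projection[OF \<theta>(1)] by blast
  have XB [simp]: "x \<in> B \<Longrightarrow> X x \<in> B" for x using X(1) Ops_B by blast
  define s where "s = inv t"
  have s [simp]: "s \<in> carrier G" by (simp add: s_def)
  define Y where "Y x = act t (X (act s x))" for x
  have YB [simp]: "x \<in> B \<Longrightarrow> Y x \<in> B" for x by (simp add: Y_def)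
  have Y_Ops: "Y \<in> Ops"
    unfolding Y_def [abs_def] using comp_Ops[OF act_Ops[OF t_G] comp_Ops[OF X(1) act_Ops[OF s]]] .
  have Y_adj: "ip (Y x) y = ip x (Y y)" if "x \<in> B" "y \<in> B" for x y
  proof -
    have adj: "ip (Y x) y = ip (X (act s x)) (act s y)" if "x \<in> B" "y \<in> B" for x y
      unfolding Y_def using act_adjoint[of t "X (act s x)" y] that by (simp add: s_def)
    have "ip (Y x) y = ip (X (act s x)) (act s y)" by (rule adj[OF that])
    also have "\<dots> = ip (act s x) (X (act s y))" by (rule X(2)) (use that in auto)
    also have "\<dots> = ip (X (act s y)) (act s x)" by (rule ip_sym) (use that in auto)
    also have "\<dots> = ip (Y y) x" by (rule adj[OF that(2,1), symmetric])
    also have "\<dots> = ip x (Y y)" by (rule ip_sym) (use that in auto)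
    finally show ?thesis .
  qed
  have Y_inv: "N (act (t \<otimes> \<gamma> \<otimes> inv t) (Y x) - Y x) \<le> \<theta> * N x" if x: "x \<in> B" and \<gamma>: "\<gamma> \<in> \<Gamma>" for x \<gamma>
  proof -
    let ?x = "X (act s x)"
    have "N (act (t \<otimes> \<gamma> \<otimes> inv t) (act t ?x) - Y x) = N (act (t \<otimes> \<gamma> \<otimes> inv t \<otimes> t) ?x - Y x)"
      by (rule act_mult_le) (use x \<gamma> in auto)
    also have "t \<otimes> \<gamma> \<otimes> inv t \<otimes> t = t \<otimes> \<gamma>" using \<gamma> by (simp add: m_assoc)
    also have "N (act (t \<otimes> \<gamma>) ?x - Y x) = N (act t (act \<gamma> ?x) - Y x)"
      by (rule act_mult_le[symmetric]) (use x \<gamma> in auto)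
    also have "\<dots> = N (act \<gamma> ?x - ?x)" unfolding Y_def by (rule N_act_diff) (use x \<gamma> in auto)
    also have "\<dots> \<le> \<theta> * N (act s x)" by (rule X(4)) (use x \<gamma> in auto)
    also have "\<dots> = \<theta> * N x" using x by (simp add: N_act)
    finally show ?thesis by (simp add: Y_def)
  qed
  have Y_fix: "N (Y x - x) \<le> \<epsilon>"
    if x: "x \<in> B" and e: "\<And>\<gamma>. \<gamma> \<in> \<Gamma> \<Longrightarrow> N (act (t \<otimes> \<gamma> \<otimes> inv t) x - x) \<le> \<epsilon>" for x \<epsilon>
  proof -
    have "N (X (act s x) - act s x) \<le> \<epsilon>"
    proof (rule X(5))
      fix \<gamma> assume \<gamma>: "\<gamma> \<in> \<Gamma>"
      have "N (act \<gamma> (act s x) - act s x) = N (act (\<gamma> \<otimes> s) x - act s x)"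
        by (rule act_mult_le) (use x \<gamma> in auto)
      also have "\<gamma> \<otimes> s = s \<otimes> (t \<otimes> \<gamma> \<otimes> inv t)"
        using \<gamma> by (simp add: s_def m_assoc[symmetric])
      also have "N (act (s \<otimes> (t \<otimes> \<gamma> \<otimes> inv t)) x - act s x) = N (act s (act (t \<otimes> \<gamma> \<otimes> inv t) x) - act s x)"
        by (rule act_mult_le[symmetric]) (use x \<gamma> in auto)
      also have "\<dots> = N (act (t \<otimes> \<gamma> \<otimes> inv t) x - x)" by (rule N_act_diff) (use x \<gamma> in auto)
      also have "\<dots> \<le> \<epsilon>" by (rule e[OF \<gamma>])
      finally show "N (act \<gamma> (act s x) - act s x) \<le> \<epsilon>" .
    qed (use x in auto)
    moreover have "N (Y x - act t (act s x)) = N (X (act s x) - act s x)"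
      unfolding Y_def by (rule N_act_diff) (use x in auto)
    moreover have "N (act t (act s x) - x) = 0"
      using act_mult_le[of t s x x] act_one[OF x] x by (simp add: s_def)
    ultimately show ?thesis using tri[of "Y x" "act t (act s x)" x] x by simp
  qed
  have YX: "N (Y (X x) - X x) \<le> \<theta> * N x" if x: "x \<in> B" for x
    by (rule Y_fix) (use X(4) t_\<Gamma> x in auto)
  define V where "V x = X (act s x) + (x - Y x)" for x
  have V_Ops: "V \<in> Ops"
  proof -
    have "(\<lambda>x. X (act s x) + (x + (-1) *\<^sub>R Y x)) \<in> Ops"
      using plus_Ops[OF comp_Ops[OF X(1) act_Ops[OF s]] plus_Ops[OF id_Ops scale_Ops[OF Y_Ops]]] .
    then show ?thesis by (simp add: V_def [abs_def])
  qed
  have V_low: "1/2 * N x \<le> N (V x)" if x: "x \<in> B" for x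
  proof -
    let ?x = "X (act s x)"
    have NY: "N (Y x) = N ?x" using x by (simp add: Y_def N_act)
    have "ip ?x (x - Y x) = ip (?x - Y ?x) x"
      using x by (simp add: ip_minus ip_minus_right Y_adj)
    moreover have "\<bar>ip (?x - Y ?x) x\<bar> \<le> \<theta> * N x * N x"
    proof (rule order_trans[OF Cauchy_Schwarz])
      have "N (?x - Y ?x) \<le> \<theta> * N (act s x)"
        using YX[of "act s x"] N_minus_commute[of ?x "Y ?x"] x by simp
      then show "N (?x - Y ?x) * N x \<le> \<theta> * N x * N x"
        using x by (intro mult_right_mono) (auto simp: N_act)
    qed (use x in auto)
    ultimately have cross: "\<bar>ip ?x (x - Y x)\<bar> \<le> \<theta> * (N x)^2" by (simp add: power2_eq_square)
    have "(N x)^2 \<le> (N (Y x) + N (x - Y x))^2"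
      by (rule power_mono) (use N_triangle[of "Y x" "x - Y x"] x in auto)
    also have "\<dots> \<le> 2 * ((N (Y x))^2 + (N (x - Y x))^2)"
      using sum_squares_bound[of "N (Y x)" "N (x - Y x)"] by (simp add: power2_sum)
    finally have "(N x)^2 \<le> 2 * ((N ?x)^2 + (N (x - Y x))^2)" by (simp add: NY)
    moreover have "(N (V x))^2 = (N ?x)^2 + (N (x - Y x))^2 + 2 * ip ?x (x - Y x)"
      unfolding V_def by (rule N_add_sq) (use x in auto)
    \<comment> \<open>Here the bound 1/8 is used: it leaves half of \<open>|x|\<^sup>2\<close> after the cross term is absorbed.\<close>
    moreover have "\<theta> * (N x)^2 \<le> 1/8 * (N x)^2" by (rule mult_right_mono) (use \<theta> in auto)
    moreover have "- (\<theta> * (N x)^2) \<le> ip ?x (x - Y x)" using cross by linarith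
    ultimately have "(N x)^2 \<le> 4 * (N (V x))^2" by argo
    then have "(1/2 * N x)^2 \<le> (N (V x))^2" by (simp add: power2_eq_square)
    then show ?thesis by (rule power2_le_imp_le) (use x V_Ops Ops_B in auto)
  qed
  obtain y where y: "y \<in> B" "N (V y - z) = 0"
    using Ops_onto[OF V_Ops _ V_low z] by auto
  have VyB [simp]: "V y \<in> B" using V_Ops Ops_B y by blast
  have Ny: "N y \<le> 2 * N z"
    using V_low[OF y(1)] N_le_add[of "V y" z] y z by simp
  let ?w = "X (act s y)"
  have wB [simp]: "?w \<in> B" using y by simp
  have "Y (V y) = Y ?w + (Y y - Y (Y y))"
    unfolding V_def using y Ops_add[OF Y_Ops, of ?w "y - Y y"] Ops_diff[OF Y_Ops, of y "Y y"] by simp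
  then have eq: "Y (V y) - ?w = (Y ?w - ?w) + (Y y - Y (Y y))" by simp
  have "N (Y (V y) - ?w) \<le> N (Y ?w - ?w) + N (Y y - Y (Y y))"
    unfolding eq by (rule N_triangle) (use y in auto)
  also have "N (Y ?w - ?w) \<le> \<theta> * N y" using YX[of "act s y"] y by (simp add: N_act)
  also have "N (Y y - Y (Y y)) \<le> \<theta> * N y"
    using Y_fix[of "Y y", OF _ Y_inv] y N_minus_commute[of "Y y" "Y (Y y)"] by simp
  finally have 1: "N (Y (V y) - ?w) \<le> 2 * \<theta> * N y" by simp
  have "N (Y (V y) - Y z) \<le> N (V y - z)"
  proof -
    have "N (Y (V y - z)) \<le> N (V y - z)"
      using X(3)[of "act s (V y - z)"] z by (simp add: Y_def N_act)
    then show ?thesis using Ops_diff[OF Y_Ops, of "V y" z] z by simp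
  qed
  then have 2: "N (Y z - Y (V y)) \<le> 0" using y z N_minus_commute[of "Y z" "Y (V y)"] by simp
  have 3: "N (z - Y z) \<le> \<delta>" using Y_fix[OF z d] z N_minus_commute[of "Y z" z] by simp
  have zw: "N (z - ?w) \<le> \<delta> + 2 * \<theta> * N y"
    using tri[of z "Y z" ?w] tri[of "Y z" "Y (V y)" ?w] 1 2 3 z by simp
  have "N (act g z - z) \<le> N (act g z - act g ?w) + (N (act g ?w - ?w) + N (?w - z))"
    using tri[of "act g z" "act g ?w" z] tri[of "act g ?w" ?w z] g z by simp
  also have "N (act g z - act g ?w) = N (z - ?w)" by (rule N_act_diff) (use g z in auto)
  also have "N (?w - z) = N (z - ?w)" by (rule N_minus_commute) (use z in auto)
  also have "N (act g ?w - ?w) \<le> \<theta> * N y" using X(4)[of "act s y" g] g y by (simp add: N_act)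
  finally have "N (act g z - z) \<le> 2 * \<delta> + 5 * (\<theta> * N y)" using zw by simp
  also have "\<theta> * N y \<le> \<theta> * (2 * N z)" using Ny \<theta> by (intro mult_left_mono) auto
  finally show ?thesis by simp
qed

lemma invariance_propagates:
  assumes z: "z \<in> B" and d: "\<And>\<gamma>. \<gamma> \<in> \<Gamma> \<Longrightarrow> N (act (t \<otimes> \<gamma> \<otimes> inv t) z - z) \<le> \<delta>" and g: "g \<in> \<Gamma>"
  shows "N (act g z - z) \<le> 2 * \<delta>"
proof (rule field_le_epsilon)
  fix e :: real assume e: "0 < e"
  define \<theta> where "\<theta> = min (1/8) (e / (10 * (N z + 1)))"
  have th: "0 < \<theta>" "\<theta> \<le> 1/8" "\<theta> * (10 * (N z + 1)) \<le> e"
  proof -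
    have p: "0 < 10 * (N z + 1)" using N_nonneg[OF z] by simp
    show "0 < \<theta>" using e p by (simp add: \<theta>_def)
    show "\<theta> \<le> 1/8" unfolding \<theta>_def by (rule min.cobounded1)
    have "\<theta> \<le> e / (10 * (N z + 1))" by (simp add: \<theta>_def)
    then show "\<theta> * (10 * (N z + 1)) \<le> e" using p by (simp add: pos_le_divide_eq)
  qed
  have "10 * \<theta> * N z \<le> \<theta> * (10 * (N z + 1))" using th by (simp add: algebra_simps)
  then show "N (act g z - z) \<le> 2 * \<delta> + e"
    using invariance_propagates_aux[OF z d g th(1,2)] th(3) by linarith
qed

section \<open>Cocycles vanishing on the smaller group\<close>

text \<open>The distance \<open>|c g - c h|\<close> depends only on \<open>g\<inverse> h\<close>, so \<open>exp (- t |c g|\<^sup>2)\<close> is positive definite by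
  Schoenberg.  For small \<open>t\<close> it is close to 1 on \<open>F\<close>, by property (T) it is then at least 1/2
  everywhere, and this bounds \<open>|c g|\<close>.\<close>

lemma cocycle_bounded:
  assumes cB: "\<And>g. g \<in> \<Gamma> \<Longrightarrow> c g \<in> B"
    and coc: "\<And>g h. g \<in> \<Gamma> \<Longrightarrow> h \<in> \<Gamma> \<Longrightarrow> N (c (g \<otimes> h) - (c g + act g (c h))) = 0"
  obtains R where "\<And>g. g \<in> \<Gamma> \<Longrightarrow> N (c g) \<le> R"
proof -
  have dist: "N (c g - c h) = N (c (inv g \<otimes> h))" if gh: "g \<in> \<Gamma>" "h \<in> \<Gamma>" for g h
  proof -
    let ?k = "inv g \<otimes> h"
    have k: "?k \<in> \<Gamma>" "g \<otimes> ?k = h" using gh by (auto simp: m_assoc[symmetric])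
    let ?y = "c g + act g (c ?k)"
    have y: "?y \<in> B" using gh k cB by auto
    have 0: "N (c h - ?y) = 0" using coc[OF gh(1) k(1)] k by simp
    have "N (c h - c g) \<le> N (c h - ?y) + N (?y - c g)" "N (?y - c g) \<le> N (?y - c h) + N (c h - c g)"
      by (rule tri; use y gh cB in auto)+
    then have "N (c h - c g) = N (?y - c g)"
      using 0 N_minus_commute[of "c h" ?y] y gh cB by simp
    also have "\<dots> = N (c ?k)" using gh k cB by (simp add: N_act)
    finally show ?thesis using N_minus_commute[of "c g" "c h"] gh cB by simp
  qed
  have one: "N (c \<one>) = 0" using dist[of \<one> \<one>] by simp
  define M where "M = Max (insert 0 ((\<lambda>s. (N (c s))^2) ` F))"
  have M: "0 \<le> M" "s \<in> F \<Longrightarrow> (N (c s))^2 \<le> M" for s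
    using F_props by (auto simp: M_def)
  \<comment> \<open>Small enough for \<open>C * (t * M)\<close>, the deviation from 1 granted by property (T), to be at most 1/2.\<close>
  define t where "t = 1 / (2 * (C * M + 1))"
  have p: "C * M \<ge> 0" using M F_props by simp
  have t: "0 < t" "C * (t * M) \<le> 1/2" using p by (auto simp: t_def field_simps)
  have small: "\<bar>exp (- t * (N (c g))^2) - 1\<bar> \<le> C * (t * M)" if g: "g \<in> \<Gamma>" for g
  proof (rule kazhdanD[of "\<lambda>g. exp (- t * (N (c g))^2)", OF _ _ _ _ g])
    fix A assume A: "finite A" "A \<subseteq> \<Gamma>"
    have "psd_on A (\<lambda>g h. exp (- t * (N (c g - c h))^2))"
      by (rule psd_exp_dist) (use A t cB in auto)
    then show "psd_on A (\<lambda>g h. exp (- t * (N (c (inv g \<otimes> h)))^2))"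
      unfolding psd_on_def using A by (simp add: dist[symmetric] subset_iff cong: sum.cong)
  next
    fix s assume "s \<in> F"
    then have "t * (N (c s))^2 \<le> t * M" using M t by (intro mult_left_mono) auto
    then show "1 - exp (- t * (N (c s))^2) \<le> t * M"
      using exp_ge_add_one_self[of "- t * (N (c s))^2"] by simp
  qed (use one M t in auto)
  have "(N (c g))^2 \<le> 1 / t" if g: "g \<in> \<Gamma>" for g
  proof -
    let ?x = "t * (N (c g))^2"
    have "1/2 \<le> exp (- ?x)" using small[OF g] t(2) by simp
    moreover have "exp (- ?x) \<le> 1 / (1 + ?x)"
    proof -
      have "1 + ?x \<le> exp ?x" by (rule exp_ge_add_one_self)
      moreover have "0 < 1 + ?x" using t by (simp add: add_pos_nonneg)
      ultimately show ?thesis by (simp add: exp_minus field_simps)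
    qed
    ultimately have "1/2 \<le> 1 / (1 + ?x)" by linarith
    moreover have "0 < 1 + ?x" using t by (simp add: add_pos_nonneg)
    ultimately have "?x \<le> 1" by (simp add: field_simps)
    then show ?thesis using t by (simp add: field_simps)
  qed
  then have "N (c g) \<le> sqrt (1 / t)" if "g \<in> \<Gamma>" for g
    using that real_le_rsqrt by blast
  then show thesis by (rule that)
qed

text \<open>The affine maps \<open>x \<mapsto> g x + c g\<close> permute the values of \<open>c\<close>, so a nearly optimal centre \<open>v\<close> of a ball
  containing all values is nearly fixed by them: otherwise the midpoint of \<open>v\<close> and its image would
  be a better centre.  For elements of \<open>t \<Gamma> t\<inverse>\<close> the maps are linear up to null vectors, so \<open>v\<close> is
  almost invariant under this subgroup, hence under \<open>\<Gamma>\<close>, and then \<open>c g\<close> is almost \<open>v - g v\<close>, that is,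
  almost 0.\<close>

lemma cocycle_vanishes:
  assumes cB: "\<And>g. g \<in> \<Gamma> \<Longrightarrow> c g \<in> B"
    and coc: "\<And>g h. g \<in> \<Gamma> \<Longrightarrow> h \<in> \<Gamma> \<Longrightarrow> N (c (g \<otimes> h) - (c g + act g (c h))) = 0"
    and van: "\<And>\<gamma>. \<gamma> \<in> \<Gamma> \<Longrightarrow> N (c (t \<otimes> \<gamma> \<otimes> inv t)) = 0"
    and g: "g \<in> \<Gamma>"
  shows "N (c g) = 0"
proof -
  obtain R where R: "\<And>g. g \<in> \<Gamma> \<Longrightarrow> N (c g) \<le> R" using cocycle_bounded[OF cB coc] by blast
  \<comment> \<open>The squared radii of the balls that contain all values of \<open>c\<close>.\<close>
  define Q where "Q = {r. 0 \<le> r \<and> (\<exists>v\<in>B. \<forall>g\<in>\<Gamma>. (N (c g - v))^2 \<le> r)}"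
  have "(N (c g - 0))^2 \<le> R^2" if "g \<in> \<Gamma>" for g
    using R[OF that] that cB by (intro power_mono) auto
  then have "\<exists>v\<in>B. \<forall>g\<in>\<Gamma>. (N (c g - v))^2 \<le> R^2" using B_closed(1) by blast
  then have "R^2 \<in> Q" by (simp add: Q_def)
  then have Qne: "Q \<noteq> {}" by blast
  have Qbd: "bdd_below Q" by (rule bdd_belowI[of _ 0]) (simp add: Q_def)
  define r where "r = Inf Q"
  have "N (c g) \<le> 3 * e" if e: "0 < e" for e
  proof -
    have "r < r + e^2 / 4" using e by simp
    then obtain q where q: "q \<in> Q" "q < r + e^2 / 4"
      using cInf_lessD[OF Qne, of "r + e^2/4"] by (auto simp: r_def)
    then obtain v where v: "v \<in> B" "\<And>g. g \<in> \<Gamma> \<Longrightarrow> (N (c g - v))^2 \<le> q" and q0: "0 \<le> q"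
      by (auto simp: Q_def)
    have fixd: "N (v - (act g v + c g)) \<le> e" if g: "g \<in> \<Gamma>" for g
    proof -
      let ?u = "act g v + c g"
      have u: "?u \<in> B" using g v cB by auto
      have rad: "(N (c h - ?u))^2 \<le> q" if h: "h \<in> \<Gamma>" for h
      proof -
        let ?k = "inv g \<otimes> h"
        have k: "?k \<in> \<Gamma>" "g \<otimes> ?k = h" using g h by (auto simp: m_assoc[symmetric])
        have "N (c h - ?u) \<le> N (c h - (c g + act g (c ?k))) + N (c g + act g (c ?k) - ?u)"
          by (rule tri) (use g h k v cB in auto)
        also have "N (c h - (c g + act g (c ?k))) = 0" using coc[OF g k(1)] k by simp
        also have "c g + act g (c ?k) - ?u = act g (c ?k) - act g v" by simp
        also have "N (act g (c ?k) - act g v) = N (c ?k - v)" by (rule N_act_diff) (use g k v cB in auto)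
        finally have "(N (c h - ?u))^2 \<le> (N (c ?k - v))^2"
          using h cB u by (intro power_mono) auto
        then show ?thesis using v(2)[OF k(1)] by simp
      qed
      define m where "m = (1/2) *\<^sub>R (v + ?u)"
      have m: "m \<in> B" using v u by (simp add: m_def)
      have par: "(N (c h - m))^2 \<le> q - (N (v - ?u))^2 / 4" if h: "h \<in> \<Gamma>" for h
      proof -
        let ?a = "c h - v" and ?b = "c h - ?u"
        have ab: "?a \<in> B" "?b \<in> B" using cB[OF h] v u by auto
        have "c h - m = (1/2) *\<^sub>R (?a + ?b)"
          by (simp add: m_def algebra_simps flip: scaleR_left_distrib)
        then have "(N (c h - m))^2 = (N (?a + ?b))^2 / 4"
          using ab by (simp add: N_scale power_divide)
        moreover have "?b - ?a = v - ?u" by simp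
        then have "(N (?b - ?a))^2 = (N (v - ?u))^2" by (simp only:)
        ultimately show ?thesis
          using N_add_sq[OF ab] N_diff_sq[OF ab(2,1)] ip_sym[OF ab] v(2)[OF h] rad[OF h] by linarith
      qed
      have "0 \<le> q - (N (v - ?u))^2 / 4"
        using par[OF g] zero_le_power2[of "N (c g - m)"] by linarith
      then have "q - (N (v - ?u))^2 / 4 \<in> Q" using par m by (auto simp: Q_def)
      then have "r \<le> q - (N (v - ?u))^2 / 4" unfolding r_def by (rule cInf_lower[OF _ Qbd])
      then have "(N (v - ?u))^2 \<le> e^2" using q(2) by simp
      then show ?thesis by (rule power2_le_imp_le) (use e in simp)
    qed
    have "N (act (t \<otimes> \<gamma> \<otimes> inv t) v - v) \<le> e" if \<gamma>: "\<gamma> \<in> \<Gamma>" for \<gamma>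
    proof -
      let ?h = "t \<otimes> \<gamma> \<otimes> inv t"
      have h: "?h \<in> \<Gamma>" using t_\<Gamma>[OF \<gamma>] .
      have "N (v - act ?h v) \<le> N (v - (act ?h v + c ?h)) + N (c ?h)"
        using tri[of v "act ?h v + c ?h" "act ?h v"] h v cB by simp
      then show ?thesis using fixd[OF h] van[OF \<gamma>] N_minus_commute[of v "act ?h v"] h v by simp
    qed
    then have "N (act g v - v) \<le> 2 * e" by (rule invariance_propagates[OF v(1) _ g])
    moreover have "N (c g) \<le> N (v - (act g v + c g)) + N (act g v - v)"
    proof -
      have "N (c g) = N (- c g)" using N_scale[of "c g" "-1"] cB[OF g] by simp
      also have "- c g = (v - (act g v + c g)) + (act g v - v)" by simp
      also have "N \<dots> \<le> N (v - (act g v + c g)) + N (act g v - v)"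
        by (rule N_triangle) (use g v cB in auto)
      finally show ?thesis .
    qed
    ultimately show ?thesis using fixd[OF g] by simp
  qed
  from this[of "(N (c g)) / 4"] show ?thesis
    using N_nonneg[OF cB[OF g]] by (cases "N (c g) = 0") auto
qed

end

section \<open>The Hilbert space of a positive definite function\<close>

text \<open>The form of \<open>\<phi>\<close> on finitely supported functions is completed to a Hilbert space on which the
  group acts by translations, and property (T) is applied to this representation.\<close>

locale gns = group K for K :: "'g monoid" (structure) +
  fixes \<phi> :: "'g \<Rightarrow> real"
  assumes pd: "pos_def K \<phi>"
begin

definition E :: "('g \<Rightarrow> complex) set" where
  "E = {a. finite {g. a g \<noteq> 0} \<and> {g. a g \<noteq> 0} \<subseteq> carrier K}"

definition cip :: "('g \<Rightarrow> complex) \<Rightarrow> ('g \<Rightarrow> complex) \<Rightarrow> complex" where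
  "cip a b = (\<Sum>g | a g \<noteq> 0. \<Sum>h | b h \<noteq> 0. a g * cnj (b h) * of_real (\<phi> (inv g \<otimes> h)))"

definition rip :: "('g \<Rightarrow> complex) \<Rightarrow> ('g \<Rightarrow> complex) \<Rightarrow> real" where
  "rip a b = Re (cip a b)"

lemma cip_eq:
  assumes "finite A" "{g. a g \<noteq> 0} \<subseteq> A" "{g. b g \<noteq> 0} \<subseteq> A"
  shows "cip a b = (\<Sum>g\<in>A. \<Sum>h\<in>A. a g * cnj (b h) * of_real (\<phi> (inv g \<otimes> h)))"
proof -
  have "cip a b = (\<Sum>g | a g \<noteq> 0. \<Sum>h\<in>A. a g * cnj (b h) * of_real (\<phi> (inv g \<otimes> h)))"
    unfolding cip_def by (intro sum.cong refl sum.mono_neutral_left) (use assms in auto)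
  also have "\<dots> = (\<Sum>g\<in>A. \<Sum>h\<in>A. a g * cnj (b h) * of_real (\<phi> (inv g \<otimes> h)))"
    by (intro sum.mono_neutral_left) (use assms in auto)
  finally show ?thesis .
qed

lemma E_common:
  assumes "a \<in> E" "b \<in> E"
  obtains A where "finite A" "A \<subseteq> carrier K" "{g. a g \<noteq> 0} \<subseteq> A" "{g. b g \<noteq> 0} \<subseteq> A"
  using that[of "{g. a g \<noteq> 0} \<union> {g. b g \<noteq> 0}"] assms by (auto simp: E_def)

lemma pd_A: "finite A \<Longrightarrow> A \<subseteq> carrier K \<Longrightarrow> psd_on A (\<lambda>g h. \<phi> (inv g \<otimes> h))"
  using pd by (simp add: pos_def_def)

lemma \<phi>_inv: "g \<in> carrier K \<Longrightarrow> h \<in> carrier K \<Longrightarrow> \<phi> (inv g \<otimes> h) = \<phi> (inv h \<otimes> g)"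
  using psd_on_sym[OF pd_A[of "{g, h}"], of g h] by simp

lemma E_zero: "0 \<in> E" by (simp add: E_def)

lemma E_add: "a \<in> E \<Longrightarrow> b \<in> E \<Longrightarrow> a + b \<in> E"
proof -
  assume a: "a \<in> E" "b \<in> E"
  have sub: "{g. (a + b) g \<noteq> 0} \<subseteq> {g. a g \<noteq> 0} \<union> {g. b g \<noteq> 0}" by auto
  then have "finite {g. (a + b) g \<noteq> 0}" by (rule finite_subset) (use a in \<open>simp add: E_def\<close>)
  then show ?thesis using a sub unfolding E_def by blast
qed

lemma E_cscale: "a \<in> E \<Longrightarrow> (\<lambda>g. c * a g) \<in> E"
  by (auto simp: E_def elim: finite_subset[rotated])

lemma E_scale: "a \<in> E \<Longrightarrow> r *\<^sub>R a \<in> E"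
  using E_cscale[of a "of_real r"] by (simp add: scaleR_fun_def scaleR_conv_of_real)

lemma cip_add:
  assumes "a \<in> E" "b \<in> E" "c \<in> E" shows "cip (a + b) c = cip a c + cip b c"
proof -
  obtain A where A: "finite A" "{g. a g \<noteq> 0} \<subseteq> A" "{g. b g \<noteq> 0} \<subseteq> A" "{g. c g \<noteq> 0} \<subseteq> A"
    using assms that[of "{g. a g \<noteq> 0} \<union> {g. b g \<noteq> 0} \<union> {g. c g \<noteq> 0}"] by (auto simp: E_def)
  have "{g. (a + b) g \<noteq> 0} \<subseteq> {g. a g \<noteq> 0} \<union> {g. b g \<noteq> 0}" by auto
  then have A': "{g. (a + b) g \<noteq> 0} \<subseteq> A" using A by blast
  show ?thesis
    unfolding cip_eq[OF A(1) A' A(4)] cip_eq[OF A(1,2,4)] cip_eq[OF A(1,3,4)]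
      sum.distrib[symmetric]
    by (intro sum.cong refl) (simp add: algebra_simps)
qed

lemma cip_cscale:
  assumes "a \<in> E" "b \<in> E" shows "cip (\<lambda>g. c * a g) b = c * cip a b"
proof -
  obtain A where A: "finite A" "{g. a g \<noteq> 0} \<subseteq> A" "{g. b g \<noteq> 0} \<subseteq> A"
    using E_common[OF assms] by metis
  have A': "{g. c * a g \<noteq> 0} \<subseteq> A" using A by auto
  show ?thesis
    unfolding cip_eq[OF A(1) A' A(3)] cip_eq[OF A] by (simp add: sum_distrib_left mult.assoc)
qed

lemma cip_cnj:
  assumes "a \<in> E" "b \<in> E" shows "cip b a = cnj (cip a b)"
proof -
  obtain A where A: "finite A" "A \<subseteq> carrier K" "{g. a g \<noteq> 0} \<subseteq> A" "{g. b g \<noteq> 0} \<subseteq> A"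
    using E_common[OF assms] by metis
  have "cip b a = (\<Sum>h\<in>A. \<Sum>g\<in>A. b g * cnj (a h) * of_real (\<phi> (inv g \<otimes> h)))"
    unfolding cip_eq[OF A(1,4,3)] by (rule sum.swap)
  also have "\<dots> = (\<Sum>h\<in>A. \<Sum>g\<in>A. cnj (a h) * b g * of_real (\<phi> (inv h \<otimes> g)))"
  proof (intro sum.cong refl)
    fix h g assume "h \<in> A" "g \<in> A"
    then have "\<phi> (inv g \<otimes> h) = \<phi> (inv h \<otimes> g)" using A \<phi>_inv by blast
    then show "b g * cnj (a h) * of_real (\<phi> (inv g \<otimes> h)) = cnj (a h) * b g * of_real (\<phi> (inv h \<otimes> g))"
      by simp
  qed
  also have "\<dots> = cnj (cip a b)"
    unfolding cip_eq[OF A(1,3,4)] by simp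
  finally show ?thesis .
qed

lemma rip_nonneg:
  assumes "a \<in> E" shows "0 \<le> rip a a"
proof -
  obtain A where A: "finite A" "A \<subseteq> carrier K" "{g. a g \<noteq> 0} \<subseteq> A"
    using E_common[OF assms assms] by metis
  have "rip a a = (\<Sum>g\<in>A. \<Sum>h\<in>A. Re (a g) * Re (a h) * \<phi> (inv g \<otimes> h))
      + (\<Sum>g\<in>A. \<Sum>h\<in>A. Im (a g) * Im (a h) * \<phi> (inv g \<otimes> h))"
    unfolding rip_def cip_eq[OF A(1,3,3)] sum.distrib[symmetric] Re_sum
    by (intro sum.cong refl) (simp add: algebra_simps)
  then show ?thesis using psd_onD[OF pd_A[OF A(1,2)]] by (simp add: add_nonneg_nonneg)
qed

sublocale semi_inner E rip
proof
  show "rip (r *\<^sub>R x) z = r * rip x z" if "x \<in> E" "z \<in> E" for x z r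
    using cip_cscale[OF that, of "of_real r"]
    by (simp add: rip_def scaleR_fun_def scaleR_conv_of_real)
  show "rip x y = rip y x" if "x \<in> E" "y \<in> E" for x y
    using cip_cnj[OF that] by (simp add: rip_def)
qed (auto simp: E_zero E_add E_scale rip_nonneg, simp_all add: rip_def cip_add)

lemma cip_rip:
  assumes "a \<in> E" "b \<in> E"
  shows "cip a b = Complex (rip a b) (rip a (\<lambda>g. \<i> * b g))"
proof -
  have "cip a (\<lambda>g. \<i> * b g) = cnj (\<i> * cip b a)"
    using cip_cnj[of "\<lambda>g. \<i> * b g" a] cip_cscale[of b a \<i>] E_cscale[of b] assms by simp
  also have "\<dots> = - \<i> * cip a b" using cip_cnj[OF assms] by simp
  finally show ?thesis by (simp add: rip_def complex_eq_iff)
qed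

lemma N_i: "b \<in> E \<Longrightarrow> N (\<lambda>g. \<i> * b g) = N b"
proof -
  assume b: "b \<in> E"
  then have ib: "(\<lambda>g. \<i> * b g) \<in> E" by (rule E_cscale)
  have "cip (\<lambda>g. \<i> * b g) (\<lambda>g. \<i> * b g) = \<i> * cnj (\<i> * cip b b)"
    using cip_cscale[OF b ib, of \<i>] cip_cnj[OF ib b] cip_cscale[OF b b, of \<i>] by simp
  also have "\<dots> = cip b b" using cip_cnj[OF b b] by simp
  finally show ?thesis by (simp add: N_def rip_def)
qed

text \<open>The real and the imaginary part are bounded separately, whence the factor 2.\<close>

lemma cip_bound:
  assumes a: "a \<in> E" and b: "b \<in> E"
  shows "cmod (cip a b) \<le> 2 * (N a * N b)"
proof -
  have "cmod (cip a b) \<le> \<bar>rip a b\<bar> + \<bar>rip a (\<lambda>g. \<i> * b g)\<bar>"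
    unfolding cip_rip[OF a b] using cmod_le[of "Complex (rip a b) (rip a (\<lambda>g. \<i> * b g))"] by simp
  also have "\<dots> \<le> N a * N b + N a * N (\<lambda>g. \<i> * b g)"
    by (intro add_mono Cauchy_Schwarz a b E_cscale)
  finally show ?thesis using N_i[OF b] by simp
qed

lemma cip_diff: "\<lbrakk>a \<in> E; b \<in> E; c \<in> E\<rbrakk> \<Longrightarrow> cip (a - b) c = cip a c - cip b c"
  using cip_add[of "a - b" b c] by simp

lemma cip_diff_right: "\<lbrakk>a \<in> E; b \<in> E; c \<in> E\<rbrakk> \<Longrightarrow> cip c (a - b) = cip c a - cip c b"
  by (subst (1 2 3) cip_cnj) (auto simp: cip_diff)

definition point_mass :: "'g \<Rightarrow> 'g \<Rightarrow> complex" where "point_mass h = (\<lambda>g. if g = h then 1 else 0)"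

lemma point_mass_E [simp]: "h \<in> carrier K \<Longrightarrow> point_mass h \<in> E" by (simp add: E_def point_mass_def)

lemma cip_point_mass: "g \<in> carrier K \<Longrightarrow> h \<in> carrier K \<Longrightarrow> cip (point_mass g) (point_mass h) = of_real (\<phi> (inv g \<otimes> h))"
  by (simp add: cip_def point_mass_def)

lemma cip_point_mass_sum:
  assumes a: "a \<in> E" and b: "b \<in> E"
  shows "cip a b = (\<Sum>h | b h \<noteq> 0. cnj (b h) * cip a (point_mass h))"
proof -
  have "cip a (point_mass h) = (\<Sum>g | a g \<noteq> 0. a g * of_real (\<phi> (inv g \<otimes> h)))" for h
    by (simp add: cip_def point_mass_def)
  then have "(\<Sum>h | b h \<noteq> 0. cnj (b h) * cip a (point_mass h))
      = (\<Sum>h | b h \<noteq> 0. \<Sum>g | a g \<noteq> 0. a g * cnj (b h) * of_real (\<phi> (inv g \<otimes> h)))"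
    by (simp add: sum_distrib_left algebra_simps)
  also have "\<dots> = cip a b" unfolding cip_def by (rule sum.swap)
  finally show ?thesis by simp
qed

subsection \<open>Cauchy sequences\<close>

definition Cauchy_seqs :: "(nat \<Rightarrow> 'g \<Rightarrow> complex) set" where
  "Cauchy_seqs = {x. (\<forall>n. x n \<in> E) \<and> (\<forall>\<epsilon>>0. \<exists>M. \<forall>m\<ge>M. \<forall>n\<ge>M. N (x m - x n) < \<epsilon>)}"

lemma Cauchy_seqs_E [simp]: "x \<in> Cauchy_seqs \<Longrightarrow> x n \<in> E" by (simp add: Cauchy_seqs_def)

lemma CsD: "x \<in> Cauchy_seqs \<Longrightarrow> \<epsilon> > 0 \<Longrightarrow> \<exists>M. \<forall>m\<ge>M. \<forall>n\<ge>M. N (x m - x n) < \<epsilon>" unfolding Cauchy_seqs_def by blast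

lemma Cauchy_seqs_bounded: assumes "x \<in> Cauchy_seqs" obtains R where "0 < R" "\<And>n. N (x n) \<le> R"
proof -
  obtain M where M: "\<And>m n. m \<ge> M \<Longrightarrow> n \<ge> M \<Longrightarrow> N (x m - x n) < 1" using CsD[OF assms, of 1] by auto
  define R where "R = Max ((\<lambda>n. N (x n)) ` {..M}) + 1"
  have le: "N (x n) \<le> R - 1" if "n \<le> M" for n using that by (auto simp: R_def intro: Max_ge)
  have "N (x n) \<le> R" for n
  proof (cases "n \<le> M")
    case False
    then show ?thesis using M[of n M] N_le_add[of "x n" "x M"] le[of M] assms by simp
  qed (use le in fastforce)
  moreover have "0 < R" using le[of M] N_nonneg[OF Cauchy_seqs_E[OF assms, of M]] by simp
  ultimately show thesis using that by blast
qed

lemma Cauchy_seqs_add: assumes "x \<in> Cauchy_seqs" "y \<in> Cauchy_seqs" shows "(\<lambda>n. x n + y n) \<in> Cauchy_seqs"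
  unfolding Cauchy_seqs_def
proof (intro CollectI conjI allI impI)
  fix \<epsilon> :: real assume e: "\<epsilon> > 0"
  obtain M1 where M1: "\<And>m n. m \<ge> M1 \<Longrightarrow> n \<ge> M1 \<Longrightarrow> N (x m - x n) < \<epsilon> / 2" using CsD[OF assms(1), of "\<epsilon>/2"] e by auto
  obtain M2 where M2: "\<And>m n. m \<ge> M2 \<Longrightarrow> n \<ge> M2 \<Longrightarrow> N (y m - y n) < \<epsilon> / 2" using CsD[OF assms(2), of "\<epsilon>/2"] e by auto
  have "N (x m + y m - (x n + y n)) < \<epsilon>" if "m \<ge> max M1 M2" "n \<ge> max M1 M2" for m n
    using N_triangle[of "x m - x n" "y m - y n"] M1[of m n] M2[of m n] that assms
    by (simp add: algebra_simps)
  then show "\<exists>M. \<forall>m\<ge>M. \<forall>n\<ge>M. N (x m + y m - (x n + y n)) < \<epsilon>" by blast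
qed (use assms in auto)

lemma Cauchy_seqs_map:
  assumes x: "x \<in> Cauchy_seqs" and T: "\<And>a. a \<in> E \<Longrightarrow> T a \<in> E" "\<And>a b. a \<in> E \<Longrightarrow> b \<in> E \<Longrightarrow> N (T a - T b) \<le> C * N (a - b)"
  shows "(\<lambda>n. T (x n)) \<in> Cauchy_seqs"
  unfolding Cauchy_seqs_def
proof (intro CollectI conjI allI impI)
  fix \<epsilon> :: real assume e: "\<epsilon> > 0"
  obtain M where M: "\<And>m n. m \<ge> M \<Longrightarrow> n \<ge> M \<Longrightarrow> N (x m - x n) < \<epsilon> / (\<bar>C\<bar> + 1)"
    using CsD[OF x, of "\<epsilon> / (\<bar>C\<bar> + 1)"] e by auto
  have "N (T (x m) - T (x n)) < \<epsilon>" if "m \<ge> M" "n \<ge> M" for m n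
  proof -
    have "N (T (x m) - T (x n)) \<le> C * N (x m - x n)" using x by (intro T) auto
    also have "\<dots> \<le> (\<bar>C\<bar> + 1) * N (x m - x n)" using x by (intro mult_right_mono) auto
    also have "\<dots> < \<epsilon>" using M[OF that] by (simp add: pos_less_divide_eq mult.commute)
    finally show ?thesis .
  qed
  then show "\<exists>M. \<forall>m\<ge>M. \<forall>n\<ge>M. N (T (x m) - T (x n)) < \<epsilon>" by blast
qed (use x T in auto)

lemma N_cscale: "a \<in> E \<Longrightarrow> N (\<lambda>g. c * a g) = cmod c * N a"
proof -
  assume a: "a \<in> E"
  have "cip (\<lambda>g. c * a g) (\<lambda>g. c * a g) = c * cnj (c * cip a a)"
    using cip_cscale[OF a E_cscale[OF a], of c c] cip_cnj[OF E_cscale[OF a] a, of c] cip_cscale[OF a a, of c] by simp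
  also have "\<dots> = of_real ((cmod c)^2) * cip a a"
    unfolding complex_norm_square using cip_cnj[OF a a] by simp
  finally show ?thesis
    using a by (simp add: N_def rip_def real_sqrt_mult)
qed

lemma Cauchy_seqs_cscale: assumes "x \<in> Cauchy_seqs" shows "(\<lambda>n g. c * x n g) \<in> Cauchy_seqs"
proof (rule Cauchy_seqs_map[OF assms, of "\<lambda>a g. c * a g" "cmod c"])
  fix a b assume ab: "a \<in> E" "b \<in> E"
  have "(\<lambda>g. c * a g) - (\<lambda>g. c * b g) = (\<lambda>g. c * (a - b) g)" by (simp add: fun_eq_iff algebra_simps)
  then show "N ((\<lambda>g. c * a g) - (\<lambda>g. c * b g)) \<le> cmod c * N (a - b)"
    using N_cscale[of "a - b" c] ab by simp
qed (rule E_cscale)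

lemma Cauchy_seqs_const [simp]: "a \<in> E \<Longrightarrow> (\<lambda>_. a) \<in> Cauchy_seqs"
  unfolding Cauchy_seqs_def by (intro CollectI conjI allI impI) auto

lemma Cauchy_seqs_diff: assumes "x \<in> Cauchy_seqs" "y \<in> Cauchy_seqs" shows "(\<lambda>n. x n - y n) \<in> Cauchy_seqs"
proof -
  have "(\<lambda>n. x n + (\<lambda>g. -1 * y n g)) = (\<lambda>n. x n - y n)" by (simp add: fun_eq_iff)
  then show ?thesis using Cauchy_seqs_add[OF assms(1) Cauchy_seqs_cscale[OF assms(2), of "-1"]] by simp
qed

lemma cip_convergent:
  assumes x: "x \<in> Cauchy_seqs" and y: "y \<in> Cauchy_seqs"
  shows "convergent (\<lambda>n. cip (x n) (y n))"
proof -
  obtain R1 where R1: "0 < R1" "\<And>n. N (x n) \<le> R1" using Cauchy_seqs_bounded[OF x] by blast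
  obtain R2 where R2: "0 < R2" "\<And>n. N (y n) \<le> R2" using Cauchy_seqs_bounded[OF y] by blast
  have "Cauchy (\<lambda>n. cip (x n) (y n))"
    unfolding Cauchy_iff
  proof (intro allI impI)
    fix \<epsilon> :: real assume e: "\<epsilon> > 0"
    obtain M1 where M1: "\<And>m n. m \<ge> M1 \<Longrightarrow> n \<ge> M1 \<Longrightarrow> N (x m - x n) < \<epsilon> / (4 * R2)"
      using CsD[OF x, of "\<epsilon> / (4 * R2)"] e R2 by auto
    obtain M2 where M2: "\<And>m n. m \<ge> M2 \<Longrightarrow> n \<ge> M2 \<Longrightarrow> N (y m - y n) < \<epsilon> / (4 * R1)"
      using CsD[OF y, of "\<epsilon> / (4 * R1)"] e R1 by auto
    have "cmod (cip (x m) (y m) - cip (x n) (y n)) < \<epsilon>" if "m \<ge> max M1 M2" "n \<ge> max M1 M2" for m n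
    proof -
      have "cip (x m) (y m) - cip (x n) (y n) = cip (x m - x n) (y m) + cip (x n) (y m - y n)"
        using x y by (simp add: cip_diff cip_diff_right)
      then have "cmod (cip (x m) (y m) - cip (x n) (y n)) \<le> cmod (cip (x m - x n) (y m)) + cmod (cip (x n) (y m - y n))"
        by (metis norm_triangle_ineq)
      also have "\<dots> \<le> 2 * (N (x m - x n) * N (y m)) + 2 * (N (x n) * N (y m - y n))"
        using x y by (intro add_mono cip_bound) auto
      also have "\<dots> \<le> 2 * (N (x m - x n) * R2) + 2 * (R1 * N (y m - y n))"
        using x y R1 R2 by (intro add_mono mult_left_mono mult_right_mono) auto
      also have "\<dots> < 2 * (\<epsilon> / (4 * R2) * R2) + 2 * (R1 * (\<epsilon> / (4 * R1)))"
        using M1[of m n] M2[of m n] that R1(1) R2(1)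
        by (intro add_strict_mono mult_strict_left_mono mult_strict_right_mono) auto
      also have "\<dots> = \<epsilon>" using R1(1) R2(1) by simp
      finally show ?thesis .
    qed
    then show "\<exists>M. \<forall>m\<ge>M. \<forall>n\<ge>M. cmod (cip (x m) (y m) - cip (x n) (y n)) < \<epsilon>" by blast
  qed
  then show ?thesis by (simp add: Cauchy_convergent_iff)
qed

definition clim :: "(nat \<Rightarrow> 'g \<Rightarrow> complex) \<Rightarrow> (nat \<Rightarrow> 'g \<Rightarrow> complex) \<Rightarrow> complex" where
  "clim x y = lim (\<lambda>n. cip (x n) (y n))"

lemma clim: "x \<in> Cauchy_seqs \<Longrightarrow> y \<in> Cauchy_seqs \<Longrightarrow> (\<lambda>n. cip (x n) (y n)) \<longlonglongrightarrow> clim x y"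
  unfolding clim_def using cip_convergent convergent_LIMSEQ_iff by blast

lemma climI: "x \<in> Cauchy_seqs \<Longrightarrow> y \<in> Cauchy_seqs \<Longrightarrow> (\<lambda>n. cip (x n) (y n)) \<longlonglongrightarrow> l \<Longrightarrow> clim x y = l"
  using LIMSEQ_unique clim by blast

lemma clim_add: "\<lbrakk>x \<in> Cauchy_seqs; y \<in> Cauchy_seqs; z \<in> Cauchy_seqs\<rbrakk> \<Longrightarrow> clim (\<lambda>n. x n + y n) z = clim x z + clim y z"
  by (rule climI) (auto simp: Cauchy_seqs_add cip_add intro: tendsto_add clim)

lemma clim_cscale: "\<lbrakk>x \<in> Cauchy_seqs; z \<in> Cauchy_seqs\<rbrakk> \<Longrightarrow> clim (\<lambda>n g. c * x n g) z = c * clim x z"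
  by (rule climI) (auto simp: Cauchy_seqs_cscale cip_cscale intro: tendsto_mult_left clim)

lemma clim_cnj: "\<lbrakk>x \<in> Cauchy_seqs; y \<in> Cauchy_seqs\<rbrakk> \<Longrightarrow> clim y x = cnj (clim x y)"
proof (rule climI)
  assume xy: "x \<in> Cauchy_seqs" "y \<in> Cauchy_seqs"
  have "(\<lambda>n. cnj (cip (x n) (y n))) \<longlonglongrightarrow> cnj (clim x y)" by (intro tendsto_cnj clim xy)
  then show "(\<lambda>n. cip (y n) (x n)) \<longlonglongrightarrow> cnj (clim x y)" using xy by (simp add: cip_cnj[symmetric])
qed

lemma N_lim: "x \<in> Cauchy_seqs \<Longrightarrow> (\<lambda>n. N (x n)) \<longlonglongrightarrow> sqrt (Re (clim x x))"
  unfolding N_def rip_def by (intro tendsto_real_sqrt tendsto_Re clim)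

text \<open>Every finitely supported function is a combination of point masses, and \<open>y\<close> is approximated by its
  own terms, uniformly in the bounded sequence \<open>x\<close>.\<close>

lemma clim_null:
  assumes x: "x \<in> Cauchy_seqs" and y: "y \<in> Cauchy_seqs" and 0: "\<And>h. h \<in> carrier K \<Longrightarrow> clim x (\<lambda>_. point_mass h) = 0"
  shows "clim x y = 0"
proof -
  have null: "clim x (\<lambda>_. b) = 0" if b: "b \<in> E" for b
  proof (rule climI[OF x])
    have "(\<lambda>n. \<Sum>h | b h \<noteq> 0. cnj (b h) * cip (x n) (point_mass h)) \<longlonglongrightarrow> (\<Sum>h | b h \<noteq> 0. cnj (b h) * 0)"
      using b clim[OF x Cauchy_seqs_const[OF point_mass_E]] 0
      by (intro tendsto_sum tendsto_mult_left) (auto simp: E_def)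
    then show "(\<lambda>n. cip (x n) b) \<longlonglongrightarrow> 0" using x b by (simp add: cip_point_mass_sum[of "x _" b])
  qed (use b in simp)
  obtain R where R: "0 < R" "\<And>n. N (x n) \<le> R" using Cauchy_seqs_bounded[OF x] by blast
  have small: "cmod (clim x y) \<le> e" if e: "e > 0" for e
  proof -
    obtain M where M: "\<And>m n. m \<ge> M \<Longrightarrow> n \<ge> M \<Longrightarrow> N (y m - y n) < e / (2 * R)"
      using CsD[OF y, of "e / (2 * R)"] e R by auto
    have lim: "(\<lambda>n. cmod (cip (x n) (y n) - cip (x n) (y M))) \<longlonglongrightarrow> cmod (clim x y - 0)"
      using null[of "y M"] clim[OF x Cauchy_seqs_const[of "y M"]] y by (intro tendsto_norm tendsto_diff clim x) auto
    have "cmod (cip (x n) (y n) - cip (x n) (y M)) \<le> e" if "n \<ge> M" for n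
    proof -
      have "cmod (cip (x n) (y n) - cip (x n) (y M)) \<le> 2 * (N (x n) * N (y n - y M))"
        using cip_bound[of "x n" "y n - y M"] x y by (simp add: cip_diff_right)
      also have "\<dots> \<le> 2 * (R * (e / (2 * R)))"
        using R M[OF that, of M] x y by (intro mult_left_mono mult_mono) auto
      also have "\<dots> = e" using R by simp
      finally show ?thesis .
    qed
    then have "cmod (clim x y - 0) \<le> e"
      by (intro LIMSEQ_le_const2[OF lim]) blast
    then show ?thesis by simp
  qed
  then have "cmod (clim x y) \<le> 0" using field_le_epsilon[of "cmod (clim x y)" 0] by simp
  then show ?thesis by simp
qed

subsection \<open>The completion\<close>

text \<open>A vector of the completion is recorded by its products with the point masses.  Equivalent Cauchy
  sequences thus give the same function, and the vectors have the type over which the definition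
  of property (T) ranges.\<close>

definition L :: "(nat \<Rightarrow> 'g \<Rightarrow> complex) \<Rightarrow> 'g \<times> nat \<Rightarrow> complex" where
  "L x = (\<lambda>(h, k). if h \<in> carrier K then clim x (\<lambda>_. point_mass h) else 0)"

definition R :: "('g \<times> nat \<Rightarrow> complex) \<Rightarrow> nat \<Rightarrow> 'g \<Rightarrow> complex" where
  "R f = (SOME x. x \<in> Cauchy_seqs \<and> L x = f)"

lemma R: "f \<in> L ` Cauchy_seqs \<Longrightarrow> R f \<in> Cauchy_seqs" "f \<in> L ` Cauchy_seqs \<Longrightarrow> L (R f) = f"
proof -
  assume "f \<in> L ` Cauchy_seqs"
  then have "\<exists>x. x \<in> Cauchy_seqs \<and> L x = f" by blast
  from someI_ex[OF this] show "R f \<in> Cauchy_seqs" "L (R f) = f" unfolding R_def by blast+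
qed

lemma L_add: "x \<in> Cauchy_seqs \<Longrightarrow> y \<in> Cauchy_seqs \<Longrightarrow> L (\<lambda>n. x n + y n) = L x + L y"
  by (simp add: L_def fun_eq_iff clim_add)

lemma L_cscale: "x \<in> Cauchy_seqs \<Longrightarrow> L (\<lambda>n g. c * x n g) = (\<lambda>p. c * L x p)"
  by (auto simp: L_def fun_eq_iff clim_cscale)

lemma L_diff: "x \<in> Cauchy_seqs \<Longrightarrow> y \<in> Cauchy_seqs \<Longrightarrow> L (\<lambda>n. x n - y n) = L x - L y"
  using L_add[of "\<lambda>n. x n - y n" y] by (simp add: Cauchy_seqs_diff)

lemma clim_cong:
  assumes "x \<in> Cauchy_seqs" "x' \<in> Cauchy_seqs" "y \<in> Cauchy_seqs" "L x = L x'"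
  shows "clim x y = clim x' y"
proof -
  have "clim (\<lambda>n. x n - x' n) y = 0"
  proof (rule clim_null)
    fix h assume h: "h \<in> carrier K"
    have "L (\<lambda>n. x n - x' n) (h, 0) = 0" using assms by (simp add: L_diff)
    then show "clim (\<lambda>n. x n - x' n) (\<lambda>_. point_mass h) = 0" using h by (simp add: L_def)
  qed (use assms Cauchy_seqs_diff in auto)
  moreover have "clim (\<lambda>n. (x n - x' n) + x' n) y = clim (\<lambda>n. x n - x' n) y + clim x' y"
    by (rule clim_add) (use assms Cauchy_seqs_diff in auto)
  ultimately show ?thesis by simp
qed

definition gns_space :: "('g \<times> nat \<Rightarrow> complex) hilb" where
  "gns_space = \<lparr>carrier = L ` Cauchy_seqs, monoid.mult = (\<lambda>f _. f), one = 0, zero = 0, add = (+),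
         module.smult = (\<lambda>c f p. c * f p), hinner = (\<lambda>f f'. clim (R f) (R f'))\<rparr>"

lemma gns_space_simps [simp]:
  "carrier gns_space = L ` Cauchy_seqs" "\<zero>\<^bsub>gns_space\<^esub> = 0" "f \<oplus>\<^bsub>gns_space\<^esub> f' = f + f'" "c \<odot>\<^bsub>gns_space\<^esub> f = (\<lambda>p. c * f p)"
  by (simp_all add: gns_space_def)

lemma hinner_L: "x \<in> Cauchy_seqs \<Longrightarrow> y \<in> Cauchy_seqs \<Longrightarrow> hinner gns_space (L x) (L y) = clim x y"
proof -
  assume xy: "x \<in> Cauchy_seqs" "y \<in> Cauchy_seqs"
  have "hinner gns_space (L x) (L y) = clim (R (L x)) (R (L y))" by (simp add: gns_space_def)
  also have "\<dots> = clim x (R (L y))" by (rule clim_cong) (use xy R in auto)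
  also have "\<dots> = cnj (clim (R (L y)) x)" by (rule clim_cnj) (use xy R in auto)
  also have "\<dots> = cnj (clim y x)" by (subst clim_cong[of _ y]) (use xy R in auto)
  also have "\<dots> = clim x y" by (rule clim_cnj[symmetric]) (use xy in auto)
  finally show ?thesis .
qed

lemma L_closed: "f \<in> L ` Cauchy_seqs \<Longrightarrow> f' \<in> L ` Cauchy_seqs \<Longrightarrow> f + f' \<in> L ` Cauchy_seqs" "f \<in> L ` Cauchy_seqs \<Longrightarrow> (\<lambda>p. c * f p) \<in> L ` Cauchy_seqs"
  by (auto simp: L_add[symmetric] L_cscale[symmetric] Cauchy_seqs_add Cauchy_seqs_cscale)

lemma L_zero: "L (\<lambda>_. 0) = 0"
proof -
  have "(\<lambda>n g. 0 * (0 :: 'g \<Rightarrow> complex) g) = (\<lambda>_::nat. 0)" by (simp add: fun_eq_iff)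
  then show ?thesis using L_cscale[of "\<lambda>_. 0" 0] by (simp add: E_zero) (simp add: fun_eq_iff)
qed

lemma gns_space_abelian: "abelian_group gns_space"
proof (rule abelian_groupI)
  show "\<exists>y\<in>carrier gns_space. y \<oplus>\<^bsub>gns_space\<^esub> x = \<zero>\<^bsub>gns_space\<^esub>" if "x \<in> carrier gns_space" for x
  proof (rule bexI)
    have "(\<lambda>p. -1 * x p) = - x" by (simp add: fun_eq_iff)
    then show "- x \<in> carrier gns_space" using L_closed(2)[of x "-1"] that by simp
  qed simp
  show "\<zero>\<^bsub>gns_space\<^esub> \<in> carrier gns_space" using L_zero by (metis gns_space_simps(1,2) Cauchy_seqs_const E_zero image_eqI)
qed (auto simp: L_closed add.assoc add.commute simp del: image_iff)

lemma gns_space_minus: assumes "f \<in> carrier gns_space" "f' \<in> carrier gns_space" shows "f \<ominus>\<^bsub>gns_space\<^esub> f' = f - f'"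
proof -
  interpret abelian_group gns_space by (rule gns_space_abelian)
  have "(\<lambda>p. -1 * f' p) = - f'" by (simp add: fun_eq_iff)
  then have m: "- f' \<in> carrier gns_space" using L_closed(2)[of f' "-1"] assms by simp
  have "\<ominus>\<^bsub>gns_space\<^esub> f' = - f'" by (rule minus_equality) (use m assms in auto)
  then show ?thesis by (simp add: a_minus_def)
qed

lemma hnorm_L: "x \<in> Cauchy_seqs \<Longrightarrow> hnorm gns_space (L x) = sqrt (Re (clim x x))"
  by (simp add: hnorm_def hinner_L)

lemma hnorm_lim: "x \<in> Cauchy_seqs \<Longrightarrow> (\<lambda>n. N (x n)) \<longlonglongrightarrow> hnorm gns_space (L x)"
  using N_lim by (simp add: hnorm_L)

text \<open>A diagonal argument: \<open>z k\<close> is a term, within \<open>1 / (k + 1)\<close> of the limit, of a Cauchy sequence that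
  represents \<open>f k\<close>.\<close>

lemma gns_space_complete:
  assumes f: "\<And>n. f n \<in> carrier gns_space"
    and cau: "\<And>\<epsilon>. \<epsilon> > 0 \<Longrightarrow> \<exists>M. \<forall>m\<ge>M. \<forall>n\<ge>M. hnorm gns_space (f m \<ominus>\<^bsub>gns_space\<^esub> f n) < \<epsilon>"
  shows "\<exists>l\<in>carrier gns_space. (\<lambda>n. hnorm gns_space (f n \<ominus>\<^bsub>gns_space\<^esub> l)) \<longlonglongrightarrow> 0"
proof -
  define x where "x k = R (f k)" for k
  have x: "x k \<in> Cauchy_seqs" "L (x k) = f k" for k using R f by (auto simp: x_def)
  have "\<exists>m. \<forall>n\<ge>m. N (x k n - x k m) < 1 / (real k + 1)" for k
    using CsD[OF x(1)[of k], of "1 / (real k + 1)"] by force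
  then obtain m where m: "\<And>k n. n \<ge> m k \<Longrightarrow> N (x k n - x k (m k)) < 1 / (real k + 1)" by metis
  define z where "z k = x k (m k)" for k
  have zE: "z k \<in> E" for k using x by (simp add: z_def)
  have dist: "(\<lambda>n. N (x k n - x l n)) \<longlonglongrightarrow> hnorm gns_space (f k \<ominus>\<^bsub>gns_space\<^esub> f l)" for k l
  proof -
    have "f k \<ominus>\<^bsub>gns_space\<^esub> f l = L (\<lambda>n. x k n - x l n)" using gns_space_minus f x by (simp add: L_diff)
    then show ?thesis using hnorm_lim[OF Cauchy_seqs_diff[OF x(1) x(1)]] by simp
  qed
  have zz: "N (z k - z l) \<le> hnorm gns_space (f k \<ominus>\<^bsub>gns_space\<^esub> f l) + 1 / (real k + 1) + 1 / (real l + 1)" for k l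
  proof -
    have ev: "N (z k - z l) \<le> N (x k n - x l n) + 1 / (real k + 1) + 1 / (real l + 1)" if "n \<ge> max (m k) (m l)" for n
    proof -
      have "N (z k - z l) \<le> N (z k - x k n) + (N (x k n - x l n) + N (x l n - z l))"
        using tri[of "z k" "x k n" "z l"] tri[of "x k n" "x l n" "z l"] x zE by simp
      moreover have "N (z k - x k n) = N (x k n - z k)" using N_minus_commute x zE by simp
      ultimately show ?thesis using m[of k n] m[of l n] that by (simp add: z_def)
    qed
    have "(\<lambda>n. N (x k n - x l n) + 1 / (real k + 1) + 1 / (real l + 1))
        \<longlonglongrightarrow> hnorm gns_space (f k \<ominus>\<^bsub>gns_space\<^esub> f l) + 1 / (real k + 1) + 1 / (real l + 1)"
      by (intro tendsto_add dist tendsto_const)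
    then show ?thesis by (rule LIMSEQ_le_const) (use ev in blast)
  qed
  have inv_small: "\<exists>M. \<forall>k\<ge>M. 1 / (real k + 1) < e" if "e > 0" for e :: real
    using LIMSEQ_inverse_real_of_nat[THEN LIMSEQ_D, OF that] by (auto simp: inverse_eq_divide add.commute)
  have z: "z \<in> Cauchy_seqs"
    unfolding Cauchy_seqs_def
  proof (intro CollectI conjI allI impI)
    fix \<epsilon> :: real assume e: "\<epsilon> > 0"
    obtain M1 where M1: "\<forall>m\<ge>M1. \<forall>n\<ge>M1. hnorm gns_space (f m \<ominus>\<^bsub>gns_space\<^esub> f n) < \<epsilon> / 3" using cau[of "\<epsilon>/3"] e by auto
    obtain M2 where M2: "\<forall>k\<ge>M2. 1 / (real k + 1) < \<epsilon> / 3" using inv_small[of "\<epsilon>/3"] e by auto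
    have "N (z k - z l) < \<epsilon>" if "k \<ge> max M1 M2" "l \<ge> max M1 M2" for k l
    proof -
      have "hnorm gns_space (f k \<ominus>\<^bsub>gns_space\<^esub> f l) < \<epsilon> / 3" "1 / (real k + 1) < \<epsilon> / 3" "1 / (real l + 1) < \<epsilon> / 3"
        using M1 M2 that by auto
      then show ?thesis using zz[of k l] by linarith
    qed
    then show "\<exists>M. \<forall>m\<ge>M. \<forall>n\<ge>M. N (z m - z n) < \<epsilon>" by blast
  qed (rule zE)
  have lz: "(\<lambda>n. N (x k n - z n)) \<longlonglongrightarrow> hnorm gns_space (f k \<ominus>\<^bsub>gns_space\<^esub> L z)" for k
  proof -
    have "f k \<ominus>\<^bsub>gns_space\<^esub> L z = L (\<lambda>n. x k n - z n)" using gns_space_minus f x z by (simp add: L_diff)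
    then show ?thesis using hnorm_lim[OF Cauchy_seqs_diff[OF x(1) z]] by simp
  qed
  have "(\<lambda>n. hnorm gns_space (f n \<ominus>\<^bsub>gns_space\<^esub> L z)) \<longlonglongrightarrow> 0"
  proof (rule LIMSEQ_I)
    fix \<epsilon> :: real assume e: "\<epsilon> > 0"
    obtain M1 where M1: "\<forall>m\<ge>M1. \<forall>n\<ge>M1. N (z m - z n) < \<epsilon> / 3" using CsD[OF z, of "\<epsilon>/3"] e by auto
    obtain M2 where M2: "\<forall>k\<ge>M2. 1 / (real k + 1) < \<epsilon> / 3" using inv_small[of "\<epsilon>/3"] e by auto
    have "norm (hnorm gns_space (f k \<ominus>\<^bsub>gns_space\<^esub> L z) - 0) < \<epsilon>" if k: "k \<ge> max M1 M2" for k
    proof -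
      have "N (x k n - z n) \<le> 2 * \<epsilon> / 3" if n: "n \<ge> max (m k) M1" for n
      proof -
        have "N (x k n - z k) < \<epsilon> / 3" using m[of k n] n M2 k unfolding z_def by (meson less_trans max.boundedE)
        moreover have "N (z k - z n) < \<epsilon> / 3" using M1 k n by auto
        ultimately show ?thesis using tri[of "x k n" "z k" "z n"] x zE by simp
      qed
      then have "hnorm gns_space (f k \<ominus>\<^bsub>gns_space\<^esub> L z) \<le> 2 * \<epsilon> / 3"
        by (intro LIMSEQ_le_const2[OF lz]) blast
      moreover have "0 \<le> hnorm gns_space (f k \<ominus>\<^bsub>gns_space\<^esub> L z)"
        by (rule LIMSEQ_le_const[OF lz]) (use x zE in auto)
      ultimately show ?thesis using e by simp
    qed
    then show "\<exists>M. \<forall>n\<ge>M. norm (hnorm gns_space (f n \<ominus>\<^bsub>gns_space\<^esub> L z) - 0) < \<epsilon>" by blast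
  qed
  then show ?thesis using z by auto
qed

lemma gns_space_hilbert: "hilbert_space gns_space"
proof -
  interpret abelian_group gns_space by (rule gns_space_abelian)
  have mod: "module class_ring gns_space"
  proof (rule moduleI)
    show "cring (class_ring :: complex ring)"
      using class_field[where 'a = complex] unfolding field_def domain_def by blast
  qed (auto simp: gns_space_abelian L_closed class_ring_simps fun_eq_iff algebra_simps simp del: image_iff)
  show ?thesis
    unfolding hilbert_space_def
  proof (intro conjI)
    show "hilbert_space_axioms gns_space"
    proof
      fix u v w assume "u \<in> carrier gns_space" "v \<in> carrier gns_space" "w \<in> carrier gns_space"
      then show "hinner gns_space (u \<oplus>\<^bsub>gns_space\<^esub> v) w = hinner gns_space u w + hinner gns_space v w"
        by (auto simp: L_add[symmetric] hinner_L Cauchy_seqs_add clim_add)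
    next
      fix u v c assume "u \<in> carrier gns_space" "v \<in> carrier gns_space"
      then show "hinner gns_space (c \<odot>\<^bsub>gns_space\<^esub> u) v = c * hinner gns_space u v"
        by (auto simp: L_cscale[symmetric] hinner_L Cauchy_seqs_cscale clim_cscale)
    next
      fix u v assume "u \<in> carrier gns_space" "v \<in> carrier gns_space"
      then obtain x y where xy: "x \<in> Cauchy_seqs" "y \<in> Cauchy_seqs" "u = L x" "v = L y" by auto
      then show "hinner gns_space v u = cnj (hinner gns_space u v)" using clim_cnj[OF xy(1,2)] by (simp add: hinner_L)
    next
      fix v assume v: "v \<in> carrier gns_space" "v \<noteq> \<zero>\<^bsub>gns_space\<^esub>"
      then obtain x where x: "x \<in> Cauchy_seqs" "v = L x" by auto
      have ge: "0 \<le> Re (clim x x)"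
        using LIMSEQ_le_const[OF tendsto_Re[OF clim[OF x(1) x(1)]], of 0] rip_nonneg x by (auto simp: rip_def)
      have "Re (clim x x) \<noteq> 0"
      proof
        assume "Re (clim x x) = 0"
        then have N0: "(\<lambda>n. N (x n)) \<longlonglongrightarrow> 0" using N_lim[OF x(1)] by simp
        have "clim x (\<lambda>_. point_mass h) = 0" if h: "h \<in> carrier K" for h
        proof (rule climI[OF x(1)])
          show "(\<lambda>n. cip (x n) (point_mass h)) \<longlonglongrightarrow> 0"
          proof (rule tendsto_norm_zero_cancel, rule tendsto_sandwich[OF _ _ tendsto_const[of 0]])
            show "\<forall>\<^sub>F n in sequentially. cmod (cip (x n) (point_mass h)) \<le> 2 * (N (x n) * N (point_mass h))"
              using x h by (intro always_eventually allI cip_bound) auto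
            show "\<forall>\<^sub>F n in sequentially. 0 \<le> cmod (cip (x n) (point_mass h))" by simp
            show "(\<lambda>n. 2 * (N (x n) * N (point_mass h))) \<longlonglongrightarrow> 0"
              using tendsto_mult_right_zero[OF tendsto_mult_left_zero[OF N0]] .
          qed
        qed (use h in simp)
        then have "L x = 0" by (auto simp: L_def fun_eq_iff)
        then show False using v x by simp
      qed
      then show "0 < Re (hinner gns_space v v)" using ge x by (simp add: hinner_L)
    next
      fix f :: "nat \<Rightarrow> 'g \<times> nat \<Rightarrow> complex" assume "\<And>n. f n \<in> carrier gns_space" "\<And>\<epsilon>. \<epsilon> > 0 \<Longrightarrow> \<exists>N. \<forall>m\<ge>N. \<forall>n\<ge>N. hnorm gns_space (f m \<ominus>\<^bsub>gns_space\<^esub> f n) < \<epsilon>"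
      then show "\<exists>l\<in>carrier gns_space. (\<lambda>n. hnorm gns_space (f n \<ominus>\<^bsub>gns_space\<^esub> l)) \<longlonglongrightarrow> 0" by (rule gns_space_complete)
    qed
  qed (rule mod)
qed

subsection \<open>The translation representation\<close>

definition transl :: "'g \<Rightarrow> ('g \<Rightarrow> complex) \<Rightarrow> 'g \<Rightarrow> complex" where
  "transl g a = (\<lambda>h. if h \<in> carrier K then a (inv g \<otimes> h) else 0)"

definition gns_rep :: "'g \<Rightarrow> ('g \<times> nat \<Rightarrow> complex) \<Rightarrow> 'g \<times> nat \<Rightarrow> complex" where
  "gns_rep g f = (\<lambda>(h, k). if h \<in> carrier K then f (inv g \<otimes> h, k) else 0)"

lemma transl_supp: "g \<in> carrier K \<Longrightarrow> a \<in> E \<Longrightarrow> {h. transl g a h \<noteq> 0} = (\<otimes>) g ` {h. a h \<noteq> 0}"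
proof (intro equalityI subsetI)
  fix h assume g: "g \<in> carrier K" and a: "a \<in> E" and "h \<in> {h. transl g a h \<noteq> 0}"
  then have h: "h \<in> carrier K" "a (inv g \<otimes> h) \<noteq> 0" by (auto simp: transl_def split: if_splits)
  then have "h = g \<otimes> (inv g \<otimes> h)" using g by (simp add: m_assoc[symmetric])
  then show "h \<in> (\<otimes>) g ` {h. a h \<noteq> 0}" using h by blast
next
  fix h assume g: "g \<in> carrier K" and a: "a \<in> E" and "h \<in> (\<otimes>) g ` {h. a h \<noteq> 0}"
  then obtain k where k: "h = g \<otimes> k" "a k \<noteq> 0" by blast
  then have "k \<in> carrier K" using a by (auto simp: E_def)
  then show "h \<in> {h. transl g a h \<noteq> 0}" using k g by (simp add: transl_def m_assoc[symmetric])
qed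

lemma transl_E [simp]: "g \<in> carrier K \<Longrightarrow> a \<in> E \<Longrightarrow> transl g a \<in> E"
  using transl_supp[of g a] by (auto simp: E_def)

lemma cip_transl:
  assumes g: "g \<in> carrier K" and a: "a \<in> E" and b: "b \<in> E"
  shows "cip (transl g a) (transl g b) = cip a b"
proof -
  have inj: "inj_on ((\<otimes>) g) A" if "A \<subseteq> carrier K" for A using that g by (auto simp: inj_on_def subset_iff)
  have sub: "{h. a h \<noteq> 0} \<subseteq> carrier K" "{h. b h \<noteq> 0} \<subseteq> carrier K" using a b by (auto simp: E_def)
  have transl_g: "transl g c (g \<otimes> h) = c h" if "h \<in> carrier K" for c h
    using that g by (simp add: transl_def m_assoc[symmetric])
  have \<phi>_g: "\<phi> (inv (g \<otimes> h) \<otimes> (g \<otimes> k)) = \<phi> (inv h \<otimes> k)" if "h \<in> carrier K" "k \<in> carrier K" for h k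
  proof -
    have "inv (g \<otimes> h) \<otimes> (g \<otimes> k) = inv h \<otimes> (inv g \<otimes> (g \<otimes> k))"
      using that g by (simp add: inv_mult_group m_assoc)
    also have "inv g \<otimes> (g \<otimes> k) = k" using that g by (simp add: m_assoc[symmetric])
    finally show ?thesis by simp
  qed
  show ?thesis
    unfolding cip_def transl_supp[OF g a] transl_supp[OF g b] sum.reindex[OF inj[OF sub(1)]] sum.reindex[OF inj[OF sub(2)]] o_def
    by (intro sum.cong refl) (use sub in \<open>auto simp: transl_g \<phi>_g subset_iff\<close>)
qed

lemma transl_inv: "g \<in> carrier K \<Longrightarrow> a \<in> E \<Longrightarrow> transl g (transl (inv g) a) = a"
proof (rule ext)
  fix h assume g: "g \<in> carrier K" and a: "a \<in> E"
  show "transl g (transl (inv g) a) h = a h"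
  proof (cases "h \<in> carrier K")
    case True
    then have "inv (inv g) \<otimes> (inv g \<otimes> h) = h" using g by (simp add: m_assoc[symmetric])
    then show ?thesis using True g by (simp add: transl_def)
  next
    case False
    then show ?thesis using a by (auto simp: transl_def E_def)
  qed
qed

lemma transl_diff: "transl g a - transl g b = transl g (a - b)" by (simp add: transl_def fun_eq_iff)

lemma N_transl: "g \<in> carrier K \<Longrightarrow> a \<in> E \<Longrightarrow> N (transl g a) = N a"
  by (simp add: N_def rip_def cip_transl)

lemma Cauchy_seqs_tr: "g \<in> carrier K \<Longrightarrow> x \<in> Cauchy_seqs \<Longrightarrow> (\<lambda>n. transl g (x n)) \<in> Cauchy_seqs"
  by (rule Cauchy_seqs_map[of x "transl g" 1]) (auto simp: transl_diff N_transl)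

lemma clim_transl: "g \<in> carrier K \<Longrightarrow> x \<in> Cauchy_seqs \<Longrightarrow> y \<in> Cauchy_seqs \<Longrightarrow> clim (\<lambda>n. transl g (x n)) (\<lambda>n. transl g (y n)) = clim x y"
  by (simp add: clim_def cip_transl)

lemma transl_point_mass: "g \<in> carrier K \<Longrightarrow> h \<in> carrier K \<Longrightarrow> transl g (point_mass h) = point_mass (g \<otimes> h)"
  by (rule ext) (auto simp: transl_def point_mass_def m_assoc[symmetric])

lemma gns_rep_L: assumes "g \<in> carrier K" "x \<in> Cauchy_seqs" shows "gns_rep g (L x) = L (\<lambda>n. transl g (x n))"
proof -
  have "clim x (\<lambda>_. point_mass (inv g \<otimes> h)) = clim (\<lambda>n. transl g (x n)) (\<lambda>_. point_mass h)" if h: "h \<in> carrier K" for h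
    using clim_transl[of g x "\<lambda>_. point_mass (inv g \<otimes> h)"] assms h by (simp add: transl_point_mass m_assoc[symmetric])
  then show ?thesis using assms by (auto simp: gns_rep_def L_def fun_eq_iff)
qed

lemma gns_rep_rep: "unitary_rep K gns_space gns_rep"
  unfolding unitary_rep_def
proof (intro conjI ballI)
  fix g assume g: "g \<in> carrier K"
  have closed: "gns_rep g f \<in> L ` Cauchy_seqs" if "f \<in> L ` Cauchy_seqs" "g \<in> carrier K" for f g
    using that by (auto simp: gns_rep_L Cauchy_seqs_tr)
  have inv: "gns_rep g (gns_rep (inv g) f) = f" if "f \<in> L ` Cauchy_seqs" "g \<in> carrier K" for f g
    using that by (auto simp: gns_rep_L Cauchy_seqs_tr transl_inv)
  show "unitary_op gns_space (gns_rep g)"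
    unfolding unitary_op_def
  proof (intro conjI ballI allI)
    show "bij_betw (gns_rep g) (carrier gns_space) (carrier gns_space)"
      by (rule bij_betw_byWitness[of _ "gns_rep (inv g)"])
        (use closed[OF _ g] closed[of _ "inv g"] inv[OF _ g] inv[of _ "inv g"] g in auto)
    show "gns_rep g (u \<oplus>\<^bsub>gns_space\<^esub> v) = gns_rep g u \<oplus>\<^bsub>gns_space\<^esub> gns_rep g v" for u v
      by (auto simp: gns_rep_def fun_eq_iff)
    show "gns_rep g (c \<odot>\<^bsub>gns_space\<^esub> v) = c \<odot>\<^bsub>gns_space\<^esub> gns_rep g v" for c v
      by (auto simp: gns_rep_def fun_eq_iff)
    show "hinner gns_space (gns_rep g u) (gns_rep g v) = hinner gns_space u v" if "u \<in> carrier gns_space" "v \<in> carrier gns_space" for u v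
      using that g by (auto simp: gns_rep_L hinner_L Cauchy_seqs_tr clim_transl)
  qed
next
  fix g h v assume gh: "g \<in> carrier K" "h \<in> carrier K"
  then show "gns_rep (g \<otimes> h) v = gns_rep g (gns_rep h v)"
    by (auto simp: gns_rep_def fun_eq_iff inv_mult_group m_assoc)
qed

lemma pos_def_bound: assumes g: "g \<in> carrier K" shows "\<bar>\<phi> g\<bar> \<le> \<phi> \<one>"
proof (cases "g = \<one>")
  case True
  have "0 \<le> \<phi> \<one>" using psd_on_diag[OF pd_A[of "{\<one>}"], of \<one>] by simp
  then show ?thesis using True by simp
next
  case False
  then have "0 \<le> r^2 * \<phi> \<one> + 2 * r * q * \<phi> g + q^2 * \<phi> \<one>" for r q
    using psd_on_two[OF pd_A[of "{\<one>, g}"], of \<one> g r q] g by simp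
  from this[of 1 1] this[of 1 "-1"] show ?thesis by simp
qed

text \<open>If on \<open>F\<close> the function \<open>\<phi>\<close> is close to its value at \<open>\<one>\<close>, the point mass at \<open>\<one>\<close> is an almost invariant
  vector, and property (T) yields an invariant \<open>w \<noteq> 0\<close>.  All its products with point masses have
  the same value \<open>\<beta>\<close>, so for finitely supported \<open>b\<close> with sum \<open>\<sigma>\<close> the Cauchy-Schwarz inequality bounds
  \<open>|\<sigma> \<beta>|\<close> by a multiple of \<open>|b|\<close>.  This says that \<open>\<phi>\<close> minus a positive constant is still positive definite.\<close>

lemma invariant_part:
  assumes T: "\<And>(H :: ('g \<times> nat \<Rightarrow> complex) hilb) \<rho>.
          hilbert_space H \<Longrightarrow> unitary_rep K H \<rho> \<Longrightarrow>
          (\<exists>v\<in>carrier H. v \<noteq> \<zero>\<^bsub>H\<^esub> \<and> (\<forall>g\<in>F. hnorm H (\<rho> g v \<ominus>\<^bsub>H\<^esub> v) < \<epsilon> * hnorm H v)) \<Longrightarrow>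
          (\<exists>w\<in>carrier H. w \<noteq> \<zero>\<^bsub>H\<^esub> \<and> (\<forall>g\<in>carrier K. \<rho> g w = w))"
    and F: "F \<subseteq> carrier K" and \<epsilon>: "0 < \<epsilon>" and pos: "0 < \<phi> \<one>"
    and s: "\<And>s. s \<in> F \<Longrightarrow> 2 * (\<phi> \<one> - \<phi> s) < \<epsilon>^2 * \<phi> \<one>"
  shows "\<exists>c>0. pos_def K (\<lambda>g. \<phi> g - c)"
proof -
  let ?d = "\<lambda>g _. point_mass g"
  have const: "clim (\<lambda>_. a) (\<lambda>_. b) = cip a b" for a b by (simp add: clim_def)
  define v where "v = L (?d \<one>)"
  have v: "v \<in> carrier gns_space" by (simp add: v_def)
  have "v (\<one>, 0) = of_real (\<phi> \<one>)" by (simp add: v_def L_def const cip_point_mass)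
  then have v0: "v \<noteq> \<zero>\<^bsub>gns_space\<^esub>" using pos by auto
  have nv: "hnorm gns_space v = sqrt (\<phi> \<one>)" by (simp add: v_def hnorm_L const cip_point_mass)
  have "hnorm gns_space (gns_rep g v \<ominus>\<^bsub>gns_space\<^esub> v) < \<epsilon> * hnorm gns_space v" if g: "g \<in> F" for g
  proof -
    have gK: "g \<in> carrier K" using g F by blast
    have dE: "point_mass g - point_mass \<one> \<in> E" using gK by simp
    have "gns_rep g v = L (?d g)" using gK by (simp add: v_def gns_rep_L transl_point_mass)
    then have "gns_rep g v \<ominus>\<^bsub>gns_space\<^esub> v = L (\<lambda>_. point_mass g - point_mass \<one>)"
      using gK gns_space_minus[of "L (?d g)" v] v by (simp add: v_def L_diff)
    then have "hnorm gns_space (gns_rep g v \<ominus>\<^bsub>gns_space\<^esub> v) = sqrt (Re (cip (point_mass g - point_mass \<one>) (point_mass g - point_mass \<one>)))"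
      using dE by (simp add: hnorm_L const)
    also have "cip (point_mass g - point_mass \<one>) (point_mass g - point_mass \<one>) = of_real (2 * (\<phi> \<one> - \<phi> g))"
      using gK dE \<phi>_inv[of g \<one>] by (simp add: cip_diff cip_diff_right cip_point_mass)
    also have "sqrt (Re (of_real (2 * (\<phi> \<one> - \<phi> g)))) < sqrt (\<epsilon>^2 * \<phi> \<one>)" using s[OF g] by simp
    also have "\<dots> = \<epsilon> * hnorm gns_space v" using \<epsilon> by (simp add: nv real_sqrt_mult)
    finally show ?thesis .
  qed
  then obtain w where w: "w \<in> carrier gns_space" "w \<noteq> \<zero>\<^bsub>gns_space\<^esub>" "\<And>g. g \<in> carrier K \<Longrightarrow> gns_rep g w = w"
    using T[OF gns_space_hilbert gns_rep_rep] v v0 by blast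
  then obtain x where x: "x \<in> Cauchy_seqs" "w = L x" by auto
  define \<beta> where "\<beta> = clim x (?d \<one>)"
  have wh: "clim x (?d h) = \<beta>" if h: "h \<in> carrier K" for h
  proof -
    have "w (h, 0) = gns_rep h w (h, 0)" using w(3)[OF h] by simp
    also have "\<dots> = w (\<one>, 0)" using h by (simp add: gns_rep_def)
    finally show ?thesis using h by (simp add: x L_def \<beta>_def)
  qed
  have "\<beta> \<noteq> 0"
  proof
    assume "\<beta> = 0"
    then have "L x = 0" using wh by (auto simp: L_def fun_eq_iff)
    then show False using w x by simp
  qed
  obtain M where M: "0 < M" "\<And>n. N (x n) \<le> M" using Cauchy_seqs_bounded[OF x(1)] by blast
  \<comment> \<open>The 4 compensates the factor 2 of \<open>cip_bound\<close>.\<close>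
  define c where "c = (cmod \<beta>)^2 / (4 * M^2)"
  have c: "0 < c" using \<open>\<beta> \<noteq> 0\<close> M by (simp add: c_def)
  have "pos_def K (\<lambda>g. \<phi> g - c)"
    unfolding pos_def_def psd_on_def
  proof (intro allI impI conjI ballI)
    fix A i j assume "finite A" "A \<subseteq> carrier K" "i \<in> A" "j \<in> A"
    then have "\<phi> (inv i \<otimes> j) = \<phi> (inv j \<otimes> i)" using \<phi>_inv by blast
    then show "\<phi> (inv i \<otimes> j) - c = \<phi> (inv j \<otimes> i) - c" by simp
  next
    fix A and a :: "'g \<Rightarrow> real" assume A: "finite A" "A \<subseteq> carrier K"
    define b where "b = (\<lambda>h. if h \<in> A then complex_of_real (a h) else 0)"
    have bA: "{h. b h \<noteq> 0} \<subseteq> A" by (auto simp: b_def)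
    then have b: "b \<in> E" using A finite_subset by (auto simp: E_def)
    have "cip b b = (\<Sum>g\<in>A. \<Sum>h\<in>A. of_real (a g * a h * \<phi> (inv g \<otimes> h)))"
      unfolding cip_eq[OF A(1) bA bA] by (intro sum.cong refl) (auto simp: b_def)
    then have Nb: "(N b)^2 = (\<Sum>g\<in>A. \<Sum>h\<in>A. a g * a h * \<phi> (inv g \<otimes> h))"
      using b by (simp add: N_sq rip_def)
    have xb: "clim x (\<lambda>_. b) = of_real (\<Sum>h\<in>A. a h) * \<beta>"
    proof (rule climI[OF x(1)])
      have eq: "cip (x n) b = (\<Sum>h\<in>A. of_real (a h) * cip (x n) (point_mass h))" for n
      proof -
        have "cip (x n) b = (\<Sum>h | b h \<noteq> 0. cnj (b h) * cip (x n) (point_mass h))"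
          by (rule cip_point_mass_sum) (use x b in auto)
        also have "\<dots> = (\<Sum>h\<in>A. cnj (b h) * cip (x n) (point_mass h))"
          by (rule sum.mono_neutral_left) (use A bA in auto)
        finally show ?thesis by (simp add: b_def)
      qed
      have "(\<lambda>n. \<Sum>h\<in>A. of_real (a h) * cip (x n) (point_mass h)) \<longlonglongrightarrow> (\<Sum>h\<in>A. of_real (a h) * \<beta>)"
        using A wh clim[OF x(1) Cauchy_seqs_const[OF point_mass_E]]
        by (intro tendsto_sum tendsto_mult_left) (metis subsetD)
      then show "(\<lambda>n. cip (x n) b) \<longlonglongrightarrow> of_real (\<Sum>h\<in>A. a h) * \<beta>"
        by (simp add: eq sum_distrib_right)
    qed (use b in simp)
    have "cmod (clim x (\<lambda>_. b)) \<le> 2 * (M * N b)"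
    proof (rule LIMSEQ_le_const2[OF tendsto_norm[OF clim[OF x(1) Cauchy_seqs_const[OF b]]]])
      have "cmod (cip (x n) b) \<le> 2 * (M * N b)" for n
      proof -
        have "cmod (cip (x n) b) \<le> 2 * (N (x n) * N b)" using cip_bound[of "x n" b] x b by simp
        also have "\<dots> \<le> 2 * (M * N b)" using M b by (intro mult_left_mono mult_right_mono) auto
        finally show ?thesis .
      qed
      then show "\<exists>Na. \<forall>n\<ge>Na. cmod (cip (x n) b) \<le> 2 * (M * N b)" by blast
    qed
    then have "(\<bar>\<Sum>h\<in>A. a h\<bar> * cmod \<beta>)^2 \<le> (2 * (M * N b))^2"
      unfolding xb by (intro power_mono) (auto simp: norm_mult simp flip: of_real_sum)
    then have "c * (\<Sum>h\<in>A. a h)^2 \<le> (N b)^2"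
      using M by (simp add: c_def power_mult_distrib field_simps)
    moreover have "(\<Sum>i\<in>A. \<Sum>j\<in>A. a i * a j * (\<phi> (inv i \<otimes> j) - c)) = (N b)^2 - c * (\<Sum>h\<in>A. a h)^2"
    proof -
      have "(\<Sum>i\<in>A. \<Sum>j\<in>A. a i * a j * (\<phi> (inv i \<otimes> j) - c))
          = (N b)^2 - (\<Sum>i\<in>A. \<Sum>j\<in>A. c * (a i * a j))"
        unfolding Nb sum_subtractf[symmetric] by (intro sum.cong refl) (simp add: algebra_simps)
      also have "(\<Sum>i\<in>A. \<Sum>j\<in>A. c * (a i * a j)) = c * (\<Sum>h\<in>A. a h)^2"
        unfolding power2_eq_square sum_product by (simp only: sum_distrib_left)
      finally show ?thesis .
    qed
    ultimately show "0 \<le> (\<Sum>i\<in>A. \<Sum>j\<in>A. a i * a j * (\<phi> (inv i \<otimes> j) - c))" by simp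
  qed
  then show ?thesis using c by blast
qed

end

lemma pos_def_limit:
  assumes "\<And>n. pos_def K (f n)" "\<And>g. (\<lambda>n. f n g) \<longlonglongrightarrow> \<phi> g"
  shows "pos_def K \<phi>"
  unfolding pos_def_def psd_on_def
proof (intro allI impI conjI ballI)
  fix A i j assume A: "finite A" "A \<subseteq> carrier K" "i \<in> A" "j \<in> A"
  have "f n (inv\<^bsub>K\<^esub> i \<otimes>\<^bsub>K\<^esub> j) = f n (inv\<^bsub>K\<^esub> j \<otimes>\<^bsub>K\<^esub> i)" for n
    using assms(1)[of n] A unfolding pos_def_def psd_on_def by blast
  then show "\<phi> (inv\<^bsub>K\<^esub> i \<otimes>\<^bsub>K\<^esub> j) = \<phi> (inv\<^bsub>K\<^esub> j \<otimes>\<^bsub>K\<^esub> i)"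
    using LIMSEQ_unique[OF assms(2)[of "inv\<^bsub>K\<^esub> i \<otimes>\<^bsub>K\<^esub> j"]] assms(2)[of "inv\<^bsub>K\<^esub> j \<otimes>\<^bsub>K\<^esub> i"] by simp
next
  fix A a assume A: "finite A" "A \<subseteq> carrier K"
  have "(\<lambda>n. \<Sum>i\<in>A. \<Sum>j\<in>A. a i * a j * f n (inv\<^bsub>K\<^esub> i \<otimes>\<^bsub>K\<^esub> j))
      \<longlonglongrightarrow> (\<Sum>i\<in>A. \<Sum>j\<in>A. a i * a j * \<phi> (inv\<^bsub>K\<^esub> i \<otimes>\<^bsub>K\<^esub> j))"
    by (intro tendsto_sum tendsto_mult_left assms(2))
  moreover have "0 \<le> (\<Sum>i\<in>A. \<Sum>j\<in>A. a i * a j * f n (inv\<^bsub>K\<^esub> i \<otimes>\<^bsub>K\<^esub> j))" for n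
    using assms(1)[of n] A unfolding pos_def_def psd_on_def by blast
  ultimately show "0 \<le> (\<Sum>i\<in>A. \<Sum>j\<in>A. a i * a j * \<phi> (inv\<^bsub>K\<^esub> i \<otimes>\<^bsub>K\<^esub> j))"
    by (intro LIMSEQ_le_const) auto
qed

text \<open>Let \<open>m\<close> be the largest constant with \<open>\<phi> - m\<close> positive definite, that is, the mass of the trivial
  representation in \<open>\<phi>\<close>.  By maximality \<open>invariant_part\<close> does not apply to \<open>\<phi> - m\<close>, so \<open>1 - m\<close> is at most a
  multiple of the defect \<open>M\<close> on \<open>F\<close>; and \<open>\<phi> - m\<close> is bounded by its value \<open>1 - m\<close> at \<open>\<one>\<close>.\<close>

theorem property_T_kazhdan:
  assumes K: "group K" and T: "property_T K"
  shows "\<exists>F C. kazhdan K F C"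
proof -
  interpret group K by (rule K)
  obtain F \<epsilon> where F: "finite F" "F \<subseteq> carrier K" "\<epsilon> > 0"
    and inv: "\<And>(H :: ('a \<times> nat \<Rightarrow> complex) hilb) \<rho>.
          hilbert_space H \<Longrightarrow> unitary_rep K H \<rho> \<Longrightarrow>
          (\<exists>v\<in>carrier H. v \<noteq> \<zero>\<^bsub>H\<^esub> \<and> (\<forall>g\<in>F. hnorm H (\<rho> g v \<ominus>\<^bsub>H\<^esub> v) < \<epsilon> * hnorm H v)) \<Longrightarrow>
          (\<exists>w\<in>carrier H. w \<noteq> \<zero>\<^bsub>H\<^esub> \<and> (\<forall>g\<in>carrier K. \<rho> g w = w))"
    using T unfolding property_T_def by blast
  have "\<bar>\<phi> g - 1\<bar> \<le> 4 / \<epsilon>^2 * M"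
    if pd: "pos_def K \<phi>" and one: "\<phi> \<one>\<^bsub>K\<^esub> = 1" and M: "0 \<le> M" "\<forall>s\<in>F. 1 - \<phi> s \<le> M" and g: "g \<in> carrier K"
    for \<phi> M g
  proof -
    define Q where "Q = {c. 0 \<le> c \<and> pos_def K (\<lambda>g. \<phi> g - c)}"
    have Q0: "0 \<in> Q" using pd by (simp add: Q_def)
    have Q1: "c \<le> 1" if "c \<in> Q" for c
    proof -
      have "pos_def K (\<lambda>g. \<phi> g - c)" using that by (simp add: Q_def)
      then interpret gns K "\<lambda>g. \<phi> g - c" by unfold_locales
      show ?thesis using pos_def_bound[of "\<one>\<^bsub>K\<^esub>"] one by simp
    qed
    have Qbd: "bdd_above Q" using Q1 by (rule bdd_aboveI)
    define m where "m = Sup Q"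
    have m0: "0 \<le> m" unfolding m_def by (rule cSup_upper[OF Q0 Qbd])
    have "\<exists>c\<in>Q. m - inverse (real (Suc n)) < c" for n
      using less_cSup_iff[OF _ Qbd, of "m - inverse (real (Suc n))"] Q0 by (auto simp: m_def)
    then obtain q where q1: "\<And>n. q n \<in> Q" "\<And>n. m - inverse (real (Suc n)) < q n" by metis
    have "q \<longlonglongrightarrow> m"
    proof (rule tendsto_sandwich[OF _ _ _ tendsto_const])
      show "(\<lambda>n. m - inverse (real (Suc n))) \<longlonglongrightarrow> m"
        using tendsto_diff[OF tendsto_const LIMSEQ_inverse_real_of_nat, of m] by simp
      show "\<forall>\<^sub>F n in sequentially. m - inverse (real (Suc n)) \<le> q n"
        using q1(2) by (auto intro!: always_eventually less_imp_le)
      show "\<forall>\<^sub>F n in sequentially. q n \<le> m"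
        using cSup_upper[OF q1(1) Qbd] by (auto simp: m_def)
    qed
    note q = q1(1) this
    have pdm: "pos_def K (\<lambda>g. \<phi> g - m)"
    proof (rule pos_def_limit)
      show "pos_def K (\<lambda>g. \<phi> g - q n)" for n using q(1)[of n] by (simp add: Q_def)
      show "(\<lambda>n. \<phi> g - q n) \<longlonglongrightarrow> \<phi> g - m" for g by (intro tendsto_diff tendsto_const q)
    qed
    interpret gns K "\<lambda>g. \<phi> g - m" using pdm by unfold_locales
    have m1: "0 \<le> 1 - m" using pos_def_bound[of "\<one>\<^bsub>K\<^esub>"] one by simp
    have "\<epsilon>^2 * (1 - m) \<le> 2 * M"
    proof (rule ccontr)
      assume "\<not> ?thesis"
      then have big: "2 * M < \<epsilon>^2 * (1 - m)" by simp
      then have "0 < \<epsilon>^2 * (1 - m)" using M by linarith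
      then have pos: "0 < 1 - m" using F(3) by (simp add: zero_less_mult_iff)
      have "\<exists>c>0. pos_def K (\<lambda>g. \<phi> g - m - c)"
      proof (rule invariant_part[OF inv F(2,3)])
        show "0 < \<phi> \<one>\<^bsub>K\<^esub> - m" using pos one by simp
        show "2 * (\<phi> \<one>\<^bsub>K\<^esub> - m - (\<phi> s - m)) < \<epsilon>^2 * (\<phi> \<one>\<^bsub>K\<^esub> - m)" if "s \<in> F" for s
          using M(2) that big one by force
      qed
      then obtain c where c: "c > 0" "pos_def K (\<lambda>g. \<phi> g - (m + c))" by (auto simp: algebra_simps)
      then have "m + c \<in> Q" using m0 by (simp add: Q_def)
      from cSup_upper[OF this Qbd] have "m + c \<le> m" by (simp add: m_def)
      then show False using c by simp
    qed
    then have "2 * (1 - m) \<le> 4 / \<epsilon>^2 * M" using F(3) by (simp add: field_simps)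
    moreover have "\<bar>\<phi> g - m\<bar> \<le> 1 - m" using pos_def_bound[OF g] one by simp
    then have "\<bar>\<phi> g - 1\<bar> \<le> 2 * (1 - m)" using m1 by argo
    ultimately show ?thesis by (rule order_trans[rotated])
  qed
  then have "kazhdan K F (4 / \<epsilon>^2)" using F by (auto simp: kazhdan_def)
  then show ?thesis by blast
qed

section \<open>Matrix norms\<close>

abbreviation adj :: "complex mat \<Rightarrow> complex mat" where "adj \<equiv> mat_adjoint"

definition hs_ip :: "nat \<Rightarrow> complex mat \<Rightarrow> complex mat \<Rightarrow> complex" where
  "hs_ip d X Y = (\<Sum>i<d. \<Sum>j<d. X $$ (i,j) * cnj (Y $$ (i,j)))"

definition hs :: "nat \<Rightarrow> complex mat \<Rightarrow> real" where
  "hs d X = L2_set (\<lambda>p. cmod (X $$ p)) ({..<d} \<times> {..<d})"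

definition vec_ip :: "complex Matrix.vec \<Rightarrow> complex Matrix.vec \<Rightarrow> complex" where
  "vec_ip v w = (\<Sum>i<dim_vec v. v $ i * cnj (w $ i))"

lemma adj_carrier [simp]: "A \<in> carrier_mat n m \<Longrightarrow> adj A \<in> carrier_mat m n"
  by (auto simp: mat_adjoint_def mat_of_rows_def)

lemma adj_dim [simp]: "dim_row (adj A) = dim_col A" "dim_col (adj A) = dim_row A"
  by (simp_all add: mat_adjoint_def)

lemma adj_index [simp]: "i < dim_col A \<Longrightarrow> j < dim_row A \<Longrightarrow> adj A $$ (i, j) = cnj (A $$ (j, i))"
  by (simp add: mat_adjoint_def mat_of_rows_def)

lemma adj_adj [simp]: "adj (adj A) = A"
  by (rule eq_matI) auto

lemma mult_index:
  assumes "i < dim_row A" "j < dim_col B" "dim_row B = dim_col A"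
  shows "(A * B) $$ (i, j) = (\<Sum>k<dim_col A. A $$ (i, k) * B $$ (k, j))"
  using assms by (simp add: scalar_prod_def atLeast0LessThan)

lemma mult_vec_index:
  assumes "i < dim_row A" "dim_vec v = dim_col A"
  shows "(A *\<^sub>v v) $ i = (\<Sum>k<dim_col A. A $$ (i, k) * v $ k)"
  using assms by (simp add: scalar_prod_def atLeast0LessThan)

lemma adj_mult: "dim_col A = dim_row B \<Longrightarrow> adj (A * B) = adj B * adj A"
  by (rule eq_matI) (simp_all add: mult_index mult.commute del: index_mult_mat(1))

lemma adj_one [simp]: "adj (1\<^sub>m n) = 1\<^sub>m n"
  by (rule eq_matI) auto

lemma adj_zero [simp]: "adj (0\<^sub>m n m) = 0\<^sub>m m n"
  by (rule eq_matI) auto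

lemma adj_add: "A \<in> carrier_mat n m \<Longrightarrow> B \<in> carrier_mat n m \<Longrightarrow> adj (A + B) = adj A + adj B"
  by (rule eq_matI) auto

lemma adj_minus: "A \<in> carrier_mat n m \<Longrightarrow> B \<in> carrier_mat n m \<Longrightarrow> adj (A - B) = adj A - adj B"
  by (rule eq_matI) auto

lemma adj_smult: "adj (c \<cdot>\<^sub>m A) = cnj c \<cdot>\<^sub>m adj A"
  by (rule eq_matI) auto

lemma vec_l2_nonneg [simp]: "0 \<le> vec_l2 v" by (simp add: vec_l2_def)

lemma vec_l2_sq: "(vec_l2 v)^2 = (\<Sum>i<dim_vec v. (cmod (v $ i))^2)"
  by (simp add: vec_l2_def L2_set_def sum_nonneg)

lemma vec_ip_self: "vec_ip v v = of_real ((vec_l2 v)^2)"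
  by (simp add: vec_ip_def vec_l2_sq complex_norm_square del: of_real_power)

lemma vec_ip_bound: "dim_vec v = dim_vec w \<Longrightarrow> cmod (vec_ip v w) \<le> vec_l2 v * vec_l2 w"
proof -
  assume d: "dim_vec v = dim_vec w"
  have "cmod (vec_ip v w) \<le> (\<Sum>i<dim_vec v. \<bar>cmod (v $ i)\<bar> * \<bar>cmod (w $ i)\<bar>)"
    unfolding vec_ip_def by (rule sum_norm_le) (simp add: norm_mult)
  also have "\<dots> \<le> vec_l2 v * vec_l2 w"
    unfolding vec_l2_def using L2_set_mult_ineq[of "\<lambda>i. cmod (v $ i)" "\<lambda>i. cmod (w $ i)"] d by simp
  finally show ?thesis .
qed

lemma vec_ip_adj:
  assumes "A \<in> carrier_mat n m" "v \<in> carrier_vec m" "w \<in> carrier_vec n"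
  shows "vec_ip (A *\<^sub>v v) w = vec_ip v (adj A *\<^sub>v w)"
proof -
  have "vec_ip (A *\<^sub>v v) w = (\<Sum>i<n. \<Sum>k<m. A $$ (i, k) * v $ k * cnj (w $ i))"
    using assms by (simp add: vec_ip_def mult_vec_index sum_distrib_right del: index_mult_mat_vec)
  also have "\<dots> = (\<Sum>k<m. \<Sum>i<n. A $$ (i, k) * v $ k * cnj (w $ i))" by (rule sum.swap)
  also have "\<dots> = vec_ip v (adj A *\<^sub>v w)"
    using assms by (simp add: vec_ip_def mult_vec_index sum_distrib_left mult.assoc mult.commute mult.left_commute del: index_mult_mat_vec)
  finally show ?thesis .
qed

lemma vec_l2_smult: "vec_l2 (c \<cdot>\<^sub>v v) = cmod c * vec_l2 v"
  unfolding vec_l2_def L2_set_right_distrib[OF norm_ge_zero] by (auto intro!: L2_set_cong simp: norm_mult)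

lemma vec_l2_add: "dim_vec v = dim_vec w \<Longrightarrow> vec_l2 (v + w) \<le> vec_l2 v + vec_l2 w"
proof -
  assume d: "dim_vec v = dim_vec w"
  have "vec_l2 (v + w) \<le> L2_set (\<lambda>i. cmod (v $ i) + cmod (w $ i)) {..<dim_vec w}"
    unfolding vec_l2_def using d by (auto intro!: L2_set_mono norm_triangle_ineq)
  also have "\<dots> \<le> vec_l2 v + vec_l2 w"
    unfolding vec_l2_def using L2_set_triangle_ineq[of "\<lambda>i. cmod (v $ i)" "\<lambda>i. cmod (w $ i)"] d by simp
  finally show ?thesis .
qed

lemma vec_l2_zero [simp]: "vec_l2 (0\<^sub>v n) = 0"
  by (simp add: vec_l2_def L2_set_def)

lemma hs_nonneg [simp]: "0 \<le> hs d X" by (simp add: hs_def)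

lemma hs_sq: "(hs d X)^2 = (\<Sum>i<d. \<Sum>j<d. (cmod (X $$ (i,j)))^2)"
  by (simp add: hs_def L2_set_def sum_nonneg sum.cartesian_product case_prod_beta)

lemma hs_cols: "X \<in> carrier_mat d d \<Longrightarrow> (hs d X)^2 = (\<Sum>j<d. (vec_l2 (col X j))^2)"
  unfolding hs_sq vec_l2_sq by (subst sum.swap) (auto intro!: sum.cong)

text \<open>Provides an upper bound for the set whose supremum defines the operator norm.\<close>

lemma mat_vec_hs:
  assumes A: "A \<in> carrier_mat d d" and v: "v \<in> carrier_vec d"
  shows "vec_l2 (A *\<^sub>v v) \<le> hs d A * vec_l2 v"
proof -
  have row: "(cmod ((A *\<^sub>v v) $ i))^2 \<le> (\<Sum>j<d. (cmod (A $$ (i,j)))^2) * (vec_l2 v)^2" if i: "i < d" for i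
  proof -
    have "cmod ((A *\<^sub>v v) $ i) \<le> (\<Sum>j<d. \<bar>cmod (A $$ (i,j))\<bar> * \<bar>cmod (v $ j)\<bar>)"
      using A v i by (auto simp: mult_vec_index norm_mult simp del: index_mult_mat_vec intro!: sum_norm_le)
    also have "\<dots> \<le> L2_set (\<lambda>j. cmod (A $$ (i,j))) {..<d} * vec_l2 v"
      using L2_set_mult_ineq[of "\<lambda>j. cmod (A $$ (i,j))" "\<lambda>j. cmod (v $ j)" "{..<d}"] v by (simp add: vec_l2_def)
    finally have "(cmod ((A *\<^sub>v v) $ i))^2 \<le> (L2_set (\<lambda>j. cmod (A $$ (i,j))) {..<d} * vec_l2 v)^2"
      by (rule power_mono) simp
    then show ?thesis by (simp add: power_mult_distrib L2_set_def sum_nonneg)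
  qed
  have "(vec_l2 (A *\<^sub>v v))^2 \<le> (\<Sum>i<d. (\<Sum>j<d. (cmod (A $$ (i,j)))^2) * (vec_l2 v)^2)"
    unfolding vec_l2_sq[of "A *\<^sub>v v"] using row A by (auto intro!: sum_mono simp del: index_mult_mat_vec)
  also have "\<dots> = (hs d A * vec_l2 v)^2" by (simp add: hs_sq power_mult_distrib sum_distrib_right)
  finally show ?thesis by (rule power2_le_imp_le) simp
qed

context
  fixes d :: nat
begin

lemma square_closed [simp, intro]:
  fixes A B :: "complex mat"
  assumes "A \<in> carrier_mat d d"
  shows "c \<cdot>\<^sub>m A \<in> carrier_mat d d"
    and "B \<in> carrier_mat d d \<Longrightarrow> A * B \<in> carrier_mat d d"
    and "B \<in> carrier_mat d d \<Longrightarrow> A + B \<in> carrier_mat d d"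
    and "B \<in> carrier_mat d d \<Longrightarrow> A - B \<in> carrier_mat d d"
  using assms by auto

lemma op_norm_vec:
  assumes A: "A \<in> carrier_mat d d" and v: "v \<in> carrier_vec d"
  shows "vec_l2 (A *\<^sub>v v) \<le> op_norm A * vec_l2 v"
proof (cases "vec_l2 v = 0")
  case True
  then show ?thesis using mat_vec_hs[OF A v] by simp
next
  case False
  then have p: "0 < vec_l2 v" using vec_l2_nonneg[of v] by linarith
  let ?S = "{vec_l2 (A *\<^sub>v v) | v. v \<in> carrier_vec (dim_col A) \<and> vec_l2 v \<le> 1}"
  have bdd: "bdd_above ?S"
  proof (rule bdd_aboveI)
    fix x assume "x \<in> ?S"
    then obtain w where w: "x = vec_l2 (A *\<^sub>v w)" "w \<in> carrier_vec d" "vec_l2 w \<le> 1" using A by auto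
    then show "x \<le> hs d A" using mat_vec_hs[OF A w(2)] mult_left_mono[OF w(3), of "hs d A"] by simp
  qed
  let ?w = "of_real (1 / vec_l2 v) \<cdot>\<^sub>v v"
  have "vec_l2 ?w = 1" using p by (simp add: vec_l2_smult norm_divide)
  then have "vec_l2 (A *\<^sub>v ?w) \<in> ?S" using A v by force
  then have "vec_l2 (A *\<^sub>v ?w) \<le> op_norm A" unfolding op_norm_def by (rule cSup_upper[OF _ bdd])
  moreover have "A *\<^sub>v ?w = of_real (1 / vec_l2 v) \<cdot>\<^sub>v (A *\<^sub>v v)"
    by (rule mult_mat_vec[OF A v])
  ultimately show ?thesis using p by (simp add: vec_l2_smult norm_divide field_simps)
qed

lemma op_norm_le:
  assumes A: "A \<in> carrier_mat d d" and c: "\<And>v. v \<in> carrier_vec d \<Longrightarrow> vec_l2 (A *\<^sub>v v) \<le> c * vec_l2 v" "0 \<le> c"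
  shows "op_norm A \<le> c"
  unfolding op_norm_def
proof (rule cSup_least)
  show "{vec_l2 (A *\<^sub>v v) |v. v \<in> carrier_vec (dim_col A) \<and> vec_l2 v \<le> 1} \<noteq> {}"
    using A by (auto intro!: exI[of _ "0\<^sub>v d"])
  fix x assume "x \<in> {vec_l2 (A *\<^sub>v v) |v. v \<in> carrier_vec (dim_col A) \<and> vec_l2 v \<le> 1}"
  then obtain v where v: "x = vec_l2 (A *\<^sub>v v)" "v \<in> carrier_vec d" "vec_l2 v \<le> 1" using A by auto
  then have "x \<le> c * vec_l2 v" using c by simp
  also have "\<dots> \<le> c" using v c mult_left_mono[of "vec_l2 v" 1 c] by simp
  finally show "x \<le> c" .
qed

lemma op_norm_nonneg [simp]:
  assumes A: "A \<in> carrier_mat d d"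
  shows "0 \<le> op_norm A"
proof -
  let ?S = "{vec_l2 (A *\<^sub>v v) | v. v \<in> carrier_vec (dim_col A) \<and> vec_l2 v \<le> 1}"
  have bdd: "bdd_above ?S"
  proof (rule bdd_aboveI)
    fix x assume "x \<in> ?S"
    then obtain w where w: "x = vec_l2 (A *\<^sub>v w)" "w \<in> carrier_vec d" "vec_l2 w \<le> 1" using A by auto
    then show "x \<le> hs d A" using mat_vec_hs[OF A w(2)] mult_left_mono[OF w(3), of "hs d A"] by simp
  qed
  have "vec_l2 (A *\<^sub>v 0\<^sub>v d) \<in> ?S" using A by (auto intro!: exI[of _ "0\<^sub>v d"])
  then have "vec_l2 (A *\<^sub>v 0\<^sub>v d) \<le> op_norm A" unfolding op_norm_def by (rule cSup_upper[OF _ bdd])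
  then show ?thesis using vec_l2_nonneg[of "A *\<^sub>v 0\<^sub>v d"] by linarith
qed

lemma op_norm_mult:
  assumes A: "A \<in> carrier_mat d d" and B: "B \<in> carrier_mat d d"
  shows "op_norm (A * B) \<le> op_norm A * op_norm B"
proof (rule op_norm_le)
  fix v :: "complex Matrix.vec" assume v: "v \<in> carrier_vec d"
  then have "vec_l2 (A * B *\<^sub>v v) = vec_l2 (A *\<^sub>v (B *\<^sub>v v))" using A B by (simp add: assoc_mult_mat_vec)
  also have "\<dots> \<le> op_norm A * vec_l2 (B *\<^sub>v v)" by (rule op_norm_vec[OF A]) (use B v in auto)
  also have "\<dots> \<le> op_norm A * (op_norm B * vec_l2 v)"
    by (intro mult_left_mono op_norm_vec B v) (use A in auto)
  finally show "vec_l2 (A * B *\<^sub>v v) \<le> op_norm A * op_norm B * vec_l2 v" by simp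
qed (use A B in auto)

lemma op_norm_add:
  assumes A: "A \<in> carrier_mat d d" and B: "B \<in> carrier_mat d d"
  shows "op_norm (A + B) \<le> op_norm A + op_norm B"
proof (rule op_norm_le)
  fix v :: "complex Matrix.vec" assume v: "v \<in> carrier_vec d"
  then have "vec_l2 ((A + B) *\<^sub>v v) = vec_l2 (A *\<^sub>v v + B *\<^sub>v v)" using A B by (simp add: add_mult_distrib_mat_vec)
  also have "\<dots> \<le> vec_l2 (A *\<^sub>v v) + vec_l2 (B *\<^sub>v v)" by (rule vec_l2_add) (use A B in auto)
  also have "\<dots> \<le> op_norm A * vec_l2 v + op_norm B * vec_l2 v"
    by (intro add_mono op_norm_vec A B v)
  finally show "vec_l2 ((A + B) *\<^sub>v v) \<le> (op_norm A + op_norm B) * vec_l2 v" by (simp add: algebra_simps)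
qed (use A B in auto)

lemma op_norm_smult:
  assumes A: "A \<in> carrier_mat d d"
  shows "op_norm (c \<cdot>\<^sub>m A) \<le> cmod c * op_norm A"
proof (rule op_norm_le)
  fix v :: "complex Matrix.vec" assume v: "v \<in> carrier_vec d"
  have "(c \<cdot>\<^sub>m A) *\<^sub>v v = c \<cdot>\<^sub>v (A *\<^sub>v v)" using A v by (intro eq_vecI) (auto simp: scalar_prod_def sum_distrib_left mult.assoc)
  then show "vec_l2 ((c \<cdot>\<^sub>m A) *\<^sub>v v) \<le> cmod c * op_norm A * vec_l2 v"
    using op_norm_vec[OF A v] mult_left_mono[of "vec_l2 (A *\<^sub>v v)" "op_norm A * vec_l2 v" "cmod c"]
    by (simp add: vec_l2_smult mult.assoc)
qed (use A in auto)

lemma op_norm_minus: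
  assumes A: "A \<in> carrier_mat d d" and B: "B \<in> carrier_mat d d"
  shows "op_norm (A - B) \<le> op_norm A + op_norm B"
proof -
  have eq: "A - B = A + (-1) \<cdot>\<^sub>m B" by (rule eq_matI) (use A B in auto)
  show ?thesis unfolding eq using op_norm_add[OF A, of "(-1) \<cdot>\<^sub>m B"] op_norm_smult[OF B, of "-1"] B by simp
qed

lemma op_norm_minus_commute:
  assumes A: "A \<in> carrier_mat d d" and B: "B \<in> carrier_mat d d"
  shows "op_norm (A - B) = op_norm (B - A)"
proof -
  have "op_norm (A - B) \<le> op_norm (B - A)" if "A \<in> carrier_mat d d" "B \<in> carrier_mat d d" for A B :: "complex mat"
  proof -
    have eq: "A - B = (-1) \<cdot>\<^sub>m (B - A)" by (rule eq_matI) (use that in auto)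
    show ?thesis unfolding eq using op_norm_smult[of "B - A" "-1"] that by simp
  qed
  then show ?thesis using A B by (simp add: order_antisym)
qed

lemma op_norm_zero [simp]: "op_norm (0\<^sub>m d d) = 0"
proof (rule order_antisym)
  have "0\<^sub>m d d *\<^sub>v v = 0\<^sub>v d" if "v \<in> carrier_vec d" for v :: "complex Matrix.vec"
    using that by (intro eq_vecI) (auto simp: scalar_prod_def)
  then show "op_norm (0\<^sub>m d d) \<le> 0" by (intro op_norm_le) auto
qed simp

lemma op_norm_one: "op_norm (1\<^sub>m d) \<le> 1"
  by (rule op_norm_le) auto

lemma op_norm_isometry:
  assumes U: "U \<in> carrier_mat d d" and UU: "adj U * U = 1\<^sub>m d"
  shows "op_norm U \<le> 1"
proof (rule op_norm_le[OF U])
  fix v :: "complex Matrix.vec" assume v: "v \<in> carrier_vec d"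
  have "vec_ip (U *\<^sub>v v) (U *\<^sub>v v) = vec_ip v (adj U *\<^sub>v (U *\<^sub>v v))" by (rule vec_ip_adj[OF U v]) (use U v in auto)
  also have "adj U *\<^sub>v (U *\<^sub>v v) = v" using U v UU assoc_mult_mat_vec[of "adj U" d d U d v] by simp
  finally have "(vec_l2 (U *\<^sub>v v))^2 = (vec_l2 v)^2" unfolding vec_ip_self of_real_eq_iff .
  then show "vec_l2 (U *\<^sub>v v) \<le> 1 * vec_l2 v" by (simp add: power2_eq_iff_nonneg)
qed simp

lemma op_norm_adj:
  assumes A: "A \<in> carrier_mat d d"
  shows "op_norm (adj A) = op_norm A"
proof -
  have "op_norm (adj A) \<le> op_norm A" if A: "A \<in> carrier_mat d d" for A
  proof (rule op_norm_le)
    fix v :: "complex Matrix.vec" assume v: "v \<in> carrier_vec d"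
    let ?w = "adj A *\<^sub>v v"
    have w: "?w \<in> carrier_vec d" using A v by (auto intro!: mult_mat_vec_carrier)
    have "(vec_l2 ?w)^2 = cmod (vec_ip ?w ?w)" by (simp add: vec_ip_self del: of_real_power)
    also have "vec_ip ?w ?w = vec_ip v (A *\<^sub>v ?w)" using vec_ip_adj[of "adj A" d d v ?w] A v w by simp
    also have "cmod \<dots> \<le> vec_l2 v * vec_l2 (A *\<^sub>v ?w)" by (rule vec_ip_bound) (use A v in auto)
    also have "\<dots> \<le> vec_l2 v * (op_norm A * vec_l2 ?w)" by (intro mult_left_mono op_norm_vec A w) auto
    finally have *: "vec_l2 ?w * vec_l2 ?w \<le> (op_norm A * vec_l2 v) * vec_l2 ?w"
      by (simp add: power2_eq_square mult.assoc mult.left_commute)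
    show "vec_l2 ?w \<le> op_norm A * vec_l2 v"
    proof (cases "vec_l2 ?w = 0")
      case False
      then have "0 < vec_l2 ?w" using vec_l2_nonneg[of ?w] by linarith
      then show ?thesis using * by simp
    qed (use A in simp)
  qed (use A in auto)
  from this[OF A] this[of "adj A"] A show ?thesis by simp
qed

section \<open>Hilbert--Schmidt norm\<close>

lemma hs_ip_self: "hs_ip d X X = of_real ((hs d X)^2)"
  by (simp add: hs_ip_def hs_sq complex_norm_square del: of_real_power)

lemma hs_ip_bound: "cmod (hs_ip d X Y) \<le> hs d X * hs d Y"
proof -
  have "cmod (hs_ip d X Y) \<le> (\<Sum>p\<in>{..<d}\<times>{..<d}. \<bar>cmod (X $$ p)\<bar> * \<bar>cmod (Y $$ p)\<bar>)"
    unfolding hs_ip_def sum.cartesian_product by (rule sum_norm_le) (auto simp: norm_mult)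
  also have "\<dots> \<le> hs d X * hs d Y" unfolding hs_def by (rule L2_set_mult_ineq)
  finally show ?thesis .
qed

lemma hs_ip_add: "X \<in> carrier_mat d d \<Longrightarrow> Y \<in> carrier_mat d d \<Longrightarrow> hs_ip d (X + Y) Z = hs_ip d X Z + hs_ip d Y Z"
  by (simp add: hs_ip_def distrib_right sum.distrib)

lemma hs_ip_minus: "X \<in> carrier_mat d d \<Longrightarrow> Y \<in> carrier_mat d d \<Longrightarrow> hs_ip d (X - Y) Z = hs_ip d X Z - hs_ip d Y Z"
  by (simp add: hs_ip_def left_diff_distrib right_diff_distrib sum_subtractf)

lemma hs_ip_minus_right: "X \<in> carrier_mat d d \<Longrightarrow> Y \<in> carrier_mat d d \<Longrightarrow> hs_ip d Z (X - Y) = hs_ip d Z X - hs_ip d Z Y"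
  by (simp add: hs_ip_def left_diff_distrib right_diff_distrib sum_subtractf)

lemma hs_ip_cnj: "hs_ip d Y X = cnj (hs_ip d X Y)"
  by (simp add: hs_ip_def mult.commute)

lemma hs_ip_left:
  assumes A: "A \<in> carrier_mat d d" and X: "X \<in> carrier_mat d d" and Y: "Y \<in> carrier_mat d d"
  shows "hs_ip d (A * X) Y = hs_ip d X (adj A * Y)"
proof -
  have "hs_ip d (A * X) Y = (\<Sum>i<d. \<Sum>j<d. \<Sum>k<d. A $$ (i,k) * X $$ (k,j) * cnj (Y $$ (i,j)))"
    using assms by (simp add: hs_ip_def mult_index sum_distrib_right del: index_mult_mat(1))
  also have "\<dots> = (\<Sum>i<d. \<Sum>k<d. \<Sum>j<d. A $$ (i,k) * X $$ (k,j) * cnj (Y $$ (i,j)))"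
    by (intro sum.cong refl sum.swap)
  also have "\<dots> = (\<Sum>k<d. \<Sum>i<d. \<Sum>j<d. A $$ (i,k) * X $$ (k,j) * cnj (Y $$ (i,j)))"
    by (rule sum.swap)
  also have "\<dots> = (\<Sum>k<d. \<Sum>j<d. \<Sum>i<d. A $$ (i,k) * X $$ (k,j) * cnj (Y $$ (i,j)))"
    by (intro sum.cong refl sum.swap)
  also have "\<dots> = hs_ip d X (adj A * Y)"
    using assms by (simp add: hs_ip_def mult_index sum_distrib_left algebra_simps del: index_mult_mat(1))
  finally show ?thesis .
qed

lemma hs_ip_adj_adj: "X \<in> carrier_mat d d \<Longrightarrow> Y \<in> carrier_mat d d \<Longrightarrow> hs_ip d (adj X) (adj Y) = cnj (hs_ip d X Y)"
  unfolding hs_ip_def by (subst sum.swap) simp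

lemma hs_ip_right:
  assumes A: "A \<in> carrier_mat d d" and X: "X \<in> carrier_mat d d" and Y: "Y \<in> carrier_mat d d"
  shows "hs_ip d (X * A) Y = hs_ip d X (Y * adj A)"
proof -
  have "cnj (hs_ip d (X * A) Y) = hs_ip d (adj A * adj X) (adj Y)"
    using assms hs_ip_adj_adj[of "X * A" Y] by (simp add: adj_mult)
  also have "\<dots> = hs_ip d (adj X) (adj (Y * adj A))"
    using assms hs_ip_left[of "adj A" "adj X" "adj Y"] by (simp add: adj_mult)
  also have "\<dots> = cnj (hs_ip d X (Y * adj A))" using assms by (intro hs_ip_adj_adj) auto
  finally show ?thesis by simp
qed

lemma hs_adj: "X \<in> carrier_mat d d \<Longrightarrow> hs d (adj X) = hs d X"
proof -
  assume "X \<in> carrier_mat d d"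
  then have "(hs d (adj X))^2 = (hs d X)^2" unfolding hs_sq by (subst sum.swap) simp
  then show ?thesis by (simp add: power2_eq_iff_nonneg)
qed

lemma hs_left:
  assumes A: "A \<in> carrier_mat d d" and X: "X \<in> carrier_mat d d"
  shows "hs d (A * X) \<le> op_norm A * hs d X"
proof (rule power2_le_imp_le)
  have "(hs d (A * X))^2 = (\<Sum>j<d. (vec_l2 (A *\<^sub>v col X j))^2)"
    using A X by (subst hs_cols) (auto intro!: sum.cong simp: col_mult2[OF A X] simp del: col_mult)
  also have "\<dots> \<le> (\<Sum>j<d. (op_norm A * vec_l2 (col X j))^2)"
    by (intro sum_mono power_mono op_norm_vec A) (use X in auto)
  also have "\<dots> = (op_norm A * hs d X)^2"
    by (simp add: power_mult_distrib hs_cols[OF X] sum_distrib_left)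
  finally show "(hs d (A * X))^2 \<le> (op_norm A * hs d X)^2" .
qed (use A in simp)

lemma hs_right:
  assumes A: "A \<in> carrier_mat d d" and X: "X \<in> carrier_mat d d"
  shows "hs d (X * A) \<le> op_norm A * hs d X"
  using hs_left[of "adj A" "adj X"] hs_adj[of "X * A"] assms
  by (simp add: adj_mult[symmetric] hs_adj op_norm_adj)

lemma hs_triangle:
  assumes X: "X \<in> carrier_mat d d" and Y: "Y \<in> carrier_mat d d"
  shows "hs d (X + Y) \<le> hs d X + hs d Y"
proof -
  have "hs d (X + Y) \<le> L2_set (\<lambda>p. cmod (X $$ p) + cmod (Y $$ p)) ({..<d} \<times> {..<d})"
    unfolding hs_def using X Y by (auto intro!: L2_set_mono norm_triangle_ineq)
  also have "\<dots> \<le> hs d X + hs d Y" unfolding hs_def by (rule L2_set_triangle_ineq)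
  finally show ?thesis .
qed

text \<open>The trace norm of \<open>X\<close> is at most \<open>C\<close>, expressed by duality with the operator norm.\<close>

definition trace_norm_le :: "complex mat \<Rightarrow> real \<Rightarrow> bool" where
  "trace_norm_le X C \<longleftrightarrow> (\<forall>Y \<in> carrier_mat d d. cmod (hs_ip d X Y) \<le> C * op_norm Y)"

text \<open>Test the duality with \<open>X\<close> itself.  This is how closeness in operator norm will be turned into
  closeness in Hilbert-Schmidt norm, at the price of a trace norm bound.\<close>

lemma trace_norm_le_hs: "X \<in> carrier_mat d d \<Longrightarrow> trace_norm_le X C \<Longrightarrow> (hs d X)^2 \<le> C * op_norm X"
  using hs_ip_self[of X] unfolding trace_norm_le_def by (metis abs_power2 norm_of_real)

lemma trace_norm_le_add:
  assumes "X \<in> carrier_mat d d" "Y \<in> carrier_mat d d" "trace_norm_le X C" "trace_norm_le Y D"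
  shows "trace_norm_le (X + Y) (C + D)"
  unfolding trace_norm_le_def
proof
  fix Z :: "complex mat" assume Z: "Z \<in> carrier_mat d d"
  have "cmod (hs_ip d (X + Y) Z) \<le> cmod (hs_ip d X Z) + cmod (hs_ip d Y Z)"
    using assms by (simp add: hs_ip_add norm_triangle_ineq)
  also have "\<dots> \<le> C * op_norm Z + D * op_norm Z" using assms Z by (intro add_mono) (auto simp: trace_norm_le_def)
  finally show "cmod (hs_ip d (X + Y) Z) \<le> (C + D) * op_norm Z" by (simp add: algebra_simps)
qed

lemma trace_norm_le_minus:
  assumes "X \<in> carrier_mat d d" "Y \<in> carrier_mat d d" "trace_norm_le X C" "trace_norm_le Y D"
  shows "trace_norm_le (X - Y) (C + D)"
  unfolding trace_norm_le_def
proof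
  fix Z :: "complex mat" assume Z: "Z \<in> carrier_mat d d"
  have "cmod (hs_ip d (X - Y) Z) \<le> cmod (hs_ip d X Z) + cmod (hs_ip d Y Z)"
    using assms by (simp add: hs_ip_minus norm_triangle_ineq4)
  also have "\<dots> \<le> C * op_norm Z + D * op_norm Z" using assms Z by (intro add_mono) (auto simp: trace_norm_le_def)
  finally show "cmod (hs_ip d (X - Y) Z) \<le> (C + D) * op_norm Z" by (simp add: algebra_simps)
qed

lemma trace_norm_le_conj:
  assumes U: "U \<in> carrier_mat d d" and X: "X \<in> carrier_mat d d" and t: "trace_norm_le X C" "0 \<le> C"
  shows "trace_norm_le (U * X * adj U) (C * (op_norm U)^2)"
  unfolding trace_norm_le_def
proof
  fix Z :: "complex mat" assume Z: "Z \<in> carrier_mat d d"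
  have "hs_ip d (U * X * adj U) Z = hs_ip d X (adj U * (Z * U))"
    using U X Z hs_ip_right[of "adj U" "U * X" Z] hs_ip_left[of U X "Z * U"] by simp
  moreover have "cmod (hs_ip d X (adj U * (Z * U))) \<le> C * op_norm (adj U * (Z * U))"
    using t U Z by (simp add: trace_norm_le_def)
  moreover have "op_norm (adj U * (Z * U)) \<le> op_norm U * (op_norm Z * op_norm U)"
    using order_trans[OF op_norm_mult[of "adj U" "Z * U"] mult_left_mono[OF op_norm_mult[of Z U]]] U Z
    by (simp add: op_norm_adj)
  then have "C * op_norm (adj U * (Z * U)) \<le> C * (op_norm U * (op_norm Z * op_norm U))"
    using t by (intro mult_left_mono) auto
  ultimately show "cmod (hs_ip d (U * X * adj U) Z) \<le> C * (op_norm U)^2 * op_norm Z"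
    by (simp add: power2_eq_square mult.assoc mult.commute mult.left_commute)
qed

text \<open>For Hermitian \<open>X\<close> with \<open>X\<^sup>3 = X\<close> the trace norm and the squared Hilbert-Schmidt norm are both the rank.  In the proof
  \<open>X = X (X X)\<close>, and moving one factor across gives the product of two Hilbert-Schmidt norms.\<close>

lemma trace_norm_le_cube:
  assumes X: "X \<in> carrier_mat d d" and h: "adj X = X" and c: "X * X * X = X"
  shows "trace_norm_le X ((hs d X)^2 * op_norm X)"
  unfolding trace_norm_le_def
proof
  fix Z :: "complex mat" assume Z: "Z \<in> carrier_mat d d"
  have "hs_ip d X Z = hs_ip d (X * (X * X)) Z" using c X by (simp add: assoc_mult_mat[of X d d X d X d])
  also have "\<dots> = hs_ip d (X * X) (X * Z)" using hs_ip_left[of X "X * X" Z] X Z h by simp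
  finally have "cmod (hs_ip d X Z) \<le> hs d (X * X) * hs d (X * Z)" using hs_ip_bound by simp
  also have "\<dots> \<le> (op_norm X * hs d X) * (op_norm Z * hs d X)"
    by (intro mult_mono hs_left hs_right X Z) (use X in auto)
  finally show "cmod (hs_ip d X Z) \<le> (hs d X)^2 * op_norm X * op_norm Z"
    by (simp add: power2_eq_square mult.assoc mult.commute mult.left_commute)
qed

end

section \<open>Rounding the spectrum of a Hermitian matrix\<close>

definition diagm :: "nat \<Rightarrow> (nat \<Rightarrow> complex) \<Rightarrow> complex mat" where
  "diagm n l = mat n n (\<lambda>(i, j). if i = j then l i else 0)"

text \<open>The block diagonal matrix with the blocks \<open>a\<close> and \<open>B\<close>, of sizes 1 and \<open>n\<close>.\<close>

definition blk :: "nat \<Rightarrow> complex \<Rightarrow> complex mat \<Rightarrow> complex mat" where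
  "blk n a B = mat (Suc n) (Suc n)
     (\<lambda>(i, j). if i = 0 \<or> j = 0 then (if i = j then a else 0) else B $$ (i - 1, j - 1))"

lemma diagm_carrier [simp]: "diagm n l \<in> carrier_mat n n" by (simp add: diagm_def)

lemma blk_carrier [simp]: "blk n a B \<in> carrier_mat (Suc n) (Suc n)" by (simp add: blk_def)

lemma diagm_mult: "diagm n l * diagm n k = diagm n (\<lambda>i. l i * k i)"
proof (rule eq_matI)
  fix i j assume ij: "i < dim_row (diagm n (\<lambda>i. l i * k i))" "j < dim_col (diagm n (\<lambda>i. l i * k i))"
  then have "(diagm n l * diagm n k) $$ (i, j)
      = (\<Sum>x<n. (if i = x then l i else 0) * (if x = j then k x else 0))"
    by (subst mult_index) (auto simp: diagm_def)
  also have "\<dots> = (\<Sum>x<n. if x = i then (if i = j then l i * k i else 0) else 0)"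
    by (intro sum.cong refl) auto
  finally show "(diagm n l * diagm n k) $$ (i, j) = diagm n (\<lambda>i. l i * k i) $$ (i, j)"
    using ij by (simp add: diagm_def)
qed (auto simp: diagm_def)

lemma diagm_minus: "diagm n l - diagm n k = diagm n (\<lambda>i. l i - k i)"
  by (rule eq_matI) (auto simp: diagm_def)

lemma adj_diagm: "adj (diagm n l) = diagm n (\<lambda>i. cnj (l i))"
  by (rule eq_matI) (auto simp: diagm_def)

lemma blk_mult:
  assumes B: "B \<in> carrier_mat n n" and C: "C \<in> carrier_mat n n"
  shows "blk n a B * blk n c C = blk n (a * c) (B * C)"
proof (rule eq_matI)
  fix i j assume ij: "i < dim_row (blk n (a * c) (B * C))" "j < dim_col (blk n (a * c) (B * C))"
  then have *: "(blk n a B * blk n c C) $$ (i, j) =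
      blk n a B $$ (i, 0) * blk n c C $$ (0, j) + (\<Sum>k<n. blk n a B $$ (i, Suc k) * blk n c C $$ (Suc k, j))"
    by (subst mult_index) (auto simp: blk_def sum.lessThan_Suc_shift simp del: sum.lessThan_Suc)
  show "(blk n a B * blk n c C) $$ (i, j) = blk n (a * c) (B * C) $$ (i, j)"
    unfolding * using ij B C
    by (cases i; cases j) (auto simp: blk_def mult_index simp del: index_mult_mat(1))
qed (auto simp: blk_def)

lemma adj_blk: "B \<in> carrier_mat n n \<Longrightarrow> adj (blk n a B) = blk n (cnj a) (adj B)"
  by (rule eq_matI) (auto simp: blk_def)

lemma blk_diagm: "blk n a (diagm n l) = diagm (Suc n) (case_nat a l)"
  by (rule eq_matI) (auto simp: blk_def diagm_def split: nat.splits)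

lemma blk_one: "blk n 1 (1\<^sub>m n) = 1\<^sub>m (Suc n)"
  by (rule eq_matI) (auto simp: blk_def)

text \<open>Complete \<open>v\<close> to a basis, orthogonalise it by Gram-Schmidt, and normalise the columns.\<close>

lemma unitary_first_column:
  assumes v: "v \<in> carrier_vec n" "v \<noteq> 0\<^sub>v n" and n: "0 < n"
  obtains U c where "U \<in> carrier_mat n n" "adj U * U = 1\<^sub>m n" "col U 0 = c \<cdot>\<^sub>v (v :: complex Matrix.vec)"
proof -
  interpret cof_vec_space n "TYPE(complex)" .
  define b where "b = basis_completion v"
  define ws where "ws = gram_schmidt n b"
  from basis_completion[OF v, folded b_def]
  have b: "span (set b) = carrier_vec n" "distinct b" "\<not> lin_dep (set b)" "set b \<subseteq> carrier_vec n"
    and hdb: "hd b = v" and len: "length b = n" by auto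
  from hdb len n obtain vs where bv: "b = v # vs" by (cases b, auto)
  from gram_schmidt_result[OF b(4,2,3) refl, folded ws_def]
  have ws: "set ws \<subseteq> carrier_vec n" "corthogonal ws" "length ws = n" by (auto simp: len)
  have hdws: "hd ws = v" using gram_schmidt_hd[OF v(1), of vs, folded bv] by (simp add: ws_def)
  define W where "W = mat_of_cols n ws"
  have W: "W \<in> carrier_mat n n" using ws by (auto simp: W_def)
  have orth: "corthogonal_mat W" using orthogonal_mat_of_cols ws unfolding W_def by blast
  have cvW: "vec_ip (col W i) (col W j) = 0 \<longleftrightarrow> i \<noteq> j" if "i < n" "j < n" for i j
    using corthogonal_matD[OF orth, of i j] that W
    by (simp add: vec_ip_def scalar_prod_def atLeast0LessThan)
  have colW0: "col W 0 = v"
    using ws n hdws v by (cases ws) (auto simp: W_def)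
  define l where "l j = vec_l2 (col W j)" for j
  have l0: "l j \<noteq> 0" if "j < n" for j
    using cvW[OF that that] by (auto simp: l_def vec_ip_self)
  define U where "U = mat n n (\<lambda>(i, j). W $$ (i, j) / of_real (l j))"
  have U: "U \<in> carrier_mat n n" by (simp add: U_def)
  have "adj U * U = 1\<^sub>m n"
  proof (rule eq_matI)
    fix i j assume "i < dim_row (1\<^sub>m n :: complex mat)" "j < dim_col (1\<^sub>m n :: complex mat)"
    then have ij: "i < n" "j < n" by auto
    have "(adj U * U) $$ (i, j) = (\<Sum>k<n. cnj (W $$ (k, i) / of_real (l i)) * (W $$ (k, j) / of_real (l j)))"
      using ij by (subst mult_index) (auto simp: U_def)
    also have "\<dots> = vec_ip (col W j) (col W i) / (of_real (l i) * of_real (l j))"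
      using W ij by (simp add: vec_ip_def sum_divide_distrib mult.commute)
    also have "\<dots> = (if i = j then 1 else 0)"
      using cvW[of j i] ij l0[of j] by (auto simp: vec_ip_self l_def power2_eq_square)
    finally show "(adj U * U) $$ (i, j) = 1\<^sub>m n $$ (i, j)" using ij by simp
  qed (auto simp: U_def)
  moreover have "col U 0 = (1 / of_real (l 0)) \<cdot>\<^sub>v v"
  proof -
    have "v $ i = W $$ (i, 0)" if "i < n" for i using colW0 W n that by (metis carrier_matD index_col)
    then show ?thesis using n v by (intro eq_vecI) (auto simp: U_def)
  qed
  ultimately show thesis using that U by blast
qed

text \<open>Conjugation by a unitary matrix whose first column is an eigenvector clears the rest of the first
  column and, the matrix being Hermitian, of the first row; the remaining block is smaller.\<close>

theorem hermitian_diagonalisation: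
  fixes A :: "complex mat"
  assumes "A \<in> carrier_mat n n" "adj A = A"
  shows "\<exists>U l. U \<in> carrier_mat n n \<and> adj U * U = 1\<^sub>m n \<and> A = U * diagm n l * adj U"
  using assms
proof (induction n arbitrary: A)
  case 0
  then show ?case by (intro exI[of _ "1\<^sub>m 0"] exI) auto
next
  case (Suc n)
  let ?n = "Suc n"
  note A = Suc.prems(1) and hA = Suc.prems(2)
  obtain e where "eigenvalue A e" using spectrum_non_empty[OF A] by (auto simp: spectrum_def)
  then obtain v where v: "v \<in> carrier_vec ?n" "v \<noteq> 0\<^sub>v ?n" and Av: "A *\<^sub>v v = e \<cdot>\<^sub>v v"
    using A by (auto simp: eigenvalue_def eigenvector_def)
  obtain U c where U: "U \<in> carrier_mat ?n ?n" and UU: "adj U * U = 1\<^sub>m ?n" and U0: "col U 0 = c \<cdot>\<^sub>v v"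
    using unitary_first_column[OF v] by blast
  have aU: "adj U \<in> carrier_mat ?n ?n" using U by simp
  have UU': "U * adj U = 1\<^sub>m ?n" by (rule mat_mult_left_right_inverse[OF aU U UU])
  define A' where "A' = adj U * (A * U)"
  have A': "A' \<in> carrier_mat ?n ?n" using A U aU by (simp add: A'_def)
  have hA': "adj A' = A'"
    using A U hA by (simp add: A'_def adj_mult assoc_mult_mat[of _ ?n ?n _ ?n _ ?n])
  have AU0: "A *\<^sub>v col U 0 = e \<cdot>\<^sub>v col U 0"
    using mult_mat_vec[OF A v(1), of c] Av by (simp add: U0 smult_smult_assoc mult.commute)
  have col0: "A' $$ (i, 0) = (if i = 0 then e else 0)" if i: "i < ?n" for i
  proof -
    have "A' $$ (i, 0) = (\<Sum>k<?n. adj U $$ (i, k) * (A * U) $$ (k, 0))"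
      unfolding A'_def using A U i by (subst mult_index) auto
    also have "\<dots> = (\<Sum>k<?n. adj U $$ (i, k) * (e * U $$ (k, 0)))"
    proof (intro sum.cong refl)
      fix k assume k: "k \<in> {..<?n}"
      have "(A * U) $$ (k, 0) = (A *\<^sub>v col U 0) $ k" using A U k by simp
      also have "\<dots> = e * U $$ (k, 0)" unfolding AU0 using U k by simp
      finally show "adj U $$ (i, k) * (A * U) $$ (k, 0) = adj U $$ (i, k) * (e * U $$ (k, 0))" by simp
    qed
    also have "\<dots> = e * (adj U * U) $$ (i, 0)"
      using U i by (subst mult_index) (auto simp: sum_distrib_left algebra_simps simp del: sum.lessThan_Suc)
    finally show ?thesis using i by (simp add: UU)
  qed
  have row0: "A' $$ (0, j) = (if j = 0 then e else 0)" if j: "j < ?n" for j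
  proof (cases "j = 0")
    case False
    have "A' $$ (0, j) = adj A' $$ (0, j)" by (simp add: hA')
    also have "\<dots> = cnj (A' $$ (j, 0))" using A' j by simp
    finally show ?thesis using col0[OF j] False by simp
  qed (use col0 in simp)
  define B where "B = mat n n (\<lambda>(i, j). A' $$ (Suc i, Suc j))"
  have B: "B \<in> carrier_mat n n" by (simp add: B_def)
  have A'blk: "A' = blk n e B"
    using A' col0 row0 by (intro eq_matI) (auto simp: blk_def B_def)
  have "adj B = B"
  proof (rule eq_matI)
    fix i j assume ij: "i < dim_row B" "j < dim_col B"
    have "A' $$ (Suc i, Suc j) = adj A' $$ (Suc i, Suc j)" by (simp add: hA')
    also have "\<dots> = cnj (A' $$ (Suc j, Suc i))" using A' ij by (simp add: B_def)
    finally show "adj B $$ (i, j) = B $$ (i, j)" using ij by (simp add: B_def)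
  qed (auto simp: B_def)
  then obtain P l where P: "P \<in> carrier_mat n n" and PP: "adj P * P = 1\<^sub>m n" and BP: "B = P * diagm n l * adj P"
    using Suc.IH[OF B] by blast
  define Q where "Q = blk n 1 P"
  have Q: "Q \<in> carrier_mat ?n ?n" by (simp add: Q_def)
  have aQ: "adj Q = blk n 1 (adj P)" using P by (simp add: Q_def adj_blk)
  have QQ: "adj Q * Q = 1\<^sub>m ?n" unfolding aQ unfolding Q_def using P PP by (simp add: blk_mult blk_one)
  define D where "D = diagm ?n (case_nat e l)"
  have D: "D \<in> carrier_mat ?n ?n" by (simp add: D_def)
  have A'Q: "A' = Q * D * adj Q"
    unfolding aQ unfolding Q_def D_def blk_diagm[symmetric] A'blk BP using P by (simp add: blk_mult)
  define V where "V = U * Q"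
  have V: "V \<in> carrier_mat ?n ?n" using U Q by (simp add: V_def)
  have aV: "adj V = adj Q * adj U" using U Q by (simp add: V_def adj_mult)
  have aQc: "adj Q \<in> carrier_mat ?n ?n" using Q by simp
  note assoc = assoc_mult_mat[of _ ?n ?n _ ?n _ ?n]
  have "adj V * V = adj Q * (adj U * U) * Q"
    unfolding aV unfolding V_def using U Q aU aQc by (simp add: assoc)
  also have "\<dots> = 1\<^sub>m ?n" using QQ by (simp add: UU right_mult_one_mat[OF aQc])
  finally have VV: "adj V * V = 1\<^sub>m ?n" .
  have "V * D * adj V = U * (Q * D * adj Q) * adj U"
    unfolding aV unfolding V_def using U Q D aU aQc by (simp add: assoc)
  also have "\<dots> = U * (adj U * (A * U)) * adj U" unfolding A'Q[symmetric] A'_def by simp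
  also have "\<dots> = (U * adj U) * A * (U * adj U)" using U A aU by (simp add: assoc)
  also have "\<dots> = A" using UU' A by simp
  finally show ?case using V VV unfolding D_def by (metis)
qed

lemma op_norm_diagm_le:
  assumes "\<And>i. i < d \<Longrightarrow> cmod (l i) \<le> c" "0 \<le> c"
  shows "op_norm (diagm d l) \<le> c"
proof (rule op_norm_le)
  fix v :: "complex Matrix.vec" assume v: "v \<in> carrier_vec d"
  have ix: "(diagm d l *\<^sub>v v) $ i = l i * v $ i" if i: "i < d" for i
  proof -
    have "(diagm d l *\<^sub>v v) $ i = (\<Sum>k<d. (if i = k then l i else 0) * v $ k)"
      using i v by (subst mult_vec_index) (auto simp: diagm_def)
    also have "\<dots> = (\<Sum>k<d. if k = i then l i * v $ i else 0)" by (intro sum.cong refl) auto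
    finally show ?thesis using i by simp
  qed
  have "(vec_l2 (diagm d l *\<^sub>v v))^2 = (\<Sum>i<d. (cmod (l i))^2 * (cmod (v $ i))^2)"
    unfolding vec_l2_sq using ix by (simp add: norm_mult power_mult_distrib diagm_def del: index_mult_mat_vec)
  also have "\<dots> \<le> (\<Sum>i<d. c^2 * (cmod (v $ i))^2)"
    using assms by (intro sum_mono mult_right_mono power_mono) auto
  also have "\<dots> = (c * vec_l2 v)^2" using v by (simp add: vec_l2_sq power_mult_distrib sum_distrib_left)
  finally show "vec_l2 (diagm d l *\<^sub>v v) \<le> c * vec_l2 v"
    by (rule power2_le_imp_le) (use assms in simp)
qed (use assms in auto)

lemma diagm_le_op_norm:
  assumes i: "i < d"
  shows "cmod (l i) \<le> op_norm (diagm d l)"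
proof -
  let ?e = "unit_vec d i :: complex Matrix.vec"
  have l2: "vec_l2 (c \<cdot>\<^sub>v ?e) = cmod c" for c
  proof -
    have "(vec_l2 ?e)^2 = (\<Sum>k<d. if k = i then 1 else 0)"
      unfolding vec_l2_sq index_unit_vec(3) by (intro sum.cong refl) (use i in auto)
    then have "(vec_l2 ?e)^2 = 1^2" using i by simp
    then have "vec_l2 ?e = 1" by (rule power2_eq_imp_eq) auto
    then show ?thesis by (simp add: vec_l2_smult)
  qed
  have "diagm d l *\<^sub>v ?e = l i \<cdot>\<^sub>v ?e"
    using i by (intro eq_vecI) (auto simp: diagm_def)
  then have "cmod (l i) = vec_l2 (diagm d l *\<^sub>v ?e)" by (simp add: l2)
  also have "\<dots> \<le> op_norm (diagm d l) * vec_l2 ?e" by (rule op_norm_vec[of _ d]) auto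
  also have "vec_l2 ?e = 1" using l2[of 1] by simp
  finally show ?thesis by simp
qed

text \<open>Every eigenvalue \<open>x\<close> is rounded to a point \<open>r\<close> of \<open>{-1, 0, 1}\<close>.  Of the three factors of
  \<open>x\<^sup>3 - x = x (x - 1) (x + 1)\<close> one is \<open>x - r\<close>, and the other two have product at least 1/2 in absolute value.\<close>

theorem hermitian_rounding:
  assumes A: "A \<in> carrier_mat d d" and h: "adj A = A"
  obtains D where "D \<in> carrier_mat d d" "adj D = D" "D * D * D = D"
    "op_norm (A - D) \<le> 2 * op_norm (A * A * A - A)"
proof -
  obtain U l where U: "U \<in> carrier_mat d d" and UU: "adj U * U = 1\<^sub>m d" and AU: "A = U * diagm d l * adj U"
    using hermitian_diagonalisation[OF A h] by blast
  have aU: "adj U \<in> carrier_mat d d" using U by simp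
  have UU': "U * adj U = 1\<^sub>m d" by (rule mat_mult_left_right_inverse[OF aU U UU])
  note assoc = assoc_mult_mat[of _ d d _ d _ d]
  define cj where "cj M = U * M * adj U" for M
  have cjc: "M \<in> carrier_mat d d \<Longrightarrow> cj M \<in> carrier_mat d d" for M using U aU by (simp add: cj_def)
  have cj_mult: "cj M * cj N = cj (M * N)" if "M \<in> carrier_mat d d" "N \<in> carrier_mat d d" for M N
  proof -
    have "cj M * cj N = U * M * (adj U * U) * N * adj U" using that U aU by (simp add: cj_def assoc)
    then show ?thesis using that U aU by (simp add: UU cj_def assoc)
  qed
  have cj_minus: "cj M - cj N = cj (M - N)" if "M \<in> carrier_mat d d" "N \<in> carrier_mat d d" for M N
    using that U aU by (simp add: cj_def mult_minus_distrib_mat[of U d d] minus_mult_distrib_mat[of "U * M" d d "U * N" "adj U" d])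
  have cj_back: "adj U * cj M * U = M" if "M \<in> carrier_mat d d" for M
  proof -
    have "adj U * cj M * U = (adj U * U) * M * (adj U * U)" using that U aU by (simp add: cj_def assoc)
    then show ?thesis using that by (simp add: UU)
  qed
  have adj_cj: "adj (cj M) = cj (adj M)" if "M \<in> carrier_mat d d" for M
    using that U aU by (simp add: cj_def adj_mult assoc)
  have opU: "op_norm U \<le> 1" by (rule op_norm_isometry[OF U UU])
  have opaU: "op_norm (adj U) \<le> 1" using opU op_norm_adj[OF U] by simp
  have op3: "op_norm (X * M * Y) \<le> op_norm M"
    if "X \<in> carrier_mat d d" "M \<in> carrier_mat d d" "Y \<in> carrier_mat d d" "op_norm X \<le> 1" "op_norm Y \<le> 1" for X M Y
  proof -
    have "op_norm (X * M * Y) \<le> op_norm (X * M) * op_norm Y" by (rule op_norm_mult) (use that in auto)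
    also have "\<dots> \<le> op_norm (X * M) * 1" by (intro mult_left_mono that op_norm_nonneg[of _ d]) (use that in auto)
    also have "\<dots> \<le> op_norm X * op_norm M" using op_norm_mult[of X d M] that by simp
    also have "\<dots> \<le> 1 * op_norm M" by (intro mult_right_mono that op_norm_nonneg[of _ d])
    finally show ?thesis by simp
  qed
  have Acj: "A = cj (diagm d l)" by (simp add: AU cj_def)
  have real: "cnj (l i) = l i" if i: "i < d" for i
  proof -
    have "cj (diagm d (\<lambda>i. cnj (l i))) = cj (diagm d l)"
      using h by (simp add: Acj adj_cj adj_diagm)
    then have "diagm d (\<lambda>i. cnj (l i)) = diagm d l" using cj_back by (metis diagm_carrier)
    then have "diagm d (\<lambda>i. cnj (l i)) $$ (i, i) = diagm d l $$ (i, i)" by simp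
    then show ?thesis using i by (simp add: diagm_def)
  qed
  define x where "x i = Re (l i)" for i
  have lx: "l i = of_real (x i)" if "i < d" for i using real[OF that] by (simp add: x_def complex_eq_iff)
  define r where "r i = (if \<bar>x i\<bar> \<le> 1/2 then 0 else sgn (x i))" for i
  have r3: "r i * r i * r i = r i" for i by (auto simp: r_def sgn_if)
  have rd: "\<bar>x i - r i\<bar> \<le> 2 * \<bar>x i * x i * x i - x i\<bar>" for i
  proof -
    have fac: "\<bar>x i * x i * x i - x i\<bar> = \<bar>x i\<bar> * \<bar>x i - 1\<bar> * \<bar>x i + 1\<bar>"
      by (simp add: abs_mult[symmetric] algebra_simps)
    consider "\<bar>x i\<bar> \<le> 1/2" | "x i > 1/2" | "x i < - 1/2" by linarith
    then show ?thesis
    proof cases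
      case 1
      have "1/2 \<le> \<bar>x i - 1\<bar>" "1 \<le> \<bar>x i - 1\<bar> \<or> 1 \<le> \<bar>x i + 1\<bar>" "1/2 \<le> \<bar>x i + 1\<bar>" using 1 by linarith+
      then have "1/2 \<le> \<bar>x i - 1\<bar> * \<bar>x i + 1\<bar>"
        using mult_mono[of "1/2" "\<bar>x i - 1\<bar>" 1 "\<bar>x i + 1\<bar>"] mult_mono[of 1 "\<bar>x i - 1\<bar>" "1/2" "\<bar>x i + 1\<bar>"] by auto
      then have "\<bar>x i\<bar> * (1/2) \<le> \<bar>x i\<bar> * (\<bar>x i - 1\<bar> * \<bar>x i + 1\<bar>)" by (intro mult_left_mono) auto
      then have "\<bar>x i\<bar> \<le> 2 * (\<bar>x i\<bar> * \<bar>x i - 1\<bar> * \<bar>x i + 1\<bar>)" unfolding mult.assoc by linarith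
      then show ?thesis unfolding fac using 1 by (simp only: r_def if_True diff_zero)
    next
      case 2
      have "1/2 \<le> \<bar>x i\<bar> * \<bar>x i + 1\<bar>" using mult_mono[of "1/2" "\<bar>x i\<bar>" 1 "\<bar>x i + 1\<bar>"] 2 by auto
      then have "\<bar>x i - 1\<bar> * (1/2) \<le> \<bar>x i - 1\<bar> * (\<bar>x i\<bar> * \<bar>x i + 1\<bar>)" by (intro mult_left_mono) auto
      moreover have e: "\<bar>x i\<bar> * \<bar>x i - 1\<bar> * \<bar>x i + 1\<bar> = \<bar>x i - 1\<bar> * (\<bar>x i\<bar> * \<bar>x i + 1\<bar>)" by (simp only: mult_ac)
      moreover have "r i = 1" using 2 by (simp add: r_def)
      ultimately show ?thesis unfolding fac e by (simp only:; linarith)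
    next
      case 3
      have "1/2 \<le> \<bar>x i\<bar> * \<bar>x i - 1\<bar>" using mult_mono[of "1/2" "\<bar>x i\<bar>" 1 "\<bar>x i - 1\<bar>"] 3 by auto
      then have "\<bar>x i + 1\<bar> * (1/2) \<le> \<bar>x i + 1\<bar> * (\<bar>x i\<bar> * \<bar>x i - 1\<bar>)" by (intro mult_left_mono) auto
      moreover have e: "\<bar>x i\<bar> * \<bar>x i - 1\<bar> * \<bar>x i + 1\<bar> = \<bar>x i + 1\<bar> * (\<bar>x i\<bar> * \<bar>x i - 1\<bar>)" by (simp only: mult_ac)
      moreover have "r i = - 1" "x i - - 1 = x i + 1" using 3 by (simp_all add: r_def)
      ultimately show ?thesis unfolding fac e by (simp only:; linarith)
    qed
  qed
  define R where "R = diagm d (\<lambda>i. of_real (r i))"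
  have Rc: "R \<in> carrier_mat d d" by (simp add: R_def)
  have R3: "R * R * R = R"
    unfolding R_def diagm_mult by (rule arg_cong[of _ _ "diagm d"]) (use r3 in \<open>simp add: fun_eq_iff flip: of_real_mult\<close>)
  have hR: "adj R = R" by (simp add: R_def adj_diagm)
  show thesis
  proof (rule that[of "cj R"])
    show "cj R \<in> carrier_mat d d" using Rc by (rule cjc)
    show "adj (cj R) = cj R" using Rc by (simp add: adj_cj hR)
    show "cj R * cj R * cj R = cj R" using Rc by (simp add: cj_mult R3)
    have L: "diagm d l \<in> carrier_mat d d" by simp
    define \<delta> where "\<delta> = op_norm (A * A * A - A)"
    have d0: "0 \<le> \<delta>" unfolding \<delta>_def using A by (intro op_norm_nonneg[of _ d]) auto
    have cube: "A * A * A - A = cj (diagm d (\<lambda>i. l i * l i * l i - l i))"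
      by (simp add: Acj cj_mult cj_minus diagm_mult diagm_minus)
    have small: "cmod (l i * l i * l i - l i) \<le> \<delta>" if "i < d" for i
    proof -
      have "cmod (l i * l i * l i - l i) \<le> op_norm (diagm d (\<lambda>i. l i * l i * l i - l i))"
        by (rule diagm_le_op_norm[OF that])
      also have "diagm d (\<lambda>i. l i * l i * l i - l i) = adj U * (A * A * A - A) * U"
        unfolding cube by (simp add: cj_back)
      also have "op_norm \<dots> \<le> op_norm (A * A * A - A)" by (rule op3) (use A U aU opU opaU in auto)
      finally show ?thesis by (simp add: \<delta>_def)
    qed
    have diff: "cj (diagm d l) - cj R = cj (diagm d (\<lambda>i. l i - of_real (r i)))"
      by (simp add: R_def cj_minus diagm_minus)
    have "op_norm (A - cj R) = op_norm (U * diagm d (\<lambda>i. l i - of_real (r i)) * adj U)"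
      unfolding Acj diff by (simp only: cj_def)
    also have "\<dots> \<le> op_norm (diagm d (\<lambda>i. l i - of_real (r i)))" by (rule op3) (use U aU opU opaU in auto)
    also have "\<dots> \<le> 2 * \<delta>"
    proof (rule op_norm_diagm_le)
      fix i assume i: "i < d"
      have "cmod (l i - of_real (r i)) = \<bar>x i - r i\<bar>" by (simp add: lx[OF i] flip: of_real_diff)
      also have "\<dots> \<le> 2 * \<bar>x i * x i * x i - x i\<bar>" by (rule rd)
      also have "\<bar>x i * x i * x i - x i\<bar> = cmod (l i * l i * l i - l i)"
        by (simp add: lx[OF i] flip: of_real_diff of_real_mult)
      finally show "cmod (l i - of_real (r i)) \<le> 2 * \<delta>" using small[OF i] by simp
    qed (use d0 in simp)
    finally show "op_norm (A - cj R) \<le> 2 * op_norm (A * A * A - A)" by (simp add: \<delta>_def)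
  qed
qed

section \<open>Limits along an ultrafilter\<close>

definition ultra :: "'a filter \<Rightarrow> bool" where
  "ultra U \<longleftrightarrow> U \<noteq> bot \<and> (\<forall>P. eventually P U \<or> eventually (\<lambda>x. \<not> P x) U)"

text \<open>A minimal proper filter decides every predicate, since otherwise the predicate would refine it.\<close>

lemma ultrafilter_exists:
  assumes "(F :: 'a filter) \<noteq> bot"
  obtains U where "U \<le> F" "ultra U"
proof -
  define A where "A = {G. G \<noteq> bot \<and> G \<le> F}"
  define r where "r = {(G, G'). G \<in> A \<and> G' \<in> A \<and> G' \<le> G}"
  have field: "Field r = A" by (auto simp: r_def Field_def)
  have po: "Partial_order r"
    unfolding partial_order_on_def preorder_on_def refl_on_def trans_def antisym_def field
    by (auto simp: r_def)
  have "\<exists>m\<in>Field r. \<forall>a\<in>Field r. (m, a) \<in> r \<longrightarrow> a = m"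
  proof (rule Zorns_po_lemma[OF po])
    fix C assume C: "C \<in> Chains r"
    show "\<exists>u\<in>Field r. \<forall>a\<in>C. (a, u) \<in> r"
    proof (cases "C = {}")
      case True
      then show ?thesis using assms field by (auto simp: A_def)
    next
      case False
      have CA: "C \<subseteq> A" using C by (auto simp: Chains_def r_def)
      have dir: "\<exists>x\<in>C. x \<le> inf a b" if "a \<in> C" "b \<in> C" for a b
        using C that by (auto simp: Chains_def r_def intro: bexI[of _ a] bexI[of _ b])
      have "\<not> eventually (\<lambda>_. False) (Inf C)"
        using eventually_Inf_base[OF False dir, of "\<lambda>_. False"] CA
        by (auto simp: A_def trivial_limit_def)
      then have "Inf C \<noteq> bot" by (simp add: trivial_limit_def)
      moreover have "Inf C \<le> F" using False CA by (auto simp: A_def intro: Inf_lower2)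
      ultimately have u: "Inf C \<in> A" by (simp add: A_def)
      then show ?thesis using CA field by (auto simp: r_def intro: Inf_lower)
    qed
  qed
  then obtain m where m: "m \<in> A" "\<And>a. a \<in> A \<Longrightarrow> a \<le> m \<Longrightarrow> a = m" unfolding field by (auto simp: r_def)
  have "ultra m"
    unfolding ultra_def
  proof (intro conjI allI)
    fix P
    show "eventually P m \<or> eventually (\<lambda>x. \<not> P x) m"
    proof (rule disjCI)
      assume n: "\<not> eventually (\<lambda>x. \<not> P x) m"
      let ?G = "inf m (principal {x. P x})"
      have "?G \<noteq> bot" using n by (simp add: trivial_limit_def eventually_inf_principal)
      moreover have "?G \<le> F" using m(1) by (auto simp: A_def intro: le_infI1)
      ultimately have "?G = m" by (intro m(2)) (auto simp: A_def)
      moreover have "eventually P ?G" by (simp add: eventually_inf_principal)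
      ultimately show "eventually P m" by simp
    qed
  qed (use m in \<open>simp add: A_def\<close>)
  then show thesis using that m by (auto simp: A_def)
qed

text \<open>The limit is the supremum of the numbers that \<open>f\<close> exceeds along \<open>U\<close>.\<close>

lemma ultra_bounded_limit:
  assumes U: "ultra U" and b: "\<And>n. \<bar>f n :: real\<bar> \<le> C"
  shows "(f \<longlongrightarrow> Lim U f) U"
proof -
  have ne: "U \<noteq> bot" and alt: "\<And>P. eventually P U \<or> eventually (\<lambda>x. \<not> P x) U" using U by (auto simp: ultra_def)
  define Q where "Q = {r. eventually (\<lambda>x. r \<le> f x) U}"
  have lo: "- C \<in> Q" using b by (auto simp: Q_def abs_le_iff intro!: always_eventually) (use minus_le_iff in blast)
  have bd: "r \<le> C" if "r \<in> Q" for r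
  proof -
    have "eventually (\<lambda>x. r \<le> f x) U" using that by (simp add: Q_def)
    then obtain x where "r \<le> f x" using eventually_happens[of "\<lambda>x. r \<le> f x" U] ne by blast
    then show ?thesis using b[of x] by (simp add: abs_le_iff)
  qed
  have bdd: "bdd_above Q" using bd by (rule bdd_aboveI)
  define l where "l = Sup Q"
  have "(f \<longlongrightarrow> l) U"
  proof (rule tendstoI)
    fix e :: real assume e: "e > 0"
    obtain r where r: "r \<in> Q" "l - e < r"
      using less_cSup_iff[OF _ bdd, of "l - e"] lo e by (auto simp: l_def)
    have 1: "eventually (\<lambda>x. l - e < f x) U"
      using r by (auto simp: Q_def elim!: eventually_mono)
    have 2: "eventually (\<lambda>x. f x < l + e) U"
    proof (rule ccontr)
      assume "\<not> ?thesis"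
      then have "eventually (\<lambda>x. \<not> f x < l + e) U" using alt by blast
      then have "l + e \<in> Q" by (simp add: Q_def not_less)
      then have "l + e \<le> l" unfolding l_def by (rule cSup_upper[OF _ bdd])
      then show False using e by simp
    qed
    show "eventually (\<lambda>x. dist (f x) l < e) U"
      using 1 2 by eventually_elim (auto simp: dist_real_def)
  qed
  then show ?thesis using tendsto_Lim[OF ne] by metis
qed

section \<open>Linear maps that are bounded below are onto\<close>

text \<open>The image of a basis is independent and has as many elements as the basis, so it spans.\<close>

lemma finite_dim_onto:
  fixes T :: "'e::real_vector \<Rightarrow> 'e"
  assumes fin: "finite b" and S: "S = Real_Vector_Spaces.span b"
    and add: "\<And>x y. x \<in> S \<Longrightarrow> y \<in> S \<Longrightarrow> T (x + y) = T x + T y"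
    and scale: "\<And>r x. x \<in> S \<Longrightarrow> T (r *\<^sub>R x) = r *\<^sub>R T x"
    and TS: "\<And>x. x \<in> S \<Longrightarrow> T x \<in> S"
    and inj: "\<And>x. x \<in> S \<Longrightarrow> T x = 0 \<Longrightarrow> x = 0"
    and z: "z \<in> S"
  shows "\<exists>y\<in>S. T y = z"
proof -
  interpret rv: vector_space "scaleR :: real \<Rightarrow> 'e \<Rightarrow> 'e" by (rule real_vector.vector_space_axioms)
  obtain c where c0: "c \<subseteq> b" "\<not> Real_Vector_Spaces.dependent c" "b \<subseteq> Real_Vector_Spaces.span c"
    by (rule real_vector.maximal_independent_subset[of b])
  have "Real_Vector_Spaces.span b \<subseteq> Real_Vector_Spaces.span c"
    using real_vector.span_mono[OF c0(3)] by (simp add: real_vector.span_span)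
  then have "S = Real_Vector_Spaces.span c" using real_vector.span_mono[OF c0(1)] S by blast
  note c = c0(1,2) this
  have finc: "finite c" using c fin finite_subset by blast
  have cS: "c \<subseteq> S" using c(3) real_vector.span_superset by blast
  have subS: "0 \<in> S" "\<And>x y. x \<in> S \<Longrightarrow> y \<in> S \<Longrightarrow> x + y \<in> S" "\<And>r x. x \<in> S \<Longrightarrow> r *\<^sub>R x \<in> S"
    using c(3) real_vector.span_zero real_vector.span_add real_vector.span_scale by auto
  have Tsum: "(\<Sum>v\<in>I. u v *\<^sub>R v) \<in> S \<and> T (\<Sum>v\<in>I. u v *\<^sub>R v) = (\<Sum>v\<in>I. u v *\<^sub>R T v)" if "I \<subseteq> c" for I u
    using finite_subset[OF that finc] that
  proof (induction I rule: finite_induct)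
    case empty
    then show ?case using scale[OF subS(1), of 0] subS(1) by simp
  next
    case (insert v I)
    then have "v \<in> S" "u v *\<^sub>R v \<in> S" using cS subS by auto
    then show ?case using insert subS add scale by simp
  qed
  have injT: "inj_on T S"
  proof (rule inj_onI)
    fix x y assume xy: "x \<in> S" "y \<in> S" "T x = T y"
    have m: "(-1) *\<^sub>R y \<in> S" using subS xy by blast
    have "T (x + (-1) *\<^sub>R y) = T x + (-1) *\<^sub>R T y" using add[OF xy(1) m] scale[OF xy(2), of "-1"] by simp
    then have "T (x + (-1) *\<^sub>R y) = 0" using xy by simp
    then have "x + (-1) *\<^sub>R y = 0" using inj subS xy m by blast
    then show "x = y" by simp
  qed
  have indT: "\<not> Real_Vector_Spaces.dependent (T ` c)"
  proof
    assume "Real_Vector_Spaces.dependent (T ` c)"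
    then have "\<exists>u. (\<exists>v\<in>T ` c. u v \<noteq> 0) \<and> (\<Sum>w\<in>T ` c. u w *\<^sub>R w) = 0"
      by (simp only: real_vector.dependent_finite[OF finite_imageI[OF finc]])
    then obtain u v where uv: "(\<Sum>w\<in>T ` c. u w *\<^sub>R w) = 0" "v \<in> T ` c" "u v \<noteq> 0" by blast
    have injc: "inj_on T c" using injT cS by (rule inj_on_subset)
    have "(\<Sum>w\<in>c. u (T w) *\<^sub>R T w) = 0" using uv(1) by (simp add: sum.reindex[OF injc])
    then have "T (\<Sum>w\<in>c. u (T w) *\<^sub>R w) = 0" using Tsum[of c "\<lambda>w. u (T w)"] by simp
    then have "(\<Sum>w\<in>c. u (T w) *\<^sub>R w) = 0" using inj Tsum[of c "\<lambda>w. u (T w)"] by blast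
    moreover obtain w where "w \<in> c" "u (T w) \<noteq> 0" using uv(2,3) by blast
    ultimately have "Real_Vector_Spaces.dependent c"
      unfolding real_vector.dependent_finite[OF finc] by (intro exI[of _ "\<lambda>w. u (T w)"]) blast
    then show False using c(2) by simp
  qed
  have "z \<in> Real_Vector_Spaces.span (T ` c)"
  proof (rule ccontr)
    assume nz: "z \<notin> Real_Vector_Spaces.span (T ` c)"
    then have ind: "\<not> Real_Vector_Spaces.dependent (insert z (T ` c))"
      using indT by (simp add: real_vector.independent_insert)
    have "insert z (T ` c) \<subseteq> Real_Vector_Spaces.span c" using z TS cS c(3) by auto
    from real_vector.independent_span_bound[OF finc ind this]
    have "card (insert z (T ` c)) \<le> card c" by (rule conjunct2)
    moreover have "z \<notin> T ` c" using nz real_vector.span_base[of z "T ` c"] by auto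
    moreover have "card (T ` c) = card c" using inj_on_subset[OF injT cS] by (rule card_image)
    ultimately show False using finc by simp
  qed
  then obtain u where "z = (\<Sum>w\<in>T ` c. u w *\<^sub>R w)"
    unfolding real_vector.span_finite[OF finite_imageI[OF finc]] by auto
  then have "z = (\<Sum>w\<in>c. u (T w) *\<^sub>R T w)" by (simp add: sum.reindex[OF inj_on_subset[OF injT cS]])
  then show ?thesis using Tsum[of c "\<lambda>w. u (T w)"] by (metis order_refl)
qed

text \<open>The size of the matrices varies along a sequence, so they are recorded as functions that vanish
  outside the square of indices below \<open>d\<close>; these all lie in one real vector space.\<close>

type_synonym cmatf = "nat \<Rightarrow> nat \<Rightarrow> complex"

definition entry_mat :: "nat \<Rightarrow> cmatf \<Rightarrow> complex mat" where
  "entry_mat d x = mat d d (\<lambda>(i, j). x i j)"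

definition entries :: "nat \<Rightarrow> complex mat \<Rightarrow> cmatf" where
  "entries d X = (\<lambda>i j. if i < d \<and> j < d then X $$ (i, j) else 0)"

definition entry_space :: "nat \<Rightarrow> cmatf set" where
  "entry_space d = {x. \<forall>i j. \<not> (i < d \<and> j < d) \<longrightarrow> x i j = 0}"

lemma entry_mat_carrier [simp]: "entry_mat d x \<in> carrier_mat d d" by (simp add: entry_mat_def)
lemma entries_in_space [simp]: "entries d X \<in> entry_space d" by (simp add: entries_def entry_space_def)
lemma entry_mat_entries: "X \<in> carrier_mat d d \<Longrightarrow> entry_mat d (entries d X) = X" by (auto simp: entries_def entry_mat_def)
lemma entry_mat_add: "entry_mat d (x + y) = entry_mat d x + entry_mat d y" by (auto simp: entry_mat_def)
lemma entry_mat_diff: "entry_mat d (x - y) = entry_mat d x - entry_mat d y" by (auto simp: entry_mat_def)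
lemma entry_mat_scale: "entry_mat d (r *\<^sub>R x) = of_real r \<cdot>\<^sub>m entry_mat d x"
  by (auto simp: entry_mat_def scaleR_fun_def scaleR_conv_of_real)
lemma entries_add: "X \<in> carrier_mat d d \<Longrightarrow> Y \<in> carrier_mat d d \<Longrightarrow> entries d (X + Y) = entries d X + entries d Y"
  by (auto simp: entries_def fun_eq_iff)
lemma entries_scale: "X \<in> carrier_mat d d \<Longrightarrow> entries d (of_real r \<cdot>\<^sub>m X) = r *\<^sub>R entries d X"
  by (auto simp: entries_def fun_eq_iff scaleR_fun_def scaleR_conv_of_real)
lemma entry_space_closed: "0 \<in> entry_space d" "x \<in> entry_space d \<Longrightarrow> y \<in> entry_space d \<Longrightarrow> x + y \<in> entry_space d" "x \<in> entry_space d \<Longrightarrow> r *\<^sub>R x \<in> entry_space d"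
  by (auto simp: entry_space_def scaleR_fun_def)

lemma entry_space_span: "\<exists>b. finite b \<and> entry_space d = Real_Vector_Spaces.span b"
proof -
  define E where "E i j c = (\<lambda>k l. if k = i \<and> l = j then c else (0::complex))" for i j :: nat and c
  define b where "b = (\<lambda>(i, j, c). E i j c) ` ({..<d} \<times> {..<d} \<times> {1, \<i>})"
  have fin: "finite b" by (simp add: b_def)
  have bS: "b \<subseteq> entry_space d" by (auto simp: b_def E_def entry_space_def)
  have "Real_Vector_Spaces.span b \<subseteq> entry_space d"
  proof
    fix x assume "x \<in> Real_Vector_Spaces.span b"
    then show "x \<in> entry_space d"
    proof (induction rule: real_vector.span_induct_alt)
      case base
      show ?case by (rule entry_space_closed(1))
    next
      case (step c a y)
      then show ?case using bS by (intro entry_space_closed(2,3)) auto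
    qed
  qed
  moreover have "entry_space d \<subseteq> Real_Vector_Spaces.span b"
  proof
    fix x assume x: "x \<in> entry_space d"
    have "x = (\<Sum>p\<in>{..<d} \<times> {..<d}. Re (x (fst p) (snd p)) *\<^sub>R E (fst p) (snd p) 1
              + Im (x (fst p) (snd p)) *\<^sub>R E (fst p) (snd p) \<i>)" (is "x = ?s")
    proof (rule ext, rule ext)
      fix k l
      have app: "(\<Sum>p\<in>I. f p) k l = (\<Sum>p\<in>I. f p k l)" for I and f :: "nat \<times> nat \<Rightarrow> cmatf"
        by (induction I rule: infinite_finite_induct) auto
      have "?s k l = (\<Sum>p\<in>{..<d} \<times> {..<d}. if p = (k, l) then x k l else 0)"
        unfolding app
        by (intro sum.cong refl) (auto simp: scaleR_fun_def E_def complex_eq_iff)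
      also have "\<dots> = x k l" using x by (auto simp: entry_space_def)
      finally show "x k l = ?s k l" by simp
    qed
    also have "\<dots> \<in> Real_Vector_Spaces.span b"
    proof -
      have "E i j c \<in> b" if "i < d" "j < d" "c \<in> {1, \<i>}" for i j c
        unfolding b_def using that by (intro image_eqI[of _ _ "(i, j, c)"]) auto
      then show ?thesis
        by (intro real_vector.span_sum real_vector.span_add real_vector.span_scale real_vector.span_base) auto
    qed
    finally show "x \<in> Real_Vector_Spaces.span b" .
  qed
  ultimately show ?thesis using fin by blast
qed

lemma hs_entry_mat_zero: "x \<in> entry_space d \<Longrightarrow> hs d (entry_mat d x) = 0 \<Longrightarrow> x = 0"
proof -
  assume x: "x \<in> entry_space d" and h: "hs d (entry_mat d x) = 0"
  have "x i j = 0" for i j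
  proof (cases "i < d \<and> j < d")
    case True
    then show ?thesis using h by (auto simp: hs_def L2_set_eq_0_iff entry_mat_def)
  qed (use x in \<open>auto simp: entry_space_def\<close>)
  then show ?thesis by (simp add: fun_eq_iff)
qed

lemma hs_smult: "X \<in> carrier_mat d d \<Longrightarrow> hs d (c \<cdot>\<^sub>m X) = cmod c * hs d X"
  unfolding hs_def L2_set_right_distrib[OF norm_ge_zero] by (auto intro!: L2_set_cong simp: norm_mult)

section \<open>Ultraproducts of Hilbert--Schmidt spaces\<close>

lemma hs_entry_mat0 [simp]: "hs d (entry_mat d 0) = 0"
  by (auto simp: hs_def L2_set_eq_0_iff entry_mat_def)

text \<open>The Hilbert-Schmidt spaces of the \<open>d n\<close>-square matrices, with squared norms divided by \<open>w n\<close>, along \<open>U\<close>.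
  The weight is not the dimension: it will be the total rank of the matrices under study, which
  may be negligible compared with \<open>d n\<close>.\<close>

locale ultraproduct =
  fixes U :: "nat filter" and d :: "nat \<Rightarrow> nat" and w :: "nat \<Rightarrow> real"
  assumes U_ultra: "ultra U" and U_seq: "U \<le> sequentially" and w_pos: "0 < w n"
begin

lemma U_ne [simp]: "U \<noteq> bot" using U_ultra by (simp add: ultra_def)

lemma seq_U: "(f \<longlongrightarrow> l) sequentially \<Longrightarrow> (f \<longlongrightarrow> l) U"
  using U_seq by (rule tendsto_mono)

abbreviation M :: "(nat \<Rightarrow> cmatf) \<Rightarrow> nat \<Rightarrow> complex mat" where "M x n \<equiv> entry_mat (d n) (x n)"

definition B :: "(nat \<Rightarrow> cmatf) set" where
  "B = {x. (\<forall>n. x n \<in> entry_space (d n)) \<and> (\<exists>C. \<forall>n. (hs (d n) (M x n))^2 \<le> C * w n)}"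

definition q :: "(nat \<Rightarrow> cmatf) \<Rightarrow> (nat \<Rightarrow> cmatf) \<Rightarrow> nat \<Rightarrow> real" where
  "q x y n = Re (hs_ip (d n) (M x n) (M y n)) / w n"

definition ip :: "(nat \<Rightarrow> cmatf) \<Rightarrow> (nat \<Rightarrow> cmatf) \<Rightarrow> real" where
  "ip x y = Lim U (q x y)"

lemma B_entry_space: "x \<in> B \<Longrightarrow> x n \<in> entry_space (d n)" by (simp add: B_def)

lemma B_bound:
  assumes "x \<in> B"
  obtains C where "0 < C" "\<And>n. hs (d n) (M x n) \<le> C * sqrt (w n)"
proof -
  obtain C where C: "\<And>n. (hs (d n) (M x n))^2 \<le> C * w n" using assms by (auto simp: B_def)
  have "hs (d n) (M x n) \<le> sqrt (\<bar>C\<bar> + 1) * sqrt (w n)" for n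
  proof -
    have "(hs (d n) (M x n))^2 \<le> (\<bar>C\<bar> + 1) * w n"
      by (rule order_trans[OF C]) (use w_pos[of n] in \<open>auto intro!: mult_right_mono\<close>)
    then have "hs (d n) (M x n) \<le> sqrt ((\<bar>C\<bar> + 1) * w n)" by (rule real_le_rsqrt)
    then show ?thesis by (simp add: real_sqrt_mult)
  qed
  then show thesis using that[of "sqrt (\<bar>C\<bar> + 1)"] by simp
qed

lemma B_I:
  assumes "\<And>n. x n \<in> entry_space (d n)" "\<And>n. hs (d n) (M x n) \<le> C * sqrt (w n)"
  shows "x \<in> B"
proof -
  have "(hs (d n) (M x n))^2 \<le> C^2 * w n" for n
    using power_mono[OF assms(2)[of n], of 2] w_pos[of n] by (simp add: power_mult_distrib)
  then show ?thesis using assms(1) unfolding B_def by blast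
qed

lemma prod_bound:
  assumes "x \<in> B" "y \<in> B"
  obtains C where "0 < C" "\<And>n. hs (d n) (M x n) * hs (d n) (M y n) / w n \<le> C"
proof -
  obtain C1 where C1: "0 < C1" "\<And>n. hs (d n) (M x n) \<le> C1 * sqrt (w n)" using B_bound[OF assms(1)] by blast
  obtain C2 where C2: "0 < C2" "\<And>n. hs (d n) (M y n) \<le> C2 * sqrt (w n)" using B_bound[OF assms(2)] by blast
  have "hs (d n) (M x n) * hs (d n) (M y n) / w n \<le> C1 * C2" for n
  proof -
    have "hs (d n) (M x n) * hs (d n) (M y n) \<le> (C1 * sqrt (w n)) * (C2 * sqrt (w n))"
      by (intro mult_mono C1 C2) (use C1 w_pos[of n] in auto)
    also have "\<dots> = C1 * C2 * w n" using w_pos[of n] by simp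
    finally show ?thesis using w_pos[of n] by (simp add: pos_divide_le_eq)
  qed
  note bd = this
  show thesis by (rule that[OF _ bd]) (use C1 C2 in simp)
qed

lemma ip_tendsto:
  assumes "x \<in> B" "y \<in> B"
  shows "(q x y \<longlongrightarrow> ip x y) U"
proof -
  obtain C where C: "\<And>n. hs (d n) (M x n) * hs (d n) (M y n) / w n \<le> C" using prod_bound[OF assms] by blast
  have "\<bar>q x y n\<bar> \<le> C" for n
  proof -
    have "\<bar>q x y n\<bar> \<le> hs (d n) (M x n) * hs (d n) (M y n) / w n"
      using order_trans[OF abs_Re_le_cmod hs_ip_bound] w_pos[of n] by (simp add: q_def divide_right_mono)
    then show ?thesis using C[of n] by simp
  qed
  then show ?thesis unfolding ip_def by (rule ultra_bounded_limit[OF U_ultra])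
qed

lemma ip_I: "(q x y \<longlongrightarrow> l) U \<Longrightarrow> ip x y = l"
  unfolding ip_def by (rule tendsto_Lim) simp

lemma B_zero: "0 \<in> B"
  by (rule B_I[of _ 0]) (simp_all add: entry_space_closed(1))

lemma B_plus: assumes "x \<in> B" "y \<in> B" shows "x + y \<in> B"
proof -
  obtain C1 where C1: "0 < C1" "\<And>n. hs (d n) (M x n) \<le> C1 * sqrt (w n)" using B_bound[OF assms(1)] by blast
  obtain C2 where C2: "0 < C2" "\<And>n. hs (d n) (M y n) \<le> C2 * sqrt (w n)" using B_bound[OF assms(2)] by blast
  show ?thesis
  proof (rule B_I[of _ "C1 + C2"])
    show "(x + y) n \<in> entry_space (d n)" for n using assms by (simp add: B_entry_space entry_space_closed)
    show "hs (d n) (M (x + y) n) \<le> (C1 + C2) * sqrt (w n)" for n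
      using hs_triangle[of "M x n" "d n" "M y n"] C1(2)[of n] C2(2)[of n]
      by (simp add: entry_mat_add algebra_simps)
  qed
qed

lemma B_scaled: assumes "x \<in> B" shows "r *\<^sub>R x \<in> B"
proof -
  obtain C1 where C1: "0 < C1" "\<And>n. hs (d n) (M x n) \<le> C1 * sqrt (w n)" using B_bound[OF assms(1)] by blast
  show ?thesis
  proof (rule B_I[of _ "\<bar>r\<bar> * C1"])
    show "(r *\<^sub>R x) n \<in> entry_space (d n)" for n using assms entry_space_closed(3)[of "x n" "d n" r] by (simp add: B_entry_space scaleR_fun_def)
    show "hs (d n) (M (r *\<^sub>R x) n) \<le> \<bar>r\<bar> * C1 * sqrt (w n)" for n
      using mult_left_mono[OF C1(2)[of n], of "\<bar>r\<bar>"] entry_mat_scale[of "d n" r "x n"]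
      by (simp add: scaleR_fun_def hs_smult mult.assoc)
  qed
qed

sublocale semi_inner B ip
proof
  show "ip (x + y) z = ip x z + ip y z" if "x \<in> B" "y \<in> B" "z \<in> B" for x y z
  proof (rule ip_I)
    have "q (x + y) z = (\<lambda>n. q x z n + q y z n)"
      by (simp add: q_def fun_eq_iff entry_mat_add hs_ip_add add_divide_distrib)
    then show "(q (x + y) z \<longlongrightarrow> ip x z + ip y z) U"
      using tendsto_add[OF ip_tendsto[OF that(1,3)] ip_tendsto[OF that(2,3)]] by simp
  qed
  show "ip (r *\<^sub>R x) z = r * ip x z" if "x \<in> B" "z \<in> B" for x z r
  proof (rule ip_I)
    have sm: "hs_ip d' (of_real r \<cdot>\<^sub>m X) Y = of_real r * hs_ip d' X Y" if "X \<in> carrier_mat d' d'" for d' X Y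
      using that by (simp add: hs_ip_def sum_distrib_left mult.assoc)
    have "q (r *\<^sub>R x) z = (\<lambda>n. r * q x z n)"
      using entry_mat_scale[of "d _" r "x _"] by (simp add: q_def fun_eq_iff scaleR_fun_def sm)
    then show "(q (r *\<^sub>R x) z \<longlongrightarrow> r * ip x z) U"
      using tendsto_mult_left[OF ip_tendsto[OF that]] by simp
  qed
  show "ip x y = ip y x" if "x \<in> B" "y \<in> B" for x y
  proof (rule ip_I)
    have "q x y = q y x" by (simp add: q_def fun_eq_iff hs_ip_cnj[of "d _" "M y _" "M x _"])
    then show "(q x y \<longlongrightarrow> ip y x) U" using ip_tendsto[OF that(2,1)] by simp
  qed
  show "0 \<le> ip x x" if "x \<in> B" for x
    by (rule tendsto_lowerbound[OF ip_tendsto[OF that that]])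
      (use w_pos in \<open>auto simp: q_def hs_ip_self less_imp_le intro!: always_eventually divide_nonneg_nonneg\<close>)
qed (auto intro: B_zero B_plus B_scaled)

lemma N_tendsto: assumes "x \<in> B" shows "((\<lambda>n. (hs (d n) (M x n))^2 / w n) \<longlongrightarrow> (N x)^2) U"
proof -
  have "q x x = (\<lambda>n. (hs (d n) (M x n))^2 / w n)" by (simp add: q_def fun_eq_iff hs_ip_self)
  then show ?thesis using ip_tendsto[OF assms assms] by (simp add: N_sq[OF assms])
qed

lemma N_null:
  assumes x: "x \<in> B" and e: "(\<epsilon> \<longlongrightarrow> 0) U" and le: "\<And>n. hs (d n) (M x n) \<le> \<epsilon> n * sqrt (w n)"
  shows "N x = 0"
proof -
  have "((\<lambda>n. (hs (d n) (M x n))^2 / w n) \<longlongrightarrow> 0) U"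
  proof (rule tendsto_sandwich[OF _ _ tendsto_const])
    show "\<forall>\<^sub>F n in U. 0 \<le> (hs (d n) (M x n))^2 / w n"
      using w_pos by (auto intro!: always_eventually divide_nonneg_pos)
    have "(hs (d n) (M x n))^2 / w n \<le> (\<epsilon> n)^2" for n
      using power_mono[OF le[of n], of 2] w_pos[of n] by (simp add: power_mult_distrib pos_divide_le_eq)
    then show "\<forall>\<^sub>F n in U. (hs (d n) (M x n))^2 / w n \<le> (\<epsilon> n)^2" by simp
    show "((\<lambda>n. (\<epsilon> n)^2) \<longlongrightarrow> 0) U" using tendsto_power[OF e, of 2] by simp
  qed
  then have "(N x)^2 = 0" using tendsto_unique[OF U_ne N_tendsto[OF x]] by blast
  then show ?thesis by simp
qed

definition lin :: "nat \<Rightarrow> (cmatf \<Rightarrow> cmatf) \<Rightarrow> bool" where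
  "lin n T \<longleftrightarrow> (\<forall>x\<in>entry_space (d n). T x \<in> entry_space (d n)) \<and> (\<forall>x\<in>entry_space (d n). \<forall>y\<in>entry_space (d n). T (x + y) = T x + T y)
     \<and> (\<forall>r. \<forall>x\<in>entry_space (d n). T (r *\<^sub>R x) = r *\<^sub>R T x)"

text \<open>Uniformly bounded operators acting in each coordinate separately; an ultraproduct of
  finite-dimensional spaces has the surjectivity property of such spaces for them only.\<close>

definition Ops :: "((nat \<Rightarrow> cmatf) \<Rightarrow> nat \<Rightarrow> cmatf) set" where
  "Ops = {V. \<exists>T C. (\<forall>n. lin n (T n)) \<and> 0 \<le> C
     \<and> (\<forall>n. \<forall>x\<in>entry_space (d n). hs (d n) (entry_mat (d n) (T n x)) \<le> C * hs (d n) (entry_mat (d n) x))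
     \<and> V = (\<lambda>x n. T n (x n))}"

lemma Ops_E:
  assumes "V \<in> Ops"
  obtains T C where "\<And>n. lin n (T n)" "0 \<le> C"
    "\<And>n x. x \<in> entry_space (d n) \<Longrightarrow> hs (d n) (entry_mat (d n) (T n x)) \<le> C * hs (d n) (entry_mat (d n) x)"
    "V = (\<lambda>x n. T n (x n))"
  using assms unfolding Ops_def by blast

lemma Ops_I:
  assumes "\<And>n. lin n (T n)" "0 \<le> C"
    "\<And>n x. x \<in> entry_space (d n) \<Longrightarrow> hs (d n) (entry_mat (d n) (T n x)) \<le> C * hs (d n) (entry_mat (d n) x)"
  shows "(\<lambda>x n. T n (x n)) \<in> Ops"
  using assms unfolding Ops_def by blast

lemma Ops_closed: assumes "V \<in> Ops" "x \<in> B" shows "V x \<in> B"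
proof -
  obtain T C where T: "\<And>n. lin n (T n)" "0 \<le> C"
    "\<And>n x. x \<in> entry_space (d n) \<Longrightarrow> hs (d n) (entry_mat (d n) (T n x)) \<le> C * hs (d n) (entry_mat (d n) x)"
    "V = (\<lambda>x n. T n (x n))" using Ops_E[OF assms(1)] by blast
  obtain C1 where C1: "\<And>n. hs (d n) (M x n) \<le> C1 * sqrt (w n)" using B_bound[OF assms(2)] by blast
  show ?thesis
  proof (rule B_I[of _ "C * C1"])
    show "V x n \<in> entry_space (d n)" for n using T(1)[of n] B_entry_space[OF assms(2)] by (simp add: T(4) lin_def)
    show "hs (d n) (M (V x) n) \<le> C * C1 * sqrt (w n)" for n
      using T(3)[OF B_entry_space[OF assms(2)], of n] mult_left_mono[OF C1[of n] T(2)] by (simp add: T(4) mult.assoc)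
  qed
qed

lemma id_in_Ops: "(\<lambda>x. x) \<in> Ops"
  using Ops_I[of "\<lambda>n x. x" 1] by (simp add: lin_def)

lemma comp_in_Ops: assumes "V \<in> Ops" "W \<in> Ops" shows "(\<lambda>x. V (W x)) \<in> Ops"
proof -
  obtain T C where T: "\<And>n. lin n (T n)" "0 \<le> C"
    "\<And>n x. x \<in> entry_space (d n) \<Longrightarrow> hs (d n) (entry_mat (d n) (T n x)) \<le> C * hs (d n) (entry_mat (d n) x)"
    "V = (\<lambda>x n. T n (x n))" using Ops_E[OF assms(1)] by blast
  obtain T' C' where T': "\<And>n. lin n (T' n)" "0 \<le> C'"
    "\<And>n x. x \<in> entry_space (d n) \<Longrightarrow> hs (d n) (entry_mat (d n) (T' n x)) \<le> C' * hs (d n) (entry_mat (d n) x)"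
    "W = (\<lambda>x n. T' n (x n))" using Ops_E[OF assms(2)] by blast
  have "(\<lambda>x n. T n (T' n (x n))) \<in> Ops"
  proof (rule Ops_I[of "\<lambda>n x. T n (T' n x)" "C * C'"])
    show "lin n (\<lambda>x. T n (T' n x))" for n using T(1)[of n] T'(1)[of n] by (simp add: lin_def)
    show "hs (d n) (entry_mat (d n) (T n (T' n x))) \<le> C * C' * hs (d n) (entry_mat (d n) x)" if "x \<in> entry_space (d n)" for n x
      using T(3)[of "T' n x" n] mult_left_mono[OF T'(3)[OF that] T(2)] T'(1)[of n] that
      by (simp add: lin_def mult.assoc)
  qed (use T T' in simp)
  then show ?thesis by (simp add: T(4) T'(4))
qed

lemma plus_in_Ops: assumes "V \<in> Ops" "W \<in> Ops" shows "(\<lambda>x. V x + W x) \<in> Ops"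
proof -
  obtain T C where T: "\<And>n. lin n (T n)" "0 \<le> C"
    "\<And>n x. x \<in> entry_space (d n) \<Longrightarrow> hs (d n) (entry_mat (d n) (T n x)) \<le> C * hs (d n) (entry_mat (d n) x)"
    "V = (\<lambda>x n. T n (x n))" using Ops_E[OF assms(1)] by blast
  obtain T' C' where T': "\<And>n. lin n (T' n)" "0 \<le> C'"
    "\<And>n x. x \<in> entry_space (d n) \<Longrightarrow> hs (d n) (entry_mat (d n) (T' n x)) \<le> C' * hs (d n) (entry_mat (d n) x)"
    "W = (\<lambda>x n. T' n (x n))" using Ops_E[OF assms(2)] by blast
  have "(\<lambda>x n. T n (x n) + T' n (x n)) \<in> Ops"
  proof (rule Ops_I[of "\<lambda>n x. T n x + T' n x" "C + C'"])
    show "lin n (\<lambda>x. T n x + T' n x)" for n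
      using T(1)[of n] T'(1)[of n] unfolding lin_def by (auto simp: entry_space_closed(2) scaleR_add_right)
    show "hs (d n) (entry_mat (d n) (T n x + T' n x)) \<le> (C + C') * hs (d n) (entry_mat (d n) x)" if "x \<in> entry_space (d n)" for n x
      using hs_triangle[of "entry_mat (d n) (T n x)" "d n" "entry_mat (d n) (T' n x)"] T(3)[OF that] T'(3)[OF that]
      by (simp add: entry_mat_add distrib_right)
  qed (use T T' in simp)
  moreover have "(\<lambda>x. V x + W x) = (\<lambda>x n. T n (x n) + T' n (x n))"
    by (simp add: T(4) T'(4) plus_fun_def)
  ultimately show ?thesis by simp
qed

lemma scale_in_Ops: assumes "V \<in> Ops" shows "(\<lambda>x. r *\<^sub>R V x) \<in> Ops"
proof -
  obtain T C where T: "\<And>n. lin n (T n)" "0 \<le> C"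
    "\<And>n x. x \<in> entry_space (d n) \<Longrightarrow> hs (d n) (entry_mat (d n) (T n x)) \<le> C * hs (d n) (entry_mat (d n) x)"
    "V = (\<lambda>x n. T n (x n))" using Ops_E[OF assms(1)] by blast
  have "(\<lambda>x n. r *\<^sub>R T n (x n)) \<in> Ops"
  proof (rule Ops_I[of "\<lambda>n x. r *\<^sub>R T n x" "\<bar>r\<bar> * C"])
    show "lin n (\<lambda>x. r *\<^sub>R T n x)" for n
      using T(1)[of n] unfolding lin_def by (auto simp: entry_space_closed(3) scaleR_add_right mult.commute)
    show "hs (d n) (entry_mat (d n) (r *\<^sub>R T n x)) \<le> \<bar>r\<bar> * C * hs (d n) (entry_mat (d n) x)" if "x \<in> entry_space (d n)" for n x
      using mult_left_mono[OF T(3)[OF that], of "\<bar>r\<bar>"] by (simp add: entry_mat_scale hs_smult mult.assoc)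
  qed (use T in simp)
  moreover have "(\<lambda>x. r *\<^sub>R V x) = (\<lambda>x n. r *\<^sub>R T n (x n))"
    by (simp add: T(4) fun_eq_iff scaleR_fun_def)
  ultimately show ?thesis by simp
qed

text \<open>If the coordinate operators failed to be bounded below by \<open>c / 2\<close> along \<open>U\<close>, normalised witnesses of
  this would form a vector violating the bound for \<open>V\<close>.  So along \<open>U\<close> they are injective, hence onto by
  \<open>finite_dim_onto\<close>, and the coordinatewise solutions are bounded by \<open>2 / c\<close> times \<open>z\<close>.\<close>

lemma bounded_below_onto:
  assumes V: "V \<in> Ops" and c: "0 < c" and low: "\<And>y. y \<in> B \<Longrightarrow> c * N y \<le> N (V y)" and z: "z \<in> B"
  shows "\<exists>y\<in>B. N (V y - z) = 0"
proof -
  obtain T C where T: "\<And>n. lin n (T n)" "0 \<le> C"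
    "\<And>n x. x \<in> entry_space (d n) \<Longrightarrow> hs (d n) (entry_mat (d n) (T n x)) \<le> C * hs (d n) (entry_mat (d n) x)"
    "V = (\<lambda>x n. T n (x n))" using Ops_E[OF V] by blast
  define bad where "bad n \<longleftrightarrow> (\<exists>y\<in>entry_space (d n). hs (d n) (entry_mat (d n) (T n y)) < c / 2 * hs (d n) (entry_mat (d n) y))" for n
  have "\<not> eventually bad U"
  proof
    assume ev: "eventually bad U"
    have "\<exists>y. y \<in> entry_space (d n) \<and> hs (d n) (entry_mat (d n) y) \<le> sqrt (w n) \<and>
        (bad n \<longrightarrow> hs (d n) (entry_mat (d n) y) = sqrt (w n) \<and> hs (d n) (entry_mat (d n) (T n y)) \<le> c / 2 * sqrt (w n))" for n
    proof (cases "bad n")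
      case True
      then obtain y where y: "y \<in> entry_space (d n)" "hs (d n) (entry_mat (d n) (T n y)) < c / 2 * hs (d n) (entry_mat (d n) y)"
        by (auto simp: bad_def)
      have "hs (d n) (entry_mat (d n) y) \<noteq> 0"
      proof
        assume "hs (d n) (entry_mat (d n) y) = 0"
        then have "hs (d n) (entry_mat (d n) (T n y)) < 0" using y(2) by simp
        then show False using hs_nonneg[of "d n" "entry_mat (d n) (T n y)"] by linarith
      qed
      then have p: "0 < hs (d n) (entry_mat (d n) y)" using hs_nonneg[of "d n" "entry_mat (d n) y"] by linarith
      define r where "r = sqrt (w n) / hs (d n) (entry_mat (d n) y)"
      have r: "0 < r" using p w_pos[of n] by (simp add: r_def)
      have "T n (r *\<^sub>R y) = r *\<^sub>R T n y" using T(1)[of n] y by (simp add: lin_def)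
      then have "hs (d n) (entry_mat (d n) (T n (r *\<^sub>R y))) = r * hs (d n) (entry_mat (d n) (T n y))"
        using r by (simp add: entry_mat_scale hs_smult)
      also have "\<dots> \<le> r * (c / 2 * hs (d n) (entry_mat (d n) y))" using y(2) r by (intro mult_left_mono) auto
      also have "\<dots> = c / 2 * sqrt (w n)" using p by (simp add: r_def)
      finally have "hs (d n) (entry_mat (d n) (T n (r *\<^sub>R y))) \<le> c / 2 * sqrt (w n)" .
      moreover have "hs (d n) (entry_mat (d n) (r *\<^sub>R y)) = sqrt (w n)"
        using r p by (simp add: entry_mat_scale hs_smult) (simp add: r_def)
      ultimately show ?thesis using y entry_space_closed(3) by (intro exI[of _ "r *\<^sub>R y"]) auto
    next
      case False
        then show ?thesis using False entry_space_closed(1) w_pos[of n] by (intro exI[of _ 0]) (auto simp: less_imp_le)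
    qed
    then obtain y where y: "\<And>n. y n \<in> entry_space (d n)" "\<And>n. hs (d n) (entry_mat (d n) (y n)) \<le> sqrt (w n)"
      "\<And>n. bad n \<Longrightarrow> hs (d n) (entry_mat (d n) (y n)) = sqrt (w n)"
      "\<And>n. bad n \<Longrightarrow> hs (d n) (entry_mat (d n) (T n (y n))) \<le> c / 2 * sqrt (w n)" by metis
    have yB: "y \<in> B" by (rule B_I[of _ 1]) (use y in auto)
    have VyB: "V y \<in> B" by (rule Ops_closed[OF V yB])
    have "(N y)^2 = 1"
    proof (rule tendsto_unique[OF U_ne N_tendsto[OF yB]])
      show "((\<lambda>n. (hs (d n) (M y n))^2 / w n) \<longlongrightarrow> 1) U"
        by (rule tendsto_eventually) (use ev y(3) w_pos in \<open>auto elim!: eventually_mono simp: less_imp_le dual_order.strict_implies_not_eq\<close>)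
    qed
    then have N1: "N y = 1" using N_nonneg[OF yB] by (simp add: power2_eq_1_iff)
    have "(N (V y))^2 \<le> (c / 2)^2"
    proof (rule tendsto_upperbound[OF N_tendsto[OF VyB]])
      show "\<forall>\<^sub>F n in U. (hs (d n) (M (V y) n))^2 / w n \<le> (c / 2)^2"
        using ev
      proof eventually_elim
        case (elim n)
        have "(hs (d n) (M (V y) n))^2 \<le> (c / 2 * sqrt (w n))^2"
          using y(4)[OF elim] by (intro power_mono) (auto simp: T(4))
        also have "(c / 2 * sqrt (w n))^2 = (c / 2)^2 * w n"
          unfolding power_mult_distrib using w_pos[of n] by simp
        finally show ?case using w_pos[of n] by (simp only: pos_divide_le_eq)
      qed
    qed simp
    then have "N (V y) \<le> c / 2" by (rule power2_le_imp_le) (use c in simp)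
    then show False using low[OF yB] N1 c by simp
  qed
  then have good: "eventually (\<lambda>n. \<not> bad n) U" using U_ultra by (auto simp: ultra_def)
  have "\<exists>y. y \<in> entry_space (d n) \<and> hs (d n) (entry_mat (d n) y) \<le> 2 / c * hs (d n) (M z n) \<and> (\<not> bad n \<longrightarrow> T n y = z n)" for n
  proof (cases "bad n")
    case True
    then show ?thesis using True c entry_space_closed(1) by (intro exI[of _ 0]) auto
  next
    case False
    then have nb: "c / 2 * hs (d n) (entry_mat (d n) y) \<le> hs (d n) (entry_mat (d n) (T n y))" if "y \<in> entry_space (d n)" for y
      using that by (auto simp: bad_def not_less)
    obtain b where b: "finite b" "entry_space (d n) = Real_Vector_Spaces.span b" using entry_space_span by blast
    have "\<exists>y\<in>entry_space (d n). T n y = z n"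
    proof (rule finite_dim_onto[OF b])
      show "x = 0" if "x \<in> entry_space (d n)" "T n x = 0" for x
      proof (rule hs_entry_mat_zero[OF that(1)])
        have "hs (d n) (entry_mat (d n) (T n x)) = 0" unfolding that(2) by simp
        then have "c / 2 * hs (d n) (entry_mat (d n) x) \<le> 0" using nb[OF that(1)] by simp
        then show "hs (d n) (entry_mat (d n) x) = 0"
          using c hs_nonneg[of "d n" "entry_mat (d n) x"] by (simp add: mult_le_0_iff)
      qed
    qed (use T(1)[of n] B_entry_space[OF z] in \<open>auto simp: lin_def\<close>)
    then obtain y where y: "y \<in> entry_space (d n)" "T n y = z n" by blast
    then show ?thesis using nb[OF y(1)] c by (intro exI[of _ y]) (auto simp: field_simps)
  qed
  then obtain y where y: "\<And>n. y n \<in> entry_space (d n)" "\<And>n. hs (d n) (entry_mat (d n) (y n)) \<le> 2 / c * hs (d n) (M z n)"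
    "\<And>n. \<not> bad n \<Longrightarrow> T n (y n) = z n" by metis
  obtain C1 where C1: "\<And>n. hs (d n) (M z n) \<le> C1 * sqrt (w n)" using B_bound[OF z] by blast
  have yB: "y \<in> B"
  proof (rule B_I[of _ "2 / c * C1"])
    show "hs (d n) (M y n) \<le> 2 / c * C1 * sqrt (w n)" for n
      using order_trans[OF y(2)[of n] mult_left_mono[OF C1[of n], of "2 / c"]] c by (simp add: mult.assoc)
  qed (rule y(1))
  have D: "V y - z \<in> B" using Ops_closed[OF V yB] z by simp
  have "(N (V y - z))^2 = 0"
  proof (rule tendsto_unique[OF U_ne N_tendsto[OF D]])
    show "((\<lambda>n. (hs (d n) (M (V y - z) n))^2 / w n) \<longlongrightarrow> 0) U"
    proof (rule tendsto_eventually)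
      show "\<forall>\<^sub>F n in U. (hs (d n) (M (V y - z) n))^2 / w n = 0"
        using good by eventually_elim (simp add: T(4) y(3))
    qed
  qed
  then show ?thesis using yB by auto
qed

end

section \<open>Almost representations act on the ultraproduct\<close>

locale matrix_model = ultraproduct U d w + group G
  for U d w and G :: "'g monoid" (structure) +
  fixes u :: "'g \<Rightarrow> nat \<Rightarrow> complex mat"
  assumes u_carrier: "g \<in> carrier G \<Longrightarrow> u g n \<in> carrier_mat (d n) (d n)"
    and u_bdd: "g \<in> carrier G \<Longrightarrow> \<exists>C. \<forall>n. op_norm (u g n) \<le> C"
    and u_iso: "g \<in> carrier G \<Longrightarrow> (\<lambda>n. op_norm (adj (u g n) * u g n - 1\<^sub>m (d n))) \<longlonglongrightarrow> 0"
    and u_mult: "\<lbrakk>g \<in> carrier G; h \<in> carrier G\<rbrakk> \<Longrightarrow> (\<lambda>n. op_norm (u g n * u h n - u (g \<otimes> h) n)) \<longlonglongrightarrow> 0"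
begin

definition act :: "'g \<Rightarrow> (nat \<Rightarrow> cmatf) \<Rightarrow> nat \<Rightarrow> cmatf" where
  "act g x = (\<lambda>n. entries (d n) (u g n * M x n * adj (u g n)))"

lemma u_bound:
  assumes "g \<in> carrier G"
  obtains C where "0 < C" "\<And>n. op_norm (u g n) \<le> C"
  using u_bdd[OF assms] by (metis abs_ge_self abs_ge_zero add_pos_nonneg add_increasing less_add_one order_trans zero_less_one order_le_less_trans less_imp_le)

lemma hs_conj:
  assumes "A \<in> carrier_mat m m" "X \<in> carrier_mat m m" "A' \<in> carrier_mat m m"
  shows "hs m (A * X * adj A') \<le> op_norm A * op_norm A' * hs m X"
proof -
  have "hs m (A * X * adj A') \<le> op_norm A' * hs m (A * X)"
    using hs_right[of "adj A'" m "A * X"] assms op_norm_adj[of A' m] by simp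
  also have "\<dots> \<le> op_norm A' * (op_norm A * hs m X)"
    using assms by (intro mult_left_mono hs_left op_norm_nonneg) auto
  finally show ?thesis by (simp add: mult.commute mult.left_commute)
qed

lemma act_in_Ops: assumes g: "g \<in> carrier G" shows "act g \<in> Ops"
proof -
  obtain C where C: "0 < C" "\<And>n. op_norm (u g n) \<le> C" using u_bound[OF g] by blast
  have uc: "u g n \<in> carrier_mat (d n) (d n)" for n by (rule u_carrier[OF g])
  have "(\<lambda>x n. (\<lambda>n x. entries (d n) (u g n * entry_mat (d n) x * adj (u g n))) n (x n)) \<in> Ops"
  proof (rule Ops_I[of _ "C * C"])
    fix n
    have dist: "u g n * (X + Y) * adj (u g n) = u g n * X * adj (u g n) + u g n * Y * adj (u g n)"
      if "X \<in> carrier_mat (d n) (d n)" "Y \<in> carrier_mat (d n) (d n)" for X Y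
    proof -
      have "u g n * (X + Y) = u g n * X + u g n * Y"
        by (rule mult_add_distrib_mat[OF uc[of n] that])
      then show ?thesis
        using add_mult_distrib_mat[of "u g n * X" "d n" "d n" "u g n * Y" "adj (u g n)" "d n"] that uc[of n]
        by (simp del: assoc_mult_mat)
    qed
    have scal: "u g n * (c \<cdot>\<^sub>m X) * adj (u g n) = c \<cdot>\<^sub>m (u g n * X * adj (u g n))"
      if "X \<in> carrier_mat (d n) (d n)" for X c
    proof -
      have "u g n * (c \<cdot>\<^sub>m X) = c \<cdot>\<^sub>m (u g n * X)"
        by (rule mult_smult_distrib[OF uc[of n] that])
      then show ?thesis
        using mult_smult_assoc_mat[of "u g n * X" "d n" "d n" "adj (u g n)" "d n" c] that uc[of n]
        by (simp del: assoc_mult_mat)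
    qed
    show "lin n (\<lambda>x. entries (d n) (u g n * entry_mat (d n) x * adj (u g n)))"
      unfolding lin_def using uc[of n]
      by (auto simp: entry_mat_add entry_mat_scale dist scal entries_add entries_scale)
  next
    fix n x
    have "hs (d n) (u g n * entry_mat (d n) x * adj (u g n)) \<le> op_norm (u g n) * op_norm (u g n) * hs (d n) (entry_mat (d n) x)"
      using uc[of n] by (intro hs_conj) auto
    also have "\<dots> \<le> C * C * hs (d n) (entry_mat (d n) x)"
      using C uc[of n] by (intro mult_right_mono mult_mono) auto
    finally show "hs (d n) (entry_mat (d n) (entries (d n) (u g n * entry_mat (d n) x * adj (u g n)))) \<le> C * C * hs (d n) (entry_mat (d n) x)"
      using uc[of n] by (simp add: entry_mat_entries)
  qed (use C in simp)
  then show ?thesis by (simp add: act_def [abs_def])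
qed

lemma M_act: "g \<in> carrier G \<Longrightarrow> M (act g x) n = u g n * M x n * adj (u g n)"
  using u_carrier[of g n] by (simp add: act_def entry_mat_entries)

text \<open>Moving the conjugating matrices across the inner product replaces \<open>Y\<close> by \<open>P Y P\<close> with
  \<open>P = u\<^sup>* u\<close>, which tends to the identity.\<close>

lemma act_isometry:
  assumes g: "g \<in> carrier G" and x: "x \<in> B" and y: "y \<in> B"
  shows "ip (act g x) (act g y) = ip x y"
proof (rule ip_I)
  obtain C where C: "0 < C" "\<And>n. op_norm (u g n) \<le> C" using u_bound[OF g] by blast
  obtain K where K: "0 < K" "\<And>n. hs (d n) (M x n) * hs (d n) (M y n) / w n \<le> K" using prod_bound[OF x y] by blast
  define \<epsilon> where "\<epsilon> n = op_norm (adj (u g n) * u g n - 1\<^sub>m (d n))" for n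
  have e: "(\<epsilon> \<longlongrightarrow> 0) U" using u_iso[OF g] unfolding \<epsilon>_def by (rule seq_U)
  have diff: "\<bar>q (act g x) (act g y) n - q x y n\<bar> \<le> \<epsilon> n * ((C * C + 1) * K)" for n
  proof -
    define m where "m = d n"
    define a where "a = u g n"
    define X where "X = M x n"
    define Y where "Y = M y n"
    have c: "a \<in> carrier_mat m m" "X \<in> carrier_mat m m" "Y \<in> carrier_mat m m"
      using u_carrier[OF g] by (auto simp: m_def a_def X_def Y_def)
    have ac: "adj a \<in> carrier_mat m m" using c by simp
    define P where "P = adj a * a"
    have P: "P \<in> carrier_mat m m" using c ac by (simp add: P_def)
    note assoc = assoc_mult_mat[of _ m m _ m _ m]
    have "hs_ip m (a * X * adj a) (a * Y * adj a) = hs_ip m (a * X) (a * Y * adj a * a)"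
      by (rule hs_ip_right[of "adj a" m "a * X" "a * Y * adj a", unfolded adj_adj]) (use c ac in auto)
    also have "\<dots> = hs_ip m X (adj a * (a * Y * adj a * a))" using c ac by (intro hs_ip_left) auto
    also have "adj a * (a * Y * adj a * a) = P * Y * P" using c ac by (simp add: P_def assoc)
    finally have "hs_ip m (a * X * adj a) (a * Y * adj a) - hs_ip m X Y = hs_ip m X (P * Y * P - Y)"
      using c P by (simp add: hs_ip_minus_right)
    moreover have "P * Y * P - Y = (P - 1\<^sub>m m) * (Y * P) + Y * (P - 1\<^sub>m m)"
    proof -
      have "(P - 1\<^sub>m m) * (Y * P) = P * (Y * P) - Y * P"
        using c P minus_mult_distrib_mat[of P m m "1\<^sub>m m" "Y * P" m] by simp
      moreover have "Y * (P - 1\<^sub>m m) = Y * P - Y"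
        using c P mult_minus_distrib_mat[of Y m m P m "1\<^sub>m m"] by simp
      moreover have "P * (Y * P) - Y * P + (Y * P - Y) = P * (Y * P) - Y"
        by (rule eq_matI) (use c P in auto)
      ultimately show ?thesis using c P by (simp add: assoc)
    qed
    moreover have hsb: "hs m ((P - 1\<^sub>m m) * (Y * P) + Y * (P - 1\<^sub>m m)) \<le> \<epsilon> n * (C * C + 1) * hs m Y"
    proof -
      have en: "op_norm (P - 1\<^sub>m m) = \<epsilon> n" by (simp add: \<epsilon>_def P_def a_def m_def)
      have e0: "0 \<le> \<epsilon> n" unfolding en[symmetric] using P by (intro op_norm_nonneg[of _ m]) auto
      have a0: "0 \<le> op_norm a" "op_norm a \<le> C" using c op_norm_nonneg C(2)[of n] by (auto simp: a_def)
      have "op_norm P \<le> op_norm (adj a) * op_norm a" unfolding P_def using c ac by (intro op_norm_mult) auto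
      also have "\<dots> \<le> C * C" using a0 op_norm_adj[OF c(1)] C(1) by (simp add: mult_mono)
      finally have P_le: "op_norm P \<le> C * C" .
      have "hs m ((P - 1\<^sub>m m) * (Y * P) + Y * (P - 1\<^sub>m m)) \<le> hs m ((P - 1\<^sub>m m) * (Y * P)) + hs m (Y * (P - 1\<^sub>m m))"
        by (rule hs_triangle) (use c P in auto)
      also have "\<dots> \<le> \<epsilon> n * hs m (Y * P) + \<epsilon> n * hs m Y"
        using hs_left[of "P - 1\<^sub>m m" m "Y * P"] hs_right[of "P - 1\<^sub>m m" m Y] c P by (simp add: en)
      also have "\<dots> \<le> \<epsilon> n * (C * C * hs m Y) + \<epsilon> n * hs m Y"
        using order_trans[OF hs_right[OF P c(3)] mult_right_mono[OF P_le hs_nonneg]] e0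
        by (intro add_mono mult_left_mono) auto
      finally show ?thesis by (simp add: algebra_simps)
    qed
    ultimately have "cmod (hs_ip m (a * X * adj a) (a * Y * adj a) - hs_ip m X Y) \<le> hs m X * (\<epsilon> n * (C * C + 1) * hs m Y)"
      using order_trans[OF hs_ip_bound mult_left_mono[OF hsb hs_nonneg]] by simp
    then have "\<bar>Re (hs_ip m (a * X * adj a) (a * Y * adj a)) - Re (hs_ip m X Y)\<bar> \<le> hs m X * (\<epsilon> n * (C * C + 1) * hs m Y)"
      using order_trans[OF abs_Re_le_cmod] by (metis minus_complex.simps(1))
    then have "\<bar>q (act g x) (act g y) n - q x y n\<bar> \<le> hs m X * (\<epsilon> n * (C * C + 1) * hs m Y) / w n"
      using w_pos[of n] M_act[OF g]
      by (simp add: q_def m_def X_def Y_def a_def diff_divide_distrib[symmetric] divide_right_mono)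
    also have "\<dots> = \<epsilon> n * (C * C + 1) * (hs m X * hs m Y / w n)" by simp
    also have "\<dots> \<le> \<epsilon> n * (C * C + 1) * K"
    proof (rule mult_left_mono)
      show "hs m X * hs m Y / w n \<le> K" using K(2)[of n] by (simp add: m_def X_def Y_def)
      have "0 \<le> \<epsilon> n" unfolding \<epsilon>_def using u_carrier[OF g, of n] by (intro op_norm_nonneg[of _ "d n"]) auto
      then show "0 \<le> \<epsilon> n * (C * C + 1)" using C by simp
    qed
    finally show ?thesis by (simp add: mult.assoc)
  qed
  have "((\<lambda>n. q (act g x) (act g y) n - q x y n) \<longlongrightarrow> 0) U"
  proof (rule tendsto_rabs_zero_cancel, rule tendsto_sandwich[OF _ _ tendsto_const])
    show "((\<lambda>n. \<epsilon> n * ((C * C + 1) * K)) \<longlongrightarrow> 0) U" using tendsto_mult_left_zero[OF e] .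
  qed (use diff in auto)
  from tendsto_add[OF this ip_tendsto[OF x y]] show "(q (act g x) (act g y) \<longlongrightarrow> ip x y) U" by simp
qed

lemma act_multiplicative:
  assumes g: "g \<in> carrier G" and h: "h \<in> carrier G" and x: "x \<in> B"
  shows "N (act (g \<otimes> h) x - act g (act h x)) = 0"
proof -
  have gh: "g \<otimes> h \<in> carrier G" using g h by simp
  obtain C1 where C1: "0 < C1" "\<And>n. op_norm (u g n) \<le> C1" using u_bound[OF g] by blast
  obtain C2 where C2: "0 < C2" "\<And>n. op_norm (u h n) \<le> C2" using u_bound[OF h] by blast
  obtain C3 where C3: "0 < C3" "\<And>n. op_norm (u (g \<otimes> h) n) \<le> C3" using u_bound[OF gh] by blast
  obtain K where K: "0 < K" "\<And>n. hs (d n) (M x n) \<le> K * sqrt (w n)" using B_bound[OF x] by blast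
  define \<epsilon> where "\<epsilon> n = op_norm (u g n * u h n - u (g \<otimes> h) n)" for n
  have e: "(\<epsilon> \<longlongrightarrow> 0) U" using u_mult[OF g h] unfolding \<epsilon>_def by (rule seq_U)
  show ?thesis
  proof (rule N_null)
    show "act (g \<otimes> h) x - act g (act h x) \<in> B"
      using Ops_closed[OF act_in_Ops] g h gh x by (intro B_closed(3)) auto
    show "((\<lambda>n. \<epsilon> n * ((C1 * C2 + C3) * K)) \<longlongrightarrow> 0) U" using tendsto_mult_left_zero[OF e] .
    fix n
    define m where "m = d n"
    define a where "a = u g n"
    define b where "b = u h n"
    define c where "c = u (g \<otimes> h) n"
    define X where "X = M x n"
    have cc: "a \<in> carrier_mat m m" "b \<in> carrier_mat m m" "c \<in> carrier_mat m m" "X \<in> carrier_mat m m"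
      using u_carrier g h gh by (auto simp: m_def a_def b_def c_def X_def)
    note assoc = assoc_mult_mat[of _ m m _ m _ m]
    have ac: "adj a \<in> carrier_mat m m" "adj b \<in> carrier_mat m m" "adj c \<in> carrier_mat m m" using cc by auto
    have e0: "0 \<le> \<epsilon> n" unfolding \<epsilon>_def using u_carrier g h gh by (intro op_norm_nonneg[of _ "d n"]) auto
    have eq: "c * X * adj c - a * (b * X * adj b) * adj a
        = (c - a * b) * X * adj (a * b) + c * X * adj (c - a * b)"
    proof -
      have 1: "(c - a * b) * X * adj (a * b) = c * X * adj (a * b) - (a * b) * X * adj (a * b)"
        using cc ac minus_mult_distrib_mat[of c m m "a * b" X m]
          minus_mult_distrib_mat[of "c * X" m m "(a * b) * X" "adj (a * b)" m] by simp
      have 2: "c * X * adj (c - a * b) = c * X * adj c - c * X * adj (a * b)"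
        using cc ac mult_minus_distrib_mat[of "c * X" m m "adj c" m "adj (a * b)"] by (simp add: adj_minus[of _ m m])
      have 3: "(a * b) * X * adj (a * b) = a * (b * X * adj b) * adj a"
        using cc ac by (simp add: adj_mult assoc)
      have 4: "A - B' + (D - A) = D - B'"
        if "A \<in> carrier_mat m m" "B' \<in> carrier_mat m m" "D \<in> carrier_mat m m" for A B' D :: "complex mat"
        by (rule eq_matI) (use that in auto)
      show ?thesis unfolding 1 2 3 by (rule 4[symmetric]) (use cc ac in auto)
    qed
    have ab: "op_norm (a * b) \<le> C1 * C2"
    proof -
      have "op_norm (a * b) \<le> op_norm a * op_norm b" using cc by (intro op_norm_mult) auto
      also have "\<dots> \<le> C1 * C2" using C1 C2 cc by (intro mult_mono) (auto simp: a_def b_def)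
      finally show ?thesis .
    qed
    have op_e: "op_norm (c - a * b) = \<epsilon> n"
      using op_norm_minus_commute[of c m "a * b"] cc by (simp add: \<epsilon>_def a_def b_def c_def)
    have "hs m (c * X * adj c - a * (b * X * adj b) * adj a)
        \<le> hs m ((c - a * b) * X * adj (a * b)) + hs m (c * X * adj (c - a * b))"
      unfolding eq using cc ac by (intro hs_triangle) auto
    also have "\<dots> \<le> \<epsilon> n * op_norm (a * b) * hs m X + op_norm c * \<epsilon> n * hs m X"
      using hs_conj[of "c - a * b" m X "a * b"] hs_conj[of c m X "c - a * b"] cc by (simp add: op_e)
    also have "\<dots> \<le> \<epsilon> n * (C1 * C2) * hs m X + C3 * \<epsilon> n * hs m X"
      using ab C3(2)[of n] e0 by (intro add_mono mult_right_mono mult_left_mono) (auto simp: c_def)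
    also have "\<dots> = \<epsilon> n * (C1 * C2 + C3) * hs m X" by (simp add: algebra_simps)
    also have "\<dots> \<le> \<epsilon> n * (C1 * C2 + C3) * (K * sqrt (w n))"
      using K(2)[of n] e0 C1 C2 C3 by (intro mult_left_mono) (auto simp: X_def m_def)
    finally show "hs (d n) (M (act (g \<otimes> h) x - act g (act h x)) n) \<le> \<epsilon> n * ((C1 * C2 + C3) * K) * sqrt (w n)"
      using g h gh by (simp add: entry_mat_diff M_act m_def a_def b_def c_def X_def mult.assoc)
  qed
qed

sublocale finite_action B ip G act Ops
proof
  show "V (x + y) = V x + V y" if V: "V \<in> Ops" and x: "x \<in> B" and y: "y \<in> B" for V x y
  proof -
    obtain T C where "\<And>n. lin n (T n)" "V = (\<lambda>x n. T n (x n))" using Ops_E[OF V] by blast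
    then show ?thesis using B_entry_space[OF x] B_entry_space[OF y] by (simp add: lin_def fun_eq_iff)
  qed
  show "V (r *\<^sub>R x) = r *\<^sub>R V x" if V: "V \<in> Ops" and x: "x \<in> B" for V x r
  proof -
    obtain T C where T: "\<And>n. lin n (T n)" "V = (\<lambda>x n. T n (x n))" using Ops_E[OF V] by blast
    have "T n (r *\<^sub>R x n) = r *\<^sub>R T n (x n)" for n using T(1)[of n] B_entry_space[OF x] by (simp add: lin_def)
    moreover have "(r *\<^sub>R x) n = r *\<^sub>R x n" "(r *\<^sub>R V x) n = r *\<^sub>R V x n" for n by (simp_all add: scaleR_fun_def)
    ultimately show ?thesis by (intro ext[of "V (r *\<^sub>R x)"]) (simp add: T(2))
  qed
qed (auto intro: Ops_closed id_in_Ops comp_in_Ops plus_in_Ops scale_in_Ops act_in_Ops act_isometry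
  act_multiplicative bounded_below_onto)

end

section \<open>A Kazhdan set generates\<close>

text \<open>The indicator function of a subgroup is positive definite, and it equals 1 on \<open>F\<close>.\<close>

lemma kazhdan_generates:
  assumes K: "group K" and kz: "kazhdan K F C" and S: "subgroup S K" and F: "F \<subseteq> S"
  shows "S = carrier K"
proof -
  interpret K: group K by (rule K)
  interpret S: subgroup S K by (rule S)
  define \<phi> where "\<phi> g = (if g \<in> S then 1 else 0 :: real)" for g
  \<comment> \<open>The coset \<open>g S\<close>; the kernel of \<open>\<phi>\<close> is the relation of lying in the same coset.\<close>
  define \<kappa> where "\<kappa> g = {x \<in> carrier K. inv\<^bsub>K\<^esub> g \<otimes>\<^bsub>K\<^esub> x \<in> S}" for g
  have same: "inv\<^bsub>K\<^esub> g \<otimes>\<^bsub>K\<^esub> h \<in> S \<longleftrightarrow> \<kappa> g = \<kappa> h" if gh: "g \<in> carrier K" "h \<in> carrier K" for g h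
  proof
    assume "\<kappa> g = \<kappa> h"
    moreover have "h \<in> \<kappa> h" using gh by (simp add: \<kappa>_def)
    ultimately show "inv\<^bsub>K\<^esub> g \<otimes>\<^bsub>K\<^esub> h \<in> S" by (auto simp: \<kappa>_def)
  next
    have step: "\<kappa> h \<subseteq> \<kappa> g" if s: "inv\<^bsub>K\<^esub> g \<otimes>\<^bsub>K\<^esub> h \<in> S" and c: "g \<in> carrier K" "h \<in> carrier K" for g h
    proof
      fix x assume x: "x \<in> \<kappa> h"
      then have xK: "x \<in> carrier K" "inv\<^bsub>K\<^esub> h \<otimes>\<^bsub>K\<^esub> x \<in> S" by (auto simp: \<kappa>_def)
      have "(inv\<^bsub>K\<^esub> g \<otimes>\<^bsub>K\<^esub> h) \<otimes>\<^bsub>K\<^esub> (inv\<^bsub>K\<^esub> h \<otimes>\<^bsub>K\<^esub> x) \<in> S" using s xK by blast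
      moreover have "h \<otimes>\<^bsub>K\<^esub> (inv\<^bsub>K\<^esub> h \<otimes>\<^bsub>K\<^esub> x) = x" using c xK by (simp add: K.m_assoc[symmetric])
      ultimately have "inv\<^bsub>K\<^esub> g \<otimes>\<^bsub>K\<^esub> x \<in> S" using c xK by (simp add: K.m_assoc)
      then show "x \<in> \<kappa> g" using xK by (simp add: \<kappa>_def)
    qed
    assume s: "inv\<^bsub>K\<^esub> g \<otimes>\<^bsub>K\<^esub> h \<in> S"
    have "inv\<^bsub>K\<^esub> (inv\<^bsub>K\<^esub> g \<otimes>\<^bsub>K\<^esub> h) \<in> S" using s by blast
    then have "inv\<^bsub>K\<^esub> h \<otimes>\<^bsub>K\<^esub> g \<in> S" using gh by (simp add: K.inv_mult_group)
    then show "\<kappa> g = \<kappa> h" using step[OF s gh] step[of h g] gh by blast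
  qed
  have "pos_def K \<phi>"
    unfolding pos_def_def psd_on_def
  proof (intro allI impI conjI ballI)
    fix A i j assume A: "finite A" "A \<subseteq> carrier K" and ij: "i \<in> A" "j \<in> A"
    then have "i \<in> carrier K" "j \<in> carrier K" by auto
    then show "\<phi> (inv\<^bsub>K\<^esub> i \<otimes>\<^bsub>K\<^esub> j) = \<phi> (inv\<^bsub>K\<^esub> j \<otimes>\<^bsub>K\<^esub> i)" by (auto simp: \<phi>_def same)
  next
    fix A and a :: "'a \<Rightarrow> real" assume A: "finite A" "A \<subseteq> carrier K"
    have "(\<Sum>i\<in>A. \<Sum>j\<in>A. a i * a j * \<phi> (inv\<^bsub>K\<^esub> i \<otimes>\<^bsub>K\<^esub> j))
        = (\<Sum>i\<in>A. \<Sum>j\<in>A. \<Sum>D\<in>\<kappa> ` A. (if \<kappa> i = D then a i else 0) * (if \<kappa> j = D then a j else 0))"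
    proof (intro sum.cong refl)
      fix i j assume ij: "i \<in> A" "j \<in> A"
      have "(\<Sum>D\<in>\<kappa> ` A. (if \<kappa> i = D then a i else 0) * (if \<kappa> j = D then a j else 0))
          = (\<Sum>D\<in>\<kappa> ` A. if D = \<kappa> i then (if \<kappa> i = \<kappa> j then a i * a j else 0) else 0)"
        by (intro sum.cong refl) auto
      also have "\<dots> = (if \<kappa> i = \<kappa> j then a i * a j else 0)" using A ij by simp
      also have "\<dots> = a i * a j * \<phi> (inv\<^bsub>K\<^esub> i \<otimes>\<^bsub>K\<^esub> j)" using A ij same[of i j] by (auto simp: \<phi>_def)
      finally show "a i * a j * \<phi> (inv\<^bsub>K\<^esub> i \<otimes>\<^bsub>K\<^esub> j)
          = (\<Sum>D\<in>\<kappa> ` A. (if \<kappa> i = D then a i else 0) * (if \<kappa> j = D then a j else 0))" by simp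
    qed
    also have "\<dots> = (\<Sum>i\<in>A. \<Sum>D\<in>\<kappa> ` A. \<Sum>j\<in>A. (if \<kappa> i = D then a i else 0) * (if \<kappa> j = D then a j else 0))"
      by (intro sum.cong refl sum.swap)
    also have "\<dots> = (\<Sum>D\<in>\<kappa> ` A. \<Sum>i\<in>A. \<Sum>j\<in>A. (if \<kappa> i = D then a i else 0) * (if \<kappa> j = D then a j else 0))"
      by (rule sum.swap)
    also have "\<dots> = (\<Sum>D\<in>\<kappa> ` A. (\<Sum>i\<in>A. if \<kappa> i = D then a i else 0)^2)"
      by (simp only: power2_eq_square sum_product)
    finally show "0 \<le> (\<Sum>i\<in>A. \<Sum>j\<in>A. a i * a j * \<phi> (inv\<^bsub>K\<^esub> i \<otimes>\<^bsub>K\<^esub> j))" by (simp add: sum_nonneg)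
  qed
  moreover have "\<phi> \<one>\<^bsub>K\<^esub> = 1" by (simp add: \<phi>_def)
  moreover have "\<forall>s\<in>F. 1 - \<phi> s \<le> 0" using F by (auto simp: \<phi>_def)
  ultimately have "\<forall>g\<in>carrier K. \<bar>\<phi> g - 1\<bar> \<le> C * 0"
    using kz unfolding kazhdan_def by (metis order_refl)
  then have "g \<in> S" if "g \<in> carrier K" for g using that by (force simp: \<phi>_def split: if_splits)
  then show ?thesis using S.subset by blast
qed

section \<open>Bounded sequences of matrices modulo null sequences\<close>

definition bd :: "(nat \<Rightarrow> nat) \<Rightarrow> (nat \<Rightarrow> complex mat) \<Rightarrow> bool" where
  "bd d A \<longleftrightarrow> (\<forall>n. A n \<in> carrier_mat (d n) (d n)) \<and> (\<exists>C. \<forall>n. op_norm (A n) \<le> C)"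

text \<open>The two sequences represent the same element of \<open>\<Q>\<^sub>d\<close>.\<close>

definition eqv :: "(nat \<Rightarrow> nat) \<Rightarrow> (nat \<Rightarrow> complex mat) \<Rightarrow> (nat \<Rightarrow> complex mat) \<Rightarrow> bool" where
  "eqv d A B \<longleftrightarrow> bd d A \<and> bd d B \<and> (\<lambda>n. op_norm (A n - B n)) \<longlonglongrightarrow> 0"

lemma bd_carrier [simp]: "bd d A \<Longrightarrow> A n \<in> carrier_mat (d n) (d n)" by (simp add: bd_def)

lemma bd_bound:
  assumes "bd d A" shows "\<exists>C>0. \<forall>n. op_norm (A n) \<le> C"
proof -
  obtain C where "\<forall>n. op_norm (A n) \<le> C" using assms by (auto simp: bd_def)
  then have "\<forall>n. op_norm (A n) \<le> \<bar>C\<bar> + 1" by (meson abs_ge_self add_increasing2 order_trans zero_le_one)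
  then show ?thesis by (intro exI[of _ "\<bar>C\<bar> + 1"]) auto
qed

lemma bdI: "(\<And>n. A n \<in> carrier_mat (d n) (d n)) \<Longrightarrow> (\<And>n. op_norm (A n) \<le> C) \<Longrightarrow> bd d A"
  by (auto simp: bd_def)

lemma bd_mult: assumes "bd d A" "bd d B" shows "bd d (\<lambda>n. A n * B n)"
proof -
  obtain C where C: "0 < C" "\<forall>n. op_norm (A n) \<le> C" using bd_bound[OF assms(1)] by blast
  obtain D where D: "0 < D" "\<forall>n. op_norm (B n) \<le> D" using bd_bound[OF assms(2)] by blast
  show ?thesis
  proof (rule bdI)
    show "op_norm (A n * B n) \<le> C * D" for n
    proof -
      have "op_norm (A n * B n) \<le> op_norm (A n) * op_norm (B n)" by (rule op_norm_mult[of _ "d n"]) (use assms in auto)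
      also have "\<dots> \<le> C * D" using C D op_norm_nonneg[OF bd_carrier[OF assms(2)]] by (intro mult_mono) auto
      finally show ?thesis .
    qed
  qed (use assms in \<open>auto intro!: mult_carrier_mat[of _ "d _" "d _" _ "d _"]\<close>)
qed

lemma bd_add: assumes "bd d A" "bd d B" shows "bd d (\<lambda>n. A n + B n)"
proof -
  obtain C where C: "0 < C" "\<forall>n. op_norm (A n) \<le> C" using bd_bound[OF assms(1)] by blast
  obtain D where D: "0 < D" "\<forall>n. op_norm (B n) \<le> D" using bd_bound[OF assms(2)] by blast
  show ?thesis
  proof (rule bdI)
    show "op_norm (A n + B n) \<le> C + D" for n
      using op_norm_add[OF bd_carrier[OF assms(1)] bd_carrier[OF assms(2)], of n] C D by (meson add_mono order_trans)
  qed (use assms in auto)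
qed

lemma bd_smult: assumes "bd d A" shows "bd d (\<lambda>n. c \<cdot>\<^sub>m A n)"
proof -
  obtain C where C: "0 < C" "\<forall>n. op_norm (A n) \<le> C" using bd_bound[OF assms(1)] by blast
  show ?thesis
  proof (rule bdI)
    show "op_norm (c \<cdot>\<^sub>m A n) \<le> cmod c * C" for n
      using op_norm_smult[OF bd_carrier[OF assms], of c n] C mult_left_mono[of "op_norm (A n)" C "cmod c"]
      by (meson norm_ge_zero order_trans)
  qed (use assms in auto)
qed

lemma bd_minus: assumes "bd d A" "bd d B" shows "bd d (\<lambda>n. A n - B n)"
proof -
  have "A n - B n = A n + (-1) \<cdot>\<^sub>m B n" for n
    by (rule eq_matI) (use bd_carrier[OF assms(1), of n] bd_carrier[OF assms(2), of n] in auto)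
  then show ?thesis using bd_add[OF assms(1) bd_smult[OF assms(2), of "-1"]] by simp
qed

lemma bd_adj: "bd d A \<Longrightarrow> bd d (\<lambda>n. adj (A n))"
  unfolding bd_def by (metis adj_carrier op_norm_adj)

lemma bd_one: "bd d (\<lambda>n. 1\<^sub>m (d n))" by (rule bdI[OF _ op_norm_one]) auto

lemma bd_zero: "bd d (\<lambda>n. 0\<^sub>m (d n) (d n))" by (rule bdI[of _ _ 0]) auto

lemma eqv_bd: "eqv d A B \<Longrightarrow> bd d A" "eqv d A B \<Longrightarrow> bd d B" by (auto simp: eqv_def)

lemma eqv_I:
  assumes "bd d A" "bd d B" "e \<longlonglongrightarrow> 0" "\<And>n. op_norm (A n - B n) \<le> e n"
  shows "eqv d A B"
  unfolding eqv_def
proof (intro conjI assms(1,2))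
  show "(\<lambda>n. op_norm (A n - B n)) \<longlonglongrightarrow> 0"
  proof (rule tendsto_sandwich[OF _ _ tendsto_const assms(3)])
    have "0 \<le> op_norm (A n - B n)" for n
      using bd_carrier[OF assms(1), of n] bd_carrier[OF assms(2), of n] by (intro op_norm_nonneg[of _ "d n"]) auto
    then show "\<forall>\<^sub>F n in sequentially. 0 \<le> op_norm (A n - B n)" by simp
  qed (use assms(4) in auto)
qed

lemma eqv_lim: "eqv d A B \<Longrightarrow> (\<lambda>n. op_norm (A n - B n)) \<longlonglongrightarrow> 0" by (simp add: eqv_def)

lemma eqv_refl: "bd d A \<Longrightarrow> eqv d A A"
  by (rule eqv_I[of _ _ _ "\<lambda>_. 0"]) (auto simp: minus_r_inv_mat[OF bd_carrier])

lemma eqv_sym: "eqv d A B \<Longrightarrow> eqv d B A"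
proof -
  assume e: "eqv d A B"
  have "op_norm (B n - A n) = op_norm (A n - B n)" for n
    using bd_carrier[OF eqv_bd(1)[OF e], of n] bd_carrier[OF eqv_bd(2)[OF e], of n]
    by (rule op_norm_minus_commute[rotated])
  then show ?thesis using e by (simp add: eqv_def)
qed

lemma eqv_trans [trans]:
  assumes "eqv d A B" "eqv d B C" shows "eqv d A C"
proof (rule eqv_I)
  note b = eqv_bd[OF assms(1)] eqv_bd[OF assms(2)]
  show "bd d A" "bd d C" using b by auto
  show "(\<lambda>n. op_norm (A n - B n) + op_norm (B n - C n)) \<longlonglongrightarrow> 0"
    using tendsto_add[OF eqv_lim[OF assms(1)] eqv_lim[OF assms(2)]] by simp
  fix n
  have c: "A n \<in> carrier_mat (d n) (d n)" "B n \<in> carrier_mat (d n) (d n)" "C n \<in> carrier_mat (d n) (d n)" using b by auto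
  have "A n - C n = (A n - B n) + (B n - C n)" by (rule eq_matI) (use c in auto)
  then show "op_norm (A n - C n) \<le> op_norm (A n - B n) + op_norm (B n - C n)"
    using op_norm_add[of "A n - B n" "d n" "B n - C n"] c by auto
qed

lemma eqv_add:
  assumes "eqv d A A'" "eqv d B B'" shows "eqv d (\<lambda>n. A n + B n) (\<lambda>n. A' n + B' n)"
proof (rule eqv_I)
  note b = eqv_bd[OF assms(1)] eqv_bd[OF assms(2)]
  show "bd d (\<lambda>n. A n + B n)" "bd d (\<lambda>n. A' n + B' n)" using b bd_add by auto
  show "(\<lambda>n. op_norm (A n - A' n) + op_norm (B n - B' n)) \<longlonglongrightarrow> 0"
    using tendsto_add[OF eqv_lim[OF assms(1)] eqv_lim[OF assms(2)]] by simp
  fix n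
  have c: "A n \<in> carrier_mat (d n) (d n)" "B n \<in> carrier_mat (d n) (d n)"
    "A' n \<in> carrier_mat (d n) (d n)" "B' n \<in> carrier_mat (d n) (d n)" using b by auto
  have "A n + B n - (A' n + B' n) = (A n - A' n) + (B n - B' n)" by (rule eq_matI) (use c in auto)
  then show "op_norm (A n + B n - (A' n + B' n)) \<le> op_norm (A n - A' n) + op_norm (B n - B' n)"
    using op_norm_add[of "A n - A' n" "d n" "B n - B' n"] c by auto
qed

lemma eqv_smult:
  assumes "eqv d A A'" shows "eqv d (\<lambda>n. c \<cdot>\<^sub>m A n) (\<lambda>n. c \<cdot>\<^sub>m A' n)"
proof (rule eqv_I)
  note b = eqv_bd[OF assms(1)]
  show "bd d (\<lambda>n. c \<cdot>\<^sub>m A n)" "bd d (\<lambda>n. c \<cdot>\<^sub>m A' n)" using b bd_smult by auto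
  show "(\<lambda>n. cmod c * op_norm (A n - A' n)) \<longlonglongrightarrow> 0"
    using tendsto_mult_right_zero[OF eqv_lim[OF assms(1)]] by simp
  fix n
  have cc: "A n \<in> carrier_mat (d n) (d n)" "A' n \<in> carrier_mat (d n) (d n)" using b by auto
  have "c \<cdot>\<^sub>m A n - c \<cdot>\<^sub>m A' n = c \<cdot>\<^sub>m (A n - A' n)" by (rule eq_matI) (use cc in \<open>auto simp: algebra_simps\<close>)
  then show "op_norm (c \<cdot>\<^sub>m A n - c \<cdot>\<^sub>m A' n) \<le> cmod c * op_norm (A n - A' n)"
    using op_norm_smult[of "A n - A' n" "d n" c] cc by auto
qed

lemma eqv_minus:
  assumes "eqv d A A'" "eqv d B B'" shows "eqv d (\<lambda>n. A n - B n) (\<lambda>n. A' n - B' n)"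
proof -
  have "A n - B n = A n + (-1) \<cdot>\<^sub>m B n" "A' n - B' n = A' n + (-1) \<cdot>\<^sub>m B' n" for n
    using bd_carrier[OF eqv_bd(1)[OF assms(1)], of n] bd_carrier[OF eqv_bd(1)[OF assms(2)], of n]
      bd_carrier[OF eqv_bd(2)[OF assms(1)], of n] bd_carrier[OF eqv_bd(2)[OF assms(2)], of n]
    by (auto intro!: eq_matI)
  then show ?thesis using eqv_add[OF assms(1) eqv_smult[OF assms(2), of "-1"]] by simp
qed

lemma eqv_adj: assumes "eqv d A B" shows "eqv d (\<lambda>n. adj (A n)) (\<lambda>n. adj (B n))"
proof (rule eqv_I)
  note b = eqv_bd[OF assms(1)]
  show "bd d (\<lambda>n. adj (A n))" "bd d (\<lambda>n. adj (B n))" using b bd_adj by auto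
  show "(\<lambda>n. op_norm (A n - B n)) \<longlonglongrightarrow> 0" by (rule eqv_lim[OF assms])
  show "op_norm (adj (A n) - adj (B n)) \<le> op_norm (A n - B n)" for n
    using op_norm_adj[of "A n - B n" "d n"] adj_minus[OF bd_carrier[OF b(1)] bd_carrier[OF b(2)], of n] b by auto
qed

lemma eqv_mult:
  assumes "eqv d A A'" "eqv d B B'" shows "eqv d (\<lambda>n. A n * B n) (\<lambda>n. A' n * B' n)"
proof -
  note b = eqv_bd[OF assms(1)] eqv_bd[OF assms(2)]
  obtain C where C: "0 < C" "\<forall>n. op_norm (A' n) \<le> C" using bd_bound[OF b(2)] by blast
  obtain D where D: "0 < D" "\<forall>n. op_norm (B n) \<le> D" using bd_bound[OF b(3)] by blast
  show ?thesis
  proof (rule eqv_I)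
    show "bd d (\<lambda>n. A n * B n)" "bd d (\<lambda>n. A' n * B' n)" using b bd_mult by auto
    show "(\<lambda>n. op_norm (A n - A' n) * D + C * op_norm (B n - B' n)) \<longlonglongrightarrow> 0"
      using tendsto_add[OF tendsto_mult_left_zero[OF eqv_lim[OF assms(1)]] tendsto_mult_right_zero[OF eqv_lim[OF assms(2)]]]
      by simp
    fix n
    have c: "A n \<in> carrier_mat (d n) (d n)" "B n \<in> carrier_mat (d n) (d n)"
      "A' n \<in> carrier_mat (d n) (d n)" "B' n \<in> carrier_mat (d n) (d n)" using b by auto
    have "(A n - A' n) * B n = A n * B n - A' n * B n" by (rule minus_mult_distrib_mat[OF c(1,3,2)])
    moreover have "A' n * (B n - B' n) = A' n * B n - A' n * B' n" by (rule mult_minus_distrib_mat[OF c(3,2,4)])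
    moreover have "P - R = (P - Q) + (Q - R)"
      if "P \<in> carrier_mat (d n) (d n)" "Q \<in> carrier_mat (d n) (d n)" "R \<in> carrier_mat (d n) (d n)" for P Q R :: "complex mat"
      by (rule eq_matI) (use that in auto)
    ultimately have "A n * B n - A' n * B' n = (A n - A' n) * B n + A' n * (B n - B' n)"
      using c by (metis mult_carrier_mat)
    then have "op_norm (A n * B n - A' n * B' n) \<le> op_norm ((A n - A' n) * B n) + op_norm (A' n * (B n - B' n))"
      using op_norm_add[of "(A n - A' n) * B n" "d n" "A' n * (B n - B' n)"] c by auto
    also have "\<dots> \<le> op_norm (A n - A' n) * op_norm (B n) + op_norm (A' n) * op_norm (B n - B' n)"
      using c by (intro add_mono op_norm_mult[of _ "d n"]) auto
    also have "\<dots> \<le> op_norm (A n - A' n) * D + C * op_norm (B n - B' n)"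
      using C D c by (intro add_mono mult_left_mono mult_right_mono op_norm_nonneg[of _ "d n"]) auto
    finally show "op_norm (A n * B n - A' n * B' n) \<le> op_norm (A n - A' n) * D + C * op_norm (B n - B' n)" .
  qed
qed

lemma eqv_assoc: "bd d A \<Longrightarrow> bd d B \<Longrightarrow> bd d C \<Longrightarrow> (\<lambda>n. A n * B n * C n) = (\<lambda>n. A n * (B n * C n))"
  by (rule ext, rule assoc_mult_mat[OF bd_carrier bd_carrier bd_carrier])

section \<open>Asymptotic rigidity\<close>

text \<open>If \<open>x\<close> and \<open>y\<close> commute and square to one, the joint eigenvalues of \<open>(x - y) / 2\<close> are \<open>-1\<close>, \<open>0\<close>, \<open>1\<close>,
  the roots of \<open>z\<^sup>3 = z\<close>.\<close>

lemma half_difference_cube: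
  assumes xx: "eqv d (\<lambda>n. x n * x n) (\<lambda>n. 1\<^sub>m (d n))" and yy: "eqv d (\<lambda>n. y n * y n) (\<lambda>n. 1\<^sub>m (d n))"
    and xy: "eqv d (\<lambda>n. x n * y n) (\<lambda>n. y n * x n)" and x: "bd d x" and y: "bd d y"
  defines "D \<equiv> \<lambda>n. (1/2 :: complex) \<cdot>\<^sub>m (x n - y n)"
  shows "eqv d (\<lambda>n. D n * D n * D n) D"
proof -
  let ?I = "\<lambda>n. 1\<^sub>m (d n) :: complex mat"
  define e where "e n = x n - y n" for n
  have e: "bd d e" unfolding e_def [abs_def] using x y by (rule bd_minus)
  define p where "p n = x n * y n" for n
  have p: "bd d p" unfolding p_def [abs_def] using x y by (rule bd_mult)
  have xc: "x n \<in> carrier_mat (d n) (d n)" "y n \<in> carrier_mat (d n) (d n)" "p n \<in> carrier_mat (d n) (d n)"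
    "e n \<in> carrier_mat (d n) (d n)" for n
    using x y p e by auto
  have dbl: "(P - Q) - (Q - P) = 2 \<cdot>\<^sub>m (P - Q)" if "P \<in> carrier_mat m m" "Q \<in> carrier_mat m m" for P Q :: "complex mat" and m
    by (rule eq_matI) (use that in auto)
  have "eqv d (\<lambda>n. e n * e n) (\<lambda>n. 2 \<cdot>\<^sub>m (?I n - p n))"
  proof -
    have eq1: "(\<lambda>n. e n * e n) = (\<lambda>n. (x n * x n - x n * y n) - (y n * x n - y n * y n))"
    proof
      fix n
      have 1: "e n * e n = x n * e n - y n * e n"
        using minus_mult_distrib_mat[OF xc(1,2,4)[of n]] by (simp add: e_def)
      have 2: "x n * e n = x n * x n - x n * y n" "y n * e n = y n * x n - y n * y n"
        unfolding e_def
        using mult_minus_distrib_mat[OF xc(1,1,2)[of n]] mult_minus_distrib_mat[OF xc(2,1,2)[of n]] by blast+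
      show "e n * e n = (x n * x n - x n * y n) - (y n * x n - y n * y n)" unfolding 1 2 ..
    qed
    have eq2: "eqv d (\<lambda>n. (x n * x n - x n * y n) - (y n * x n - y n * y n)) (\<lambda>n. (?I n - p n) - (p n - ?I n))"
    proof -
      have P: "eqv d (\<lambda>n. x n * y n) p" using eqv_refl[OF p] by (simp add: p_def [abs_def])
      have Q: "eqv d (\<lambda>n. y n * x n) p" by (rule eqv_trans[OF eqv_sym[OF xy] P])
      show ?thesis by (rule eqv_minus[OF eqv_minus[OF xx P] eqv_minus[OF Q yy]])
    qed
    have eq3: "(\<lambda>n. (?I n - p n) - (p n - ?I n)) = (\<lambda>n. 2 \<cdot>\<^sub>m (?I n - p n))"
    proof
      show "(?I n - p n) - (p n - ?I n) = 2 \<cdot>\<^sub>m (?I n - p n)" for n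
        by (rule dbl[OF _ xc(3)[of n]]) simp
    qed
    show ?thesis using eq2 unfolding eq1 eq3 .
  qed
  then have "eqv d (\<lambda>n. e n * e n * e n) (\<lambda>n. 2 \<cdot>\<^sub>m (?I n - p n) * e n)"
    by (rule eqv_mult) (rule eqv_refl[OF e])
  also have "(\<lambda>n. 2 \<cdot>\<^sub>m (?I n - p n) * e n) = (\<lambda>n. 2 \<cdot>\<^sub>m (e n - (p n * x n - p n * y n)))"
  proof
    fix n
    have "2 \<cdot>\<^sub>m (?I n - p n) * e n = 2 \<cdot>\<^sub>m ((?I n - p n) * e n)"
      by (rule mult_smult_assoc_mat[OF _ xc(4)[of n]]) (use xc[of n] in auto)
    also have "(?I n - p n) * e n = ?I n * e n - p n * e n"
      by (rule minus_mult_distrib_mat[OF _ xc(3,4)[of n]]) simp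
    also have "?I n * e n = e n" using xc(4)[of n] by simp
    also have "p n * e n = p n * x n - p n * y n"
      unfolding e_def by (rule mult_minus_distrib_mat[OF xc(3,1,2)[of n]])
    finally show "2 \<cdot>\<^sub>m (?I n - p n) * e n = 2 \<cdot>\<^sub>m (e n - (p n * x n - p n * y n))" .
  qed
  also have "eqv d \<dots> (\<lambda>n. 2 \<cdot>\<^sub>m (e n - (y n - x n)))"
  proof (intro eqv_smult eqv_minus eqv_refl e)
    have "eqv d (\<lambda>n. p n * x n) (\<lambda>n. y n * x n * x n)"
      unfolding p_def by (rule eqv_mult[OF xy eqv_refl[OF x]])
    also have "(\<lambda>n. y n * x n * x n) = (\<lambda>n. y n * (x n * x n))" by (rule eqv_assoc[OF y x x])
    also have "eqv d \<dots> (\<lambda>n. y n * ?I n)" by (rule eqv_mult[OF eqv_refl[OF y] xx])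
    also have "(\<lambda>n. y n * ?I n) = y" using right_mult_one_mat[OF xc(2)] by auto
    finally show "eqv d (\<lambda>n. p n * x n) y" .
    have "(\<lambda>n. p n * y n) = (\<lambda>n. x n * (y n * y n))" unfolding p_def by (rule eqv_assoc[OF x y y])
    moreover have "eqv d (\<lambda>n. x n * (y n * y n)) (\<lambda>n. x n * ?I n)" by (rule eqv_mult[OF eqv_refl[OF x] yy])
    moreover have "(\<lambda>n. x n * ?I n) = x" using right_mult_one_mat[OF xc(1)] by auto
    ultimately show "eqv d (\<lambda>n. p n * y n) x" by (simp only:)
  qed
  also have "(\<lambda>n. 2 \<cdot>\<^sub>m (e n - (y n - x n))) = (\<lambda>n. 4 \<cdot>\<^sub>m e n)"
  proof
    have "2 \<cdot>\<^sub>m ((P - Q) - (Q - P)) = 4 \<cdot>\<^sub>m (P - Q)"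
      if "P \<in> carrier_mat m m" "Q \<in> carrier_mat m m" for P Q :: "complex mat" and m
      by (rule eq_matI) (use that in auto)
    from this[OF xc(1,2)] show "2 \<cdot>\<^sub>m (e n - (y n - x n)) = 4 \<cdot>\<^sub>m e n" for n by (simp only: e_def)
  qed
  finally have "eqv d (\<lambda>n. (1/8) \<cdot>\<^sub>m (e n * e n * e n)) (\<lambda>n. (1/8) \<cdot>\<^sub>m (4 \<cdot>\<^sub>m e n))" by (rule eqv_smult)
  moreover have "(\<lambda>n. (1/8) \<cdot>\<^sub>m (4 \<cdot>\<^sub>m e n)) = D"
    by (rule ext, rule eq_matI) (auto simp: D_def e_def)
  moreover have "(\<lambda>n. D n * D n * D n) = (\<lambda>n. (1/8) \<cdot>\<^sub>m (e n * e n * e n))"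
  proof
    fix n
    have De: "D n = (1/2) \<cdot>\<^sub>m e n" by (simp add: D_def e_def)
    have ee: "e n * e n \<in> carrier_mat (d n) (d n)" using xc by auto
    have "D n * D n = (1/2) \<cdot>\<^sub>m ((1/2) \<cdot>\<^sub>m (e n * e n))"
      unfolding De using mult_smult_assoc_mat[OF xc(4)[of n], of "(1/2) \<cdot>\<^sub>m e n" "d n" "1/2"] mult_smult_distrib[OF xc(4,4)[of n], of "1/2"] xc(4)[of n] by simp
    then have "D n * D n * D n = ((1/2) \<cdot>\<^sub>m ((1/2) \<cdot>\<^sub>m (e n * e n))) * ((1/2) \<cdot>\<^sub>m e n)" by (simp add: De)
    also have "\<dots> = (1/2) \<cdot>\<^sub>m (((1/2) \<cdot>\<^sub>m (e n * e n)) * ((1/2) \<cdot>\<^sub>m e n))"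
      by (rule mult_smult_assoc_mat) (use ee xc[of n] in auto)
    also have "((1/2) \<cdot>\<^sub>m (e n * e n)) * ((1/2) \<cdot>\<^sub>m e n) = (1/2) \<cdot>\<^sub>m ((e n * e n) * ((1/2) \<cdot>\<^sub>m e n))"
      by (rule mult_smult_assoc_mat) (use ee xc[of n] in auto)
    also have "(e n * e n) * ((1/2) \<cdot>\<^sub>m e n) = (1/2) \<cdot>\<^sub>m (e n * e n * e n)"
      by (rule mult_smult_distrib) (use ee xc[of n] in auto)
    also have "(1/2) \<cdot>\<^sub>m ((1/2) \<cdot>\<^sub>m ((1/2) \<cdot>\<^sub>m (e n * e n * e n))) = (1/8 :: complex) \<cdot>\<^sub>m (e n * e n * e n)"
      by (rule eq_matI) auto
    finally show "D n * D n * D n = (1/8) \<cdot>\<^sub>m (e n * e n * e n)" .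
  qed
  ultimately show ?thesis by simp
qed

lemma trace_norm_le_mono: "trace_norm_le d X C \<Longrightarrow> C \<le> C' \<Longrightarrow> trace_norm_le d X C'"
  unfolding trace_norm_le_def by (meson mult_right_mono op_norm_nonneg order_trans)

lemma trace_norm_le_zero: "trace_norm_le d (0\<^sub>m d d) 0"
  by (simp add: trace_norm_le_def hs_ip_def)

text \<open>Replace \<open>x\<close> by its Hermitian part \<open>h\<close> and round the spectrum in every coordinate; the error is
  controlled by \<open>h\<^sup>3 - h\<close>.\<close>

lemma eqv_rounding:
  assumes cube: "eqv d (\<lambda>n. x n * x n * x n) x" and herm: "eqv d (\<lambda>n. adj (x n)) x"
  obtains D where "eqv d D x" "\<And>n. adj (D n) = D n" "\<And>n. D n * D n * D n = D n"
proof -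
  have x: "bd d x" by (rule eqv_bd(2)[OF cube])
  define h where "h n = (1/2) \<cdot>\<^sub>m (x n + adj (x n))" for n
  have hx: "eqv d h x"
  proof -
    have "eqv d (\<lambda>n. (1/2) \<cdot>\<^sub>m (x n + adj (x n))) (\<lambda>n. (1/2) \<cdot>\<^sub>m (x n + x n))"
      by (rule eqv_smult[OF eqv_add[OF eqv_refl[OF x] herm]])
    moreover have "(\<lambda>n. (1/2 :: complex) \<cdot>\<^sub>m (x n + x n)) = x"
      by (rule ext, rule eq_matI) auto
    ultimately show ?thesis by (simp add: h_def [abs_def])
  qed
  have h: "bd d h" by (rule eqv_bd(1)[OF hx])
  have hc: "h n \<in> carrier_mat (d n) (d n)" for n using h by simp
  have hh: "adj (h n) = h n" for n
    using bd_carrier[OF x, of n] unfolding h_def adj_smult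
    by (subst adj_add[of _ "d n" "d n"]) (auto intro!: eq_matI)
  have h3: "eqv d (\<lambda>n. h n * h n * h n) h"
    by (rule eqv_trans[OF eqv_mult[OF eqv_mult[OF hx hx] hx] eqv_trans[OF cube eqv_sym[OF hx]]])
  have "\<exists>D. D \<in> carrier_mat (d n) (d n) \<and> adj D = D \<and> D * D * D = D
      \<and> op_norm (h n - D) \<le> 2 * op_norm (h n * h n * h n - h n)" for n
    by (rule hermitian_rounding[OF hc hh]) blast
  then obtain D where D: "\<And>n. D n \<in> carrier_mat (d n) (d n)" "\<And>n. adj (D n) = D n" "\<And>n. D n * D n * D n = D n"
    "\<And>n. op_norm (h n - D n) \<le> 2 * op_norm (h n * h n * h n - h n)" by metis
  obtain C1 where C1: "\<forall>n. op_norm (h n) \<le> C1" using bd_bound[OF h] by blast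
  obtain C2 where C2: "\<forall>n. op_norm (h n * h n * h n - h n) \<le> C2"
    using bd_bound[OF bd_minus[OF eqv_bd(1)[OF h3] h]] by blast
  have "bd d D"
  proof (rule bdI[OF D(1)])
    fix n
    have "D n = h n - (h n - D n)" by (rule eq_matI) (use hc[of n] D(1)[of n] in auto)
    then have "op_norm (D n) \<le> op_norm (h n) + op_norm (h n - D n)"
      using op_norm_minus[OF hc[of n], of "h n - D n"] hc[of n] D(1)[of n] by auto
    then show "op_norm (D n) \<le> C1 + 2 * C2" using C1 C2 D(4)[of n] by (smt (verit))
  qed
  moreover have "(\<lambda>n. 2 * op_norm (h n * h n * h n - h n)) \<longlonglongrightarrow> 0"
    using tendsto_mult_right_zero[OF eqv_lim[OF h3]] by simp
  ultimately have "eqv d h D" by (intro eqv_I[OF h _ _ D(4)])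
  then have "eqv d D x" by (rule eqv_trans[OF eqv_sym hx])
  then show thesis using that D by blast
qed

text \<open>The half differences \<open>y g = (a g - a \<one>) / 2\<close> satisfy \<open>y (g h) = y g + v g y h (v g)\<^sup>*\<close> asymptotically
  and vanish asymptotically on \<open>t \<Gamma> t\<inverse>\<close>, so they should form a cocycle to which \<open>cocycle_vanishes\<close>
  applies.  The difficulty is to find a Hilbert space that contains them and detects their operator
  norms.  By \<open>eqv_rounding\<close> the \<open>y s\<close> can be represented by Hermitian matrices \<open>D s n\<close> equal to their
  cubes.  Suppose that one of them, with \<open>s \<in> F\<close>, is not asymptotically zero.  Let the weight be the
  sum of the squared Hilbert-Schmidt norms of the \<open>D s n\<close> over \<open>s \<in> F\<close>, and let the ultrafilter contain
  the set of \<open>n\<close> where it is positive.  The values of the cocycle are those representatives of \<open>y g\<close>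
  whose trace norm is bounded by a multiple of the weight: two of them differ by a null vector of
  the ultraproduct, since \<open>|x|\<^sub>H\<^sub>S\<^sup>2 \<le> |x|\<^sub>1 |x|\<close>, and they exist on a subgroup containing \<open>F\<close>, that is,
  on \<open>\<Gamma>\<close>.  The cocycle vanishes, but by the choice of the weight its squared norms sum to 1 over \<open>F\<close>.\<close>

theorem asymptotic_rigidity:
  fixes G :: "'g monoid" (structure) and v a :: "'g \<Rightarrow> nat \<Rightarrow> complex mat"
  assumes G: "group G" and \<Gamma>: "subgroup \<Gamma> G" and kz: "kazhdan (G\<lparr>carrier := \<Gamma>\<rparr>) F C"
    and t: "t \<in> carrier G" and t\<Gamma>: "\<And>\<gamma>. \<gamma> \<in> \<Gamma> \<Longrightarrow> t \<otimes> \<gamma> \<otimes> inv t \<in> \<Gamma>"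
    and v_mult: "\<And>g h. g \<in> carrier G \<Longrightarrow> h \<in> carrier G \<Longrightarrow> eqv d (\<lambda>n. v g n * v h n) (v (g \<otimes> h))"
    and v_iso: "\<And>g. g \<in> carrier G \<Longrightarrow> eqv d (\<lambda>n. adj (v g n) * v g n) (\<lambda>n. 1\<^sub>m (d n))"
    and a_inv: "\<And>g. g \<in> \<Gamma> \<Longrightarrow> eqv d (\<lambda>n. a g n * a g n) (\<lambda>n. 1\<^sub>m (d n))"
    and a_adj: "\<And>g. g \<in> \<Gamma> \<Longrightarrow> eqv d (\<lambda>n. adj (a g n)) (a g)"
    and a_comm: "\<And>g h. g \<in> \<Gamma> \<Longrightarrow> h \<in> \<Gamma> \<Longrightarrow> eqv d (\<lambda>n. a g n * a h n) (\<lambda>n. a h n * a g n)"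
    and a_equi: "\<And>g h. g \<in> \<Gamma> \<Longrightarrow> h \<in> \<Gamma> \<Longrightarrow> eqv d (\<lambda>n. v g n * a h n * adj (v g n)) (a (g \<otimes> h))"
    and a_stab: "\<And>\<gamma>. \<gamma> \<in> \<Gamma> \<Longrightarrow> eqv d (a (t \<otimes> \<gamma> \<otimes> inv t)) (a \<one>)"
    and g: "g \<in> \<Gamma>"
  shows "eqv d (a g) (a \<one>)"
proof -
  interpret group G by (rule G)
  interpret \<Gamma>: subgroup \<Gamma> G by (rule \<Gamma>)
  have K: "group (G\<lparr>carrier := \<Gamma>\<rparr>)" by (rule \<Gamma>.subgroup_is_group[OF G])
  have gen: "S = \<Gamma>" if "S \<subseteq> \<Gamma>" "F \<subseteq> S" "\<one> \<in> S" "\<And>x y. x \<in> S \<Longrightarrow> y \<in> S \<Longrightarrow> x \<otimes> y \<in> S"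
    "\<And>x. x \<in> S \<Longrightarrow> inv x \<in> S" for S
  proof -
    have "subgroup S G"
      by (rule subgroupI) (use that \<Gamma>.subset in auto)
    then have "subgroup S (G\<lparr>carrier := \<Gamma>\<rparr>)" using subgroup_incl[OF _ \<Gamma> that(1)] by blast
    then show ?thesis using kazhdan_generates[OF K kz _ that(2)] by simp
  qed
  have F: "finite F" "F \<subseteq> \<Gamma>" using kz by (auto simp: kazhdan_def)
  have a_bd: "bd d (a g)" if "g \<in> \<Gamma>" for g using eqv_bd(2)[OF a_adj[OF that]] .
  have v_bd: "bd d (v g)" if "g \<in> carrier G" for g
    using eqv_bd(2)[OF v_mult[OF that one_closed]] that by simp
  define y where "y g n = (1/2 :: complex) \<cdot>\<^sub>m (a g n - a \<one> n)" for g n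
  have y_bd: "bd d (y g)" if "g \<in> \<Gamma>" for g
    unfolding y_def [abs_def] using that by (intro bd_smult bd_minus a_bd) auto
  have y_equi: "eqv d (\<lambda>n. v g n * y h n * adj (v g n)) (\<lambda>n. (1/2) \<cdot>\<^sub>m (a (g \<otimes> h) n - a g n))"
    if gh: "g \<in> \<Gamma>" "h \<in> \<Gamma>" for g h
  proof -
    have "eqv d (\<lambda>n. (1/2) \<cdot>\<^sub>m (v g n * a h n * adj (v g n) - v g n * a \<one> n * adj (v g n)))
        (\<lambda>n. (1/2) \<cdot>\<^sub>m (a (g \<otimes> h) n - a (g \<otimes> \<one>) n))"
      by (intro eqv_smult eqv_minus a_equi) (use gh in auto)
    moreover have "(\<lambda>n. v g n * y h n * adj (v g n))
        = (\<lambda>n. (1/2) \<cdot>\<^sub>m (v g n * a h n * adj (v g n) - v g n * a \<one> n * adj (v g n)))"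
    proof
      fix n
      have c: "v g n \<in> carrier_mat (d n) (d n)" "a h n \<in> carrier_mat (d n) (d n)" "a \<one> n \<in> carrier_mat (d n) (d n)"
        using gh v_bd a_bd by auto
      have ac: "adj (v g n) \<in> carrier_mat (d n) (d n)" using c by simp
      have 1: "v g n * y h n = (1/2) \<cdot>\<^sub>m (v g n * (a h n - a \<one> n))"
        unfolding y_def by (rule mult_smult_distrib[OF c(1)]) (use c in auto)
      have 2: "v g n * (a h n - a \<one> n) = v g n * a h n - v g n * a \<one> n"
        by (rule mult_minus_distrib_mat[OF c])
      have 3: "(1/2) \<cdot>\<^sub>m (v g n * a h n - v g n * a \<one> n) * adj (v g n)
          = (1/2) \<cdot>\<^sub>m ((v g n * a h n - v g n * a \<one> n) * adj (v g n))"
        by (rule mult_smult_assoc_mat[OF _ ac]) (use c in auto)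
      have 4: "(v g n * a h n - v g n * a \<one> n) * adj (v g n) = v g n * a h n * adj (v g n) - v g n * a \<one> n * adj (v g n)"
        by (rule minus_mult_distrib_mat[OF _ _ ac]) (use c in auto)
      show "v g n * y h n * adj (v g n) = (1/2) \<cdot>\<^sub>m (v g n * a h n * adj (v g n) - v g n * a \<one> n * adj (v g n))"
        unfolding 1 2 3 4 ..
    qed
    ultimately show ?thesis using gh by simp
  qed
  have rounding: "\<exists>D. eqv d D (y s) \<and> (\<forall>n. adj (D n) = D n) \<and> (\<forall>n. D n * D n * D n = D n)" if s: "s \<in> \<Gamma>" for s
  proof -
    have cube: "eqv d (\<lambda>n. y s n * y s n * y s n) (y s)"
      unfolding y_def by (rule half_difference_cube) (use s in \<open>auto intro: a_inv a_comm a_bd\<close>)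
    have "eqv d (\<lambda>n. (1/2) \<cdot>\<^sub>m (adj (a s n) - adj (a \<one> n))) (y s)"
      unfolding y_def by (intro eqv_smult eqv_minus a_adj) (use s in auto)
    moreover have "adj (y s n) = (1/2) \<cdot>\<^sub>m (adj (a s n) - adj (a \<one> n))" for n
      unfolding y_def adj_smult using adj_minus[OF bd_carrier[OF a_bd[OF s]] bd_carrier[OF a_bd[OF \<Gamma>.one_closed]], of n]
      by simp
    ultimately have herm: "eqv d (\<lambda>n. adj (y s n)) (y s)" by simp
    show ?thesis by (rule eqv_rounding[OF cube herm]) blast
  qed
  then obtain D where D: "\<And>s. s \<in> \<Gamma> \<Longrightarrow> eqv d (D s) (y s)" "\<And>s n. s \<in> \<Gamma> \<Longrightarrow> adj (D s n) = D s n"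
    "\<And>s n. s \<in> \<Gamma> \<Longrightarrow> D s n * D s n * D s n = D s n" by metis
  have Dc: "D s n \<in> carrier_mat (d n) (d n)" if "s \<in> \<Gamma>" for s n
    using eqv_bd(1)[OF D(1)[OF that]] by simp
  have generators: "eqv d (a s) (a \<one>)" if s: "s \<in> F" for s
  proof (rule ccontr)
    assume neq: "\<not> eqv d (a s) (a \<one>)"
    have s\<Gamma>: "s \<in> \<Gamma>" using s F by blast
    define w0 where "w0 n = (\<Sum>s\<in>F. (hs (d n) (D s n))^2)" for n
    \<comment> \<open>The value 1 is a default outside the set \<open>I\<close> along which the limit is taken.\<close>
    define w where "w n = (if 0 < w0 n then w0 n else 1)" for n
    have w_pos: "0 < w n" for n by (simp add: w_def)
    have hs_w: "(hs (d n) (D s n))^2 \<le> w n" if "s \<in> F" for s n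
    proof -
      have "(hs (d n) (D s n))^2 \<le> w0 n"
        unfolding w0_def using that F by (intro member_le_sum) auto
      then show ?thesis by (auto simp: w_def)
    qed
    define I where "I = {n. 0 < w0 n}"
    \<comment> \<open>Where the weight vanishes, \<open>D s n = 0\<close>, and \<open>a s n - a \<one> n\<close> is as small as the rounding error.\<close>
    have freq: "\<not> eventually (\<lambda>n. n \<notin> I) sequentially"
    proof
      assume ev: "eventually (\<lambda>n. n \<notin> I) sequentially"
      have up: "eventually (\<lambda>n. op_norm (a s n - a \<one> n) \<le> 2 * op_norm (D s n - y s n)) sequentially"
        using ev
      proof eventually_elim
        case (elim n)
        have c: "a s n \<in> carrier_mat (d n) (d n)" "a \<one> n \<in> carrier_mat (d n) (d n)" using a_bd s\<Gamma> by auto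
        have "w0 n \<le> 0" using elim by (simp add: I_def)
        moreover have "(hs (d n) (D s n))^2 \<le> w0 n"
          unfolding w0_def using s F by (intro member_le_sum) auto
        ultimately have h0: "hs (d n) (D s n) = 0" by (metis power2_less_eq_zero_iff order_trans)
        have "D s n = 0\<^sub>m (d n) (d n)"
          using h0 Dc[OF s\<Gamma>, of n] by (intro eq_matI) (auto simp: hs_def L2_set_eq_0_iff)
        then have "a s n - a \<one> n = (-2) \<cdot>\<^sub>m (D s n - y s n)"
          using c by (intro eq_matI) (auto simp: y_def field_simps)
        moreover have "D s n - y s n \<in> carrier_mat (d n) (d n)" using Dc[OF s\<Gamma>, of n] bd_carrier[OF y_bd[OF s\<Gamma>], of n] by auto
        ultimately show ?case using op_norm_smult[of "D s n - y s n" "d n" "-2"] by simp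
      qed
      have lim: "(\<lambda>n. 2 * op_norm (D s n - y s n)) \<longlonglongrightarrow> 0"
        using tendsto_mult_right_zero[OF eqv_lim[OF D(1)[OF s\<Gamma>]]] by simp
      have "0 \<le> op_norm (a s n - a \<one> n)" for n
        using bd_carrier[OF a_bd[OF s\<Gamma>], of n] bd_carrier[OF a_bd[OF \<Gamma>.one_closed], of n]
        by (intro op_norm_nonneg[of _ "d n"]) auto
      then have lo: "eventually (\<lambda>n. 0 \<le> op_norm (a s n - a \<one> n)) sequentially" by simp
      have "(\<lambda>n. op_norm (a s n - a \<one> n)) \<longlonglongrightarrow> 0"
        by (rule tendsto_sandwich[OF lo up tendsto_const lim])
      then show False using neq a_bd s\<Gamma> by (simp add: eqv_def)
    qed
    have "inf sequentially (principal I) \<noteq> bot"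
      using freq by (simp add: trivial_limit_def eventually_inf_principal)
    \<comment> \<open>Along \<open>U\<close> the weight is the sum itself, which gives the normalisation contradicted at the end.\<close>
    then obtain U where U: "U \<le> inf sequentially (principal I)" "ultra U" by (rule ultrafilter_exists)
    have UI: "eventually (\<lambda>n. n \<in> I) U" using U(1) by (simp add: le_principal)
    interpret matrix_model U d w G v
    proof
      show "ultra U" by (rule U)
      show "U \<le> sequentially" using U(1) by simp
      show "0 < w n" for n by (rule w_pos)
      fix g assume g: "g \<in> carrier G"
      show "v g n \<in> carrier_mat (d n) (d n)" for n using v_bd[OF g] by simp
      show "\<exists>C. \<forall>n. op_norm (v g n) \<le> C" using bd_bound[OF v_bd[OF g]] by blast
      show "(\<lambda>n. op_norm (adj (v g n) * v g n - 1\<^sub>m (d n))) \<longlonglongrightarrow> 0" by (rule eqv_lim[OF v_iso[OF g]])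
      show "(\<lambda>n. op_norm (v g n * v h n - v (g \<otimes> h) n)) \<longlonglongrightarrow> 0" if "h \<in> carrier G" for h
        by (rule eqv_lim[OF v_mult[OF g that]])
    qed
    interpret shrinking_action B ip G act Ops \<Gamma> F C t
      by unfold_locales (use \<Gamma> kz t t\<Gamma> in auto)
    \<comment> \<open>The admissible representatives of \<open>y g\<close>: those of trace norm of the order of the weight.\<close>
    define tame where "tame g X \<longleftrightarrow> eqv d X (y g) \<and> (\<exists>C\<ge>0. \<forall>n. trace_norm_le (d n) (X n) (C * w n))" for g X
    have tame_B: "(\<lambda>n. entries (d n) (X n)) \<in> B" if tame: "tame g X" for g X
    proof -
      have X: "bd d X" using tame eqv_bd(1) by (auto simp: tame_def)
      obtain C where C: "0 \<le> C" "\<And>n. trace_norm_le (d n) (X n) (C * w n)"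
        using tame unfolding tame_def by blast
      obtain C' where C': "0 < C'" "\<And>n. op_norm (X n) \<le> C'" using bd_bound[OF X] by blast
      have "(hs (d n) (X n))^2 \<le> C * C' * w n" for n
      proof -
        have "(hs (d n) (X n))^2 \<le> C * w n * op_norm (X n)" by (rule trace_norm_le_hs[OF bd_carrier[OF X] C(2)])
        also have "\<dots> \<le> C * w n * C'" using C C'(2) w_pos[of n] by (intro mult_left_mono) auto
        finally show ?thesis by (simp add: mult_ac)
      qed
      then show ?thesis using X by (auto simp: B_def entry_mat_entries)
    qed
    have tame_unique: "N ((\<lambda>n. entries (d n) (X n)) - (\<lambda>n. entries (d n) (Y n))) = 0" if X: "tame g X" and Y: "tame g Y" for g X Y
    proof -
      obtain C1 C2 where C: "0 \<le> C1" "\<And>n. trace_norm_le (d n) (X n) (C1 * w n)" "0 \<le> C2" "\<And>n. trace_norm_le (d n) (Y n) (C2 * w n)"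
        using X Y unfolding tame_def by blast
      have e: "eqv d X Y" using X Y eqv_trans eqv_sym unfolding tame_def by blast
      have c: "X n \<in> carrier_mat (d n) (d n)" "Y n \<in> carrier_mat (d n) (d n)" for n using eqv_bd[OF e] by auto
      define \<epsilon> where "\<epsilon> n = sqrt ((C1 + C2) * op_norm (X n - Y n))" for n
      show ?thesis
      proof (rule N_null)
        show "(\<lambda>n. entries (d n) (X n)) - (\<lambda>n. entries (d n) (Y n)) \<in> B" using tame_B[OF X] tame_B[OF Y] by (rule B_closed(3))
        have "(\<epsilon> \<longlongrightarrow> sqrt 0) sequentially"
          unfolding \<epsilon>_def by (intro tendsto_real_sqrt tendsto_mult_right_zero eqv_lim[OF e])
        then show "(\<epsilon> \<longlongrightarrow> 0) U" using seq_U by simp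
        fix n
        have "trace_norm_le (d n) (X n - Y n) (C1 * w n + C2 * w n)" by (rule trace_norm_le_minus[OF c C(2,4)])
        then have "(hs (d n) (X n - Y n))^2 \<le> (C1 * w n + C2 * w n) * op_norm (X n - Y n)"
          by (intro trace_norm_le_hs) (use c[of n] in auto)
        then have "hs (d n) (X n - Y n) \<le> sqrt ((C1 * w n + C2 * w n) * op_norm (X n - Y n))" by (rule real_le_rsqrt)
        also have "(C1 * w n + C2 * w n) * op_norm (X n - Y n) = ((C1 + C2) * op_norm (X n - Y n)) * w n"
          by (simp add: algebra_simps)
        also have "sqrt \<dots> = \<epsilon> n * sqrt (w n)" unfolding \<epsilon>_def by (rule real_sqrt_mult)
        finally show "hs (d n) (entry_mat (d n) (((\<lambda>n. entries (d n) (X n)) - (\<lambda>n. entries (d n) (Y n))) n)) \<le> \<epsilon> n * sqrt (w n)"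
          using c[of n] by (simp add: entry_mat_diff entry_mat_entries)
      qed
    qed
    have v_bound: "\<exists>C>0. \<forall>n. op_norm (v g n) \<le> C" if "g \<in> carrier G" for g using bd_bound[OF v_bd[OF that]] .
    have tame_conj: "\<exists>C\<ge>0. \<forall>n. trace_norm_le (d n) (v g n * X n * adj (v g n)) (C * w n)" if X: "tame h X" and g: "g \<in> carrier G" for g h X
    proof -
      have Xb: "bd d X" using X eqv_bd(1) by (auto simp: tame_def)
      obtain C where C: "0 \<le> C" "\<And>n. trace_norm_le (d n) (X n) (C * w n)"
        using X unfolding tame_def by blast
      obtain C' where C': "0 < C'" "\<And>n. op_norm (v g n) \<le> C'" using v_bound[OF g] by blast
      have "trace_norm_le (d n) (v g n * X n * adj (v g n)) (C * C'^2 * w n)" for n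
      proof (rule trace_norm_le_mono)
        show "trace_norm_le (d n) (v g n * X n * adj (v g n)) (C * w n * (op_norm (v g n))^2)"
          by (rule trace_norm_le_conj[OF u_carrier[OF g] bd_carrier[OF Xb] C(2)]) (use C w_pos[of n] in simp)
        have "(op_norm (v g n))^2 \<le> C'^2"
          by (rule power_mono[OF C'(2)]) (rule op_norm_nonneg[OF u_carrier[OF g]])
        then have "C * w n * (op_norm (v g n))^2 \<le> C * w n * C'^2"
          using C w_pos[of n] by (intro mult_left_mono) auto
        then show "C * w n * (op_norm (v g n))^2 \<le> C * C'^2 * w n" by (simp add: mult_ac)
      qed
      then show ?thesis using C C' by (intro exI[of _ "C * C'^2"]) auto
    qed
    have tame_mult: "tame (g \<otimes> h) (\<lambda>n. X n + v g n * Z n * adj (v g n))"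
      if X: "tame g X" and Z: "tame h Z" and gh: "g \<in> \<Gamma>" "h \<in> \<Gamma>" for g h X Z
    proof -
      have ex: "eqv d X (y g)" "eqv d Z (y h)" using X Z by (auto simp: tame_def)
      have vv: "bd d (v g)" using v_bd gh by auto
      have "eqv d (\<lambda>n. v g n * Z n * adj (v g n)) (\<lambda>n. v g n * y h n * adj (v g n))"
        by (intro eqv_mult ex eqv_refl vv bd_adj)
      note sum = eqv_add[OF ex(1) eqv_trans[OF this y_equi[OF gh]]]
      have "(\<lambda>n. y g n + (1/2) \<cdot>\<^sub>m (a (g \<otimes> h) n - a g n)) = y (g \<otimes> h)"
      proof
        fix n
        have "a g n \<in> carrier_mat (d n) (d n)" "a (g \<otimes> h) n \<in> carrier_mat (d n) (d n)" "a \<one> n \<in> carrier_mat (d n) (d n)"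
          using a_bd gh by auto
        then show "y g n + (1/2) \<cdot>\<^sub>m (a (g \<otimes> h) n - a g n) = y (g \<otimes> h) n"
          unfolding y_def by (intro eq_matI) (auto simp: algebra_simps)
      qed
      then have "eqv d (\<lambda>n. X n + v g n * Z n * adj (v g n)) (y (g \<otimes> h))" using sum by simp
      moreover obtain C1 where "0 \<le> C1" "\<And>n. trace_norm_le (d n) (X n) (C1 * w n)" using X unfolding tame_def by blast
      moreover obtain C2 where "0 \<le> C2" "\<And>n. trace_norm_le (d n) (v g n * Z n * adj (v g n)) (C2 * w n)"
        using tame_conj[OF Z] gh by blast
      moreover have "trace_norm_le (d n) (X n + v g n * Z n * adj (v g n)) ((C1 + C2) * w n)" for n
        unfolding distrib_right
        by (rule trace_norm_le_add) (use calculation eqv_bd(1)[OF ex(1)] eqv_bd(1)[OF ex(2)] vv in \<open>auto intro!: square_closed\<close>)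
      ultimately show ?thesis unfolding tame_def by (metis add_nonneg_nonneg)
    qed
    have tame_one: "tame \<one> (\<lambda>n. 0\<^sub>m (d n) (d n))"
    proof -
      have "y \<one> = (\<lambda>n. 0\<^sub>m (d n) (d n))"
      proof
        show "y \<one> n = 0\<^sub>m (d n) (d n)" for n
          unfolding y_def using bd_carrier[OF a_bd[OF \<Gamma>.one_closed], of n] by (intro eq_matI) auto
      qed
      then show ?thesis using trace_norm_le_zero unfolding tame_def by (auto intro!: eqv_refl bd_zero exI[of _ 0])
    qed
    have tame_inv: "\<exists>X. tame (inv g) X" if X: "tame g X" and g: "g \<in> \<Gamma>" for g X
    proof -
      define Z where "Z n = 0\<^sub>m (d n) (d n) - v (inv g) n * X n * adj (v (inv g) n)" for n
      have ex: "eqv d X (y g)" using X by (simp add: tame_def)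
      have g': "inv g \<in> \<Gamma>" using g by simp
      have vv: "bd d (v (inv g))" using v_bd g' by auto
      have "eqv d (\<lambda>n. v (inv g) n * X n * adj (v (inv g) n)) (\<lambda>n. v (inv g) n * y g n * adj (v (inv g) n))"
        by (intro eqv_mult ex eqv_refl vv bd_adj)
      note e = eqv_minus[OF eqv_refl[OF bd_zero] eqv_trans[OF this y_equi[OF g' g]]]
      have "(\<lambda>n. 0\<^sub>m (d n) (d n) - (1/2) \<cdot>\<^sub>m (a (inv g \<otimes> g) n - a (inv g) n)) = y (inv g)"
      proof
        fix n
        have "a (inv g) n \<in> carrier_mat (d n) (d n)" "a \<one> n \<in> carrier_mat (d n) (d n)"
          using a_bd g' by auto
        then show "0\<^sub>m (d n) (d n) - (1/2) \<cdot>\<^sub>m (a (inv g \<otimes> g) n - a (inv g) n) = y (inv g) n"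
          unfolding y_def using g by (intro eq_matI) (auto simp: algebra_simps)
      qed
      then have "eqv d Z (y (inv g))" using e by (simp add: Z_def [abs_def])
      moreover obtain C2 where C2: "0 \<le> C2" "\<And>n. trace_norm_le (d n) (v (inv g) n * X n * adj (v (inv g) n)) (C2 * w n)"
        using tame_conj[OF X, of "inv g"] g by auto
      moreover have "trace_norm_le (d n) (Z n) (0 + C2 * w n)" for n
        unfolding Z_def by (rule trace_norm_le_minus[OF _ _ trace_norm_le_zero C2(2)]) (use eqv_bd(1)[OF ex] vv in \<open>auto intro!: square_closed\<close>)
      ultimately show ?thesis unfolding tame_def by auto
    qed
    have tame_gen: "tame s (D s)" if s: "s \<in> F" for s
    proof -
      have s\<Gamma>: "s \<in> \<Gamma>" using s F by blast
      obtain C' where C': "0 < C'" "\<And>n. op_norm (D s n) \<le> C'" using bd_bound[OF eqv_bd(1)[OF D(1)[OF s\<Gamma>]]] by blast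
      have "trace_norm_le (d n) (D s n) (C' * w n)" for n
      proof (rule trace_norm_le_mono[OF trace_norm_le_cube[OF Dc[OF s\<Gamma>] D(2)[OF s\<Gamma>] D(3)[OF s\<Gamma>]]])
        have "(hs (d n) (D s n))^2 * op_norm (D s n) \<le> w n * C'"
          using hs_w[OF s, of n] C'(2)[of n] w_pos[of n] op_norm_nonneg[OF Dc[OF s\<Gamma>, of n]] by (intro mult_mono) auto
        then show "(hs (d n) (D s n))^2 * op_norm (D s n) \<le> C' * w n" by (simp add: mult.commute)
      qed
      then show ?thesis unfolding tame_def using D(1)[OF s\<Gamma>] C' by (auto intro!: exI[of _ C'])
    qed
    \<comment> \<open>The cocycle identity and conjugation invariance of the trace norm make this set a subgroup.\<close>
    have "{g \<in> \<Gamma>. \<exists>X. tame g X} = \<Gamma>"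
    proof (rule gen)
      show "F \<subseteq> {g \<in> \<Gamma>. \<exists>X. tame g X}" using tame_gen F by blast
      show "\<one> \<in> {g \<in> \<Gamma>. \<exists>X. tame g X}" using tame_one by blast
      show "x \<otimes> z \<in> {g \<in> \<Gamma>. \<exists>X. tame g X}" if "x \<in> {g \<in> \<Gamma>. \<exists>X. tame g X}" "z \<in> {g \<in> \<Gamma>. \<exists>X. tame g X}" for x z
        using that tame_mult by blast
      show "inv x \<in> {g \<in> \<Gamma>. \<exists>X. tame g X}" if "x \<in> {g \<in> \<Gamma>. \<exists>X. tame g X}" for x
        using that tame_inv by blast
    qed auto
    then have "\<forall>g\<in>\<Gamma>. \<exists>X. tame g X" by blast
    then obtain X where X: "\<And>g. g \<in> \<Gamma> \<Longrightarrow> tame g (X g)" by metis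
    define c where "c g = (\<lambda>n. entries (d n) (X g n))" for g
    have cB: "c g \<in> B" if "g \<in> \<Gamma>" for g unfolding c_def by (rule tame_B[OF X[OF that]])
    have coc: "N (c (g \<otimes> h) - (c g + act g (c h))) = 0" if gh: "g \<in> \<Gamma>" "h \<in> \<Gamma>" for g h
    proof -
      have xb: "bd d (X g)" "bd d (X h)" using X gh eqv_bd(1) unfolding tame_def by blast+
      have "c g + act g (c h) = (\<lambda>n. entries (d n) (X g n + v g n * X h n * adj (v g n)))"
      proof
        fix n
        have cc: "X g n \<in> carrier_mat (d n) (d n)" "X h n \<in> carrier_mat (d n) (d n)" "v g n \<in> carrier_mat (d n) (d n)"
          using xb v_bd gh by auto
        then have "v g n * X h n * adj (v g n) \<in> carrier_mat (d n) (d n)" by auto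
        then show "(c g + act g (c h)) n = entries (d n) (X g n + v g n * X h n * adj (v g n))"
          using cc by (simp add: c_def act_def entry_mat_entries entries_add)
      qed
      then show ?thesis
        using tame_unique[OF X tame_mult[OF X X]] gh by (simp add: c_def)
    qed
    have van: "N (c (t \<otimes> \<gamma> \<otimes> inv t)) = 0" if \<gamma>: "\<gamma> \<in> \<Gamma>" for \<gamma>
    proof -
      let ?h = "t \<otimes> \<gamma> \<otimes> inv t"
      have h: "?h \<in> \<Gamma>" by (rule t\<Gamma>[OF \<gamma>])
      have "eqv d (y ?h) (\<lambda>n. (1/2) \<cdot>\<^sub>m (a \<one> n - a \<one> n))"
        unfolding y_def by (intro eqv_smult eqv_minus a_stab[OF \<gamma>] eqv_refl a_bd) auto
      then have "eqv d (y ?h) (y \<one>)" by (simp add: y_def [abs_def])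
      then have "tame \<one> (X ?h)" using X[OF h] eqv_trans unfolding tame_def by blast
      from tame_unique[OF this tame_one] have "N (c ?h - (\<lambda>n. entries (d n) (0\<^sub>m (d n) (d n)))) = 0" by (simp add: c_def)
      moreover have "(\<lambda>n. entries (d n) (0\<^sub>m (d n) (d n))) = 0" by (auto simp: entries_def fun_eq_iff)
      ultimately show ?thesis by simp
    qed
    have null: "N (\<lambda>n. entries (d n) (D s n)) = 0" if s: "s \<in> F" for s
    proof -
      have s\<Gamma>: "s \<in> \<Gamma>" using s F by blast
      have "N (c s) = 0" by (rule cocycle_vanishes[OF cB coc van s\<Gamma>])
      moreover have "N ((\<lambda>n. entries (d n) (D s n)) - c s) = 0" unfolding c_def by (rule tame_unique[OF tame_gen[OF s] X[OF s\<Gamma>]])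
      ultimately show ?thesis
        using N_le_add[OF tame_B[OF tame_gen[OF s]] cB[OF s\<Gamma>]] N_nonneg[OF tame_B[OF tame_gen[OF s]]] by simp
    qed
    have "((\<lambda>n. \<Sum>s\<in>F. (hs (d n) (D s n))^2 / w n) \<longlongrightarrow> (\<Sum>s\<in>F. 0)) U"
    proof (rule tendsto_sum)
      fix s assume s: "s \<in> F"
      then have s\<Gamma>: "s \<in> \<Gamma>" using F by blast
      show "((\<lambda>n. (hs (d n) (D s n))^2 / w n) \<longlongrightarrow> 0) U"
        using N_tendsto[OF tame_B[OF tame_gen[OF s]]] null[OF s] Dc[OF s\<Gamma>] by (simp add: entry_mat_entries)
    qed
    moreover have "((\<lambda>n. \<Sum>s\<in>F. (hs (d n) (D s n))^2 / w n) \<longlongrightarrow> 1) U"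
    proof (rule tendsto_eventually)
      show "\<forall>\<^sub>F n in U. (\<Sum>s\<in>F. (hs (d n) (D s n))^2 / w n) = 1"
        using UI by eventually_elim (simp add: I_def w_def w0_def flip: sum_divide_distrib)
    qed
    ultimately have "(\<Sum>s\<in>F. 0) = (1::real)" by (rule tendsto_unique[OF U_ne])
    then show False by simp
  qed
  have "{g \<in> \<Gamma>. eqv d (a g) (a \<one>)} = \<Gamma>"
  proof (rule gen)
    show "F \<subseteq> {g \<in> \<Gamma>. eqv d (a g) (a \<one>)}" using generators F by blast
    show "\<one> \<in> {g \<in> \<Gamma>. eqv d (a g) (a \<one>)}" by (simp add: eqv_refl a_bd)
    have move: "eqv d (a (x \<otimes> z)) (a (x \<otimes> z'))" if "x \<in> \<Gamma>" "z \<in> \<Gamma>" "z' \<in> \<Gamma>" "eqv d (a z) (a z')" for x z z'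
    proof -
      have "bd d (v x)" using v_bd that by auto
      then have "eqv d (\<lambda>n. v x n * a z n * adj (v x n)) (\<lambda>n. v x n * a z' n * adj (v x n))"
        by (intro eqv_mult that(4) eqv_refl bd_adj)
      from eqv_trans[OF eqv_trans[OF eqv_sym[OF a_equi[OF that(1,2)]] this] a_equi[OF that(1,3)]]
      show ?thesis .
    qed
    show "x \<otimes> z \<in> {g \<in> \<Gamma>. eqv d (a g) (a \<one>)}"
      if "x \<in> {g \<in> \<Gamma>. eqv d (a g) (a \<one>)}" "z \<in> {g \<in> \<Gamma>. eqv d (a g) (a \<one>)}" for x z
    proof -
      have x: "x \<in> \<Gamma>" "eqv d (a x) (a \<one>)" and z: "z \<in> \<Gamma>" "eqv d (a z) (a \<one>)" using that by auto
      have "eqv d (a (x \<otimes> z)) (a x)" using move[OF x(1) z(1) _ z(2)] x(1) by simp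
      from eqv_trans[OF this x(2)] show ?thesis using x(1) z(1) by simp
    qed
    show "inv x \<in> {g \<in> \<Gamma>. eqv d (a g) (a \<one>)}" if "x \<in> {g \<in> \<Gamma>. eqv d (a g) (a \<one>)}" for x
    proof -
      have x: "x \<in> \<Gamma>" "eqv d (a x) (a \<one>)" using that by auto
      have "eqv d (a \<one>) (a (inv x))" using move[of "inv x" x \<one>] x by simp
      from eqv_sym[OF this] show ?thesis using x(1) by simp
    qed
  qed auto
  then show ?thesis using g by blast
qed

section \<open>Lifting unitaries from the quotient\<close>

lemma carrier_prod_mat: "A \<in> carrier (prod_mat d) \<longleftrightarrow> bd d A"
  by (auto simp: prod_mat_def bd_def bdd_above_def)

abbreviation qcoset :: "(nat \<Rightarrow> nat) \<Rightarrow> (nat \<Rightarrow> complex mat) \<Rightarrow> (nat \<Rightarrow> complex mat) set" where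
  "qcoset d A \<equiv> sum_mat d +>\<^bsub>prod_mat d\<^esub> A"

lemma sum_mat_eqv: "h \<in> sum_mat d \<longleftrightarrow> eqv d h (\<lambda>n. 0\<^sub>m (d n) (d n))"
proof -
  have "h n - 0\<^sub>m (d n) (d n) = h n" if "bd d h" for n
    by (rule eq_matI) (use bd_carrier[OF that, of n] in auto)
  then show ?thesis
    using bd_zero by (auto simp: sum_mat_def carrier_prod_mat eqv_def)
qed

lemma mem_qcoset: assumes A: "bd d A" shows "B \<in> qcoset d A \<longleftrightarrow> eqv d B A"
proof
  assume "B \<in> qcoset d A"
  then obtain h where h: "h \<in> sum_mat d" "B = (\<lambda>n. h n + A n)"
    by (auto simp: a_r_coset_def' prod_mat_def)
  have "eqv d (\<lambda>n. h n + A n) (\<lambda>n. 0\<^sub>m (d n) (d n) + A n)"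
    by (rule eqv_add[OF h(1)[unfolded sum_mat_eqv] eqv_refl[OF A]])
  moreover have "(\<lambda>n. 0\<^sub>m (d n) (d n) + A n) = A" using left_add_zero_mat[OF bd_carrier[OF A]] by auto
  ultimately show "eqv d B A" by (simp add: h)
next
  assume e: "eqv d B A"
  define h where "h n = B n - A n" for n
  have "eqv d (\<lambda>n. B n - A n) (\<lambda>n. A n - A n)" by (rule eqv_minus[OF e eqv_refl[OF A]])
  moreover have "(\<lambda>n. A n - A n) = (\<lambda>n. 0\<^sub>m (d n) (d n))" using minus_r_inv_mat[OF bd_carrier[OF A]] by auto
  ultimately have "h \<in> sum_mat d" by (simp add: sum_mat_eqv h_def [abs_def])
  moreover have "B = h \<oplus>\<^bsub>prod_mat d\<^esub> A"
    unfolding prod_mat_def h_def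
  proof (simp, rule ext)
    show "B n = B n - A n + A n" for n
      by (rule eq_matI) (use bd_carrier[OF A, of n] bd_carrier[OF eqv_bd(1)[OF e], of n] in auto)
  qed
  ultimately show "B \<in> qcoset d A" by (auto simp: a_r_coset_def')
qed

lemma qcoset_eq_iff: assumes "bd d A" "bd d B" shows "qcoset d A = qcoset d B \<longleftrightarrow> eqv d A B"
proof
  assume "qcoset d A = qcoset d B"
  then show "eqv d A B" using mem_qcoset[OF assms(1), of A] mem_qcoset[OF assms(2), of A] eqv_refl[OF assms(1)] by simp
next
  assume "eqv d A B"
  then show "qcoset d A = qcoset d B"
    using mem_qcoset[OF assms(1)] mem_qcoset[OF assms(2)] eqv_trans eqv_sym by blast
qed

lemma qcoset_mult:
  assumes A: "bd d A" and B: "bd d B"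
  shows "qcoset d A \<otimes>\<^bsub>Q_alg d\<^esub> qcoset d B = qcoset d (\<lambda>n. A n * B n)"
proof -
  have "qcoset d A \<otimes>\<^bsub>Q_alg d\<^esub> qcoset d B = (\<Union>x\<in>qcoset d A. \<Union>y\<in>qcoset d B. qcoset d (\<lambda>n. x n * y n))"
    by (simp add: Q_alg_def FactRing_def rcoset_mult_def prod_mat_def)
  also have "\<dots> = (\<Union>x\<in>qcoset d A. \<Union>y\<in>qcoset d B. qcoset d (\<lambda>n. A n * B n))"
  proof (intro SUP_cong refl)
    fix x y assume "x \<in> qcoset d A" "y \<in> qcoset d B"
    then have "eqv d x A" "eqv d y B" using mem_qcoset A B by auto
    then have "eqv d (\<lambda>n. x n * y n) (\<lambda>n. A n * B n)" by (rule eqv_mult)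
    then show "qcoset d (\<lambda>n. x n * y n) = qcoset d (\<lambda>n. A n * B n)" using qcoset_eq_iff eqv_bd by blast
  qed
  also have "\<dots> = qcoset d (\<lambda>n. A n * B n)"
    using mem_qcoset[OF A, of A] mem_qcoset[OF B, of B] eqv_refl A B by auto
  finally show ?thesis .
qed

lemma one_Q_alg: "\<one>\<^bsub>Q_alg d\<^esub> = qcoset d (\<lambda>n. 1\<^sub>m (d n))"
  by (simp add: Q_alg_def FactRing_def prod_mat_def)

text \<open>The adjoint of a coset, defined as a set of adjoints, is the coset of the adjoint.\<close>

lemma Q_star_qcoset: assumes A: "bd d A" shows "Q_star (qcoset d A) = qcoset d (\<lambda>n. adj (A n))"
proof (intro equalityI subsetI)
  fix X assume "X \<in> Q_star (qcoset d A)"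
  then obtain B where "eqv d B A" "X = (\<lambda>n. adj (B n))" using mem_qcoset[OF A] by (auto simp: Q_star_def)
  then show "X \<in> qcoset d (\<lambda>n. adj (A n))" using mem_qcoset[OF bd_adj[OF A]] eqv_adj by simp
next
  fix X assume "X \<in> qcoset d (\<lambda>n. adj (A n))"
  then have "eqv d X (\<lambda>n. adj (A n))" using mem_qcoset[OF bd_adj[OF A]] by simp
  then have "eqv d (\<lambda>n. adj (X n)) A" using eqv_adj[of d X "\<lambda>n. adj (A n)"] by simp
  then have "(\<lambda>n. adj (X n)) \<in> qcoset d A" using mem_qcoset[OF A] by simp
  then show "X \<in> Q_star (qcoset d A)" unfolding Q_star_def by (rule rev_image_eqI) simp
qed

lemma Q_unitary_lift:
  assumes "x \<in> carrier (Q_unitary d)"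
  shows "\<exists>A. bd d A \<and> x = qcoset d A \<and> eqv d (\<lambda>n. adj (A n) * A n) (\<lambda>n. 1\<^sub>m (d n))
    \<and> eqv d (\<lambda>n. A n * adj (A n)) (\<lambda>n. 1\<^sub>m (d n))"
proof -
  have x: "x \<in> carrier (Q_alg d)" "Q_star x \<otimes>\<^bsub>Q_alg d\<^esub> x = \<one>\<^bsub>Q_alg d\<^esub>" "x \<otimes>\<^bsub>Q_alg d\<^esub> Q_star x = \<one>\<^bsub>Q_alg d\<^esub>"
    using assms by (auto simp: Q_unitary_def)
  obtain A where A: "bd d A" "x = qcoset d A"
    using x(1) by (auto simp: Q_alg_def FactRing_def A_RCOSETS_def' carrier_prod_mat)
  have "qcoset d (\<lambda>n. adj (A n) * A n) = qcoset d (\<lambda>n. 1\<^sub>m (d n))" "qcoset d (\<lambda>n. A n * adj (A n)) = qcoset d (\<lambda>n. 1\<^sub>m (d n))"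
    using x(2,3) A by (simp_all add: Q_star_qcoset qcoset_mult bd_adj one_Q_alg)
  then have "eqv d (\<lambda>n. adj (A n) * A n) (\<lambda>n. 1\<^sub>m (d n))" "eqv d (\<lambda>n. A n * adj (A n)) (\<lambda>n. 1\<^sub>m (d n))"
    by (simp_all only: qcoset_eq_iff[OF bd_mult[OF bd_adj[OF A(1)] A(1)] bd_one]
      qcoset_eq_iff[OF bd_mult[OF A(1) bd_adj[OF A(1)]] bd_one])
  then show ?thesis using A by blast
qed

section \<open>The wreath product\<close>

context
  fixes G :: "'g monoid" (structure) and \<Gamma> :: "'g set"
  assumes G: "group G" and \<Gamma>: "subgroup \<Gamma> G"
begin

interpretation group G by (rule G)
interpretation \<Gamma>: subgroup \<Gamma> G by (rule \<Gamma>)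

lemma lcosets_mem: "x \<in> carrier G \<Longrightarrow> x <# \<Gamma> \<in> lcosets \<Gamma>"
  by (auto simp: LCOSETS_def)

lemma lcosets_shift: "g \<in> carrier G \<Longrightarrow> X \<in> lcosets \<Gamma> \<Longrightarrow> g <# X \<in> lcosets \<Gamma>"
  by (auto simp: LCOSETS_def lcos_m_assoc[OF \<Gamma>.subset] intro!: bexI[of _ "g \<otimes> _"])

lemma lcosets_subset: "X \<in> lcosets \<Gamma> \<Longrightarrow> X \<subseteq> carrier G"
  using l_coset_subset_G[OF \<Gamma>.subset] by (auto simp: LCOSETS_def)

lemma shift_eq:
  assumes "g \<in> carrier G" "X \<in> lcosets \<Gamma>" "Y \<in> lcosets \<Gamma>"
  shows "inv g <# Y = X \<longleftrightarrow> Y = g <# X"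
  using lcos_m_assoc[OF lcosets_subset[OF assms(2)], of "inv g" g] lcos_m_assoc[OF lcosets_subset[OF assms(3)], of g "inv g"]
    lcos_mult_one[OF lcosets_subset[OF assms(2)]] lcos_mult_one[OF lcosets_subset[OF assms(3)]] assms
  by auto

abbreviation (input) A where "A \<equiv> coset_sum G \<Gamma>"
abbreviation (input) W where "W \<equiv> wreath G \<Gamma>"

lemma coset_sum_mult: "f \<otimes>\<^bsub>A\<^esub> f' = (\<lambda>i\<in>lcosets \<Gamma>. (f i + f' i) mod 2)"
  by (simp add: coset_sum_def)

lemma coset_sum_one: "\<one>\<^bsub>A\<^esub> = (\<lambda>i\<in>lcosets \<Gamma>. 0)"
  by (simp add: coset_sum_def)

lemma coset_sum_carrier:
  "carrier A = {f \<in> lcosets \<Gamma> \<rightarrow>\<^sub>E {0..<2}. finite {i \<in> lcosets \<Gamma>. f i \<noteq> 0}}"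
  by (simp add: coset_sum_def carrier_sum_group carrier_integer_mod_group)

lemma group_A: "group A" by (simp add: coset_sum_def)

lemma coset_gen_carrier: "coset_gen G \<Gamma> X \<in> carrier A"
  unfolding coset_sum_carrier coset_gen_def
  by (auto intro: finite_subset[of _ "{X}"])

lemma wreath_simps:
  "carrier W = carrier A \<times> carrier G"
  "(m, g) \<otimes>\<^bsub>W\<^esub> (n, h) = (m \<otimes>\<^bsub>A\<^esub> coset_shift G \<Gamma> g n, g \<otimes> h)"
  "\<one>\<^bsub>W\<^esub> = (\<one>\<^bsub>A\<^esub>, \<one>)"
  by (simp_all add: wreath_def semidirect_def)

lemma shift_one_elt: "g \<in> carrier G \<Longrightarrow> coset_shift G \<Gamma> g \<one>\<^bsub>A\<^esub> = \<one>\<^bsub>A\<^esub>"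
  by (auto simp: coset_shift_def coset_sum_one fun_eq_iff lcosets_shift)

lemma shift_by_one: "f \<in> carrier A \<Longrightarrow> coset_shift G \<Gamma> \<one> f = f"
  using lcos_mult_one[OF lcosets_subset]
  by (auto simp: coset_shift_def coset_sum_carrier fun_eq_iff PiE_iff extensional_def)

lemma shift_gen: "g \<in> carrier G \<Longrightarrow> X \<in> lcosets \<Gamma> \<Longrightarrow> coset_shift G \<Gamma> g (coset_gen G \<Gamma> X) = coset_gen G \<Gamma> (g <# X)"
  using lcosets_shift[of "inv g"] shift_eq[of g X]
  by (auto simp: coset_shift_def coset_gen_def fun_eq_iff)

definition emb :: "'g \<Rightarrow> ('g set \<Rightarrow> int) \<times> 'g" where "emb g = (\<one>\<^bsub>A\<^esub>, g)"
definition gen :: "'g set \<Rightarrow> ('g set \<Rightarrow> int) \<times> 'g" where "gen X = (coset_gen G \<Gamma> X, \<one>)"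

lemma emb_W: "g \<in> carrier G \<Longrightarrow> emb g \<in> carrier W"
  using group.is_monoid[OF group_A] by (simp add: wreath_simps emb_def monoid.one_closed)

lemma gen_W: "gen X \<in> carrier W"
  by (simp add: wreath_simps gen_def coset_gen_carrier)

lemma emb_mult: "g \<in> carrier G \<Longrightarrow> h \<in> carrier G \<Longrightarrow> emb g \<otimes>\<^bsub>W\<^esub> emb h = emb (g \<otimes> h)"
  using group.is_monoid[OF group_A]
  by (simp add: wreath_simps emb_def shift_one_elt monoid.l_one monoid.one_closed)

lemma gen_mult: "gen X \<otimes>\<^bsub>W\<^esub> gen Y = (coset_gen G \<Gamma> X \<otimes>\<^bsub>A\<^esub> coset_gen G \<Gamma> Y, \<one>)"
  by (simp add: wreath_simps gen_def shift_by_one coset_gen_carrier)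

lemma gen_square: "gen X \<otimes>\<^bsub>W\<^esub> gen X = \<one>\<^bsub>W\<^esub>"
  by (auto simp: gen_mult wreath_simps(3) coset_sum_mult coset_sum_one coset_gen_def fun_eq_iff)

lemma gen_commute: "gen X \<otimes>\<^bsub>W\<^esub> gen Y = gen Y \<otimes>\<^bsub>W\<^esub> gen X"
  by (simp add: gen_mult coset_sum_mult add.commute)

lemma emb_gen:
  assumes "g \<in> carrier G" "X \<in> lcosets \<Gamma>"
  shows "emb g \<otimes>\<^bsub>W\<^esub> gen X = gen (g <# X) \<otimes>\<^bsub>W\<^esub> emb g"
  using group.is_monoid[OF group_A] assms
  by (simp add: emb_def gen_def wreath_simps shift_gen shift_one_elt monoid.l_one monoid.r_one coset_gen_carrier)

lemma b_elt_gen: "b_elt G \<Gamma> t \<gamma> = gen ((\<gamma> \<otimes> t) <# \<Gamma>) \<otimes>\<^bsub>W\<^esub> gen (t <# \<Gamma>)"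
  by (simp add: b_elt_def gen_mult)

text \<open>The two cosets are distinct since \<open>\<gamma> t \<in> t \<Gamma>\<close> would put \<open>\<gamma>\<close> into \<open>t \<Gamma> t\<inverse>\<close>.\<close>

lemma b_elt_nontrivial:
  assumes t: "t \<in> carrier G" and \<gamma>: "\<gamma> \<in> \<Gamma>" "\<gamma> \<notin> (t <# \<Gamma>) #> inv t"
  shows "b_elt G \<Gamma> t \<gamma> \<noteq> \<one>\<^bsub>W\<^esub>"
proof
  assume "b_elt G \<Gamma> t \<gamma> = \<one>\<^bsub>W\<^esub>"
  then have "coset_gen G \<Gamma> ((\<gamma> \<otimes> t) <# \<Gamma>) \<otimes>\<^bsub>A\<^esub> coset_gen G \<Gamma> (t <# \<Gamma>) = \<one>\<^bsub>A\<^esub>"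
    by (simp add: b_elt_def wreath_simps)
  then have "(coset_gen G \<Gamma> ((\<gamma> \<otimes> t) <# \<Gamma>) \<otimes>\<^bsub>A\<^esub> coset_gen G \<Gamma> (t <# \<Gamma>)) (t <# \<Gamma>) = \<one>\<^bsub>A\<^esub> (t <# \<Gamma>)" by simp
  then have "t <# \<Gamma> = (\<gamma> \<otimes> t) <# \<Gamma>"
    using lcosets_mem[OF t] by (auto simp: coset_sum_mult coset_sum_one coset_gen_def split: if_splits)
  moreover have "\<gamma> \<otimes> t \<in> (\<gamma> \<otimes> t) <# \<Gamma>" by (rule lcos_self[OF _ \<Gamma>]) (use t \<gamma> in auto)
  ultimately have "\<gamma> \<otimes> t \<in> t <# \<Gamma>" by simp
  then have "\<gamma> \<otimes> t \<otimes> inv t \<in> (t <# \<Gamma>) #> inv t" by (auto simp: r_coset_def)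
  then show False using \<gamma> t by (simp add: m_assoc)
qed

section \<open>The images of the generators coincide\<close>

text \<open>Relations in \<open>W\<close> become asymptotic relations between lifts of their images to sequences of
  matrices.  The lifts of the generators at the cosets \<open>g t \<Gamma>\<close> satisfy the hypotheses of
  \<open>asymptotic_rigidity\<close>, hence all have the same image, and \<open>b\<^sub>\<gamma>\<close>, the product of two of them, is
  mapped to the square of a single element, which is 1.\<close>

theorem hom_kills_b_elt:
  assumes T: "property_T (G\<lparr>carrier := \<Gamma>\<rparr>)" and t: "t \<in> carrier G"
    and sub: "(t <# \<Gamma>) #> inv t \<subseteq> \<Gamma>" and \<gamma>: "\<gamma> \<in> \<Gamma>" and \<pi>: "\<pi> \<in> hom W (Q_unitary d)"
  shows "\<pi> \<one>\<^bsub>W\<^esub> = \<one>\<^bsub>Q_unitary d\<^esub>" "\<pi> (b_elt G \<Gamma> t \<gamma>) = \<one>\<^bsub>Q_unitary d\<^esub>"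
proof -
  have "\<forall>x\<in>carrier W. \<exists>A. bd d A \<and> \<pi> x = qcoset d A \<and> eqv d (\<lambda>n. adj (A n) * A n) (\<lambda>n. 1\<^sub>m (d n))
    \<and> eqv d (\<lambda>n. A n * adj (A n)) (\<lambda>n. 1\<^sub>m (d n))"
    using \<pi> Q_unitary_lift by (auto simp: hom_def Pi_iff)
  then obtain L where L: "\<And>x. x \<in> carrier W \<Longrightarrow> bd d (L x)" "\<And>x. x \<in> carrier W \<Longrightarrow> \<pi> x = qcoset d (L x)"
    "\<And>x. x \<in> carrier W \<Longrightarrow> eqv d (\<lambda>n. adj (L x n) * L x n) (\<lambda>n. 1\<^sub>m (d n))"
    "\<And>x. x \<in> carrier W \<Longrightarrow> eqv d (\<lambda>n. L x n * adj (L x n)) (\<lambda>n. 1\<^sub>m (d n))" by (auto dest!: bchoice)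
  have L_mult: "eqv d (\<lambda>n. L x n * L y n) (L (x \<otimes>\<^bsub>W\<^esub> y))"
    if xy: "x \<in> carrier W" "y \<in> carrier W" "x \<otimes>\<^bsub>W\<^esub> y \<in> carrier W" for x y
  proof -
    have "\<pi> (x \<otimes>\<^bsub>W\<^esub> y) = \<pi> x \<otimes>\<^bsub>Q_alg d\<^esub> \<pi> y" using \<pi> xy by (auto simp: hom_def Q_unitary_def)
    then have "qcoset d (L (x \<otimes>\<^bsub>W\<^esub> y)) = qcoset d (\<lambda>n. L x n * L y n)" using xy L by (simp add: qcoset_mult)
    then show ?thesis
      using qcoset_eq_iff[OF L(1)[OF xy(3)] bd_mult[OF L(1)[OF xy(1)] L(1)[OF xy(2)]]] eqv_sym by simp
  qed
  have one_W: "\<one>\<^bsub>W\<^esub> \<in> carrier W" using emb_W[of \<one>] by (simp add: emb_def wreath_simps)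
  have left_one: "(\<lambda>n. 1\<^sub>m (d n) * X n) = X" "(\<lambda>n. X n * 1\<^sub>m (d n)) = X" if "bd d X" for X
    using left_mult_one_mat[OF bd_carrier[OF that]] right_mult_one_mat[OF bd_carrier[OF that]] by auto
  have cancel: "eqv d X Y" if u: "bd d u" "eqv d (\<lambda>n. adj (u n) * u n) (\<lambda>n. 1\<^sub>m (d n))"
    and X: "bd d X" "bd d Y" and e: "eqv d (\<lambda>n. u n * X n) (\<lambda>n. u n * Y n)" for u X Y
  proof -
    have red: "eqv d (\<lambda>n. adj (u n) * (u n * X n)) X" if X: "bd d X" for X
    proof -
      have "eqv d (\<lambda>n. adj (u n) * u n * X n) (\<lambda>n. 1\<^sub>m (d n) * X n)" by (rule eqv_mult[OF u(2) eqv_refl[OF X]])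
      then show ?thesis by (simp only: eqv_assoc[OF bd_adj[OF u(1)] u(1) X] left_one(1)[OF X])
    qed
    have "eqv d (\<lambda>n. adj (u n) * (u n * X n)) (\<lambda>n. adj (u n) * (u n * Y n))"
      by (rule eqv_mult[OF eqv_refl[OF bd_adj[OF u(1)]] e])
    from eqv_trans[OF eqv_trans[OF eqv_sym[OF red[OF X(1)]] this] red[OF X(2)]] show ?thesis .
  qed
  have WW: "\<one>\<^bsub>W\<^esub> \<otimes>\<^bsub>W\<^esub> \<one>\<^bsub>W\<^esub> = \<one>\<^bsub>W\<^esub>" using emb_mult[of \<one> \<one>] by (simp add: emb_def wreath_simps(3))
  have L_one: "eqv d (L \<one>\<^bsub>W\<^esub>) (\<lambda>n. 1\<^sub>m (d n))"
  proof (rule cancel[OF L(1,3)[OF one_W] L(1)[OF one_W] bd_one])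
    show "eqv d (\<lambda>n. L \<one>\<^bsub>W\<^esub> n * L \<one>\<^bsub>W\<^esub> n) (\<lambda>n. L \<one>\<^bsub>W\<^esub> n * 1\<^sub>m (d n))"
      using L_mult[OF one_W one_W] one_W by (simp add: WW left_one(2)[OF L(1)[OF one_W]])
  qed
  have one_Q: "\<one>\<^bsub>Q_unitary d\<^esub> = qcoset d (\<lambda>n. 1\<^sub>m (d n))" by (simp add: Q_unitary_def one_Q_alg)
  show "\<pi> \<one>\<^bsub>W\<^esub> = \<one>\<^bsub>Q_unitary d\<^esub>"
    unfolding one_Q L(2)[OF one_W] using qcoset_eq_iff[OF L(1)[OF one_W] bd_one] L_one by simp
  define v where "v g = L (emb g)" for g
  define a where "a g = L (gen ((g \<otimes> t) <# \<Gamma>))" for g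
  have a_bd: "bd d (a g)" for g unfolding a_def by (rule L(1)[OF gen_W])
  have v_bd: "bd d (v g)" if "g \<in> carrier G" for g unfolding v_def by (rule L(1)[OF emb_W[OF that]])
  have gg_W: "gen X \<otimes>\<^bsub>W\<^esub> gen Y \<in> carrier W" for X Y
    using group.is_monoid[OF group_A] by (simp add: gen_mult wreath_simps coset_gen_carrier monoid.m_closed)
  have a_inv: "eqv d (\<lambda>n. a g n * a g n) (\<lambda>n. 1\<^sub>m (d n))" for g
  proof -
    have "eqv d (\<lambda>n. a g n * a g n) (L (gen ((g \<otimes> t) <# \<Gamma>) \<otimes>\<^bsub>W\<^esub> gen ((g \<otimes> t) <# \<Gamma>)))"
      unfolding a_def by (rule L_mult[OF gen_W gen_W gg_W])
    from eqv_trans[OF this[unfolded gen_square] L_one] show ?thesis .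
  qed
  have equi: "eqv d (\<lambda>n. v g n * a h n * adj (v g n)) (a (g \<otimes> h))" if gh: "g \<in> \<Gamma>" "h \<in> \<Gamma>" for g h
  proof -
    let ?X = "(h \<otimes> t) <# \<Gamma>"
    have gG: "g \<in> carrier G" and hG: "h \<in> carrier G" using gh by auto
    have X: "?X \<in> lcosets \<Gamma>" by (rule lcosets_mem) (use hG t in simp)
    have gX: "g <# ?X = (g \<otimes> h \<otimes> t) <# \<Gamma>"
      using lcos_m_assoc[OF \<Gamma>.subset, of g "h \<otimes> t"] gG hG t by (simp add: m_assoc)
    have rel: "emb g \<otimes>\<^bsub>W\<^esub> gen ?X = gen ((g \<otimes> h \<otimes> t) <# \<Gamma>) \<otimes>\<^bsub>W\<^esub> emb g" using emb_gen[OF gG X] by (simp add: gX)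
    have relW: "emb g \<otimes>\<^bsub>W\<^esub> gen ?X \<in> carrier W"
      unfolding rel using group.is_monoid[OF group_A] gG
      by (simp add: emb_def gen_def wreath_simps shift_one_elt monoid.r_one coset_gen_carrier)
    have "eqv d (\<lambda>n. v g n * a h n) (L (emb g \<otimes>\<^bsub>W\<^esub> gen ?X))"
      unfolding v_def a_def by (rule L_mult[OF emb_W[OF gG] gen_W relW])
    moreover have "eqv d (\<lambda>n. a (g \<otimes> h) n * v g n) (L (emb g \<otimes>\<^bsub>W\<^esub> gen ?X))"
      using L_mult[OF gen_W emb_W[OF gG] relW[unfolded rel]] unfolding rel v_def a_def .
    ultimately have e: "eqv d (\<lambda>n. v g n * a h n) (\<lambda>n. a (g \<otimes> h) n * v g n)" by (rule eqv_trans[OF _ eqv_sym])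
    have av: "bd d (\<lambda>n. adj (v g n))" by (rule bd_adj[OF v_bd[OF gG]])
    have "eqv d (\<lambda>n. v g n * a h n * adj (v g n)) (\<lambda>n. a (g \<otimes> h) n * v g n * adj (v g n))"
      by (rule eqv_mult[OF e eqv_refl[OF av]])
    moreover have "eqv d (\<lambda>n. a (g \<otimes> h) n * (v g n * adj (v g n))) (\<lambda>n. a (g \<otimes> h) n * 1\<^sub>m (d n))"
      unfolding v_def by (rule eqv_mult[OF eqv_refl[OF a_bd] L(4)[OF emb_W[OF gG]]])
    ultimately show ?thesis
      unfolding eqv_assoc[OF a_bd v_bd[OF gG] av] left_one(2)[OF a_bd] by (rule eqv_trans)
  qed
  have t\<Gamma>: "t \<otimes> g \<otimes> inv t \<in> \<Gamma>" if "g \<in> \<Gamma>" for g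
    using sub that by (auto simp: r_coset_def l_coset_def)
  obtain F C where kz: "kazhdan (G\<lparr>carrier := \<Gamma>\<rparr>) F C"
    using property_T_kazhdan[OF \<Gamma>.subgroup_is_group[OF G] T] by blast
  have "eqv d (a \<gamma>) (a \<one>)"
  proof (rule asymptotic_rigidity[OF G \<Gamma> kz t t\<Gamma>, where v = v])
    show "eqv d (\<lambda>n. v g n * v h n) (v (g \<otimes> h))" if "g \<in> carrier G" "h \<in> carrier G" for g h
      using L_mult[OF emb_W emb_W, of g h] that emb_W unfolding v_def by (simp add: emb_mult)
    show "eqv d (\<lambda>n. adj (v g n) * v g n) (\<lambda>n. 1\<^sub>m (d n))" if "g \<in> carrier G" for g
      unfolding v_def by (rule L(3)[OF emb_W[OF that]])
    show "eqv d (\<lambda>n. adj (a g n)) (a g)" for g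
    proof -
      have "eqv d (\<lambda>n. a g n * adj (a g n)) (\<lambda>n. a g n * a g n)"
        using eqv_trans[OF L(4)[OF gen_W] eqv_sym[OF a_inv]] by (simp add: a_def)
      then show ?thesis
        by (rule cancel[rotated -1]) (use a_bd bd_adj L(3)[OF gen_W] in \<open>auto simp: a_def\<close>)
    qed
    show "eqv d (\<lambda>n. a g n * a h n) (\<lambda>n. a h n * a g n)" for g h
    proof -
      have "eqv d (\<lambda>n. a g n * a h n) (L (gen ((g \<otimes> t) <# \<Gamma>) \<otimes>\<^bsub>W\<^esub> gen ((h \<otimes> t) <# \<Gamma>)))"
        "eqv d (\<lambda>n. a h n * a g n) (L (gen ((h \<otimes> t) <# \<Gamma>) \<otimes>\<^bsub>W\<^esub> gen ((g \<otimes> t) <# \<Gamma>)))"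
        unfolding a_def by (rule L_mult[OF gen_W gen_W gg_W])+
      then show ?thesis
        unfolding gen_commute[of "(h \<otimes> t) <# \<Gamma>" "(g \<otimes> t) <# \<Gamma>"] by (rule eqv_trans[OF _ eqv_sym])
    qed
    show "eqv d (a (t \<otimes> g \<otimes> inv t)) (a \<one>)" if g: "g \<in> \<Gamma>" for g
    proof -
      have "t \<otimes> g \<otimes> inv t \<otimes> t = t \<otimes> g" using g t by (simp add: m_assoc)
      moreover have "(t \<otimes> g) <# \<Gamma> = t <# \<Gamma>"
        using lcos_m_assoc[OF \<Gamma>.subset t, of g] g coset_join3[OF _ \<Gamma> g] by simp
      ultimately show ?thesis using eqv_refl[OF L(1)[OF gen_W]] t by (simp add: a_def)
    qed
  qed (use a_inv equi \<gamma> in auto)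
  then have "\<pi> (gen ((\<gamma> \<otimes> t) <# \<Gamma>)) = \<pi> (gen (t <# \<Gamma>))"
    using L(2)[OF gen_W] qcoset_eq_iff[OF L(1)[OF gen_W] L(1)[OF gen_W]] t by (simp add: a_def)
  then have "\<pi> (b_elt G \<Gamma> t \<gamma>) = \<pi> (gen (t <# \<Gamma>) \<otimes>\<^bsub>W\<^esub> gen (t <# \<Gamma>))"
    using \<pi> gen_W unfolding b_elt_gen hom_def by simp
  then show "\<pi> (b_elt G \<Gamma> t \<gamma>) = \<one>\<^bsub>Q_unitary d\<^esub>"
    using \<open>\<pi> \<one>\<^bsub>W\<^esub> = \<one>\<^bsub>Q_unitary d\<^esub>\<close> by (simp add: gen_square)
qed

lemma b_elt_carrier: "b_elt G \<Gamma> t \<gamma> \<in> carrier W"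
  using group.is_monoid[OF group_A]
  by (simp add: b_elt_def wreath_simps coset_gen_carrier monoid.m_closed)

end

theorem theorem4p3:
  fixes G :: "'g monoid" and \<Gamma> H :: "'g set" and t :: 'g
    and W :: "(('g set \<Rightarrow> int) \<times> 'g) monoid"
  assumes "group G"
    and "subgroup \<Gamma> G"
    and "property_T (G\<lparr>carrier := \<Gamma>\<rparr>)"
    and "t \<in> carrier G"
    and "H = (t <#\<^bsub>G\<^esub> \<Gamma>) #>\<^bsub>G\<^esub> inv\<^bsub>G\<^esub> t"
    and "H \<subset> \<Gamma>"
    and "W = wreath G \<Gamma>"
  shows "(\<forall>\<gamma>\<in>\<Gamma> - H. b_elt G \<Gamma> t \<gamma> \<noteq> \<one>\<^bsub>W\<^esub> \<and>
            (\<forall>d :: nat \<Rightarrow> nat. (\<forall>n. 0 < d n) \<longrightarrow>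
              (\<forall>\<pi>\<in>hom W (Q_unitary d). \<pi> (b_elt G \<Gamma> t \<gamma>) = \<one>\<^bsub>Q_unitary d\<^esub>)))
         \<and> \<not> MF_group W
         \<and> (\<forall>(K :: 'k monoid) \<iota>. group K \<longrightarrow> \<iota> \<in> hom W K \<longrightarrow> inj_on \<iota> (carrier W) \<longrightarrow> \<not> MF_group K)"
proof -
  note G = assms(1) and \<Gamma> = assms(2)
  have sub: "(t <#\<^bsub>G\<^esub> \<Gamma>) #>\<^bsub>G\<^esub> inv\<^bsub>G\<^esub> t \<subseteq> \<Gamma>" using assms(5,6) by blast
  have nontriv: "b_elt G \<Gamma> t \<gamma> \<noteq> \<one>\<^bsub>W\<^esub>" if "\<gamma> \<in> \<Gamma> - H" for \<gamma>
    using b_elt_nontrivial[OF G \<Gamma> assms(4)] that assms(5,7) by blast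
  have kill: "\<pi> \<one>\<^bsub>W\<^esub> = \<one>\<^bsub>Q_unitary d\<^esub>" "\<pi> (b_elt G \<Gamma> t \<gamma>) = \<one>\<^bsub>Q_unitary d\<^esub>"
    if "\<gamma> \<in> \<Gamma>" "\<pi> \<in> hom W (Q_unitary d)" for \<gamma> \<pi> d
    using hom_kills_b_elt[OF G \<Gamma> assms(3,4) sub that(1)] that(2) assms(7) by blast+
  obtain \<gamma> where \<gamma>: "\<gamma> \<in> \<Gamma> - H" using assms(6) by blast
  have one_W: "\<one>\<^bsub>W\<^esub> \<in> carrier W" and b_W: "b_elt G \<Gamma> t \<gamma> \<in> carrier W"
    using emb_W[OF G \<Gamma>, of "\<one>\<^bsub>G\<^esub>"] b_elt_carrier[OF G \<Gamma>] group.is_monoid[OF G] assms(7)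
    by (auto simp: emb_def[OF G \<Gamma>] wreath_simps[OF G \<Gamma>] monoid.one_closed)
  have not_MF: "\<not> MF_group W"
  proof
    assume "MF_group W"
    then obtain d \<pi> where "\<pi> \<in> hom W (Q_unitary d)" "inj_on \<pi> (carrier W)" by (auto simp: MF_group_def)
    then show False using kill[of \<gamma> \<pi> d] \<gamma> nontriv[OF \<gamma>] one_W b_W by (metis DiffD1 inj_onD)
  qed
  moreover have "\<not> MF_group K" if "\<iota> \<in> hom W K" "inj_on \<iota> (carrier W)" for K :: "'k monoid" and \<iota>
  proof
    assume "MF_group K"
    then obtain d \<pi> where d: "\<forall>n. 0 < d n" and \<pi>: "\<pi> \<in> hom K (Q_unitary d)" "inj_on \<pi> (carrier K)"
      by (auto simp: MF_group_def)
    have "\<pi> \<circ> \<iota> \<in> hom W (Q_unitary d)" using that(1) \<pi>(1) by (auto simp: hom_def Pi_iff)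
    moreover have "\<iota> ` carrier W \<subseteq> carrier K" using that(1) by (auto simp: hom_def)
    then have "inj_on (\<pi> \<circ> \<iota>) (carrier W)" using that(2) \<pi>(2) by (auto intro: comp_inj_on inj_on_subset)
    ultimately have "MF_group W" using d unfolding MF_group_def by blast
    then show False using not_MF by simp
  qed
  ultimately show ?thesis using nontriv kill(2) by blast
qed

end
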